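(* Let $p$ be a prime number. Let $\Gamma$ be a countable residually finite discrete group for which there is a "reasonable" homomorphism $\log_p\det_\Gamma:K_T(c_0(\Gamma))\to\mathbb Q_p$ (in the sense defined in the context), and fix such a homomorphism. Let $M$ be a $\mathbb Z\Gamma$-module of type $FL$ which is $p$-adically expansive and such that $\varprojlim_iM_{p^i}=0$. Then $\tau^\Gamma_p(M)\in\mathbb Q_p$ is defined and independent of the (based) resolution of $M$ by finitely generated free $\mathbb Z\Gamma$-modules. Moreover, for any sequence $\Gamma_n\to e$ we have $$\tau^\Gamma_p(M)=\lim_{n\to\infty}(\Gamma:\Gamma_n)^{-1}\log_p\chi(\Gamma_n,M)\quad\text{in }\mathbb Q_p,$$ where $\chi(\Gamma_n,M)=\prod_i|H_i(\Gamma_n,M)|^{(-1)^i}\in\mathbb Q^\times$.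
   Context: Modules are left modules. $M$ is of type $FL$ if it has a resolution $0\to F_d\to\cdots\to F_0\to M\to0$ by finitely generated free $\mathbb Z\Gamma$-modules; a based resolution is such a resolution with a chosen $\mathbb Z\Gamma$-basis $\mathfrak b_\nu$ of each $F_\nu$. $\widehat{\mathbb Z\Gamma}=\varprojlim_n\mathbb Z\Gamma/p^n\mathbb Z\Gamma$ is the ring of formal sums $\sum_\gamma x_\gamma\gamma$, $x_\gamma\in\mathbb Z_p$, $|x_\gamma|\to0$ as $\gamma\to\infty$ (for each $\epsilon>0$ only finitely many $|x_\gamma|\ge\epsilon$), and $c_0(\Gamma)=\widehat{\mathbb Z\Gamma}\otimes_{\mathbb Z}\mathbb Q$ (same with $x_\gamma\in\mathbb Q_p$). A $\mathbb Z\Gamma$-module $M$ of type $FL$ is $p$-adically expansive if $c_0(\Gamma)\otimes_{\mathbb Z\Gamma}M=0$. $M_{p^i}=\ker(p^i:M\to M)$, with transition maps $p:M_{p^i}\to M_{p^{i-1}}$. $\Gamma_n\to e$ means that $(\Gamma_n)$ is a sequence of normal subgroups of finite index of $\Gamma$ such that any infinite intersection of $\Gamma_n$'s contains only $e$; put $\Gamma^{(n)}=\Gamma/\Gamma_n$. $\log_p:\mathbb Q_p^\times\to\mathbb Z_p$ is the $p$-adic logarithm with $\log_p(p)=0$. Under the hypotheses on $M$ all $H_i(\Gamma_n,M)$ are finite and almost all vanish. $K_T(c_0(\Gamma))=K_1(c_0(\Gamma))/\langle\pm\Gamma\rangle$, where $\langle\pm\Gamma\rangle$ is the image of $\pm\Gamma\subset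 c_0(\Gamma)^\times$. For $f\in\mathrm{GL}_r(c_0(\Gamma))$ let $f^{(n)}\in\mathrm{GL}_r(\mathbb Q_p[\Gamma^{(n)}])$ be its image under the natural map $c_0(\Gamma)\to\mathbb Q_p[\Gamma^{(n)}]$, and $\det_{\mathbb Q_p}(f^{(n)})$ its determinant as a $\mathbb Q_p$-linear automorphism of $\mathbb Q_p[\Gamma^{(n)}]^r$. A homomorphism $\log_p\det_\Gamma:K_T(c_0(\Gamma))\to\mathbb Q_p$ is called reasonable if (i) for every $r\ge1$ and $u\in1+pM_r(\widehat{\mathbb Z\Gamma})$ it takes on the class of $u$ the value $\mathrm{tr}_\Gamma\log u$, where $\log u=-\sum_{\nu\ge1}(1-u)^\nu/\nu$ and $\mathrm{tr}_\Gamma$ of a matrix is the coefficient at $e$ of its trace; and (ii) for all $r\ge 1$, all $f\in\mathrm{GL}_r(c_0(\Gamma))$ and all $\Gamma_n\to e$ one has $\log_p\det_\Gamma f=\lim_{n\to\infty}(\Gamma:\Gamma_n)^{-1}\log_p(\det_{\mathbb Q_p}f^{(n)})$ in $\mathbb Q_p$. Torsion: let $(F_\bullet\to M,\mathfrak b_\bullet)$ be a based resolution such that the complex $c_0(\Gamma)\otimes_{\mathbb Z\Gamma}F_\bullet$ (degrees $0,\dots,d$, differential $\hat\partial=\mathrm{id}\otimes\partial$) is acyclic. Choose a chain contraction $\delta$ (degree one, $\delta\hat\partial+\hat\partial\delta=\mathrm{id}$). Then $\hat\partial+\delta$ restricts to an isomorphism from the sum of the odd-degree terms to the sum of the even-degree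 terms; the class in $K_T(c_0(\Gamma))$ of its matrix with respect to the bases $1\otimes\mathfrak b_\nu$ (convention $f(e_i)=\sum_ja_{ij}e_j$) is the torsion $\tau(F_\bullet,\mathfrak b_\bullet)$; it does not depend on $\delta$. The $p$-adic $R$-torsion is $\tau^\Gamma_p(M):=\log_p\det_\Gamma(\tau(F_\bullet,\mathfrak b_\bullet))\in\mathbb Q_p$. That $\tau^\Gamma_p(M)$ is defined means that $c_0(\Gamma)\otimes_{\mathbb Z\Gamma}F_\bullet$ is acyclic for any such resolution. *)

theory Defs
  imports "HOL-Algebra.Free_Abelian_Groups" "HOL-Algebra.Generated_Groups" "HOL-Algebra.Module"
    "HOL-Combinatorics.Permutations" "HOL-Computational_Algebra.Primes" "HOL-Analysis.Analysis"
begin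

section \<open>The field of \<open>p\<close>-adic numbers\<close>

text \<open>
  The prime \<open>p\<close> is carried by a type: \<open>p = CARD('p)\<close>.  The field \<open>'p padic\<close> is the completion of the
  rationals at \<open>p\<close>, built as Cauchy sequences modulo null sequences and topologized by the extension
  \<open>padic_norm\<close> of the \<open>p\<close>-adic absolute value, normalized by \<open>|p| = 1/p\<close>.
\<close>

class prime_card =
  assumes prime_card: "prime CARD('a)"

definition padic_abs :: "nat \<Rightarrow> rat \<Rightarrow> real" where
  "padic_abs p x =
     (if x = 0 then 0
      else real p powi (int (multiplicity (int p) (snd (quotient_of x)))
                        - int (multiplicity (int p) (fst (quotient_of x)))))"

definition padic_cauchy :: "nat \<Rightarrow> (nat \<Rightarrow> rat) \<Rightarrow> bool" where
  "padic_cauchy p X \<longleftrightarrow> (\<forall>e>0. \<exists>k. \<forall>m\<ge>k. \<forall>n\<ge>k. padic_abs p (X m - X n) < e)"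

definition padic_null :: "nat \<Rightarrow> (nat \<Rightarrow> rat) \<Rightarrow> bool" where
  "padic_null p X \<longleftrightarrow> (\<lambda>n. padic_abs p (X n)) \<longlonglongrightarrow> 0"

definition padic_class :: "nat \<Rightarrow> (nat \<Rightarrow> rat) \<Rightarrow> (nat \<Rightarrow> rat) set" where
  "padic_class p X = {Y. padic_cauchy p Y \<and> padic_null p (\<lambda>n. X n - Y n)}"

context
  fixes p :: nat
  assumes p: "prime p"
begin

lemma padic_abs_frac:
  assumes "a \<noteq> 0" "b \<noteq> 0"
  shows "padic_abs p (of_int a / of_int b)
         = real p powi (int (multiplicity (int p) b) - int (multiplicity (int p) a))"
proof -
  define x where "x = (of_int a / of_int b :: rat)"
  obtain n d where q: "quotient_of x = (n, d)" by fastforce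
  have d: "d > 0" and x: "x = of_int n / of_int d"
    using q quotient_of_denom_pos quotient_of_div by auto
  have xn: "x \<noteq> 0" using assms by (simp add: x_def)
  then have n: "n \<noteq> 0" using x by auto
  have "(of_int (a * d) :: rat) = of_int (n * b)"
    using x d assms unfolding x_def by (simp add: field_simps)
  then have e: "a * d = n * b" by (simp only: of_int_eq_iff)
  have pe: "prime_elem (int p)" using p by auto
  have "multiplicity (int p) a + multiplicity (int p) d
        = multiplicity (int p) n + multiplicity (int p) b"
    using arg_cong[OF e, of "multiplicity (int p)"] assms n d pe
    by (simp add: prime_elem_multiplicity_mult_distrib)
  then have "int (multiplicity (int p) d) - int (multiplicity (int p) n)
     = int (multiplicity (int p) b) - int (multiplicity (int p) a)" by linarith
  then show ?thesis using xn q unfolding padic_abs_def x_def[symmetric] by simp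
qed

lemma rat_frac:
  fixes x :: rat
  obtains a b where "x = of_int a / of_int b" "b \<noteq> 0"
  by (metis Fract_of_int_quotient Rat_cases less_irrefl)

lemma padic_abs_0 [simp]: "padic_abs p 0 = 0"
  by (simp add: padic_abs_def)

lemma padic_abs_eq_0 [simp]: "padic_abs p x = 0 \<longleftrightarrow> x = 0"
  using p by (auto simp: padic_abs_def)

lemma padic_abs_nonneg [simp]: "0 \<le> padic_abs p x"
  by (simp add: padic_abs_def)

lemma padic_abs_mult: "padic_abs p (x * y) = padic_abs p x * padic_abs p y"
proof (cases "x = 0 \<or> y = 0")
  case True then show ?thesis by auto
next
  case False
  obtain a b where x: "x = of_int a / of_int b" "b \<noteq> 0" by (rule rat_frac)
  obtain c d where y: "y = of_int c / of_int d" "d \<noteq> 0" by (rule rat_frac)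
  have a: "a \<noteq> 0" and c: "c \<noteq> 0" using False x y by auto
  have pe: "prime_elem (int p)" using p by auto
  have p0: "real p \<noteq> 0" using p by auto
  have xy: "x * y = of_int (a * c) / of_int (b * d)" using x y by simp
  show ?thesis
    unfolding xy unfolding x(1) y(1)
    using x y a c pe p0
    by (simp add: padic_abs_frac del: of_int_mult)
       (simp add: prime_elem_multiplicity_mult_distrib power_int_add[symmetric] algebra_simps)
qed

lemma padic_abs_1 [simp]: "padic_abs p 1 = 1"
  by (simp add: padic_abs_def)

lemma padic_abs_minus [simp]: "padic_abs p (- x) = padic_abs p x"
proof -
  have "padic_abs p (-1) ^ 2 = 1"
    by (simp add: power2_eq_square padic_abs_mult[symmetric])
  then have "padic_abs p (-1) = 1"
    using padic_abs_nonneg[of "-1"] by (simp add: power2_eq_1_iff) 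
  then show ?thesis using padic_abs_mult[of "-1" x] by simp
qed

lemma padic_abs_diff_commute: "padic_abs p (x - y) = padic_abs p (y - x)"
  using padic_abs_minus[of "x - y"] by simp

lemma padic_abs_ultra: "padic_abs p (x + y) \<le> max (padic_abs p x) (padic_abs p y)"
proof (cases "x = 0 \<or> y = 0 \<or> x + y = 0")
  case True then show ?thesis by (auto simp: le_max_iff_disj)
next
  case False
  obtain a b where x: "x = of_int a / of_int b" "b \<noteq> 0" by (rule rat_frac)
  obtain c d where y: "y = of_int c / of_int d" "d \<noteq> 0" by (rule rat_frac)
  define m where "m = b * d"
  define u where "u = a * d"
  define v where "v = c * b"
  have m: "m \<noteq> 0" using x y by (simp add: m_def)
  have xu: "x = of_int u / of_int m" and yv: "y = of_int v / of_int m"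
    using x y by (simp_all add: m_def u_def v_def)
  have s: "x + y = of_int (u + v) / of_int m"
    by (simp add: xu yv add_divide_distrib)
  have nz: "u \<noteq> 0" "v \<noteq> 0" "u + v \<noteq> 0" using False xu yv s by auto
  let ?M = "multiplicity (int p)"
  have nu: "\<not> is_unit (int p)" using p by auto
  have "int p ^ (min (?M u) (?M v)) dvd u + v"
    by (intro dvd_add) (auto intro: multiplicity_dvd')
  then have "min (?M u) (?M v) \<le> ?M (u + v)"
    using nz nu by (intro multiplicity_geI) auto
  then have "?M u \<le> ?M (u + v) \<or> ?M v \<le> ?M (u + v)" by auto
  moreover have p1: "1 \<le> real p" using prime_ge_1_nat[OF p] by simp
  ultimately show ?thesis
    unfolding s unfolding xu yv padic_abs_frac[OF nz(1) m] padic_abs_frac[OF nz(2) m]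
      padic_abs_frac[OF nz(3) m] le_max_iff_disj
    by (auto intro!: power_int_increasing)
qed

lemma padic_abs_triangle: "padic_abs p (x + y) \<le> padic_abs p x + padic_abs p y"
  using padic_abs_ultra[of x y] padic_abs_nonneg[of x] padic_abs_nonneg[of y] by linarith

lemma padic_abs_diff_ge: "\<bar>padic_abs p x - padic_abs p y\<bar> \<le> padic_abs p (x - y)"
  using padic_abs_triangle[of "x - y" y] padic_abs_triangle[of "y - x" x]
  by (simp add: padic_abs_diff_commute[of y x])

lemma padic_abs_inverse: "padic_abs p (inverse x) = inverse (padic_abs p x)"
proof (cases "x = 0")
  case False
  then have "padic_abs p x * padic_abs p (inverse x) = 1"
    by (simp add: padic_abs_mult[symmetric])
  then show ?thesis by (metis inverse_unique)
qed simp

lemma padic_null_add: "padic_null p X \<Longrightarrow> padic_null p Y \<Longrightarrow> padic_null p (\<lambda>n. X n + Y n)"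
  unfolding padic_null_def
  by (rule tendsto_sandwich[of "\<lambda>_. 0" _ _ "\<lambda>n. padic_abs p (X n) + padic_abs p (Y n)"])
     (auto intro!: tendsto_add_zero simp: padic_abs_triangle)

lemma padic_null_minus: "padic_null p X \<Longrightarrow> padic_null p (\<lambda>n. - X n)"
  unfolding padic_null_def by simp

lemma padic_null_sym: "padic_null p (\<lambda>n. X n - Y n) \<Longrightarrow> padic_null p (\<lambda>n. Y n - X n)"
  using padic_null_minus[of "\<lambda>n. X n - Y n"] by simp

lemma padic_null_trans:
  "padic_null p (\<lambda>n. X n - Y n) \<Longrightarrow> padic_null p (\<lambda>n. Y n - Z n) \<Longrightarrow> padic_null p (\<lambda>n. X n - Z n)"
  using padic_null_add[of "\<lambda>n. X n - Y n" "\<lambda>n. Y n - Z n"] by simp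

lemma padic_null_0 [simp]: "padic_null p (\<lambda>n. 0)"
  by (simp add: padic_null_def)

lemma padic_cauchy_conv:
  assumes "padic_cauchy p X"
  shows "convergent (\<lambda>n. padic_abs p (X n))"
proof -
  have "Cauchy (\<lambda>n. padic_abs p (X n))"
    unfolding Cauchy_def dist_real_def
    using assms unfolding padic_cauchy_def
    by (meson padic_abs_diff_ge le_less_trans)
  then show ?thesis by (simp add: Cauchy_convergent)
qed

lemma padic_cauchy_const [simp]: "padic_cauchy p (\<lambda>n. c)"
  by (simp add: padic_cauchy_def)

lemma padic_cauchy_minus: "padic_cauchy p X \<Longrightarrow> padic_cauchy p (\<lambda>n. - X n)"
proof -
  have "padic_abs p (- X m - - X n) = padic_abs p (X m - X n)" for m n
    using padic_abs_minus[of "X m - X n"] by simp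
  then show "padic_cauchy p X \<Longrightarrow> padic_cauchy p (\<lambda>n. - X n)" by (simp add: padic_cauchy_def)
qed

lemma padic_cauchy_add:
  assumes "padic_cauchy p X" "padic_cauchy p Y"
  shows "padic_cauchy p (\<lambda>n. X n + Y n)"
  unfolding padic_cauchy_def
proof (intro allI impI)
  fix e :: real assume "e > 0"
  then have e: "e / 2 > 0" by simp
  obtain k where k: "\<forall>m\<ge>k. \<forall>n\<ge>k. padic_abs p (X m - X n) < e / 2"
    using assms(1) e unfolding padic_cauchy_def by blast
  obtain l where l: "\<forall>m\<ge>l. \<forall>n\<ge>l. padic_abs p (Y m - Y n) < e / 2"
    using assms(2) e unfolding padic_cauchy_def by blast
  have "padic_abs p (X m + Y m - (X n + Y n)) < e" if "m \<ge> max k l" "n \<ge> max k l" for m n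
  proof -
    have "padic_abs p (X m + Y m - (X n + Y n)) \<le> padic_abs p (X m - X n) + padic_abs p (Y m - Y n)"
      using padic_abs_triangle[of "X m - X n" "Y m - Y n"] by (simp add: algebra_simps)
    also have "\<dots> < e / 2 + e / 2" using k l that by (intro add_strict_mono) auto
    finally show ?thesis by simp
  qed
  then show "\<exists>k. \<forall>m\<ge>k. \<forall>n\<ge>k. padic_abs p (X m + Y m - (X n + Y n)) < e" by blast
qed

lemma padic_bounded:
  assumes "padic_cauchy p X"
  shows "\<exists>B>0. \<forall>n. padic_abs p (X n) \<le> B"
proof -
  have "Bseq (\<lambda>n. padic_abs p (X n))"
    using padic_cauchy_conv[OF assms] convergent_imp_Bseq by blast
  then show ?thesis unfolding Bseq_def by auto
qed

lemma padic_null_mult: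
  assumes "padic_cauchy p X" "padic_null p Y"
  shows "padic_null p (\<lambda>n. X n * Y n)"
proof -
  obtain B where B: "B > 0" "\<forall>n. padic_abs p (X n) \<le> B"
    using padic_bounded[OF assms(1)] by blast
  have l: "(\<lambda>n. B * padic_abs p (Y n)) \<longlonglongrightarrow> 0"
    using assms(2) unfolding padic_null_def by (simp add: tendsto_mult_right_zero)
  show ?thesis
    unfolding padic_null_def padic_abs_mult
    by (rule Lim_null_comparison[OF _ l]) (use B in \<open>auto simp: abs_mult intro!: always_eventually mult_right_mono\<close>)
qed

lemma padic_cauchy_mult:
  assumes "padic_cauchy p X" "padic_cauchy p Y"
  shows "padic_cauchy p (\<lambda>n. X n * Y n)"
  unfolding padic_cauchy_def
proof (intro allI impI)
  fix e :: real assume e: "e > 0"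
  obtain B where B: "B > 0" "\<forall>n. padic_abs p (X n) \<le> B" using padic_bounded[OF assms(1)] by blast
  obtain C where C: "C > 0" "\<forall>n. padic_abs p (Y n) \<le> C" using padic_bounded[OF assms(2)] by blast
  have pC: "e / 2 / C > 0" and pB: "e / 2 / B > 0" using e B C by simp_all
  obtain k where k: "\<forall>m\<ge>k. \<forall>n\<ge>k. padic_abs p (X m - X n) < e / 2 / C"
    using assms(1) pC unfolding padic_cauchy_def by blast
  obtain l where l: "\<forall>m\<ge>l. \<forall>n\<ge>l. padic_abs p (Y m - Y n) < e / 2 / B"
    using assms(2) pB unfolding padic_cauchy_def by blast
  have "padic_abs p (X m * Y m - X n * Y n) < e" if mn: "m \<ge> max k l" "n \<ge> max k l" for m n
  proof -
    have "padic_abs p (X m * Y m - X n * Y n)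
       \<le> padic_abs p (X m * (Y m - Y n)) + padic_abs p ((X m - X n) * Y n)"
      using padic_abs_triangle[of "X m * (Y m - Y n)" "(X m - X n) * Y n"]
      by (simp add: algebra_simps)
    also have "\<dots> \<le> B * padic_abs p (Y m - Y n) + padic_abs p (X m - X n) * C"
      unfolding padic_abs_mult using B C by (intro add_mono mult_right_mono mult_left_mono) auto
    also have "\<dots> < B * (e / 2 / B) + (e / 2 / C) * C"
      using k l mn B C by (intro add_strict_mono mult_strict_left_mono mult_strict_right_mono) auto
    also have "\<dots> = e" using B C by simp
    finally show ?thesis .
  qed
  then show "\<exists>k. \<forall>m\<ge>k. \<forall>n\<ge>k. padic_abs p (X m * Y m - X n * Y n) < e" by blast
qed

lemma padic_not_null:
  assumes "padic_cauchy p X" "\<not> padic_null p X"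
  shows "\<exists>b>0. \<exists>k. \<forall>n\<ge>k. b < padic_abs p (X n)"
proof -
  obtain L where L: "(\<lambda>n. padic_abs p (X n)) \<longlonglongrightarrow> L"
    using padic_cauchy_conv[OF assms(1)] by (auto simp: convergent_def)
  have "L \<ge> 0" using L by (rule LIMSEQ_le_const) auto
  moreover have "L \<noteq> 0" using L assms(2) by (auto simp: padic_null_def)
  ultimately have "L / 2 > 0" "L / 2 < L" by auto
  moreover have "eventually (\<lambda>n. L / 2 < padic_abs p (X n)) sequentially"
    using L \<open>L / 2 < L\<close> by (rule order_tendstoD)
  ultimately show ?thesis unfolding eventually_sequentially by blast
qed

lemma padic_cauchy_inverse:
  assumes "padic_cauchy p X" "\<not> padic_null p X"
  shows "padic_cauchy p (\<lambda>n. inverse (X n))"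
  unfolding padic_cauchy_def
proof (intro allI impI)
  fix e :: real assume e: "e > 0"
  obtain b l where b: "b > 0" "\<forall>n\<ge>l. b < padic_abs p (X n)"
    using padic_not_null[OF assms] by blast
  have "e * b * b > 0" using e b by simp
  then obtain k where k: "\<forall>m\<ge>k. \<forall>n\<ge>k. padic_abs p (X m - X n) < e * b * b"
    using assms(1) unfolding padic_cauchy_def by blast
  have "padic_abs p (inverse (X m) - inverse (X n)) < e" if mn: "m \<ge> max k l" "n \<ge> max k l" for m n
  proof -
    have bm: "b < padic_abs p (X m)" and bn: "b < padic_abs p (X n)" using b mn by auto
    have nz: "X m \<noteq> 0" "X n \<noteq> 0" using bm bn b(1) by auto
    have pos: "0 < padic_abs p (X m)" "0 < padic_abs p (X n)" using bm bn b(1) by auto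
    have "inverse (X m) - inverse (X n) = (X n - X m) * (inverse (X m) * inverse (X n))"
      using nz by (simp add: field_simps)
    then have "padic_abs p (inverse (X m) - inverse (X n))
       = padic_abs p (X m - X n) / (padic_abs p (X m) * padic_abs p (X n))"
      by (simp only: padic_abs_mult padic_abs_inverse padic_abs_diff_commute[of "X n"]
          divide_inverse inverse_mult_distrib)
    also have "\<dots> \<le> padic_abs p (X m - X n) / (b * b)"
      using bm bn b(1) by (intro divide_left_mono mult_mono mult_pos_pos pos) auto
    also have "\<dots> < e" using k mn b(1) by (simp add: divide_less_eq mult.assoc)
    finally show ?thesis .
  qed
  then show "\<exists>k. \<forall>m\<ge>k. \<forall>n\<ge>k. padic_abs p (inverse (X m) - inverse (X n)) < e" by blast
qed

lemma padic_class_eq_iff: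
  assumes "padic_cauchy p X" "padic_cauchy p Y"
  shows "padic_class p X = padic_class p Y \<longleftrightarrow> padic_null p (\<lambda>n. X n - Y n)"
proof
  assume e: "padic_class p X = padic_class p Y"
  have "Y \<in> padic_class p X"
    unfolding e unfolding padic_class_def using assms by simp
  then show "padic_null p (\<lambda>n. X n - Y n)" unfolding padic_class_def by (rule CollectE) (erule conjunct2)
next
  assume n: "padic_null p (\<lambda>n. X n - Y n)"
  show "padic_class p X = padic_class p Y"
    unfolding padic_class_def
  proof (intro Collect_cong conj_cong refl iffI)
    fix Z
    show "padic_null p (\<lambda>n. Y n - Z n)" if "padic_null p (\<lambda>n. X n - Z n)"
      using padic_null_sym[OF n] that by (rule padic_null_trans)
    show "padic_null p (\<lambda>n. X n - Z n)" if "padic_null p (\<lambda>n. Y n - Z n)"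
      using n that by (rule padic_null_trans)
  qed
qed

end

typedef (overloaded) ('p::prime_card) padic = "padic_class CARD('p) ` Collect (padic_cauchy CARD('p))"
  morphisms rep_padic abs_padic
  by (rule exI[of _ "padic_class CARD('p) (\<lambda>_. 0)"]) (auto simp: padic_cauchy_const[OF prime_card])

definition padic_lim :: "(nat \<Rightarrow> rat) \<Rightarrow> 'p::prime_card padic" where
  "padic_lim X = abs_padic (padic_class CARD('p) X)"

definition padic_seq :: "'p::prime_card padic \<Rightarrow> nat \<Rightarrow> rat" where
  "padic_seq a = (SOME X. X \<in> rep_padic a)"

lemma rep_padic_lim:
  "padic_cauchy CARD('p) X \<Longrightarrow> rep_padic (padic_lim X :: 'p::prime_card padic) = padic_class CARD('p) X"
  unfolding padic_lim_def by (rule abs_padic_inverse) auto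

lemma padic_lim_eq_iff:
  assumes "padic_cauchy CARD('p) X" "padic_cauchy CARD('p) Y"
  shows "(padic_lim X :: 'p::prime_card padic) = padic_lim Y \<longleftrightarrow> padic_null CARD('p) (\<lambda>n. X n - Y n)"
proof -
  have "(padic_lim X :: 'p::prime_card padic) = padic_lim Y
        \<longleftrightarrow> padic_class CARD('p) X = padic_class CARD('p) Y"
    unfolding padic_lim_def by (rule abs_padic_inject) (use assms in auto)
  then show ?thesis by (simp add: padic_class_eq_iff[OF prime_card assms])
qed

lemma padic_seq_class:
  assumes "padic_cauchy CARD('p) X"
  shows "padic_cauchy CARD('p) (padic_seq (padic_lim X :: 'p::prime_card padic))"
    "padic_null CARD('p) (\<lambda>n. X n - padic_seq (padic_lim X :: 'p padic) n)"
proof -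
  have "X \<in> rep_padic (padic_lim X :: 'p padic)"
    using assms by (simp add: rep_padic_lim padic_class_def prime_card padic_null_0)
  then have "padic_seq (padic_lim X :: 'p padic) \<in> rep_padic (padic_lim X :: 'p padic)"
    unfolding padic_seq_def by (rule someI[where P = "\<lambda>Y. Y \<in> rep_padic (padic_lim X :: 'p padic)"])
  then show "padic_cauchy CARD('p) (padic_seq (padic_lim X :: 'p::prime_card padic))"
    "padic_null CARD('p) (\<lambda>n. X n - padic_seq (padic_lim X :: 'p padic) n)"
    using assms by (auto simp: rep_padic_lim padic_class_def)
qed

lemma padic_cases [case_names lim, cases type: padic]:
  fixes a :: "'p::prime_card padic"
  obtains X where "a = padic_lim X" "padic_cauchy CARD('p) X"
proof -
  obtain X where "padic_cauchy CARD('p) X" "rep_padic a = padic_class CARD('p) X"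
    using rep_padic[of a] by auto
  then show ?thesis using that by (metis padic_lim_def rep_padic_inverse)
qed

instantiation padic :: (prime_card) field
begin

definition zero_padic :: "'a padic" where "0 = padic_lim (\<lambda>n. 0)"
definition one_padic :: "'a padic" where "1 = padic_lim (\<lambda>n. 1)"
definition plus_padic :: "'a padic \<Rightarrow> 'a padic \<Rightarrow> 'a padic" where
  "a + b = padic_lim (\<lambda>n. padic_seq a n + padic_seq b n)"
definition uminus_padic :: "'a padic \<Rightarrow> 'a padic" where
  "- a = padic_lim (\<lambda>n. - padic_seq a n)"
definition "a - b = a + - b" for a b :: "'a padic"
definition times_padic :: "'a padic \<Rightarrow> 'a padic \<Rightarrow> 'a padic" where
  "a * b = padic_lim (\<lambda>n. padic_seq a n * padic_seq b n)"
definition inverse_padic :: "'a padic \<Rightarrow> 'a padic" where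
  "inverse a = (if a = 0 then 0 else padic_lim (\<lambda>n. inverse (padic_seq a n)))"
definition "a div b = a * inverse b" for a b :: "'a padic"

lemma add_padic_lim:
  assumes "padic_cauchy CARD('a) X" "padic_cauchy CARD('a) Y"
  shows "(padic_lim X + padic_lim Y :: 'a padic) = padic_lim (\<lambda>n. X n + Y n)"
proof -
  let ?U = "padic_seq (padic_lim X :: 'a padic)" and ?V = "padic_seq (padic_lim Y :: 'a padic)"
  have "padic_null CARD('a) (\<lambda>n. (X n - ?U n) + (Y n - ?V n))"
    using assms by (intro padic_null_add prime_card padic_seq_class)
  then have "padic_null CARD('a) (\<lambda>n. X n + Y n - (?U n + ?V n))" by (simp add: algebra_simps)
  then show ?thesis unfolding plus_padic_def
    using assms by (subst eq_commute, subst padic_lim_eq_iff)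
      (auto intro!: padic_cauchy_add prime_card padic_seq_class)
qed

lemma minus_padic_lim:
  assumes "padic_cauchy CARD('a) X"
  shows "(- padic_lim X :: 'a padic) = padic_lim (\<lambda>n. - X n)"
proof -
  let ?U = "padic_seq (padic_lim X :: 'a padic)"
  have "padic_null CARD('a) (\<lambda>n. - (X n - ?U n))"
    using assms by (intro padic_null_minus prime_card padic_seq_class)
  then have "padic_null CARD('a) (\<lambda>n. - X n - - ?U n)" by (simp add: algebra_simps)
  then show ?thesis unfolding uminus_padic_def
    using assms by (subst eq_commute, subst padic_lim_eq_iff)
      (auto intro!: padic_cauchy_minus prime_card padic_seq_class)
qed

lemma mult_padic_lim:
  assumes "padic_cauchy CARD('a) X" "padic_cauchy CARD('a) Y"
  shows "(padic_lim X * padic_lim Y :: 'a padic) = padic_lim (\<lambda>n. X n * Y n)"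
proof -
  let ?U = "padic_seq (padic_lim X :: 'a padic)" and ?V = "padic_seq (padic_lim Y :: 'a padic)"
  have "padic_null CARD('a) (\<lambda>n. X n * (Y n - ?V n) + ?V n * (X n - ?U n))"
    using assms by (intro padic_null_add padic_null_mult prime_card padic_seq_class)
  then have "padic_null CARD('a) (\<lambda>n. X n * Y n - (?U n * ?V n))" by (simp add: algebra_simps)
  then show ?thesis unfolding times_padic_def
    using assms by (subst eq_commute, subst padic_lim_eq_iff)
      (auto intro!: padic_cauchy_mult prime_card padic_seq_class)
qed

lemma padic_lim_eq_0_iff:
  assumes "padic_cauchy CARD('a) X"
  shows "(padic_lim X :: 'a padic) = 0 \<longleftrightarrow> padic_null CARD('a) X"
  unfolding zero_padic_def using assms
  by (simp add: padic_lim_eq_iff padic_cauchy_const prime_card)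

lemma mult_inverse_padic:
  fixes a :: "'a padic"
  assumes "a \<noteq> 0"
  shows "inverse a * a = 1"
proof (cases a)
  case (lim Z)
  define X where "X = padic_seq a"
  have X: "padic_cauchy CARD('a) X" "padic_null CARD('a) (\<lambda>n. Z n - X n)"
    using padic_seq_class[of Z] lim by (simp_all add: X_def)
  have aX: "a = padic_lim X"
    unfolding lim(1) by (subst padic_lim_eq_iff) (use X lim in auto)
  have nn: "\<not> padic_null CARD('a) X" using padic_lim_eq_0_iff[OF X(1)] assms aX by simp
  obtain b k where b: "b > 0" "\<forall>n\<ge>k. b < padic_abs CARD('a) (X n)"
    using padic_not_null[OF prime_card X(1) nn] by blast
  have "X n \<noteq> 0" if "n \<ge> k" for n
    using b that by (auto simp: padic_abs_0[OF prime_card] dest!: spec[of _ n])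
  then have "eventually (\<lambda>n. padic_abs CARD('a) (inverse (X n) * X n - 1) = 0) sequentially"
    unfolding eventually_sequentially by (intro exI[of _ k]) (simp add: padic_abs_0 prime_card)
  then have n: "padic_null CARD('a) (\<lambda>n. inverse (X n) * X n - 1)"
    unfolding padic_null_def by (rule tendsto_eventually)
  have "inverse a = padic_lim (\<lambda>n. inverse (X n))"
    using assms by (simp add: inverse_padic_def X_def)
  then have "inverse a * a = padic_lim (\<lambda>n. inverse (X n)) * padic_lim X"
    using aX by (rule arg_cong2)
  also have "\<dots> = padic_lim (\<lambda>n. inverse (X n) * X n)"
    by (intro mult_padic_lim padic_cauchy_inverse prime_card X nn)
  also have "\<dots> = 1"
    unfolding one_padic_def
    by (subst padic_lim_eq_iff)
       (auto intro!: padic_cauchy_mult padic_cauchy_inverse padic_cauchy_const prime_card X nn n)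
  finally show ?thesis .
qed

instance
proof
  fix a b c :: "'a padic"
  show "a + b = b + a" by (cases a; cases b) (simp add: add_padic_lim add.commute)
  show "a * b = b * a" by (cases a; cases b) (simp add: mult_padic_lim mult.commute)
  obtain X Y Z where X: "a = padic_lim X" "padic_cauchy CARD('a) X"
    and Y: "b = padic_lim Y" "padic_cauchy CARD('a) Y"
    and Z: "c = padic_lim Z" "padic_cauchy CARD('a) Z"
    by (rule padic_cases[of a], rule padic_cases[of b], rule padic_cases[of c]) blast
  note cl = padic_cauchy_add padic_cauchy_mult padic_cauchy_minus padic_cauchy_const prime_card
  show "a + b + c = a + (b + c)"
    using X Y Z by (simp add: add_padic_lim cl add.assoc)
  show "a * b * c = a * (b * c)"
    using X Y Z by (simp add: mult_padic_lim cl mult.assoc)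
  show "(a + b) * c = a * c + b * c"
    using X Y Z by (simp add: add_padic_lim mult_padic_lim cl distrib_right)
  show "0 + a = a" unfolding zero_padic_def using X by (simp add: add_padic_lim cl)
  show "1 * a = a" unfolding one_padic_def using X by (simp add: mult_padic_lim cl)
  show "- a + a = 0" unfolding zero_padic_def
    using X by (simp add: add_padic_lim minus_padic_lim cl)
  show "a - b = a + - b" by (rule minus_padic_def)
  show "(0 :: 'a padic) \<noteq> 1"
    using padic_lim_eq_0_iff[of "\<lambda>n. 1"]
    by (auto simp: one_padic_def padic_null_def padic_abs_1 padic_cauchy_const prime_card LIMSEQ_const_iff)
  show "a \<noteq> 0 \<Longrightarrow> inverse a * a = 1" by (rule mult_inverse_padic)
  show "a div b = a * inverse b" by (rule divide_padic_def)
  show "inverse (0 :: 'a padic) = 0" by (simp add: inverse_padic_def)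
qed

end

definition padic_norm :: "'p::prime_card padic \<Rightarrow> real" where
  "padic_norm a = lim (\<lambda>n. padic_abs CARD('p) (padic_seq a n))"

lemma padic_norm_lim:
  assumes "padic_cauchy CARD('p) X"
  shows "(\<lambda>n. padic_abs CARD('p) (X n)) \<longlonglongrightarrow> padic_norm (padic_lim X :: 'p::prime_card padic)"
proof -
  let ?U = "padic_seq (padic_lim X :: 'p padic)"
  have U: "padic_cauchy CARD('p) ?U" "padic_null CARD('p) (\<lambda>n. X n - ?U n)"
    using padic_seq_class[OF assms] .
  have 1: "(\<lambda>n. padic_abs CARD('p) (?U n)) \<longlonglongrightarrow> padic_norm (padic_lim X :: 'p padic)"
    unfolding padic_norm_def using padic_cauchy_conv[OF prime_card U(1)]
    by (simp add: convergent_LIMSEQ_iff)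
  have "(\<lambda>n. padic_abs CARD('p) (X n) - padic_abs CARD('p) (?U n)) \<longlonglongrightarrow> 0"
    using U(2) unfolding padic_null_def
    by (rule Lim_null_comparison[rotated]) (simp add: padic_abs_diff_ge prime_card)
  from tendsto_add[OF this 1] show ?thesis by simp
qed

lemma padic_norm_eq_0_iff: "padic_norm a = 0 \<longleftrightarrow> a = 0" for a :: "'p::prime_card padic"
proof (cases a)
  case (lim X)
  have "padic_norm a = 0 \<longleftrightarrow> padic_null CARD('p) X"
    unfolding padic_null_def using padic_norm_lim[OF lim(2)] lim(1) LIMSEQ_unique by metis
  then show ?thesis using padic_lim_eq_0_iff[OF lim(2)] lim(1) by simp
qed

lemma padic_norm_minus: "padic_norm (- a) = padic_norm a" for a :: "'p::prime_card padic"
proof (cases a)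
  case (lim X)
  have "(\<lambda>n. padic_abs CARD('p) (- X n)) \<longlonglongrightarrow> padic_norm (- a)"
    unfolding lim(1) minus_padic_lim[OF lim(2)]
    by (intro padic_norm_lim padic_cauchy_minus prime_card lim)
  moreover have "(\<lambda>n. padic_abs CARD('p) (- X n)) \<longlonglongrightarrow> padic_norm a"
    using padic_norm_lim[OF lim(2)] lim(1) by (simp add: padic_abs_minus prime_card)
  ultimately show ?thesis by (rule LIMSEQ_unique)
qed

lemma padic_norm_triangle: "padic_norm (a + b) \<le> padic_norm a + padic_norm b"
  for a b :: "'p::prime_card padic"
proof (cases a; cases b)
  fix X Y assume X: "a = padic_lim X" "padic_cauchy CARD('p) X"
    and Y: "b = padic_lim Y" "padic_cauchy CARD('p) Y"
  have 1: "(\<lambda>n. padic_abs CARD('p) (X n + Y n)) \<longlonglongrightarrow> padic_norm (a + b)"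
    unfolding X(1) Y(1) add_padic_lim[OF X(2) Y(2)]
    by (intro padic_norm_lim padic_cauchy_add prime_card X Y)
  have 2: "(\<lambda>n. padic_abs CARD('p) (X n) + padic_abs CARD('p) (Y n))
            \<longlonglongrightarrow> padic_norm a + padic_norm b"
    unfolding X(1) Y(1) by (intro tendsto_add padic_norm_lim X Y)
  show ?thesis
    by (rule LIMSEQ_le[OF 1 2]) (auto simp: padic_abs_triangle prime_card)
qed

lemma of_int_padic: "(of_int n :: 'p::prime_card padic) = padic_lim (\<lambda>_. of_int n)"
proof (induction n rule: int_induct[where k = 0])
  case base then show ?case by (simp add: zero_padic_def)
next
  case (step1 i)
  then show ?case
    by (simp add: one_padic_def add_padic_lim padic_cauchy_const prime_card)
next
  case (step2 i)
  then show ?case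
    by (simp add: one_padic_def add_padic_lim minus_padic_lim minus_padic_def
        padic_cauchy_const padic_cauchy_minus prime_card)
qed

instance padic :: (prime_card) field_char_0
proof
  have "x = y" if "(of_nat x :: 'a padic) = of_nat y" for x y
  proof -
    have "(padic_lim (\<lambda>_. of_int (int x)) :: 'a padic) = padic_lim (\<lambda>_. of_int (int y))"
      using that of_int_padic[of "int x", where 'p = 'a] of_int_padic[of "int y", where 'p = 'a] by simp
    then have "padic_null CARD('a) (\<lambda>_. of_int (int x) - of_int (int y))"
      by (simp add: padic_lim_eq_iff padic_cauchy_const prime_card)
    then have "padic_abs CARD('a) (of_int (int x) - of_int (int y)) = 0"
      unfolding padic_null_def by (simp add: LIMSEQ_const_iff)
    then show "x = y" by (simp add: padic_abs_eq_0 prime_card)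
  qed
  then show "inj (of_nat :: nat \<Rightarrow> 'a padic)" by (auto intro: injI)
qed

instantiation padic :: (prime_card) metric_space
begin

definition dist_padic :: "'a padic \<Rightarrow> 'a padic \<Rightarrow> real" where
  "dist a b = padic_norm (a - b)"
definition "uniformity = (INF e\<in>{0<..}. principal {(x, y :: 'a padic). dist x y < e})"
definition "open U \<longleftrightarrow> (\<forall>x\<in>U. eventually (\<lambda>(x', y). x' = x \<longrightarrow> y \<in> U) uniformity)"
  for U :: "'a padic set"

instance
proof
  fix x y z :: "'a padic" and U :: "'a padic set"
  show "dist x y = 0 \<longleftrightarrow> x = y" by (simp add: dist_padic_def padic_norm_eq_0_iff)
  have "dist x z + dist y z = padic_norm (x - z) + padic_norm (z - y)"
    using padic_norm_minus[of "y - z"] by (simp add: dist_padic_def)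
  then show "dist x y \<le> dist x z + dist y z"
    using padic_norm_triangle[of "x - z" "z - y"] by (simp add: dist_padic_def)
  show "open U \<longleftrightarrow> (\<forall>x\<in>U. eventually (\<lambda>(x', y). x' = x \<longrightarrow> y \<in> U) uniformity)"
    by (rule open_padic_def)
qed (rule uniformity_padic_def)

end


text \<open>
  The branch of the logarithm with \<open>log p = 0\<close>: if \<open>x = p^v * u\<close> with \<open>u\<close> a \<open>p\<close>-adic unit, then
  \<open>u^(p-1)\<close> lies in \<open>1 + p Z_p\<close>, where the logarithm series converges.  The value at \<open>0\<close> is
  irrelevant.
\<close>

definition padic_val :: "'p::prime_card padic \<Rightarrow> int" where
  "padic_val x = (THE v. padic_norm x = real CARD('p) powi (- v))"

definition padic_log :: "'p::prime_card padic \<Rightarrow> 'p padic" where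
  "padic_log x =
     (let w = (x * of_nat CARD('p) powi (- padic_val x)) ^ (CARD('p) - 1)
      in - suminf (\<lambda>\<nu>. (1 - w) ^ Suc \<nu> / of_nat (Suc \<nu>)) / of_nat (CARD('p) - 1))"


section \<open>Group rings and their completions\<close>

definition residually_finite :: "('g, 'b) monoid_scheme \<Rightarrow> bool" where
  "residually_finite G \<longleftrightarrow>
     (\<forall>g\<in>carrier G. g \<noteq> \<one>\<^bsub>G\<^esub> \<longrightarrow> (\<exists>N. N \<lhd> G \<and> finite (rcosets\<^bsub>G\<^esub> N) \<and> g \<notin> N))"

definition converges_to_e :: "('g, 'b) monoid_scheme \<Rightarrow> (nat \<Rightarrow> 'g set) \<Rightarrow> bool" where
  "converges_to_e G N \<longleftrightarrow>
     (\<forall>n. N n \<lhd> G \<and> finite (rcosets\<^bsub>G\<^esub> (N n))) \<and>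
     (\<forall>I. infinite I \<longrightarrow> (\<Inter>n\<in>I. N n) = {\<one>\<^bsub>G\<^esub>})"

definition group_elt :: "'g \<Rightarrow> 'g \<Rightarrow> 'r::zero_neq_one" where
  "group_elt g h = (if h = g then 1 else 0)"

definition group_ring :: "('g, 'b) monoid_scheme \<Rightarrow> ('g \<Rightarrow> 'r::comm_ring_1) ring" where
  "group_ring G =
     \<lparr>carrier = {x. finite {g. x g \<noteq> 0} \<and> (\<forall>g. g \<notin> carrier G \<longrightarrow> x g = 0)},
      monoid.mult = (\<lambda>x y g. if g \<in> carrier G
                       then \<Sum>h | x h \<noteq> 0. x h * y (inv\<^bsub>G\<^esub> h \<otimes>\<^bsub>G\<^esub> g) else 0),
      one = group_elt \<one>\<^bsub>G\<^esub>,
      zero = (\<lambda>_. 0),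
      add = (\<lambda>x y g. x g + y g)\<rparr>"

abbreviation int_group_ring :: "('g, 'b) monoid_scheme \<Rightarrow> ('g \<Rightarrow> int) ring" where
  "int_group_ring \<equiv> group_ring"

definition c0 :: "('g, 'b) monoid_scheme \<Rightarrow> ('g \<Rightarrow> 'p::prime_card padic) ring" where
  "c0 G =
     \<lparr>carrier = {x. (\<forall>\<epsilon>>0. finite {g. padic_norm (x g) \<ge> \<epsilon>})
                    \<and> (\<forall>g. g \<notin> carrier G \<longrightarrow> x g = 0)},
      monoid.mult = (\<lambda>x y g. if g \<in> carrier G
                       then \<Sum>\<^sub>\<infinity>h\<in>carrier G. x h * y (inv\<^bsub>G\<^esub> h \<otimes>\<^bsub>G\<^esub> g) else 0),
      one = group_elt \<one>\<^bsub>G\<^esub>,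
      zero = (\<lambda>_. 0),
      add = (\<lambda>x y g. x g + y g)\<rparr>"

text \<open>The formal sums with coefficients in the \<open>p\<close>-adic integers, that is, of norm at most \<open>1\<close>.\<close>

definition completed_group_ring :: "('g, 'b) monoid_scheme \<Rightarrow> ('g \<Rightarrow> 'p::prime_card padic) ring" where
  "completed_group_ring G =
     (c0 G)\<lparr>carrier := {x \<in> carrier (c0 G). \<forall>g. padic_norm (x g) \<le> 1}\<rparr>"

definition to_c0 :: "('g \<Rightarrow> int) \<Rightarrow> 'g \<Rightarrow> 'p::prime_card padic" where
  "to_c0 x g = of_int (x g)"

definition c0_quotient_map ::
    "('g, 'b) monoid_scheme \<Rightarrow> 'g set \<Rightarrow> ('g \<Rightarrow> 'p::prime_card padic) \<Rightarrow> 'g set \<Rightarrow> 'p padic" where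
  "c0_quotient_map G N x C = (if C \<in> carrier (G Mod N) then \<Sum>\<^sub>\<infinity>g\<in>C. x g else 0)"


section \<open>Left modules over a noncommutative ring\<close>

text \<open>The library's locale \<^locale>\<open>module\<close> requires a commutative ring of scalars.\<close>

locale left_module = R?: ring R + M?: abelian_group M
  for R (structure) and M :: "('r, 'm, 'c) module_scheme" (structure) +
  assumes smult_closed:
      "\<lbrakk>a \<in> carrier R; x \<in> carrier M\<rbrakk> \<Longrightarrow> a \<odot>\<^bsub>M\<^esub> x \<in> carrier M"
    and smult_l_distr:
      "\<lbrakk>a \<in> carrier R; b \<in> carrier R; x \<in> carrier M\<rbrakk> \<Longrightarrow>
       (a \<oplus>\<^bsub>R\<^esub> b) \<odot>\<^bsub>M\<^esub> x = a \<odot>\<^bsub>M\<^esub> x \<oplus>\<^bsub>M\<^esub> b \<odot>\<^bsub>M\<^esub> x"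
    and smult_r_distr:
      "\<lbrakk>a \<in> carrier R; x \<in> carrier M; y \<in> carrier M\<rbrakk> \<Longrightarrow>
       a \<odot>\<^bsub>M\<^esub> (x \<oplus>\<^bsub>M\<^esub> y) = a \<odot>\<^bsub>M\<^esub> x \<oplus>\<^bsub>M\<^esub> a \<odot>\<^bsub>M\<^esub> y"
    and smult_assoc1:
      "\<lbrakk>a \<in> carrier R; b \<in> carrier R; x \<in> carrier M\<rbrakk> \<Longrightarrow>
       (a \<otimes>\<^bsub>R\<^esub> b) \<odot>\<^bsub>M\<^esub> x = a \<odot>\<^bsub>M\<^esub> (b \<odot>\<^bsub>M\<^esub> x)"
    and smult_one: "x \<in> carrier M \<Longrightarrow> \<one>\<^bsub>R\<^esub> \<odot>\<^bsub>M\<^esub> x = x"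

definition lmod_hom :: "'r ring \<Rightarrow> ('r, 'm) module \<Rightarrow> ('r, 'n) module \<Rightarrow> ('m \<Rightarrow> 'n) set" where
  "lmod_hom R M N =
     {h \<in> carrier M \<rightarrow> carrier N.
        (\<forall>x\<in>carrier M. \<forall>y\<in>carrier M. h (x \<oplus>\<^bsub>M\<^esub> y) = h x \<oplus>\<^bsub>N\<^esub> h y) \<and>
        (\<forall>a\<in>carrier R. \<forall>x\<in>carrier M. h (a \<odot>\<^bsub>M\<^esub> x) = a \<odot>\<^bsub>N\<^esub> h x)}"

definition is_coords ::
    "'r ring \<Rightarrow> ('r, 'm) module \<Rightarrow> 'm list \<Rightarrow> 'm \<Rightarrow> (nat \<Rightarrow> 'r) \<Rightarrow> bool" where
  "is_coords R M bs x a \<longleftrightarrow>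
     a \<in> {..<length bs} \<rightarrow>\<^sub>E carrier R \<and>
     x = finsum M (\<lambda>i. a i \<odot>\<^bsub>M\<^esub> bs ! i) {..<length bs}"

definition lmod_basis :: "'r ring \<Rightarrow> ('r, 'm) module \<Rightarrow> 'm list \<Rightarrow> bool" where
  "lmod_basis R M bs \<longleftrightarrow>
     set bs \<subseteq> carrier M \<and> (\<forall>x\<in>carrier M. \<exists>!a. is_coords R M bs x a)"

definition coords :: "'r ring \<Rightarrow> ('r, 'm) module \<Rightarrow> 'm list \<Rightarrow> 'm \<Rightarrow> nat \<Rightarrow> 'r" where
  "coords R M bs x = (THE a. is_coords R M bs x a)"


section \<open>Extension of scalars\<close>

text \<open>
  For a ring homomorphism \<open>\<iota>: R \<rightarrow> S\<close> and a left \<open>R\<close>-module \<open>M\<close>, the tensor product of \<open>S\<close> (a right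
  \<open>R\<close>-module via \<open>\<iota>\<close>) with \<open>M\<close> over \<open>R\<close> is the free abelian group on the pairs \<open>(s, m)\<close> modulo the
  subgroup of bilinearity relations; its elements are cosets.
\<close>

definition tensor_relations ::
    "'r ring \<Rightarrow> 's ring \<Rightarrow> ('r \<Rightarrow> 's) \<Rightarrow> ('r, 'm) module \<Rightarrow> ('s \<times> 'm \<Rightarrow>\<^sub>0 int) set" where
  "tensor_relations R S \<iota> M =
     generate (free_Abelian_group (carrier S \<times> carrier M))
       ({frag_of (s \<oplus>\<^bsub>S\<^esub> s', m) - frag_of (s, m) - frag_of (s', m) | s s' m.
            s \<in> carrier S \<and> s' \<in> carrier S \<and> m \<in> carrier M} \<union>
        {frag_of (s, m \<oplus>\<^bsub>M\<^esub> m') - frag_of (s, m) - frag_of (s, m') | s m m'.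
            s \<in> carrier S \<and> m \<in> carrier M \<and> m' \<in> carrier M} \<union>
        {frag_of (s \<otimes>\<^bsub>S\<^esub> \<iota> r, m) - frag_of (s, r \<odot>\<^bsub>M\<^esub> m) | s r m.
            s \<in> carrier S \<and> r \<in> carrier R \<and> m \<in> carrier M})"

definition tensor_group ::
    "'r ring \<Rightarrow> 's ring \<Rightarrow> ('r \<Rightarrow> 's) \<Rightarrow> ('r, 'm) module \<Rightarrow> ('s \<times> 'm \<Rightarrow>\<^sub>0 int) set monoid" where
  "tensor_group R S \<iota> M =
     free_Abelian_group (carrier S \<times> carrier M) Mod tensor_relations R S \<iota> M"

definition tensor ::
    "'r ring \<Rightarrow> 's ring \<Rightarrow> ('r \<Rightarrow> 's) \<Rightarrow> ('r, 'm) module \<Rightarrow> 's \<Rightarrow> 'm \<Rightarrow> ('s \<times> 'm \<Rightarrow>\<^sub>0 int) set" where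
  "tensor R S \<iota> M s m =
     tensor_relations R S \<iota> M #>\<^bsub>free_Abelian_group (carrier S \<times> carrier M)\<^esub> frag_of (s, m)"

text \<open>
  The additive map between tensor products induced by a map of generators; the image of a coset of
  the relations of \<open>M\<close> is filled up to a coset of the relations of \<open>N\<close>.
\<close>

definition tensor_induced ::
    "'r ring \<Rightarrow> 's ring \<Rightarrow> ('r \<Rightarrow> 's) \<Rightarrow> ('r, 'n) module \<Rightarrow>
     ('s \<times> 'm \<Rightarrow> 's \<times> 'n) \<Rightarrow> ('s \<times> 'm \<Rightarrow>\<^sub>0 int) set \<Rightarrow> ('s \<times> 'n \<Rightarrow>\<^sub>0 int) set" where
  "tensor_induced R S \<iota> N h X =
     tensor_relations R S \<iota> N <#>\<^bsub>free_Abelian_group (carrier S \<times> carrier N)\<^esub>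
       (frag_extend (\<lambda>sm. frag_of (h sm)) ` X)"

text \<open>The fields \<open>mult\<close> and \<open>one\<close> of a module record carry no meaning.\<close>

definition base_change ::
    "'r ring \<Rightarrow> 's ring \<Rightarrow> ('r \<Rightarrow> 's) \<Rightarrow> ('r, 'm) module \<Rightarrow>
     ('s, ('s \<times> 'm \<Rightarrow>\<^sub>0 int) set) module" where
  "base_change R S \<iota> M =
     \<lparr>carrier = carrier (tensor_group R S \<iota> M),
      monoid.mult = (\<lambda>_ _. undefined), one = undefined,
      zero = \<one>\<^bsub>tensor_group R S \<iota> M\<^esub>,
      add = monoid.mult (tensor_group R S \<iota> M),
      module.smult = (\<lambda>s. tensor_induced R S \<iota> M (\<lambda>(t, m). (s \<otimes>\<^bsub>S\<^esub> t, m)))\<rparr>"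

definition base_change_map ::
    "'r ring \<Rightarrow> 's ring \<Rightarrow> ('r \<Rightarrow> 's) \<Rightarrow> ('r, 'n) module \<Rightarrow> ('m \<Rightarrow> 'n) \<Rightarrow>
     ('s \<times> 'm \<Rightarrow>\<^sub>0 int) set \<Rightarrow> ('s \<times> 'n \<Rightarrow>\<^sub>0 int) set" where
  "base_change_map R S \<iota> N h = tensor_induced R S \<iota> N (\<lambda>(t, m). (t, h m))"


section \<open>Based complexes and resolutions\<close>

text \<open>
  A bounded complex in degrees \<open>0, \<dots>, d = top_degree\<close>, continued by zero modules (with empty
  bases) above \<open>d\<close>.  Only \<open>boundary C \<nu>: chain C \<nu> \<rightarrow> chain C (\<nu> - 1)\<close> with \<open>\<nu> \<ge> 1\<close> is used.
\<close>

record ('r, 'f) based_complex =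
  top_degree :: nat
  chain :: "nat \<Rightarrow> ('r, 'f) module"
  boundary :: "nat \<Rightarrow> 'f \<Rightarrow> 'f"
  basis_at :: "nat \<Rightarrow> 'f list"

definition based_resolution ::
    "'r ring \<Rightarrow> ('r, 'm) module \<Rightarrow> ('r, 'f) based_complex \<Rightarrow> ('f \<Rightarrow> 'm) \<Rightarrow> bool" where
  "based_resolution R M F \<epsilon> \<longleftrightarrow>
     (\<forall>\<nu>. left_module R (chain F \<nu>) \<and> lmod_basis R (chain F \<nu>) (basis_at F \<nu>)) \<and>
     (\<forall>\<nu>>top_degree F. basis_at F \<nu> = []) \<and>
     (\<forall>\<nu>. boundary F (Suc \<nu>) \<in> lmod_hom R (chain F (Suc \<nu>)) (chain F \<nu>)) \<and>
     \<epsilon> \<in> lmod_hom R (chain F 0) M \<and>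
     \<epsilon> ` carrier (chain F 0) = carrier M \<and>
     {x \<in> carrier (chain F 0). \<epsilon> x = \<zero>\<^bsub>M\<^esub>} = boundary F 1 ` carrier (chain F 1) \<and>
     (\<forall>\<nu>. {x \<in> carrier (chain F (Suc \<nu>)). boundary F (Suc \<nu>) x = \<zero>\<^bsub>chain F \<nu>\<^esub>}
          = boundary F (Suc (Suc \<nu>)) ` carrier (chain F (Suc (Suc \<nu>))))"

text \<open>
  The type \<open>nat \<Rightarrow> 'r\<close> has room for a copy of every finitely generated free \<open>R\<close>-module (coordinate
  vectors), so fixing it as the type of the chains is no restriction.
\<close>

definition type_FL :: "'r ring \<Rightarrow> ('r, 'm) module \<Rightarrow> bool" where
  "type_FL R M \<longleftrightarrow> (\<exists>(F :: ('r, nat \<Rightarrow> 'r) based_complex) \<epsilon>. based_resolution R M F \<epsilon>)"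

definition base_change_complex ::
    "'r ring \<Rightarrow> 's ring \<Rightarrow> ('r \<Rightarrow> 's) \<Rightarrow> ('r, 'f) based_complex \<Rightarrow>
     ('s, ('s \<times> 'f \<Rightarrow>\<^sub>0 int) set) based_complex" where
  "base_change_complex R S \<iota> F =
     \<lparr>top_degree = top_degree F,
      chain = (\<lambda>\<nu>. base_change R S \<iota> (chain F \<nu>)),
      boundary = (\<lambda>\<nu>. base_change_map R S \<iota> (chain F (\<nu> - 1)) (boundary F \<nu>)),
      basis_at = (\<lambda>\<nu>. map (tensor R S \<iota> (chain F \<nu>) \<one>\<^bsub>S\<^esub>) (basis_at F \<nu>))\<rparr>"

definition acyclic_complex :: "('r, 'f) based_complex \<Rightarrow> bool" where
  "acyclic_complex C \<longleftrightarrow>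
     carrier (chain C 0) = boundary C 1 ` carrier (chain C 1) \<and>
     (\<forall>\<nu>. {x \<in> carrier (chain C (Suc \<nu>)). boundary C (Suc \<nu>) x = \<zero>\<^bsub>chain C \<nu>\<^esub>}
          = boundary C (Suc (Suc \<nu>)) ` carrier (chain C (Suc (Suc \<nu>))))"

definition chain_contraction ::
    "'r ring \<Rightarrow> ('r, 'f) based_complex \<Rightarrow> (nat \<Rightarrow> 'f \<Rightarrow> 'f) \<Rightarrow> bool" where
  "chain_contraction R C \<delta> \<longleftrightarrow>
     (\<forall>\<nu>. \<delta> \<nu> \<in> lmod_hom R (chain C \<nu>) (chain C (Suc \<nu>))) \<and>
     (\<forall>x\<in>carrier (chain C 0). boundary C 1 (\<delta> 0 x) = x) \<and>
     (\<forall>\<nu>. \<forall>x\<in>carrier (chain C (Suc \<nu>)).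
        \<delta> \<nu> (boundary C (Suc \<nu>) x) \<oplus>\<^bsub>chain C (Suc \<nu>)\<^esub>
          boundary C (Suc (Suc \<nu>)) (\<delta> (Suc \<nu>) x) = x)"

text \<open>
  The basis of the sum of all chain modules of odd (even) degree, listed as pairs (degree, position
  in the basis of that degree).
\<close>

definition basis_index :: "('r, 'f) based_complex \<Rightarrow> (nat \<Rightarrow> bool) \<Rightarrow> (nat \<times> nat) list" where
  "basis_index C P =
     concat (map (\<lambda>\<nu>. map (Pair \<nu>) [0..<length (basis_at C \<nu>)]) (filter P [0..<Suc (top_degree C)]))"

text \<open>
  The matrix \<open>(a_ij)\<close> of \<open>boundary + \<delta>\<close> from the odd to the even part, \<open>f(e_i) = \<Sum>_j a_ij e_j\<close>.  A
  basis element of degree \<open>\<nu>\<close> has components only in degrees \<open>\<nu> - 1\<close> and \<open>\<nu> + 1\<close>.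
\<close>

definition torsion_matrix ::
    "'r ring \<Rightarrow> ('r, 'f) based_complex \<Rightarrow> (nat \<Rightarrow> 'f \<Rightarrow> 'f) \<Rightarrow> nat \<Rightarrow> nat \<Rightarrow> 'r" where
  "torsion_matrix R C \<delta> i j =
     (if i < length (basis_index C odd) \<and> j < length (basis_index C even)
      then let (\<nu>, k) = basis_index C odd ! i; (\<mu>, l) = basis_index C even ! j
           in if \<nu> = Suc \<mu> then coords R (chain C \<mu>) (basis_at C \<mu>) (boundary C \<nu> (basis_at C \<nu> ! k)) l
              else if \<mu> = Suc \<nu> then coords R (chain C \<mu>) (basis_at C \<mu>) (\<delta> \<nu> (basis_at C \<nu> ! k)) l
              else \<zero>\<^bsub>R\<^esub>
      else \<zero>\<^bsub>R\<^esub>)"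


section \<open>Matrices and \<open>K_1\<close>\<close>

text \<open>Square matrices of size \<open>r\<close>, padded by zeros outside of the index range.\<close>

definition mat_ring :: "nat \<Rightarrow> 'r ring \<Rightarrow> (nat \<Rightarrow> nat \<Rightarrow> 'r) ring" where
  "mat_ring r R =
     \<lparr>carrier = {A. (\<forall>i j. A i j \<in> carrier R) \<and> (\<forall>i j. i \<ge> r \<or> j \<ge> r \<longrightarrow> A i j = \<zero>\<^bsub>R\<^esub>)},
      monoid.mult = (\<lambda>A B i j. finsum R (\<lambda>k. A i k \<otimes>\<^bsub>R\<^esub> B k j) {..<r}),
      one = (\<lambda>i j. if i = j \<and> i < r then \<one>\<^bsub>R\<^esub> else \<zero>\<^bsub>R\<^esub>),
      zero = (\<lambda>i j. \<zero>\<^bsub>R\<^esub>),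
      add = (\<lambda>A B i j. A i j \<oplus>\<^bsub>R\<^esub> B i j)\<rparr>"

text \<open>The embedding of matrices of size \<open>r\<close> into infinite matrices: the identity outside of the block.\<close>

definition stabilize :: "'r ring \<Rightarrow> nat \<Rightarrow> (nat \<Rightarrow> nat \<Rightarrow> 'r) \<Rightarrow> nat \<Rightarrow> nat \<Rightarrow> 'r" where
  "stabilize R r A i j =
     (if i < r \<and> j < r then A i j else if i = j then \<one>\<^bsub>R\<^esub> else \<zero>\<^bsub>R\<^esub>)"

definition GL_inf :: "'r ring \<Rightarrow> (nat \<Rightarrow> nat \<Rightarrow> 'r) monoid" where
  "GL_inf R =
     \<lparr>carrier = (\<Union>r. stabilize R r ` Units (mat_ring r R)),
      monoid.mult = (\<lambda>A B i j. finsum R (\<lambda>k. A i k \<otimes>\<^bsub>R\<^esub> B k j) {k. A i k \<noteq> \<zero>\<^bsub>R\<^esub>}),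
      one = (\<lambda>i j. if i = j then \<one>\<^bsub>R\<^esub> else \<zero>\<^bsub>R\<^esub>)\<rparr>"

definition K1 :: "'r ring \<Rightarrow> (nat \<Rightarrow> nat \<Rightarrow> 'r) set monoid" where
  "K1 R = GL_inf R Mod derived (GL_inf R) (carrier (GL_inf R))"

definition K1_class :: "'r ring \<Rightarrow> nat \<Rightarrow> (nat \<Rightarrow> nat \<Rightarrow> 'r) \<Rightarrow> (nat \<Rightarrow> nat \<Rightarrow> 'r) set" where
  "K1_class R r A = derived (GL_inf R) (carrier (GL_inf R)) #>\<^bsub>GL_inf R\<^esub> stabilize R r A"

definition trivial_units :: "('g, 'b) monoid_scheme \<Rightarrow> ('g \<Rightarrow> 'p::prime_card padic) set" where
  "trivial_units G = {u. \<exists>g\<in>carrier G. u = group_elt g \<or> u = \<ominus>\<^bsub>c0 G\<^esub> group_elt g}"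

definition trivial_classes ::
    "('g, 'b) monoid_scheme \<Rightarrow> (nat \<Rightarrow> nat \<Rightarrow> 'g \<Rightarrow> 'p::prime_card padic) set set" where
  "trivial_classes G = (\<lambda>u. K1_class (c0 G) 1 (\<lambda>_ _. u)) ` trivial_units G"

definition KT ::
    "('g, 'b) monoid_scheme \<Rightarrow> (nat \<Rightarrow> nat \<Rightarrow> 'g \<Rightarrow> 'p::prime_card padic) set set monoid" where
  "KT G = K1 (c0 G) Mod trivial_classes G"

definition KT_class ::
    "('g, 'b) monoid_scheme \<Rightarrow> nat \<Rightarrow> (nat \<Rightarrow> nat \<Rightarrow> 'g \<Rightarrow> 'p::prime_card padic) \<Rightarrow>
     (nat \<Rightarrow> nat \<Rightarrow> 'g \<Rightarrow> 'p padic) set set" where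
  "KT_class G r A = trivial_classes G #>\<^bsub>K1 (c0 G)\<^esub> K1_class (c0 G) r A"


section \<open>Reasonable homomorphisms\<close>

text \<open>The series converges in the sup norm, hence coefficientwise.\<close>

definition c0_mat_log ::
    "('g, 'b) monoid_scheme \<Rightarrow> nat \<Rightarrow> (nat \<Rightarrow> nat \<Rightarrow> 'g \<Rightarrow> 'p::prime_card padic) \<Rightarrow>
     nat \<Rightarrow> nat \<Rightarrow> 'g \<Rightarrow> 'p padic" where
  "c0_mat_log G r u i j g =
     - suminf (\<lambda>\<nu>. ((\<one>\<^bsub>mat_ring r (c0 G)\<^esub> \<ominus>\<^bsub>mat_ring r (c0 G)\<^esub> u) [^]\<^bsub>mat_ring r (c0 G)\<^esub> Suc \<nu>) i j g
            / of_nat (Suc \<nu>))"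

definition c0_trace ::
    "('g, 'b) monoid_scheme \<Rightarrow> nat \<Rightarrow> (nat \<Rightarrow> nat \<Rightarrow> 'g \<Rightarrow> 'p::prime_card padic) \<Rightarrow> 'p padic" where
  "c0_trace G r A = (\<Sum>i<r. A i i \<one>\<^bsub>G\<^esub>)"

definition det_on :: "'i set \<Rightarrow> ('i \<Rightarrow> 'i \<Rightarrow> 'k::comm_ring_1) \<Rightarrow> 'k" where
  "det_on I A = (\<Sum>\<sigma> | \<sigma> permutes I. of_int (sign \<sigma>) * (\<Prod>x\<in>I. A x (\<sigma> x)))"

text \<open>
  For a finite group \<open>H\<close>, the determinant over \<open>k\<close> of the endomorphism \<open>f(e_i) = \<Sum>_j A_ij e_j\<close> of the
  left \<open>k[H]\<close>-module \<open>k[H]^r\<close>, computed in the \<open>k\<close>-basis \<open>(h e_i)\<close>.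
\<close>

definition group_ring_det ::
    "('h, 'b) monoid_scheme \<Rightarrow> nat \<Rightarrow> (nat \<Rightarrow> nat \<Rightarrow> 'h \<Rightarrow> 'k::comm_ring_1) \<Rightarrow> 'k" where
  "group_ring_det H r A =
     det_on ({..<r} \<times> carrier H) (\<lambda>(i, a) (j, b). (group_elt a \<otimes>\<^bsub>group_ring H\<^esub> A i j) b)"

definition reasonable ::
    "('g, 'b) monoid_scheme \<Rightarrow>
     ((nat \<Rightarrow> nat \<Rightarrow> 'g \<Rightarrow> 'p::prime_card padic) set set \<Rightarrow> 'p padic) \<Rightarrow> bool" where
  "reasonable G logdet \<longleftrightarrow>
     logdet \<in> hom (KT G) \<lparr>carrier = UNIV, monoid.mult = (+), one = 0\<rparr> \<and>
     (\<forall>r\<ge>1. \<forall>v\<in>carrier (mat_ring r (completed_group_ring G)).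
        let u = \<one>\<^bsub>mat_ring r (c0 G)\<^esub> \<oplus>\<^bsub>mat_ring r (c0 G)\<^esub> (\<lambda>i j g. of_nat CARD('p) * v i j g)
        in logdet (KT_class G r u) = c0_trace G r (c0_mat_log G r u)) \<and>
     (\<forall>r\<ge>1. \<forall>f\<in>Units (mat_ring r (c0 G)). \<forall>N. converges_to_e G N \<longrightarrow>
        (\<lambda>n. padic_log (group_ring_det (G Mod N n) r (\<lambda>i j. c0_quotient_map G (N n) (f i j)))
              / of_nat (card (rcosets\<^bsub>G\<^esub> (N n))))
        \<longlonglongrightarrow> logdet (KT_class G r f))"


section \<open>Torsion of modules\<close>

definition c0_complex ::
    "('g, 'b) monoid_scheme \<Rightarrow> ('g \<Rightarrow> int, 'f) based_complex \<Rightarrow>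
     ('g \<Rightarrow> 'p::prime_card padic, (('g \<Rightarrow> 'p padic) \<times> 'f \<Rightarrow>\<^sub>0 int) set) based_complex" where
  "c0_complex G F = base_change_complex (int_group_ring G) (c0 G) to_c0 F"

definition padic_torsion ::
    "('g, 'b) monoid_scheme \<Rightarrow> ('g \<Rightarrow> int, 'f) based_complex \<Rightarrow>
     (nat \<Rightarrow> nat \<Rightarrow> 'g \<Rightarrow> 'p::prime_card padic) set set" where
  "padic_torsion G F =
     (let C = c0_complex G F
      in KT_class G (length (basis_index C odd))
           (torsion_matrix (c0 G) C (SOME \<delta>. chain_contraction (c0 G) C \<delta>)))"

definition padic_R_torsion ::
    "('g, 'b) monoid_scheme \<Rightarrow> ((nat \<Rightarrow> nat \<Rightarrow> 'g \<Rightarrow> 'p::prime_card padic) set set \<Rightarrow> 'p padic) \<Rightarrow>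
     ('g \<Rightarrow> int, 'm) module \<Rightarrow> 'p padic" where
  "padic_R_torsion G logdet M =
     logdet (padic_torsion G
       (SOME F :: ('g \<Rightarrow> int, nat \<Rightarrow> 'g \<Rightarrow> int) based_complex.
          \<exists>\<epsilon>. based_resolution (int_group_ring G) M F \<epsilon>))"

definition padically_expansive ::
    "'p::prime_card itself \<Rightarrow> ('g, 'b) monoid_scheme \<Rightarrow> ('g \<Rightarrow> int, 'm) module \<Rightarrow> bool" where
  "padically_expansive _ G M \<longleftrightarrow>
     (let T = base_change (int_group_ring G) (c0 G :: ('g \<Rightarrow> 'p padic) ring) to_c0 M
      in carrier T = {\<zero>\<^bsub>T\<^esub>})"

text \<open>
  The inverse limit over \<open>i\<close> of the \<open>p^i\<close>-torsion subgroups of \<open>M\<close> along multiplication by \<open>p\<close>; the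
  term with \<open>i = 0\<close> is zero.
\<close>

definition torsion_limit :: "nat \<Rightarrow> ('r, 'm) module \<Rightarrow> (nat \<Rightarrow> 'm) set" where
  "torsion_limit p M =
     {x. \<forall>i. x i \<in> carrier M \<and> add_pow M (p ^ i) (x i) = \<zero>\<^bsub>M\<^esub> \<and> add_pow M p (x (Suc i)) = x i}"


section \<open>Group homology\<close>

text \<open>
  The homology of a subgroup \<open>N\<close> of \<open>G\<close> with coefficients in the left \<open>Z[G]\<close>-module \<open>M\<close>, computed by
  the inhomogeneous bar complex: an \<open>i\<close>-chain \<open>\<Sum> m \<otimes> [g_1|\<dots>|g_i]\<close> is a finitely supported function
  from lists to \<open>M\<close>, and
  \<open>d(m \<otimes> [g_1|\<dots>|g_i]) = g_1^{-1} m \<otimes> [g_2|\<dots>|g_i]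
     + \<Sum>_{0<j<i} (-1)^j m \<otimes> [g_1|\<dots>|g_j g_{j+1}|\<dots>|g_i] + (-1)^i m \<otimes> [g_1|\<dots>|g_{i-1}]\<close>.
  The inverse turns the left module \<open>M\<close> into a right module.
\<close>

definition bar_chains ::
    "'g set \<Rightarrow> ('r, 'm) module \<Rightarrow> nat \<Rightarrow> ('g list \<Rightarrow> 'm) set" where
  "bar_chains N M i =
     {c. finite {gs. c gs \<noteq> \<zero>\<^bsub>M\<^esub>} \<and> (\<forall>gs. c gs \<in> carrier M) \<and>
         (\<forall>gs. c gs \<noteq> \<zero>\<^bsub>M\<^esub> \<longrightarrow> length gs = i \<and> set gs \<subseteq> N)}"

definition bar_face :: "('g, 'b) monoid_scheme \<Rightarrow> nat \<Rightarrow> 'g list \<Rightarrow> 'g list" where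
  "bar_face G j gs =
     (if j = 0 then tl gs
      else if j = length gs then butlast gs
      else take (j - 1) gs @ [gs ! (j - 1) \<otimes>\<^bsub>G\<^esub> gs ! j] @ drop (Suc j) gs)"

definition bar_boundary ::
    "('g, 'b) monoid_scheme \<Rightarrow> ('g \<Rightarrow> int, 'm) module \<Rightarrow> nat \<Rightarrow> ('g list \<Rightarrow> 'm) \<Rightarrow> 'g list \<Rightarrow> 'm" where
  "bar_boundary G M i c hs =
     finsum M
       (\<lambda>(gs, j). let m = if j = 0 then group_elt (inv\<^bsub>G\<^esub> (hd gs)) \<odot>\<^bsub>M\<^esub> c gs else c gs
                  in if even j then m else \<ominus>\<^bsub>M\<^esub> m)
       {(gs, j). c gs \<noteq> \<zero>\<^bsub>M\<^esub> \<and> j \<le> i \<and> bar_face G j gs = hs}"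

definition bar_cycles ::
    "('g, 'b) monoid_scheme \<Rightarrow> 'g set \<Rightarrow> ('g \<Rightarrow> int, 'm) module \<Rightarrow> nat \<Rightarrow> ('g list \<Rightarrow> 'm) set" where
  "bar_cycles G N M i =
     {c \<in> bar_chains N M i. i > 0 \<longrightarrow> bar_boundary G M i c = (\<lambda>_. \<zero>\<^bsub>M\<^esub>)}"

definition group_homology ::
    "('g, 'b) monoid_scheme \<Rightarrow> 'g set \<Rightarrow> ('g \<Rightarrow> int, 'm) module \<Rightarrow> nat \<Rightarrow> ('g list \<Rightarrow> 'm) set monoid" where
  "group_homology G N M i =
     \<lparr>carrier = bar_cycles G N M i, monoid.mult = (\<lambda>c c' gs. c gs \<oplus>\<^bsub>M\<^esub> c' gs), one = (\<lambda>_. \<zero>\<^bsub>M\<^esub>)\<rparr>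
     Mod (bar_boundary G M (Suc i) ` bar_chains N M (Suc i))"

text \<open>Only meaningful if all homology groups are finite and almost all of them have order \<open>1\<close>.\<close>

definition multiplicative_euler_char ::
    "('g, 'b) monoid_scheme \<Rightarrow> 'g set \<Rightarrow> ('g \<Rightarrow> int, 'm) module \<Rightarrow> rat" where
  "multiplicative_euler_char G N M =
     (\<Prod>i | card (carrier (group_homology G N M i)) \<noteq> 1. of_nat (card (carrier (group_homology G N M i))) powi ((-1) ^ i))"

end

theory Submission
  imports Defs "Jordan_Normal_Form.Determinant"
begin

text \<open>
  Let \<open>F\<close> be a based resolution of \<open>M\<close> and \<open>N\<close> a normal subgroup of finite index.  The coinvariants of
  \<open>F\<close> under \<open>N\<close> form a complex of finitely generated free abelian groups with homology \<open>H(N, M)\<close>.  If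
  \<open>c0 \<otimes> F\<close> is acyclic, a contraction \<open>\<delta>\<close> of it induces one of the complex of coinvariants over \<open>Q_p\<close>.
  Elementary linear algebra over the integers then shows that the homology is finite and that the
  determinant of \<open>\<partial> + \<delta>\<close> from the odd to the even part is, up to sign, the alternating product of the
  orders of the homology groups (\<open>contracted_torsion_formula\<close>).  This is the determinant over the finite
  quotient of the matrix that defines the torsion (\<open>quotient_det\<close>), so the description of a
  reasonable homomorphism as a limit gives the limit formula for the torsion of any based resolution
  (\<open>torsion_limit_formula\<close>); the sign is lost because \<open>log(-x) = log x\<close>.

  Independence of the resolution is a consequence of the limit formula: a countable residually finite
  group has a sequence of normal subgroups converging to \<open>e\<close> (\<open>converges_to_e_exists\<close>), and the terms
  of the limit depend only on \<open>M\<close>.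

  The acyclicity of \<open>c0 \<otimes> F\<close> (\<open>C_acyclic\<close>) comes from expansiveness in degree zero, by right exactness
  of the tensor product.  In positive degrees let \<open>x\<close> be a cycle with coefficients in \<open>Z_p\<close> and \<open>v_n\<close> an
  integral chain congruent to \<open>x\<close> modulo \<open>p^n\<close>.  The boundary of \<open>v_n\<close> is divisible by \<open>p^n\<close>.  In degree
  one the quotients map to \<open>p^n\<close>-torsion elements of \<open>M\<close>, which are compatible and hence zero because the
  inverse limit of the torsion groups vanishes; in higher degrees exactness of \<open>F\<close> suffices.  It follows
  that \<open>x\<close> is the boundary of an integral chain plus \<open>p\<close> times a cycle (\<open>approx_step\<close>), and repeating this
  writes \<open>x\<close> as the boundary of a convergent series (\<open>padic_exact_of_approx\<close>).

  The homology of the coinvariants is compared with the bar complex of \<open>N\<close> with coefficients in \<open>M\<close> by a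
  zigzag through the double complex of bar chains with values in \<open>F\<close>: its rows are copies of \<open>F\<close>, and its
  columns are contracted by a choice of coset representatives (\<open>homology_card\<close>).
\<close>

section \<open>Analysis over the \<open>p\<close>-adic numbers\<close>

lemma padic_prime_gt_1: "CARD('p::prime_card) > 1"
  using prime_card[where 'a = 'p] prime_gt_1_nat by blast

lemma of_rat_padic: "(of_rat q :: 'p::prime_card padic) = padic_lim (\<lambda>_. q)"
proof -
  obtain a b where q: "q = of_int a / of_int b" "b \<noteq> 0"
    by (metis Fract_of_int_quotient Rat_cases less_irrefl)
  have "(of_int b :: 'p padic) * padic_lim (\<lambda>_. q) = of_int a"
    using q by (simp add: of_int_padic mult_padic_lim padic_cauchy_const prime_card)
  moreover have "(of_int b :: 'p padic) \<noteq> 0" using q by simp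
  ultimately have "padic_lim (\<lambda>_. q) = (of_int a :: 'p padic) / of_int b"
    by (simp add: field_simps)
  also have "\<dots> = of_rat q" using q by (simp add: of_rat_divide)
  finally show ?thesis by simp
qed

lemma padic_norm_nonneg [simp]: "0 \<le> padic_norm (a :: 'p::prime_card padic)"
proof (cases a)
  case (lim X)
  show ?thesis unfolding lim(1)
    by (rule LIMSEQ_le_const[OF padic_norm_lim[OF lim(2)]]) (simp add: padic_abs_nonneg prime_card)
qed

lemma padic_norm_0 [simp]: "padic_norm (0 :: 'p::prime_card padic) = 0"
  by (simp add: padic_norm_eq_0_iff)

lemma padic_norm_of_rat: "padic_norm (of_rat q :: 'p::prime_card padic) = padic_abs CARD('p) q"
proof -
  have "padic_cauchy CARD('p) (\<lambda>_. q)" by (rule padic_cauchy_const[OF prime_card])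
  from padic_norm_lim[OF this] show ?thesis by (simp add: of_rat_padic LIMSEQ_const_iff)
qed

lemma padic_norm_mult: "padic_norm (a * b) = padic_norm a * padic_norm (b :: 'p::prime_card padic)"
proof (cases a; cases b)
  fix X Y assume X: "a = padic_lim X" "padic_cauchy CARD('p) X"
    and Y: "b = padic_lim Y" "padic_cauchy CARD('p) Y"
  have 1: "(\<lambda>n. padic_abs CARD('p) (X n * Y n)) \<longlonglongrightarrow> padic_norm (a * b)"
    unfolding X(1) Y(1) mult_padic_lim[OF X(2) Y(2)]
    by (intro padic_norm_lim padic_cauchy_mult prime_card X Y)
  have 2: "(\<lambda>n. padic_abs CARD('p) (X n) * padic_abs CARD('p) (Y n))
            \<longlonglongrightarrow> padic_norm a * padic_norm b"
    unfolding X(1) Y(1) by (intro tendsto_mult padic_norm_lim X Y)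
  show ?thesis using 1 2 by (simp add: padic_abs_mult prime_card LIMSEQ_unique)
qed

lemma padic_norm_ultra: "padic_norm (a + b) \<le> max (padic_norm a) (padic_norm b)"
  for a b :: "'p::prime_card padic"
proof (cases a; cases b)
  fix X Y assume X: "a = padic_lim X" "padic_cauchy CARD('p) X"
    and Y: "b = padic_lim Y" "padic_cauchy CARD('p) Y"
  have 1: "(\<lambda>n. padic_abs CARD('p) (X n + Y n)) \<longlonglongrightarrow> padic_norm (a + b)"
    unfolding X(1) Y(1) add_padic_lim[OF X(2) Y(2)]
    by (intro padic_norm_lim padic_cauchy_add prime_card X Y)
  have 2: "(\<lambda>n. max (padic_abs CARD('p) (X n)) (padic_abs CARD('p) (Y n)))
            \<longlonglongrightarrow> max (padic_norm a) (padic_norm b)"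
    unfolding X(1) Y(1) by (intro tendsto_max padic_norm_lim X Y)
  show ?thesis
    by (rule LIMSEQ_le[OF 1 2]) (simp add: padic_abs_ultra prime_card)
qed

lemma padic_norm_1 [simp]: "padic_norm (1 :: 'p::prime_card padic) = 1"
  using padic_norm_of_rat[of 1, where 'p = 'p] by (simp add: padic_abs_1 prime_card)

lemma padic_norm_diff_commute: "padic_norm (a - b) = padic_norm (b - a)" for a b :: "'p::prime_card padic"
  using padic_norm_minus[of "a - b"] by simp

lemma padic_norm_ultra_diff: "padic_norm (a - b) \<le> max (padic_norm a) (padic_norm b)"
  for a b :: "'p::prime_card padic"
  using padic_norm_ultra[of a "- b"] by (simp add: padic_norm_minus)

lemma padic_norm_add_le: "padic_norm a \<le> e \<Longrightarrow> padic_norm b \<le> e \<Longrightarrow> padic_norm (a + b) \<le> e"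
  for a b :: "'p::prime_card padic"
  using padic_norm_ultra[of a b] by linarith

lemma padic_norm_add_less: "padic_norm a < e \<Longrightarrow> padic_norm b < e \<Longrightarrow> padic_norm (a + b) < e"
  for a b :: "'p::prime_card padic"
  using padic_norm_ultra[of a b] by linarith

lemma padic_norm_diff_le: "padic_norm a \<le> e \<Longrightarrow> padic_norm b \<le> e \<Longrightarrow> padic_norm (a - b) \<le> e"
  for a b :: "'p::prime_card padic"
  using padic_norm_ultra_diff[of a b] by linarith

lemma padic_norm_sum_le:
  fixes f :: "'a \<Rightarrow> 'p::prime_card padic"
  assumes "\<And>x. x \<in> A \<Longrightarrow> padic_norm (f x) \<le> e" "e \<ge> 0"
  shows "padic_norm (sum f A) \<le> e"
  using assms by (induction A rule: infinite_finite_induct) (auto intro: padic_norm_add_le)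

lemma padic_norm_power: "padic_norm (a ^ n) = padic_norm (a :: 'p::prime_card padic) ^ n"
  by (induction n) (auto simp: padic_norm_mult)

lemma padic_norm_inverse: "padic_norm (inverse a) = inverse (padic_norm (a :: 'p::prime_card padic))"
proof (cases "a = 0")
  case False
  then have "padic_norm a * padic_norm (inverse a) = 1" by (simp add: padic_norm_mult[symmetric])
  then show ?thesis by (metis inverse_unique)
qed simp

lemma padic_norm_divide: "padic_norm (a / b) = padic_norm a / padic_norm (b :: 'p::prime_card padic)"
  by (simp add: divide_inverse padic_norm_mult padic_norm_inverse)

lemma padic_abs_of_int_le: "prime p \<Longrightarrow> padic_abs p (of_int m) \<le> 1"
proof (cases "m = 0")
  case False
  assume p: "prime p"
  then have "p > 1" using prime_gt_1_nat by blast
  then have "1 \<le> real p ^ multiplicity (int p) m" by simp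
  with padic_abs_frac[OF p False, of 1] show ?thesis
    by (simp add: power_int_minus inverse_le_1_iff)
qed (simp add: padic_abs_0)

lemma padic_norm_of_int_le: "padic_norm (of_int m :: 'p::prime_card padic) \<le> 1"
  using padic_norm_of_rat[of "of_int m", where 'p = 'p] padic_abs_of_int_le[OF prime_card] by simp

lemma padic_norm_of_nat_le: "padic_norm (of_nat m :: 'p::prime_card padic) \<le> 1"
  using padic_norm_of_int_le[of "int m"] by simp

lemma padic_norm_prime: "padic_norm (of_nat CARD('p) :: 'p::prime_card padic) = 1 / CARD('p)"
proof -
  have p: "prime CARD('p)" by (rule prime_card)
  then have "\<not> is_unit (int CARD('p))" "int CARD('p) \<noteq> 0" by auto
  then have m: "multiplicity (int CARD('p)) (int CARD('p)) = 1" by (simp add: multiplicity_self)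
  show ?thesis
    using padic_abs_frac[OF p \<open>int CARD('p) \<noteq> 0\<close>, of 1] padic_norm_of_rat[of "of_nat CARD('p)", where 'p = 'p] m
    by (simp add: power_int_minus inverse_eq_divide)
qed

lemma padic_prime_neq_0: "(of_nat CARD('p) :: 'p::prime_card padic) \<noteq> 0"
  using padic_prime_gt_1[where 'p = 'p] by simp

lemma padic_norm_less_1:
  assumes "padic_norm (a :: 'p::prime_card padic) < 1"
  shows "padic_norm a \<le> 1 / CARD('p)"
proof (cases a)
  case (lim X)
  have p1: "real CARD('p) > 1" using padic_prime_gt_1[where 'p = 'p] by simp
  have L: "(\<lambda>n. padic_abs CARD('p) (X n)) \<longlonglongrightarrow> padic_norm a"
    unfolding lim(1) by (rule padic_norm_lim[OF lim(2)])
  have "eventually (\<lambda>n. padic_abs CARD('p) (X n) < 1) sequentially"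
    using L assms by (rule order_tendstoD)
  then have "eventually (\<lambda>n. padic_abs CARD('p) (X n) \<le> 1 / CARD('p)) sequentially"
  proof eventually_elim
    case (elim n)
    show ?case
    proof (cases "X n = 0")
      case False
      let ?k = "int (multiplicity (int CARD('p)) (snd (quotient_of (X n))))
                        - int (multiplicity (int CARD('p)) (fst (quotient_of (X n))))"
      have e: "padic_abs CARD('p) (X n) = real CARD('p) powi ?k"
        using False by (simp add: padic_abs_def)
      have "?k < 0"
      proof (rule ccontr)
        assume "\<not> ?k < 0"
        then have "real CARD('p) powi 0 \<le> real CARD('p) powi ?k" using p1 by (intro power_int_increasing) auto
        with elim e show False by simp
      qed
      then have "real CARD('p) powi ?k \<le> real CARD('p) powi (-1)" using p1 by (intro power_int_increasing) auto
      then show ?thesis using e by (simp add: power_int_minus inverse_eq_divide)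
    qed (simp add: padic_abs_0 prime_card)
  qed
  then show ?thesis by (intro tendsto_upperbound[OF L]) auto
qed

lemma padic_norm_int_less_1_iff: "padic_norm (of_int m :: 'p::prime_card padic) < 1 \<longleftrightarrow> int CARD('p) dvd m"
proof
  assume "int CARD('p) dvd m"
  then obtain k where "m = int CARD('p) * k" by auto
  then have "padic_norm (of_int m :: 'p padic) = 1 / CARD('p) * padic_norm (of_int k :: 'p padic)"
    using padic_norm_prime[where 'p = 'p] by (simp add: padic_norm_mult)
  also have "\<dots> \<le> 1 / CARD('p) * 1" by (intro mult_left_mono padic_norm_of_int_le) auto
  also have "\<dots> < 1" using padic_prime_gt_1[where 'p = 'p] by (simp add: field_simps)
  finally show "padic_norm (of_int m :: 'p padic) < 1" .
next
  assume a: "padic_norm (of_int m :: 'p padic) < 1"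
  show "int CARD('p) dvd m"
  proof (cases "m = 0")
    case False
    show ?thesis
    proof (rule ccontr)
      assume "\<not> int CARD('p) dvd m"
      then have "multiplicity (int CARD('p)) m = 0" by (simp add: not_dvd_imp_multiplicity_0)
      then have "padic_abs CARD('p) (of_int m) = 1"
        using padic_abs_frac[OF prime_card[where 'a = 'p] False, of 1] by simp
      with a padic_norm_of_rat[of "of_int m", where 'p = 'p] show False by simp
    qed
  qed simp
qed

lemma padic_norm_diff_bound:
  fixes a :: "'p::prime_card padic"
  assumes a: "a = padic_lim X" and X: "padic_cauchy CARD('p) X"
    and n: "\<forall>m\<ge>k. \<forall>n\<ge>k. padic_abs CARD('p) (X m - X n) < e"
  shows "padic_norm (a - of_rat (X k)) \<le> e"
proof -
  have "a - of_rat (X k) = padic_lim (\<lambda>n. X n + (- X k))"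
    unfolding a of_rat_padic minus_padic_def
    using X by (simp add: add_padic_lim minus_padic_lim padic_cauchy_const padic_cauchy_minus prime_card)
  moreover have "padic_cauchy CARD('p) (\<lambda>n. X n + (- X k))"
    using X by (intro padic_cauchy_add padic_cauchy_const prime_card)
  ultimately have "(\<lambda>n. padic_abs CARD('p) (X n + (- X k))) \<longlonglongrightarrow> padic_norm (a - of_rat (X k))"
    by (simp only: padic_norm_lim)
  then show ?thesis
    by (rule LIMSEQ_le_const2) (use n in \<open>auto intro!: exI[of _ k] simp: less_imp_le\<close>)
qed

lemma padic_rat_dense:
  fixes a :: "'p::prime_card padic"
  assumes "e > 0"
  obtains q where "padic_norm (a - of_rat q) < e"
proof (cases a)
  case (lim X)
  have "e / 2 > 0" using assms by simp
  then obtain k where "\<forall>m\<ge>k. \<forall>n\<ge>k. padic_abs CARD('p) (X m - X n) < e / 2"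
    using lim(2) unfolding padic_cauchy_def by blast
  from padic_norm_diff_bound[OF lim this] that[of "X k"] assms show ?thesis by auto
qed

text \<open>
  The denominator of a rational of norm at most \<open>1\<close> is invertible modulo \<open>p\<close>, and rationals are dense.
\<close>

lemma padic_int_approx1:
  fixes a :: "'p::prime_card padic"
  assumes "padic_norm a \<le> 1"
  obtains z where "padic_norm (a - of_int z) < 1"
proof -
  let ?p = "int CARD('p)"
  obtain q where q: "padic_norm (a - of_rat q) < 1" using padic_rat_dense[of 1 a] by auto
  obtain u v where uv: "quotient_of q = (u, v)" by fastforce
  have v: "v > 0" "coprime u v" and qe: "q = of_int u / of_int v"
    using uv quotient_of_denom_pos quotient_of_coprime quotient_of_div by auto
  have qn: "padic_norm (of_rat q :: 'p padic) \<le> 1"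
    using padic_norm_diff_le[of a 1 "a - of_rat q"] assms q by simp
  have vn: "padic_norm (of_int v :: 'p padic) = 1"
  proof (rule ccontr)
    assume "padic_norm (of_int v :: 'p padic) \<noteq> 1"
    then have l: "padic_norm (of_int v :: 'p padic) < 1" using padic_norm_of_int_le[of v, where 'p = 'p] by simp
    then have "?p dvd v" by (simp add: padic_norm_int_less_1_iff)
    moreover have "\<not> is_unit ?p" using padic_prime_gt_1[where 'p = 'p] by auto
    ultimately have "\<not> ?p dvd u" using v(2) coprime_common_divisor by blast
    then have "padic_norm (of_int u :: 'p padic) = 1"
      using padic_norm_int_less_1_iff[of u, where 'p = 'p] padic_norm_of_int_le[of u, where 'p = 'p] by linarith
    moreover have "padic_norm (of_int v :: 'p padic) > 0"
      using v(1) padic_norm_eq_0_iff[of "of_int v :: 'p padic"] padic_norm_nonneg[of "of_int v :: 'p padic"]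
      by (simp del: padic_norm_nonneg)
    ultimately show False using qn l unfolding qe by (simp add: of_rat_divide padic_norm_divide field_simps)
  qed
  then have "\<not> ?p dvd v" using padic_norm_int_less_1_iff[of v, where 'p = 'p] by simp
  moreover have "prime ?p" using prime_card[where 'a = 'p] by simp
  ultimately have "coprime v ?p" by (metis prime_imp_coprime coprime_commute)
  then have "gcd v ?p = 1" by simp
  then obtain w t where w: "w * v + t * ?p = 1" using bezout_int[of v ?p] by auto
  then have "1 - v * w = ?p * t" by (simp add: algebra_simps)
  then have d: "?p dvd 1 - v * w" by simp
  have "(of_int v :: 'p padic) \<noteq> 0" using v by simp
  then have "(of_rat q - of_int (u * w) :: 'p padic) = of_int u * of_int (1 - v * w) / of_int v"
    unfolding qe by (simp add: of_rat_divide field_simps)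
  then have "padic_norm (of_rat q - of_int (u * w) :: 'p padic)
     = padic_norm (of_int u :: 'p padic) * padic_norm (of_int (1 - v * w) :: 'p padic)"
    using vn by (simp add: padic_norm_mult padic_norm_divide del: of_int_diff of_int_mult)
  also have "\<dots> \<le> 1 * padic_norm (of_int (1 - v * w) :: 'p padic)"
    by (intro mult_right_mono padic_norm_of_int_le padic_norm_nonneg)
  also have "\<dots> < 1" using d padic_norm_int_less_1_iff[of "1 - v * w", where 'p = 'p] by simp
  finally have "padic_norm ((a - of_rat q) + (of_rat q - of_int (u * w))) < 1"
    by (intro padic_norm_add_less q)
  then show ?thesis using that[of "u * w"] by simp
qed

lemma padic_int_approx:
  fixes a :: "'p::prime_card padic"
  assumes "padic_norm a \<le> 1"
  obtains z b where "a = of_int z + of_nat CARD('p) ^ n * b" "padic_norm b \<le> 1"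
proof -
  have "\<exists>z b. a = of_int z + of_nat CARD('p) ^ n * b \<and> padic_norm b \<le> 1" for n
  proof (induction n)
    case 0 then show ?case using assms by (intro exI[of _ 0] exI[of _ a]) auto
  next
    case (Suc n)
    then obtain z b where a: "a = of_int z + of_nat CARD('p) ^ n * b" "padic_norm b \<le> 1" by blast
    obtain y where y: "padic_norm (b - of_int y) < 1" using padic_int_approx1[OF a(2)] .
    define c where "c = (b - of_int y) / of_nat CARD('p)"
    have b: "b = of_int y + of_nat CARD('p) * c"
      using padic_prime_neq_0[where 'p = 'p] by (simp add: c_def)
    have "padic_norm c = padic_norm (b - of_int y) / (1 / CARD('p))"
      unfolding c_def padic_norm_divide padic_norm_prime ..
    also have "\<dots> \<le> (1 / CARD('p)) / (1 / CARD('p))"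
      using padic_norm_less_1[OF y] by (intro divide_right_mono) auto
    finally have "padic_norm c \<le> 1" using padic_prime_gt_1[where 'p = 'p] by simp
    moreover have "a = of_int (z + int CARD('p) ^ n * y) + of_nat CARD('p) ^ Suc n * c"
      unfolding a(1) b by (simp add: algebra_simps)
    ultimately show ?case by blast
  qed
  then show ?thesis using that by blast
qed


instance padic :: (prime_card) complete_space
proof
  fix A :: "nat \<Rightarrow> 'a padic" assume A: "Cauchy A"
  have "\<exists>q. padic_norm (A n - of_rat q) < 1 / real (Suc n)" for n
    using padic_rat_dense[of "1 / real (Suc n)" "A n"] by auto
  then obtain X where X: "\<And>n. padic_norm (A n - of_rat (X n)) < 1 / real (Suc n)" by metis
  have rX: "padic_abs CARD('a) (X m - X n) = padic_norm (of_rat (X m) - of_rat (X n) :: 'a padic)" for m n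
    using padic_norm_of_rat[of "X m - X n", where 'p = 'a] by (simp add: of_rat_diff)
  have small: "\<exists>k. \<forall>n\<ge>k. padic_norm (A n - of_rat (X n)) < e" if e: "e > 0" for e
  proof -
    obtain k where k: "1 / real (Suc k) < e" using e nat_approx_posE by blast
    have "padic_norm (A n - of_rat (X n)) < e" if "n \<ge> k" for n
    proof -
      have "1 / real (Suc n) \<le> 1 / real (Suc k)" using that by (simp add: frac_le)
      with X[of n] k show ?thesis by linarith
    qed
    then show ?thesis by blast
  qed
  have cX: "padic_cauchy CARD('a) X" unfolding padic_cauchy_def
  proof (intro allI impI)
    fix e :: real assume e: "e > 0"
    obtain k where k: "\<forall>n\<ge>k. padic_norm (A n - of_rat (X n)) < e" using small[OF e] by blast
    obtain l where l: "\<forall>m\<ge>l. \<forall>n\<ge>l. padic_norm (A m - A n) < e"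
      using A e unfolding Cauchy_def dist_padic_def by blast
    have "padic_abs CARD('a) (X m - X n) < e" if "m \<ge> max k l" "n \<ge> max k l" for m n
    proof -
      have 1: "padic_norm (A m - A n) < e" using l that by simp
      have 2: "padic_norm (A n - of_rat (X n)) < e" using k that by simp
      have 3: "padic_norm (of_rat (X m) - A m) < e" using k that by (subst padic_norm_diff_commute) simp
      have "padic_norm (of_rat (X m) - A m + ((A m - A n) + (A n - of_rat (X n)))) < e"
        by (intro padic_norm_add_less 1 2 3)
      then show ?thesis unfolding rX by (simp add: algebra_simps)
    qed
    then show "\<exists>k. \<forall>m\<ge>k. \<forall>n\<ge>k. padic_abs CARD('a) (X m - X n) < e" by blast
  qed
  define L :: "'a padic" where "L = padic_lim X"
  have "A \<longlonglongrightarrow> L" unfolding tendsto_iff dist_padic_def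
  proof (intro allI impI)
    fix e :: real assume e: "e > 0"
    obtain k where k: "\<forall>n\<ge>k. padic_norm (A n - of_rat (X n)) < e" using small[OF e] by blast
    have "e / 2 > 0" using e by simp
    then obtain l where l: "\<forall>m\<ge>l. \<forall>n\<ge>l. padic_abs CARD('a) (X m - X n) < e / 2"
      using cX unfolding padic_cauchy_def by blast
    have "padic_norm (A n - L) < e" if "n \<ge> max k l" for n
    proof -
      have "padic_norm (L - of_rat (X n)) \<le> e / 2"
        by (rule padic_norm_diff_bound[OF L_def cX]) (use l that in auto)
      then have "padic_norm (of_rat (X n) - L) < e" using e by (subst padic_norm_diff_commute) linarith
      moreover have "padic_norm (A n - of_rat (X n)) < e" using k that by auto
      ultimately have "padic_norm ((A n - of_rat (X n)) + (of_rat (X n) - L)) < e"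
        by (intro padic_norm_add_less)
      then show ?thesis by simp
    qed
    then show "eventually (\<lambda>n. padic_norm (A n - L) < e) sequentially"
      unfolding eventually_sequentially by blast
  qed
  then show "convergent A" by (auto simp: convergent_def)
qed

lemma padic_tendsto_iff: "(f \<longlongrightarrow> (l :: 'p::prime_card padic)) F \<longleftrightarrow> ((\<lambda>x. padic_norm (f x - l)) \<longlongrightarrow> 0) F"
  using tendsto_dist_iff[of f l F] by (simp add: dist_padic_def)

instance padic :: (prime_card) topological_ab_group_add
proof
  fix a b :: "'a padic"
  have *: "((\<lambda>x. fst x) \<longlongrightarrow> a) (nhds a \<times>\<^sub>F nhds b)" "((\<lambda>x. snd x) \<longlongrightarrow> b) (nhds a \<times>\<^sub>F nhds b)"
    by (rule filterlim_fst filterlim_snd)+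
  have 1: "((\<lambda>x. padic_norm (fst x - a) + padic_norm (snd x - b)) \<longlongrightarrow> 0) (nhds a \<times>\<^sub>F nhds b)"
    using * by (intro tendsto_add_zero) (simp_all add: padic_tendsto_iff[symmetric])
  show "((\<lambda>x. fst x + snd x) \<longlongrightarrow> a + b) (nhds a \<times>\<^sub>F nhds b)"
    unfolding padic_tendsto_iff
  proof (rule Lim_null_comparison[OF _ 1], rule always_eventually, intro allI)
    fix x :: "'a padic \<times> 'a padic"
    show "norm (padic_norm (fst x + snd x - (a + b))) \<le> padic_norm (fst x - a) + padic_norm (snd x - b)"
      using padic_norm_triangle[of "fst x - a" "snd x - b"] by (simp add: algebra_simps)
  qed
  show "(uminus \<longlongrightarrow> - a) (nhds a)"
  proof -
    have "padic_norm (- x - - a) = padic_norm (x - a)" for x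
      using padic_norm_minus[of "x - a"] by simp
    moreover have "((\<lambda>x. padic_norm (x - a)) \<longlongrightarrow> 0) (nhds a)"
      unfolding padic_tendsto_iff[symmetric] by (simp add: filterlim_ident)
    ultimately show ?thesis unfolding padic_tendsto_iff by simp
  qed
qed

instance padic :: (prime_card) topological_semigroup_mult
proof
  fix a b :: "'a padic"
  have *: "((\<lambda>x. fst x) \<longlongrightarrow> a) (nhds a \<times>\<^sub>F nhds b)" "((\<lambda>x. snd x) \<longlongrightarrow> b) (nhds a \<times>\<^sub>F nhds b)"
    by (rule filterlim_fst filterlim_snd)+
  have n: "((\<lambda>x. padic_norm (fst x - a)) \<longlongrightarrow> 0) (nhds a \<times>\<^sub>F nhds b)"
    "((\<lambda>x. padic_norm (snd x - b)) \<longlongrightarrow> 0) (nhds a \<times>\<^sub>F nhds b)"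
    using * by (simp_all add: padic_tendsto_iff[symmetric])
  have 1: "((\<lambda>x. padic_norm (fst x - a) * (padic_norm (snd x - b) + padic_norm b)
      + padic_norm a * padic_norm (snd x - b)) \<longlongrightarrow> 0 * (0 + padic_norm b) + padic_norm a * 0) (nhds a \<times>\<^sub>F nhds b)"
    by (intro tendsto_intros n)
  show "((\<lambda>x. fst x * snd x) \<longlongrightarrow> a * b) (nhds a \<times>\<^sub>F nhds b)"
    unfolding padic_tendsto_iff
  proof (rule Lim_null_comparison[OF _ 1[simplified]], rule always_eventually, intro allI)
    fix x :: "'a padic \<times> 'a padic"
    have "fst x * snd x - a * b = (fst x - a) * (snd x - b + b) + a * (snd x - b)" by (simp add: algebra_simps)
    then have "padic_norm (fst x * snd x - a * b)
      \<le> padic_norm (fst x - a) * padic_norm (snd x - b + b) + padic_norm a * padic_norm (snd x - b)"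
      using padic_norm_triangle[of "(fst x - a) * (snd x - b + b)" "a * (snd x - b)"]
      by (simp only: padic_norm_mult)
    also have "\<dots> \<le> padic_norm (fst x - a) * (padic_norm (snd x - b) + padic_norm b) + padic_norm a * padic_norm (snd x - b)"
      by (intro add_right_mono mult_left_mono padic_norm_triangle) auto
    finally show "norm (padic_norm (fst x * snd x - a * b)) \<le> \<dots>" by simp
  qed
qed

text \<open>
  By the ultrametric inequality, partial sums over sets that contain all terms of norm at least \<open>e\<close>
  differ by less than \<open>e\<close>.
\<close>

lemma padic_summable_null:
  fixes f :: "'a \<Rightarrow> 'p::prime_card padic"
  assumes fin: "\<And>e. e > 0 \<Longrightarrow> finite {x \<in> A. padic_norm (f x) \<ge> e}"
  shows "f summable_on A"
proof -
  define S where "S n = {x \<in> A. padic_norm (f x) \<ge> inverse (real (Suc n))}" for n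
  have finS: "finite (S n)" for n unfolding S_def by (rule fin) simp
  have mono: "S m \<subseteq> S n" if "m \<le> n" for m n
  proof -
    have "inverse (real (Suc n)) \<le> inverse (real (Suc m))" using that by simp
    then show ?thesis unfolding S_def by (blast intro: order_trans)
  qed
  have far: "padic_norm (sum f T - sum f (S n)) \<le> inverse (real (Suc n))"
    if T: "finite T" "S n \<subseteq> T" "T \<subseteq> A" for T n
  proof -
    have "sum f T - sum f (S n) = sum f (T - S n)" using T finS by (simp add: sum_diff)
    moreover have "padic_norm (f x) \<le> inverse (real (Suc n))" if "x \<in> T - S n" for x
      using that T unfolding S_def by auto
    ultimately show ?thesis by (metis padic_norm_sum_le inverse_nonnegative_iff_nonnegative of_nat_0_le_iff)
  qed
  have SA: "S n \<subseteq> A" for n by (auto simp: S_def)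
  have "Cauchy (\<lambda>n. sum f (S n))" unfolding Cauchy_def dist_padic_def
  proof (intro allI impI)
    fix e :: real assume "e > 0"
    then obtain k where k: "inverse (real (Suc k)) < e" using reals_Archimedean by blast
    have "padic_norm (sum f (S m) - sum f (S n)) < e" if "m \<ge> k" "n \<ge> k" for m n
    proof -
      have "padic_norm ((sum f (S m) - sum f (S k)) - (sum f (S n) - sum f (S k))) \<le> inverse (real (Suc k))"
        by (intro padic_norm_diff_le far finS mono that SA)
      then show ?thesis using k by simp
    qed
    then show "\<exists>k. \<forall>m\<ge>k. \<forall>n\<ge>k. padic_norm (sum f (S m) - sum f (S n)) < e" by blast
  qed
  then obtain L where L: "(\<lambda>n. sum f (S n)) \<longlonglongrightarrow> L" using Cauchy_convergent convergent_def by blast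
  have "(f has_sum L) A" unfolding has_sum_def tendsto_iff dist_padic_def
  proof (intro allI impI)
    fix e :: real assume e: "e > 0"
    then obtain k where k: "inverse (real (Suc k)) < e" using reals_Archimedean by blast
    have "eventually (\<lambda>n. padic_norm (sum f (S n) - L) < e) sequentially"
      using L e unfolding tendsto_iff dist_padic_def by blast
    then obtain l where l: "\<forall>n\<ge>l. padic_norm (sum f (S n) - L) < e" unfolding eventually_sequentially by blast
    let ?n = "max k l"
    have i: "inverse (real (Suc ?n)) < e"
    proof -
      have "inverse (real (Suc ?n)) \<le> inverse (real (Suc k))" by (intro le_imp_inverse_le) auto
      then show ?thesis using k by linarith
    qed
    have "padic_norm (sum f T - L) < e" if "finite T" "S ?n \<subseteq> T" "T \<subseteq> A" for T
    proof -
      have "padic_norm ((sum f T - sum f (S ?n)) + (sum f (S ?n) - L)) < e"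
        by (intro padic_norm_add_less le_less_trans[OF far i] that) (use l in auto)
      then show ?thesis by simp
    qed
    then show "eventually (\<lambda>T. padic_norm (sum f T - L) < e) (finite_subsets_at_top A)"
      unfolding eventually_finite_subsets_at_top using finS[of ?n] SA[of ?n] by (intro exI[of _ "S ?n"]) auto
  qed
  then show ?thesis by (auto simp: summable_on_def)
qed

lemma padic_infsum_norm_le:
  fixes f :: "'a \<Rightarrow> 'p::prime_card padic"
  assumes f: "f summable_on A" and le: "\<And>x. x \<in> A \<Longrightarrow> padic_norm (f x) \<le> e" and e: "e \<ge> 0"
  shows "padic_norm (infsum f A) \<le> e"
proof -
  have "(f has_sum infsum f A) A" using f by (rule has_sum_infsum)
  then have L: "((\<lambda>T. sum f T) \<longlongrightarrow> infsum f A) (finite_subsets_at_top A)" by (simp add: has_sum_def)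
  have "eventually (\<lambda>T. padic_norm (infsum f A) \<le> max e d) (finite_subsets_at_top A)" if d: "d > 0" for d
  proof -
    have "eventually (\<lambda>T. padic_norm (sum f T - infsum f A) < d) (finite_subsets_at_top A)"
      using L d unfolding tendsto_iff dist_padic_def by blast
    moreover have "eventually (\<lambda>T. finite T \<and> T \<subseteq> A) (finite_subsets_at_top A)"
      by (auto simp: eventually_finite_subsets_at_top)
    ultimately show ?thesis
    proof eventually_elim
      case (elim T)
      have "padic_norm (sum f T) \<le> e" using elim le e by (intro padic_norm_sum_le) auto
      then have "padic_norm (sum f T - (sum f T - infsum f A)) \<le> max e d"
        using elim by (intro padic_norm_diff_le[of "sum f T" "max e d" "sum f T - infsum f A"]) linarith+
      then show ?case by simp
    qed
  qed
  then have *: "padic_norm (infsum f A) \<le> max e d" if "d > 0" for d using that by simp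
  show ?thesis
  proof (rule field_le_epsilon)
    fix d :: real assume "d > 0"
    with *[OF this] e show "padic_norm (infsum f A) \<le> e + d" by linarith
  qed
qed

lemma padic_has_sum_Sigma:
  fixes f :: "'a \<Rightarrow> 'b \<Rightarrow> 'p::prime_card padic"
  assumes fin: "\<And>e. e > 0 \<Longrightarrow> finite {z \<in> Sigma A B. padic_norm (f (fst z) (snd z)) \<ge> e}"
  shows "infsum (\<lambda>z. f (fst z) (snd z)) (Sigma A B) = infsum (\<lambda>x. infsum (f x) (B x)) A"
    and "(\<lambda>x. infsum (f x) (B x)) summable_on A"
proof -
  have s: "((\<lambda>z. f (fst z) (snd z)) has_sum infsum (\<lambda>z. f (fst z) (snd z)) (Sigma A B)) (Sigma A B)"
    using padic_summable_null[OF fin] by (rule has_sum_infsum)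
  have "((\<lambda>y. f (fst (x, y)) (snd (x, y))) has_sum infsum (f x) (B x)) (B x)" if x: "x \<in> A" for x
  proof -
    have "f x summable_on B x"
    proof (rule padic_summable_null)
      fix e :: real assume "e > 0"
      have "{y \<in> B x. padic_norm (f x y) \<ge> e} \<subseteq> snd ` {z \<in> Sigma A B. padic_norm (f (fst z) (snd z)) \<ge> e}"
        using x by force
      then show "finite {y \<in> B x. padic_norm (f x y) \<ge> e}"
        using fin[OF \<open>e > 0\<close>] finite_subset by blast
    qed
    then show ?thesis by (simp add: has_sum_infsum)
  qed
  from has_sum_SigmaD[OF s this]
  have "((\<lambda>x. infsum (f x) (B x)) has_sum infsum (\<lambda>z. f (fst z) (snd z)) (Sigma A B)) A" by simp
  then show "infsum (\<lambda>z. f (fst z) (snd z)) (Sigma A B) = infsum (\<lambda>x. infsum (f x) (B x)) A"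
    "(\<lambda>x. infsum (f x) (B x)) summable_on A"
    using infsumI summable_on_def by fastforce+
qed

lemma padic_sums_null:
  fixes f :: "nat \<Rightarrow> 'p::prime_card padic"
  assumes "(\<lambda>n. padic_norm (f n)) \<longlonglongrightarrow> 0"
  shows "summable f"
proof -
  have "f summable_on UNIV"
  proof (rule padic_summable_null)
    fix e :: real assume "e > 0"
    then have "eventually (\<lambda>n. padic_norm (f n) < e) sequentially" using assms by (rule order_tendstoD(2)[rotated])
    then obtain k where "\<forall>n\<ge>k. padic_norm (f n) < e" by (auto simp: eventually_sequentially)
    then have "{x \<in> UNIV. padic_norm (f x) \<ge> e} \<subseteq> {..<k}" by (auto simp: not_less[symmetric])
    then show "finite {x \<in> UNIV. padic_norm (f x) \<ge> e}" by (rule finite_subset) simp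
  qed
  then obtain s where "(f has_sum s) UNIV" by (auto simp: summable_on_def)
  from has_sum_imp_sums[OF this] show ?thesis by (auto simp: summable_def)
qed

lemma padic_norm_inverse_nat_le:
  assumes "m > 0"
  shows "inverse (padic_norm (of_nat m :: 'p::prime_card padic)) \<le> real m"
proof -
  let ?p = "int CARD('p)" and ?v = "multiplicity (int CARD('p)) (int m)"
  have "padic_norm (of_nat m :: 'p padic) = real CARD('p) powi (- int ?v)"
    using padic_abs_frac[OF prime_card[where 'a = 'p], of "int m" 1] assms
      padic_norm_of_rat[of "of_nat m", where 'p = 'p] by simp
  then have "inverse (padic_norm (of_nat m :: 'p padic)) = real (CARD('p) ^ ?v)"
    by (simp add: power_int_minus)
  also have "?p ^ ?v \<le> int m" using assms by (intro zdvd_imp_le multiplicity_dvd) auto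
  then have "real (CARD('p) ^ ?v) \<le> real m" by (metis of_nat_le_iff of_nat_power)
  finally show ?thesis .
qed

lemma square_le_power2: "real m ^ 2 \<le> 2 * 2 ^ m"
proof (induction m)
  case (Suc m)
  consider "m = 0" | "m = 1" | "m = 2" | "m \<ge> 3" by linarith
  then show ?case
  proof cases
    case 4
    then have "3 * real m \<le> real m * real m" by (intro mult_right_mono) auto
    moreover have "real m \<ge> 3" using 4 by simp
    ultimately have "1 + real m * 2 \<le> real m * real m" by linarith
    then have "real (Suc m) ^ 2 \<le> 2 * real m ^ 2" by (simp add: power2_eq_square algebra_simps)
    with Suc show ?thesis by simp
  qed (auto simp: power2_eq_square)
qed simp

text \<open>
  The logarithm is the derivative at \<open>0\<close> of \<open>t \<mapsto> (1 - x)^t\<close>, read off along \<open>t = p^n\<close>: the binomial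
  coefficient \<open>C(p^n, k) / p^n = C(p^n - 1, k - 1) / k\<close> tends to \<open>(-1)^(k-1) / k\<close>.
\<close>

lemma padic_binomial_Suc:
  assumes "q > 0"
  shows "(of_nat (q choose Suc j) :: 'p::prime_card padic) = of_nat q * of_nat ((q - 1) choose j) / of_nat (Suc j)"
proof -
  have "Suc j * (q choose Suc j) = q * ((q - 1) choose j)"
    using Suc_times_binomial[of j "q - 1"] assms by simp
  then have "(of_nat (Suc j) * of_nat (q choose Suc j) :: 'p padic) = of_nat q * of_nat ((q - 1) choose j)"
    by (metis of_nat_mult)
  then show ?thesis by (simp add: field_simps del: of_nat_Suc of_nat_power)
qed

lemma padic_log_series_limit:
  fixes x :: "'p::prime_card padic"
  assumes x: "padic_norm x < 1"
  shows "(\<lambda>n. ((1 - x) ^ (CARD('p) ^ n) - 1) / of_nat (CARD('p) ^ n))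
           \<longlonglongrightarrow> - suminf (\<lambda>i. x ^ Suc i / of_nat (Suc i))"
proof -
  let ?p = "CARD('p)"
  have p2: "?p \<ge> 2" using padic_prime_gt_1[where 'p = 'p] by simp
  have "padic_norm x \<le> 1 / ?p" by (rule padic_norm_less_1[OF x])
  also have "1 / real ?p \<le> 1 / 2" using p2 by (simp add: field_simps)
  finally have xh: "padic_norm x \<le> 1 / 2" .
  have xk: "padic_norm (x ^ k) \<le> (1 / 2) ^ k" for k
    unfolding padic_norm_power by (intro power_mono xh) simp
  define f where "f i = x ^ Suc i / of_nat (Suc i)" for i
  have fb: "padic_norm (f i) \<le> (1 / 2) ^ Suc i * real (Suc i)" for i
  proof -
    have "padic_norm (f i) = padic_norm (x ^ Suc i) * inverse (padic_norm (of_nat (Suc i) :: 'p padic))"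
      by (simp only: f_def divide_inverse padic_norm_mult padic_norm_inverse)
    then show ?thesis by (simp only:) (intro mult_mono padic_norm_inverse_nat_le xk; simp)
  qed
  have "(\<lambda>i. (1 / 2 :: real) ^ Suc i * real (Suc i)) \<longlonglongrightarrow> 0"
    using powser_times_n_limit_0[of "1 / 2 :: real", THEN LIMSEQ_Suc] by (simp add: mult.commute)
  then have "(\<lambda>i. padic_norm (f i)) \<longlonglongrightarrow> 0"
    by (rule Lim_null_comparison[rotated]) (use fb in simp)
  then have "summable f" by (rule padic_sums_null)
  then have S: "(\<lambda>n. \<Sum>i<n. f i) \<longlonglongrightarrow> suminf f" by (rule summable_LIMSEQ)
  have "filterlim (\<lambda>n. ?p ^ n) at_top sequentially"
    using p2 by (intro filterlim_subseq strict_monoI power_strict_increasing) auto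
  from filterlim_compose[OF S this] have S': "(\<lambda>n. \<Sum>i<?p ^ n. f i) \<longlonglongrightarrow> suminf f" .
  define A where "A n = ((1 - x) ^ (?p ^ n) - 1) / of_nat (?p ^ n)" for n
  have qn: "padic_norm (of_nat (?p ^ n) :: 'p padic) = (1 / ?p) ^ n" for n
    by (simp add: padic_norm_power padic_norm_prime)
  have bin: "padic_norm ((-1) ^ j * of_nat ((?p ^ n - 1) choose j) - 1 :: 'p padic) \<le> (1 / ?p) ^ n * real (Suc j)" for j n
  proof (induction j)
    case 0 then show ?case by simp
  next
    case (Suc j)
    let ?q = "?p ^ n"
    have q: "?q = Suc (?q - 1)" using p2 by simp
    have c: "?q choose Suc j = ((?q - 1) choose j) + ((?q - 1) choose Suc j)"
      by (metis q binomial_Suc_Suc)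
    have "(of_nat (?q choose Suc j) :: 'p padic) = of_nat ?q * of_nat ((?q - 1) choose j) / of_nat (Suc j)"
      by (rule padic_binomial_Suc) (use p2 in simp)
    then have "padic_norm (of_nat (?q choose Suc j) :: 'p padic)
        = (1 / ?p) ^ n * padic_norm (of_nat ((?q - 1) choose j) :: 'p padic) * inverse (padic_norm (of_nat (Suc j) :: 'p padic))"
      by (simp only: padic_norm_mult padic_norm_divide qn) (simp only: divide_inverse)
    also have "\<dots> \<le> (1 / ?p) ^ n * 1 * real (Suc j)"
      by (intro mult_mono padic_norm_of_nat_le padic_norm_inverse_nat_le) auto
    finally have 1: "padic_norm (of_nat (?q choose Suc j) :: 'p padic) \<le> (1 / ?p) ^ n * real (Suc (Suc j))"
      by (rule order.trans) (auto intro!: mult_left_mono)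
    have e: "(-1) ^ Suc j * of_nat ((?q - 1) choose Suc j) - 1
       = ((-1) ^ j * of_nat ((?q - 1) choose j) - 1) + (-1) ^ Suc j * (of_nat (?q choose Suc j) :: 'p padic)"
      unfolding c by (simp add: algebra_simps)
    have "(1 / ?p) ^ n * real (Suc j) \<le> (1 / ?p) ^ n * real (Suc (Suc j))"
      by (intro mult_left_mono) auto
    moreover have "padic_norm ((-1) ^ Suc j * (of_nat (?q choose Suc j) :: 'p padic)) = padic_norm (of_nat (?q choose Suc j) :: 'p padic)"
      by (simp only: padic_norm_mult padic_norm_power padic_norm_minus padic_norm_1) simp
    ultimately show ?case unfolding e using Suc 1 by (intro padic_norm_add_le) linarith+
  qed
  have Ae: "A n + (\<Sum>i<?p ^ n. f i)
     = (\<Sum>j<?p ^ n. - ((-1) ^ j * of_nat ((?p ^ n - 1) choose j) - 1) * f j)" for n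
  proof -
    let ?q = "?p ^ n"
    have q: "?q = Suc (?q - 1)" using p2 by simp
    have "(1 - x) ^ ?q = (\<Sum>k\<le>?q. of_nat (?q choose k) * (- x) ^ k)"
      using binomial_ring[of "- x" 1 ?q] by simp
    also have "\<dots> = 1 + (\<Sum>j<?q. of_nat (?q choose Suc j) * (- x) ^ Suc j)"
      by (subst sum.atMost_shift) simp
    finally have "(1 - x) ^ ?q - 1 = (\<Sum>j<?q. of_nat (?q choose Suc j) * (- x) ^ Suc j)"
      by (metis add_diff_cancel_left')
    then have "A n = (\<Sum>j<?q. of_nat (?q choose Suc j) * (- x) ^ Suc j / of_nat ?q)"
      unfolding A_def by (simp add: sum_divide_distrib)
    also have "\<dots> = (\<Sum>j<?q. - ((-1) ^ j * of_nat ((?q - 1) choose j)) * f j)"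
    proof (rule sum.cong, goal_cases)
      case (2 j)
      have "(of_nat ?q :: 'p padic) \<noteq> 0" using p2 by simp
      then have "(of_nat (?q choose Suc j) :: 'p padic) / of_nat ?q = of_nat ((?q - 1) choose j) / of_nat (Suc j)"
        using p2 by (subst padic_binomial_Suc) (simp_all del: of_nat_Suc of_nat_power)
      then have "of_nat (?q choose Suc j) * (- x) ^ Suc j / of_nat ?q
         = of_nat ((?q - 1) choose j) / of_nat (Suc j) * (- x) ^ Suc j"
        by (metis times_divide_eq_left)
      then show ?case unfolding f_def power_minus[of x] by simp
    qed simp
    finally show ?thesis by (simp add: sum.distrib[symmetric] algebra_simps)
  qed
  have bound: "padic_norm (A n - - (\<Sum>i<?p ^ n. f i)) \<le> 2 * (1 / ?p) ^ n" for n
  proof -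
    have "padic_norm (- ((-1) ^ j * of_nat ((?p ^ n - 1) choose j) - 1) * f j) \<le> 2 * (1 / ?p) ^ n" for j
    proof -
      have "padic_norm (- ((-1) ^ j * of_nat ((?p ^ n - 1) choose j) - 1) * f j)
          \<le> ((1 / ?p) ^ n * real (Suc j)) * ((1 / 2) ^ Suc j * real (Suc j))"
        unfolding padic_norm_mult padic_norm_minus by (intro mult_mono bin fb) auto
      also have "\<dots> = (1 / ?p) ^ n * ((real (Suc j)) ^ 2 / 2 ^ Suc j)" by (simp add: power2_eq_square power_one_over)
      also have "\<dots> \<le> (1 / ?p) ^ n * 2"
        using square_le_power2[of "Suc j"] by (intro mult_left_mono) (auto simp: divide_le_eq)
      finally show ?thesis by simp
    qed
    then show ?thesis by (simp add: Ae) (intro padic_norm_sum_le; simp)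
  qed
  have lim: "(\<lambda>n. 2 * (1 / real ?p) ^ n) \<longlonglongrightarrow> 0"
    using p2 by (intro tendsto_mult_right_zero LIMSEQ_power_zero) auto
  have "(\<lambda>n. padic_norm ((A n - - (\<Sum>i<?p ^ n. f i)) - 0)) \<longlonglongrightarrow> 0"
  proof (rule Lim_null_comparison[OF _ lim], rule always_eventually, rule allI)
    show "norm (padic_norm ((A n - - (\<Sum>i<?p ^ n. f i)) - 0)) \<le> 2 * (1 / real ?p) ^ n" for n
      using bound[of n] padic_norm_nonneg[of "(A n - - (\<Sum>i<?p ^ n. f i)) - 0"]
      by (simp only: diff_0_right real_norm_def abs_of_nonneg)
  qed
  then have "(\<lambda>n. A n - - (\<Sum>i<?p ^ n. f i)) \<longlonglongrightarrow> 0" by (simp only: padic_tendsto_iff)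
  from tendsto_add[OF this tendsto_minus[OF S']] have "A \<longlonglongrightarrow> - suminf f" by simp
  then show ?thesis unfolding A_def[abs_def] f_def[abs_def] .
qed

lemma padic_val_of_rat:
  assumes "q \<noteq> 0"
  shows "padic_norm (of_rat q :: 'p::prime_card padic) = real CARD('p) powi (- padic_val (of_rat q :: 'p padic))"
proof -
  have p1: "real CARD('p) > 1" using padic_prime_gt_1[where 'p = 'p] by simp
  obtain k where k: "padic_norm (of_rat q :: 'p padic) = real CARD('p) powi (- k)"
    using assms that[of "int (multiplicity (int CARD('p)) (fst (quotient_of q)))
                        - int (multiplicity (int CARD('p)) (snd (quotient_of q)))"]
    by (simp add: padic_norm_of_rat padic_abs_def)
  have "v = k" if "padic_norm (of_rat q :: 'p padic) = real CARD('p) powi (- v)" for v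
  proof -
    have e: "real CARD('p) powi (- v) = real CARD('p) powi (- k)" using that k by simp
    have "\<not> - v < - k" "\<not> - k < - v" using e power_int_strict_increasing[OF _ p1] by fastforce+
    then show ?thesis by simp
  qed
  then show ?thesis unfolding padic_val_def using k by (rule_tac theI[where P = "\<lambda>v. padic_norm (of_rat q :: 'p padic) = real CARD('p) powi (- v)"]) auto
qed

text \<open>
  For odd \<open>p\<close> the sign disappears in the power \<open>p - 1\<close> that defines the logarithm, for \<open>p = 2\<close> in the
  powers \<open>p^n\<close> of the limit formula.  Torsion determinants are known up to sign only.
\<close>

lemma padic_log_minus:
  assumes "q \<noteq> 0"
  shows "padic_log (- of_rat q :: 'p::prime_card padic) = padic_log (of_rat q)"
proof (cases "CARD('p) = 2")
  case False
  then have "odd CARD('p)" using prime_odd_nat[OF prime_card[where 'a = 'p]] padic_prime_gt_1[where 'p = 'p] by linarith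
  then have "even (CARD('p) - 1)" by simp
  then show ?thesis unfolding padic_log_def padic_val_def padic_norm_minus Let_def
    by (simp del: power_mult_distrib add: power_minus_even)
next
  case True
  define y :: "'p padic" where "y = of_rat q * of_nat CARD('p) powi (- padic_val (of_rat q :: 'p padic))"
  have powi: "padic_norm (of_nat CARD('p) powi k :: 'p padic) = real CARD('p) powi (- k)" for k
    by (cases "k \<ge> 0"; cases "k = 0")
      (simp_all add: padic_norm_inverse padic_norm_power padic_norm_prime power_one_over inverse_eq_divide power_int_def
        padic_norm_divide)
  have "padic_norm y = 1"
    unfolding y_def padic_norm_mult powi padic_val_of_rat[OF assms]
    using padic_prime_gt_1[where 'p = 'p] by (simp add: power_int_minus)
  then have y1: "padic_norm y \<le> 1" by simp
  obtain z where z: "padic_norm (y - of_int z) < 1" using padic_int_approx1[OF y1] .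
  have "odd z"
  proof
    assume "even z"
    then have "padic_norm (of_int z :: 'p padic) < 1" using True by (simp add: padic_norm_int_less_1_iff)
    from padic_norm_add_less[OF z this] \<open>padic_norm y = 1\<close> show False by simp
  qed
  then have "padic_norm (of_int (1 - z) :: 'p padic) < 1" "padic_norm (of_int (1 + z) :: 'p padic) < 1"
    unfolding padic_norm_int_less_1_iff using True by auto
  from padic_norm_add_less[OF this(1), of "- (y - of_int z)"] padic_norm_add_less[OF this(2) z] z
  have y: "padic_norm (1 - y) < 1" "padic_norm (1 - - y) < 1"
    by (simp_all add: padic_norm_minus padic_norm_diff_commute[of "of_int z"])
  let ?A = "\<lambda>y :: 'p padic. \<lambda>n. ((1 - (1 - y)) ^ (CARD('p) ^ n) - 1) / of_nat (CARD('p) ^ n)"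
  have e: "(\<lambda>n. ?A (- y) (Suc n)) = (\<lambda>n. ?A y (Suc n))" using True by simp
  have l1: "(\<lambda>n. ?A (- y) (Suc n)) \<longlonglongrightarrow> - suminf (\<lambda>i. (1 - - y) ^ Suc i / of_nat (Suc i))"
    by (intro LIMSEQ_Suc padic_log_series_limit y)
  have l2: "(\<lambda>n. ?A y (Suc n)) \<longlonglongrightarrow> - suminf (\<lambda>i. (1 - y) ^ Suc i / of_nat (Suc i))"
    by (intro LIMSEQ_Suc padic_log_series_limit y)
  have "suminf (\<lambda>i. (1 - - y) ^ Suc i / of_nat (Suc i)) = suminf (\<lambda>i. (1 - y) ^ Suc i / of_nat (Suc i))"
    using LIMSEQ_unique[OF l1[unfolded e] l2] by (simp only: neg_equal_iff_equal)
  note S = this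
  have pv: "padic_val (- of_rat q :: 'p padic) = padic_val (of_rat q :: 'p padic)"
    by (simp add: padic_val_def padic_norm_minus)
  have m: "- of_rat q * of_nat CARD('p) powi (- padic_val (- of_rat q :: 'p padic)) = - y"
    by (simp add: y_def pv)
  have p1: "(- y) ^ (CARD('p) - 1) = - y" "y ^ (CARD('p) - 1) = y" using True by simp_all
  show ?thesis unfolding padic_log_def Let_def m y_def[symmetric] p1 S ..
qed

section \<open>Free modules over noncommutative rings\<close>

lemma (in abelian_monoid) finsum_swap:
  assumes "finite A" "finite B" "\<And>i j. i \<in> A \<Longrightarrow> j \<in> B \<Longrightarrow> f i j \<in> carrier G"
  shows "finsum G (\<lambda>i. finsum G (f i) B) A = finsum G (\<lambda>j. finsum G (\<lambda>i. f i j) A) B"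
  using assms(1,3)
proof (induction A rule: finite_induct)
  case empty then show ?case by (simp add: finsum_zero)
next
  case (insert a A)
  have "finsum G (\<lambda>j. f a j \<oplus> finsum G (\<lambda>i. f i j) A) B
      = finsum G (f a) B \<oplus> finsum G (\<lambda>j. finsum G (\<lambda>i. f i j) A) B"
    using insert by (intro finsum_addf) (auto intro!: finsum_closed)
  moreover have "finsum G (\<lambda>j. finsum G (\<lambda>i. f i j) (insert a A)) B
     = finsum G (\<lambda>j. f a j \<oplus> finsum G (\<lambda>i. f i j) A) B"
    using insert by (intro finsum_cong') (auto intro!: finsum_insert finsum_closed)
  ultimately show ?case using insert by (subst finsum_insert) (auto intro!: finsum_closed)
qed

lemma (in abelian_monoid) finsum_delta:
  assumes "finite A" "i \<in> A" "x \<in> carrier G"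
  shows "finsum G (\<lambda>j. if j = i then x else \<zero>) A = x" "finsum G (\<lambda>j. if i = j then x else \<zero>) A = x"
  using finsum_singleton[of i A "\<lambda>_. x"] assms by (auto simp: eq_commute)

context left_module
begin

lemma smult_l_null: "x \<in> carrier M \<Longrightarrow> \<zero> \<odot>\<^bsub>M\<^esub> x = \<zero>\<^bsub>M\<^esub>"
  using smult_l_distr[of "\<zero>" "\<zero>" x] smult_closed[of "\<zero>" x]
  by (metis M.add.l_cancel_one' R.add.l_one R.zero_closed)

lemma smult_r_null: "a \<in> carrier R \<Longrightarrow> a \<odot>\<^bsub>M\<^esub> \<zero>\<^bsub>M\<^esub> = \<zero>\<^bsub>M\<^esub>"
  using smult_r_distr[of a "\<zero>\<^bsub>M\<^esub>" "\<zero>\<^bsub>M\<^esub>"] smult_closed[of a "\<zero>\<^bsub>M\<^esub>"]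
  by (metis M.add.l_cancel_one' M.add.l_one M.zero_closed)

lemma smult_finsum_r:
  assumes "finite A" "\<And>i. i \<in> A \<Longrightarrow> f i \<in> carrier M" "a \<in> carrier R"
  shows "a \<odot>\<^bsub>M\<^esub> finsum M f A = finsum M (\<lambda>i. a \<odot>\<^bsub>M\<^esub> f i) A"
  using assms
  by (induction A rule: finite_induct)
    (auto simp: smult_r_null M.finsum_insert smult_r_distr smult_closed Pi_def)

end

lemma lmod_homD:
  assumes "h \<in> lmod_hom R M N"
  shows "x \<in> carrier M \<Longrightarrow> h x \<in> carrier N"
    "x \<in> carrier M \<Longrightarrow> y \<in> carrier M \<Longrightarrow> h (x \<oplus>\<^bsub>M\<^esub> y) = h x \<oplus>\<^bsub>N\<^esub> h y"
    "a \<in> carrier R \<Longrightarrow> x \<in> carrier M \<Longrightarrow> h (a \<odot>\<^bsub>M\<^esub> x) = a \<odot>\<^bsub>N\<^esub> h x"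
  using assms by (auto simp: lmod_hom_def)

lemma lmod_hom_zero:
  assumes "left_module R M" "left_module R N" "h \<in> lmod_hom R M N"
  shows "h \<zero>\<^bsub>M\<^esub> = \<zero>\<^bsub>N\<^esub>"
proof -
  interpret M: left_module R M by fact
  interpret N: left_module R N by fact
  have "h \<zero>\<^bsub>M\<^esub> \<oplus>\<^bsub>N\<^esub> h \<zero>\<^bsub>M\<^esub> = h \<zero>\<^bsub>M\<^esub>"
    using lmod_homD(2)[OF assms(3), of "\<zero>\<^bsub>M\<^esub>" "\<zero>\<^bsub>M\<^esub>"] by simp
  then show ?thesis using lmod_homD(1)[OF assms(3)] by (simp add: N.M.add.l_cancel_one')
qed

lemma lmod_hom_minus:
  assumes "left_module R M" "left_module R N" "h \<in> lmod_hom R M N" "x \<in> carrier M"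
  shows "h (\<ominus>\<^bsub>M\<^esub> x) = \<ominus>\<^bsub>N\<^esub> h x"
proof -
  interpret M: left_module R M by fact
  interpret N: left_module R N by fact
  have "h (\<ominus>\<^bsub>M\<^esub> x) \<oplus>\<^bsub>N\<^esub> h x = \<zero>\<^bsub>N\<^esub>"
    using lmod_homD(2)[OF assms(3), of "\<ominus>\<^bsub>M\<^esub> x" x] assms(4) lmod_hom_zero[OF assms(1-3)]
    by (simp add: M.M.l_neg)
  then show ?thesis
    using lmod_homD(1)[OF assms(3)] assms(4) by (metis M.M.a_inv_closed N.M.minus_equality)
qed

lemma lmod_hom_finsum:
  assumes "left_module R M" "left_module R N" "h \<in> lmod_hom R M N"
    and "finite A" "\<And>i. i \<in> A \<Longrightarrow> f i \<in> carrier M"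
  shows "h (finsum M f A) = finsum N (\<lambda>i. h (f i)) A"
proof -
  interpret M: left_module R M by fact
  interpret N: left_module R N by fact
  show ?thesis using assms(4,5)
    by (induction A rule: finite_induct)
      (auto simp: lmod_hom_zero[OF assms(1-3)] M.M.finsum_insert N.M.finsum_insert lmod_homD[OF assms(3)] Pi_def M.M.finsum_closed)
qed

definition lin :: "('r, 'm) module \<Rightarrow> 'm list \<Rightarrow> (nat \<Rightarrow> 'r) \<Rightarrow> 'm" where
  "lin M bs a = finsum M (\<lambda>i. a i \<odot>\<^bsub>M\<^esub> bs ! i) {..<length bs}"

locale based_module = left_module R M for R (structure) and M :: "('r, 'm) module" (structure) +
  fixes bs :: "'m list"
  assumes basis: "lmod_basis R M bs"
begin

abbreviation "rk \<equiv> length bs"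
abbreviation "co \<equiv> coords R M bs"

lemma bs_closed: "i < rk \<Longrightarrow> bs ! i \<in> carrier M"
  using basis by (auto simp: lmod_basis_def)

lemma lin_closed: "(\<And>i. i < rk \<Longrightarrow> a i \<in> carrier R) \<Longrightarrow> lin M bs a \<in> carrier M"
  unfolding lin_def by (intro M.finsum_closed) (auto intro: smult_closed bs_closed)

lemma lin_cong: "(\<And>i. i < rk \<Longrightarrow> a i = b i) \<Longrightarrow> (\<And>i. i < rk \<Longrightarrow> b i \<in> carrier R) \<Longrightarrow> lin M bs a = lin M bs b"
  unfolding lin_def by (intro M.finsum_cong') (auto intro: smult_closed bs_closed)

lemma is_coords_co: "x \<in> carrier M \<Longrightarrow> is_coords R M bs x (co x)"
  unfolding coords_def using basis by (intro theI'[of "is_coords R M bs x"]) (simp add: lmod_basis_def)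

lemma co_closed: "x \<in> carrier M \<Longrightarrow> i < rk \<Longrightarrow> co x i \<in> carrier R"
  using is_coords_co[of x] by (auto simp: is_coords_def)

lemma lin_co: "x \<in> carrier M \<Longrightarrow> lin M bs (co x) = x"
  using is_coords_co[of x] by (auto simp: is_coords_def lin_def)

lemma co_lin:
  assumes a: "\<And>i. i < rk \<Longrightarrow> a i \<in> carrier R" and i: "i < rk"
  shows "co (lin M bs a) i = a i"
proof -
  let ?a = "restrict a {..<rk}"
  have "lin M bs a = lin M bs ?a" using a by (intro lin_cong) auto
  then have "is_coords R M bs (lin M bs a) ?a" using a unfolding is_coords_def lin_def by auto
  moreover have "is_coords R M bs (lin M bs a) (co (lin M bs a))" using a by (intro is_coords_co lin_closed)
  moreover have "\<exists>!a'. is_coords R M bs (lin M bs a) a'"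
    using basis lin_closed[OF a] by (simp add: lmod_basis_def)
  ultimately have "?a = co (lin M bs a)" by (elim ex1E) metis
  from fun_cong[OF this, of i] show ?thesis using i by simp
qed

lemma eq_iff_co: "x \<in> carrier M \<Longrightarrow> y \<in> carrier M \<Longrightarrow> (\<And>i. i < rk \<Longrightarrow> co x i = co y i) \<Longrightarrow> x = y"
  using lin_cong[of "co x" "co y"] by (simp add: lin_co co_closed)

lemma lin_add:
  assumes "\<And>i. i < rk \<Longrightarrow> a i \<in> carrier R" "\<And>i. i < rk \<Longrightarrow> b i \<in> carrier R"
  shows "lin M bs (\<lambda>i. a i \<oplus> b i) = lin M bs a \<oplus>\<^bsub>M\<^esub> lin M bs b"
proof -
  have "lin M bs (\<lambda>i. a i \<oplus> b i) = finsum M (\<lambda>i. a i \<odot>\<^bsub>M\<^esub> bs ! i \<oplus>\<^bsub>M\<^esub> b i \<odot>\<^bsub>M\<^esub> bs ! i) {..<rk}"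
    unfolding lin_def using assms by (intro M.finsum_cong') (auto intro!: smult_l_distr smult_closed bs_closed M.a_closed)
  also have "\<dots> = lin M bs a \<oplus>\<^bsub>M\<^esub> lin M bs b"
    unfolding lin_def using assms by (intro M.finsum_addf) (auto intro!: smult_closed bs_closed)
  finally show ?thesis .
qed

lemma lin_smult:
  assumes "\<And>i. i < rk \<Longrightarrow> a i \<in> carrier R" "c \<in> carrier R"
  shows "lin M bs (\<lambda>i. c \<otimes> a i) = c \<odot>\<^bsub>M\<^esub> lin M bs a"
proof -
  have "lin M bs (\<lambda>i. c \<otimes> a i) = finsum M (\<lambda>i. c \<odot>\<^bsub>M\<^esub> (a i \<odot>\<^bsub>M\<^esub> bs ! i)) {..<rk}"
    unfolding lin_def using assms by (intro M.finsum_cong') (auto intro!: smult_assoc1 smult_closed bs_closed)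
  also have "\<dots> = c \<odot>\<^bsub>M\<^esub> lin M bs a"
    unfolding lin_def using assms by (intro smult_finsum_r[symmetric]) (auto intro!: smult_closed bs_closed)
  finally show ?thesis .
qed

lemma co_add: "x \<in> carrier M \<Longrightarrow> y \<in> carrier M \<Longrightarrow> i < rk \<Longrightarrow> co (x \<oplus>\<^bsub>M\<^esub> y) i = co x i \<oplus> co y i"
  using co_lin[of "\<lambda>i. co x i \<oplus> co y i" i] by (simp add: lin_add co_closed lin_co)

lemma co_smult: "c \<in> carrier R \<Longrightarrow> x \<in> carrier M \<Longrightarrow> i < rk \<Longrightarrow> co (c \<odot>\<^bsub>M\<^esub> x) i = c \<otimes> co x i"
  using co_lin[of "\<lambda>i. c \<otimes> co x i" i] by (simp add: lin_smult co_closed lin_co)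

lemma co_zero: "i < rk \<Longrightarrow> co \<zero>\<^bsub>M\<^esub> i = \<zero>"
  using co_smult[of \<zero> "\<zero>\<^bsub>M\<^esub>" i] by (simp add: smult_r_null co_closed)

lemma co_finsum:
  assumes "finite A" "\<And>k. k \<in> A \<Longrightarrow> f k \<in> carrier M" "i < rk"
  shows "co (finsum M f A) i = finsum R (\<lambda>k. co (f k) i) A"
  using assms(1,2)
  by (induction A rule: finite_induct)
    (auto simp: co_zero assms(3) M.finsum_insert R.finsum_insert co_add co_closed Pi_def M.finsum_closed)

lemma bs_eq_lin:
  assumes "i < rk"
  shows "bs ! i = lin M bs (\<lambda>j. if j = i then \<one> else \<zero>)"
proof -
  have "lin M bs (\<lambda>j. if j = i then \<one> else \<zero>) = finsum M (\<lambda>j. if j = i then bs ! i else \<zero>\<^bsub>M\<^esub>) {..<rk}"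
    unfolding lin_def using assms
    by (intro M.finsum_cong') (auto intro!: smult_l_null smult_one bs_closed)
  then show ?thesis using assms by (simp add: M.finsum_delta bs_closed)
qed

lemma co_bs: "i < rk \<Longrightarrow> j < rk \<Longrightarrow> co (bs ! i) j = (if j = i then \<one> else \<zero>)"
  by (subst bs_eq_lin) (auto simp: co_lin)

lemma hom_eq_finsum:
  assumes N: "left_module R N" and h: "h \<in> lmod_hom R M N" and x: "x \<in> carrier M"
  shows "h x = finsum N (\<lambda>i. co x i \<odot>\<^bsub>N\<^esub> h (bs ! i)) {..<rk}"
proof -
  interpret N: left_module R N by fact
  have "h x = h (lin M bs (co x))" using x by (simp add: lin_co)
  also have "\<dots> = finsum N (\<lambda>i. h (co x i \<odot>\<^bsub>M\<^esub> bs ! i)) {..<rk}"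
    unfolding lin_def using x
    by (intro lmod_hom_finsum[OF _ N h]) (auto intro!: smult_closed co_closed bs_closed left_module_axioms)
  also have "\<dots> = finsum N (\<lambda>i. co x i \<odot>\<^bsub>N\<^esub> h (bs ! i)) {..<rk}"
    using x h by (intro N.M.finsum_cong') (auto simp: lmod_homD co_closed bs_closed intro!: N.smult_closed)
  finally show ?thesis .
qed

lemma hom_from_basis:
  assumes N: "left_module R N" and t: "\<And>i. i < rk \<Longrightarrow> t i \<in> carrier N"
  shows "\<exists>h\<in>lmod_hom R M N. \<forall>i<rk. h (bs ! i) = t i"
proof -
  interpret N: left_module R N by fact
  define h where "h x = finsum N (\<lambda>i. co x i \<odot>\<^bsub>N\<^esub> t i) {..<rk}" for x
  have "h \<in> lmod_hom R M N" unfolding lmod_hom_def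
  proof (intro CollectI conjI ballI)
    show "h \<in> carrier M \<rightarrow> carrier N" unfolding h_def
      by (auto intro!: N.M.finsum_closed N.smult_closed co_closed t)
  next
    fix x y assume xy: "x \<in> carrier M" "y \<in> carrier M"
    have "h (x \<oplus>\<^bsub>M\<^esub> y) = finsum N (\<lambda>i. co x i \<odot>\<^bsub>N\<^esub> t i \<oplus>\<^bsub>N\<^esub> co y i \<odot>\<^bsub>N\<^esub> t i) {..<rk}"
      unfolding h_def using xy
      by (intro N.M.finsum_cong') (auto simp: co_add N.smult_l_distr co_closed t intro!: N.smult_closed N.M.a_closed)
    then show "h (x \<oplus>\<^bsub>M\<^esub> y) = h x \<oplus>\<^bsub>N\<^esub> h y" unfolding h_def using xy
      by (simp add: N.M.finsum_addf Pi_def N.smult_closed co_closed t)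
  next
    fix a x assume ax: "a \<in> carrier R" "x \<in> carrier M"
    have "h (a \<odot>\<^bsub>M\<^esub> x) = finsum N (\<lambda>i. a \<odot>\<^bsub>N\<^esub> (co x i \<odot>\<^bsub>N\<^esub> t i)) {..<rk}"
      unfolding h_def using ax
      by (intro N.M.finsum_cong') (auto simp: co_smult N.smult_assoc1 co_closed t intro!: N.smult_closed)
    also have "\<dots> = a \<odot>\<^bsub>N\<^esub> h x" unfolding h_def using ax
      by (intro N.smult_finsum_r[symmetric]) (auto intro!: N.smult_closed co_closed t)
    finally show "h (a \<odot>\<^bsub>M\<^esub> x) = a \<odot>\<^bsub>N\<^esub> h x" .
  qed
  moreover have "h (bs ! i) = t i" if i: "i < rk" for i
  proof -
    have "h (bs ! i) = finsum N (\<lambda>j. if j = i then t i else \<zero>\<^bsub>N\<^esub>) {..<rk}"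
      unfolding h_def using i t
      by (intro N.M.finsum_cong') (auto simp: co_bs N.smult_one N.smult_l_null)
    then show ?thesis using i t by (simp add: N.M.finsum_delta)
  qed
  ultimately show ?thesis by blast
qed

end

lemma coords_hom:
  assumes M: "based_module R M bs" and N: "based_module R N cs" and h: "h \<in> lmod_hom R M N"
    and x: "x \<in> carrier M" and j: "j < length cs"
  shows "coords R N cs (h x) j = finsum R (\<lambda>i. coords R M bs x i \<otimes>\<^bsub>R\<^esub> coords R N cs (h (bs ! i)) j) {..<length bs}"
proof -
  interpret M: based_module R M bs by fact
  interpret N: based_module R N cs by fact
  have c: "h (bs ! i) \<in> carrier N" if "i < length bs" for i using h M.bs_closed[OF that] by (rule lmod_homD)
  have "coords R N cs (h x) j = coords R N cs (finsum N (\<lambda>i. coords R M bs x i \<odot>\<^bsub>N\<^esub> h (bs ! i)) {..<length bs}) j"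
    using M.hom_eq_finsum[OF N.left_module_axioms h x] by simp
  also have "\<dots> = finsum R (\<lambda>i. coords R N cs (coords R M bs x i \<odot>\<^bsub>N\<^esub> h (bs ! i)) j) {..<length bs}"
    using j c x by (intro N.co_finsum) (auto intro!: N.smult_closed M.co_closed)
  also have "\<dots> = finsum R (\<lambda>i. coords R M bs x i \<otimes>\<^bsub>R\<^esub> coords R N cs (h (bs ! i)) j) {..<length bs}"
    using j c x by (intro M.R.finsum_cong') (auto simp: N.co_smult M.co_closed N.co_closed)
  finally show ?thesis .
qed

subsection \<open>Contractions\<close>

lemma hom_fixing_basis:
  assumes M: "based_module R M bs" and h: "h \<in> lmod_hom R M M" and b: "\<And>i. i < length bs \<Longrightarrow> h (bs ! i) = bs ! i"
    and x: "x \<in> carrier M"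
  shows "h x = x"
proof -
  interpret based_module R M bs by fact
  have "h x = lin M bs (co x)"
    unfolding hom_eq_finsum[OF left_module_axioms h x] lin_def using x
    by (intro M.finsum_cong') (auto simp: b intro!: smult_closed co_closed bs_closed)
  then show ?thesis using x by (simp add: lin_co)
qed

text \<open>
  The contraction is chosen on bases, degree by degree: if \<open>h\<close> is its part in degree \<open>n\<close>, then
  \<open>b - h (d b)\<close> is a cycle for each basis element \<open>b\<close> of degree \<open>n + 1\<close>, hence a boundary.
\<close>

lemma chain_contraction_exists:
  fixes C :: "('r, 'f) based_complex"
  assumes mod: "\<And>n. based_module R (chain C n) (basis_at C n)"
    and hom: "\<And>n. boundary C (Suc n) \<in> lmod_hom R (chain C (Suc n)) (chain C n)"
    and acyc: "acyclic_complex C"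
  shows "\<exists>\<delta>. chain_contraction R C \<delta>"
proof -
  let ?C = "chain C" and ?d = "boundary C"
  have lm: "left_module R (?C n)" for n using mod[of n] by (simp add: based_module_def)
  define cyc where "cyc n x \<longleftrightarrow> x \<in> carrier (?C n) \<and> (\<forall>m. n = Suc m \<longrightarrow> ?d n x = \<zero>\<^bsub>?C m\<^esub>)" for n x
  have lift: "\<exists>y\<in>carrier (?C (Suc n)). ?d (Suc n) y = x" if "cyc n x" for n x
  proof (cases n)
    case 0
    then show ?thesis using that acyc unfolding acyclic_complex_def cyc_def by auto
  next
    case (Suc m)
    then have "x \<in> {x \<in> carrier (?C (Suc m)). ?d (Suc m) x = \<zero>\<^bsub>?C m\<^esub>}" using that by (simp add: cyc_def)
    then have "x \<in> ?d (Suc (Suc m)) ` carrier (?C (Suc (Suc m)))" using acyc unfolding acyclic_complex_def by blast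
    then show ?thesis using Suc by auto
  qed
  have bcyc: "cyc n (?d (Suc n) y)" if "y \<in> carrier (?C (Suc n))" for n y
  proof (cases n)
    case 0
    then show ?thesis using that lmod_homD(1)[OF hom] by (simp add: cyc_def)
  next
    case (Suc m)
    have "?d (Suc (Suc m)) y \<in> {x \<in> carrier (?C (Suc m)). ?d (Suc m) x = \<zero>\<^bsub>?C m\<^esub>}"
      using that Suc acyc unfolding acyclic_complex_def by blast
    then show ?thesis using Suc by (simp add: cyc_def)
  qed
  define P where "P n h \<longleftrightarrow> h \<in> lmod_hom R (?C n) (?C (Suc n)) \<and> (\<forall>x. cyc n x \<longrightarrow> ?d (Suc n) (h x) = x)" for n h
  define Q where "Q n h h' \<longleftrightarrow> (\<forall>x\<in>carrier (?C (Suc n)). h (?d (Suc n) x) \<oplus>\<^bsub>?C (Suc n)\<^esub> ?d (Suc (Suc n)) (h' x) = x)" for n h h'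
  have "\<exists>\<delta>. \<forall>n. P n (\<delta> n) \<and> Q n (\<delta> n) (\<delta> (Suc n))"
  proof (rule dependent_nat_choice)
    interpret C0: based_module R "?C 0" "basis_at C 0" by (rule mod)
    have "\<exists>t. \<forall>i<C0.rk. t i \<in> carrier (?C (Suc 0)) \<and> ?d (Suc 0) (t i) = basis_at C 0 ! i"
      using lift[of 0] C0.bs_closed by (subst choice_iff'[symmetric]) (auto simp: cyc_def)
    then obtain t where t: "\<And>i. i < C0.rk \<Longrightarrow> t i \<in> carrier (?C (Suc 0))"
      "\<And>i. i < C0.rk \<Longrightarrow> ?d (Suc 0) (t i) = basis_at C 0 ! i" by blast
    obtain h where h: "h \<in> lmod_hom R (?C 0) (?C (Suc 0))" "\<And>i. i < C0.rk \<Longrightarrow> h (basis_at C 0 ! i) = t i"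
      using C0.hom_from_basis[OF lm, of t "Suc 0"] t(1) by blast
    have "?d (Suc 0) (h x) = x" if x: "x \<in> carrier (?C 0)" for x
    proof -
      have "(\<lambda>x. ?d (Suc 0) (h x)) \<in> lmod_hom R (?C 0) (?C 0)"
        using h(1) hom[of 0] by (auto simp: lmod_hom_def Pi_def)
      then show ?thesis by (rule hom_fixing_basis[OF mod _ _ x]) (simp add: h t)
    qed
    then show "\<exists>h. P 0 h" using h(1) unfolding P_def cyc_def by blast
  next
    fix h n assume Ph: "P n h"
    interpret C1: based_module R "?C (Suc n)" "basis_at C (Suc n)" by (rule mod)
    have hh: "h \<in> lmod_hom R (?C n) (?C (Suc n))" using Ph by (simp add: P_def)
    have rest: "cyc (Suc n) (x \<ominus>\<^bsub>?C (Suc n)\<^esub> h (?d (Suc n) x))" if x: "x \<in> carrier (?C (Suc n))" for x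
    proof -
      interpret C: based_module R "?C n" "basis_at C n" by (rule mod)
      have dx: "?d (Suc n) x \<in> carrier (?C n)" using x by (rule lmod_homD(1)[OF hom])
      have hdx: "h (?d (Suc n) x) \<in> carrier (?C (Suc n))" using dx by (rule lmod_homD(1)[OF hh])
      have "?d (Suc n) (h (?d (Suc n) x)) = ?d (Suc n) x"
        using Ph bcyc[OF x] unfolding P_def by blast
      then have "?d (Suc n) (x \<ominus>\<^bsub>?C (Suc n)\<^esub> h (?d (Suc n) x)) = \<zero>\<^bsub>?C n\<^esub>"
        using x dx hdx unfolding a_minus_def
        by (simp add: lmod_homD(2)[OF hom] lmod_hom_minus[OF lm lm hom] C.M.r_neg)
      then show ?thesis using x hdx by (simp add: cyc_def)
    qed
    have "\<exists>t. \<forall>i<C1.rk. t i \<in> carrier (?C (Suc (Suc n))) \<and>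
       ?d (Suc (Suc n)) (t i) = basis_at C (Suc n) ! i \<ominus>\<^bsub>?C (Suc n)\<^esub> h (?d (Suc n) (basis_at C (Suc n) ! i))"
      using lift[OF rest] C1.bs_closed by (subst choice_iff'[symmetric]) blast
    then obtain t where t: "\<And>i. i < C1.rk \<Longrightarrow> t i \<in> carrier (?C (Suc (Suc n)))"
      "\<And>i. i < C1.rk \<Longrightarrow> ?d (Suc (Suc n)) (t i) = basis_at C (Suc n) ! i \<ominus>\<^bsub>?C (Suc n)\<^esub> h (?d (Suc n) (basis_at C (Suc n) ! i))"
      by blast
    obtain h' where h': "h' \<in> lmod_hom R (?C (Suc n)) (?C (Suc (Suc n)))" "\<And>i. i < C1.rk \<Longrightarrow> h' (basis_at C (Suc n) ! i) = t i"
      using C1.hom_from_basis[OF lm, of t "Suc (Suc n)"] t(1) by blast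
    let ?k = "\<lambda>x. h (?d (Suc n) x) \<oplus>\<^bsub>?C (Suc n)\<^esub> ?d (Suc (Suc n)) (h' x)"
    have q: "?k x = x" if x: "x \<in> carrier (?C (Suc n))" for x
    proof -
      have a: "h (?d (Suc n) y) \<in> carrier (?C (Suc n))" "?d (Suc (Suc n)) (h' y) \<in> carrier (?C (Suc n))"
        "?d (Suc n) y \<in> carrier (?C n)" "h' y \<in> carrier (?C (Suc (Suc n)))"
        if "y \<in> carrier (?C (Suc n))" for y
        using that lmod_homD(1)[OF hom] lmod_homD(1)[OF h'(1)] lmod_homD(1)[OF hh] by blast+
      have "?k \<in> lmod_hom R (?C (Suc n)) (?C (Suc n))"
        unfolding lmod_hom_def
        by (auto simp: a lmod_homD(2,3)[OF hom] lmod_homD(2,3)[OF h'(1)] lmod_homD(2,3)[OF hh]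
            C1.M.a_ac C1.smult_r_distr)
      then show ?thesis
      proof (rule hom_fixing_basis[OF mod _ _ x])
        fix i assume i: "i < C1.rk"
        note b = C1.bs_closed[OF i]
        show "?k (basis_at C (Suc n) ! i) = basis_at C (Suc n) ! i"
          using a(1)[OF b] b unfolding h'(2)[OF i] t(2)[OF i] a_minus_def
          by (simp add: C1.M.a_lcomm[of "h (?d (Suc n) (basis_at C (Suc n) ! i))"] C1.M.r_neg)
      qed
    qed
    have "?d (Suc (Suc n)) (h' x) = x" if x: "cyc (Suc n) x" for x
    proof -
      have xc: "x \<in> carrier (?C (Suc n))" "?d (Suc n) x = \<zero>\<^bsub>?C n\<^esub>" using x by (auto simp: cyc_def)
      then show ?thesis
        using q[OF xc(1)] lmod_hom_zero[OF lm lm hh] lmod_homD(1)[OF hom] lmod_homD(1)[OF h'(1)]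
        by (simp add: C1.M.l_zero)
    qed
    then have "P (Suc n) h'" using h' by (simp add: P_def)
    then show "\<exists>h'. P (Suc n) h' \<and> Q n h h'" using q by (auto simp: Q_def)
  qed
  then obtain \<delta> where \<delta>: "\<And>n. P n (\<delta> n)" "\<And>n. Q n (\<delta> n) (\<delta> (Suc n))" by blast
  have "chain_contraction R C \<delta>"
    using \<delta> unfolding chain_contraction_def P_def Q_def cyc_def by auto
  then show ?thesis by blast
qed

section \<open>Matrices over a ring with a finite index set\<close>

definition sq_mat :: "'j set \<Rightarrow> 'r ring \<Rightarrow> ('j \<Rightarrow> 'j \<Rightarrow> 'r) ring" where
  "sq_mat J R =
     \<lparr>carrier = {A. (\<forall>i j. A i j \<in> carrier R) \<and> (\<forall>i j. i \<notin> J \<or> j \<notin> J \<longrightarrow> A i j = \<zero>\<^bsub>R\<^esub>)},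
      monoid.mult = (\<lambda>A B i j. finsum R (\<lambda>k. A i k \<otimes>\<^bsub>R\<^esub> B k j) J),
      one = (\<lambda>i j. if i = j \<and> i \<in> J then \<one>\<^bsub>R\<^esub> else \<zero>\<^bsub>R\<^esub>),
      zero = (\<lambda>i j. \<zero>\<^bsub>R\<^esub>),
      add = (\<lambda>A B i j. A i j \<oplus>\<^bsub>R\<^esub> B i j)\<rparr>"

lemma mat_ring_eq_sq_mat: "mat_ring r R = sq_mat {..<r} R"
  unfolding mat_ring_def sq_mat_def by (auto simp: not_less)

lemma sq_mat_simps:
  fixes R (structure)
  shows
  "carrier (sq_mat J R) = {A. (\<forall>i j. A i j \<in> carrier R) \<and> (\<forall>i j. i \<notin> J \<or> j \<notin> J \<longrightarrow> A i j = \<zero>)}"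
  "A \<otimes>\<^bsub>sq_mat J R\<^esub> B = (\<lambda>i j. finsum R (\<lambda>k. A i k \<otimes> B k j) J)"
  "\<one>\<^bsub>sq_mat J R\<^esub> = (\<lambda>i j. if i = j \<and> i \<in> J then \<one> else \<zero>)"
  "\<zero>\<^bsub>sq_mat J R\<^esub> = (\<lambda>i j. \<zero>)"
  "A \<oplus>\<^bsub>sq_mat J R\<^esub> B = (\<lambda>i j. A i j \<oplus> B i j)"
  by (simp_all add: sq_mat_def)

lemma ring_sq_mat:
  fixes R (structure)
  assumes R: "ring R" and J: "finite J"
  shows "ring (sq_mat J R)"
proof -
  interpret R: ring R by fact
  have fs0: "finsum R (\<lambda>k. \<zero>) J = \<zero>" by (rule R.finsum_zero)
  show ?thesis
  proof (rule ringI)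
    show "abelian_group (sq_mat J R)"
    proof (rule abelian_groupI)
      fix A assume A: "A \<in> carrier (sq_mat J R)"
      show "\<exists>B\<in>carrier (sq_mat J R). B \<oplus>\<^bsub>sq_mat J R\<^esub> A = \<zero>\<^bsub>sq_mat J R\<^esub>"
        using A by (intro bexI[of _ "\<lambda>i j. \<ominus> A i j"]) (auto simp: sq_mat_simps R.l_neg)
    qed (auto simp: sq_mat_simps R.a_ac)
    show "monoid (sq_mat J R)"
    proof (rule monoidI)
      fix A B assume A: "A \<in> carrier (sq_mat J R)" and B: "B \<in> carrier (sq_mat J R)"
      have "finsum R (\<lambda>k. A i k \<otimes> B k j) J = \<zero>" if "i \<notin> J \<or> j \<notin> J" for i j
      proof -
        have "A i k \<otimes> B k j = \<zero>" for k
        proof (cases "i \<in> J")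
          case True
          then have "B k j = \<zero>" using that B by (simp add: sq_mat_simps)
          then show ?thesis using A by (simp add: sq_mat_simps)
        next
          case False
          then have "A i k = \<zero>" using A by (simp add: sq_mat_simps)
          then show ?thesis using B by (simp add: sq_mat_simps)
        qed
        then show ?thesis by (simp add: fs0)
      qed
      moreover have "finsum R (\<lambda>k. A i k \<otimes> B k j) J \<in> carrier R" for i j
        using A B by (intro R.finsum_closed) (auto simp: sq_mat_simps)
      ultimately show "A \<otimes>\<^bsub>sq_mat J R\<^esub> B \<in> carrier (sq_mat J R)" by (simp add: sq_mat_simps)
      fix C assume C: "C \<in> carrier (sq_mat J R)"
      have a: "A i j \<in> carrier R" and b: "B i j \<in> carrier R" and c: "C i j \<in> carrier R" for i j
        using A B C by (auto simp: sq_mat_simps)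
      have "finsum R (\<lambda>k. finsum R (\<lambda>l. A i l \<otimes> B l k) J \<otimes> C k j) J
          = finsum R (\<lambda>l. A i l \<otimes> finsum R (\<lambda>k. B l k \<otimes> C k j) J) J" for i j
      proof -
        have "finsum R (\<lambda>k. finsum R (\<lambda>l. A i l \<otimes> B l k) J \<otimes> C k j) J
           = finsum R (\<lambda>k. finsum R (\<lambda>l. A i l \<otimes> (B l k \<otimes> C k j)) J) J"
          using a b c J by (intro R.finsum_cong') (auto simp: R.finsum_ldistr R.m_assoc intro!: R.finsum_closed)
        also have "\<dots> = finsum R (\<lambda>l. finsum R (\<lambda>k. A i l \<otimes> (B l k \<otimes> C k j)) J) J"
          using a b c J by (intro R.finsum_swap) auto
        also have "\<dots> = finsum R (\<lambda>l. A i l \<otimes> finsum R (\<lambda>k. B l k \<otimes> C k j) J) J"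
          using a b c J by (intro R.finsum_cong') (auto simp: R.finsum_rdistr intro!: R.finsum_closed)
        finally show ?thesis .
      qed
      then show "A \<otimes>\<^bsub>sq_mat J R\<^esub> B \<otimes>\<^bsub>sq_mat J R\<^esub> C = A \<otimes>\<^bsub>sq_mat J R\<^esub> (B \<otimes>\<^bsub>sq_mat J R\<^esub> C)"
        by (simp add: sq_mat_simps)
    next
      fix A assume A: "A \<in> carrier (sq_mat J R)"
      then have a: "A i j \<in> carrier R" for i j by (auto simp: sq_mat_simps)
      have z: "A i j = \<zero>" if "i \<notin> J \<or> j \<notin> J" for i j using A that by (simp add: sq_mat_simps)
      have "finsum R (\<lambda>k. (if i = k \<and> i \<in> J then \<one> else \<zero>) \<otimes> A k j) J = A i j" for i j
      proof (cases "i \<in> J")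
        case True
        have "finsum R (\<lambda>k. (if i = k \<and> i \<in> J then \<one> else \<zero>) \<otimes> A k j) J
          = finsum R (\<lambda>k. if i = k then A i j else \<zero>) J"
          using True a by (intro R.finsum_cong') auto
        then show ?thesis using True J a by (simp add: R.finsum_delta)
      qed (use a z fs0 in simp)
      then show "\<one>\<^bsub>sq_mat J R\<^esub> \<otimes>\<^bsub>sq_mat J R\<^esub> A = A" by (simp add: sq_mat_simps)
      have "finsum R (\<lambda>k. A i k \<otimes> (if k = j \<and> k \<in> J then \<one> else \<zero>)) J = A i j" for i j
      proof (cases "j \<in> J")
        case True
        have "finsum R (\<lambda>k. A i k \<otimes> (if k = j \<and> k \<in> J then \<one> else \<zero>)) J
          = finsum R (\<lambda>k. if k = j then A i j else \<zero>) J"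
          using True a by (intro R.finsum_cong') auto
        then show ?thesis using True J a by (simp add: R.finsum_delta)
      next
        case False
        then have "finsum R (\<lambda>k. A i k \<otimes> (if k = j \<and> k \<in> J then \<one> else \<zero>)) J
          = finsum R (\<lambda>k. \<zero>) J" using a by (intro R.finsum_cong') auto
        then show ?thesis using z False fs0 by simp
      qed
      then show "A \<otimes>\<^bsub>sq_mat J R\<^esub> \<one>\<^bsub>sq_mat J R\<^esub> = A" by (simp add: sq_mat_simps)
    qed (auto simp: sq_mat_simps)
    fix A B C assume "A \<in> carrier (sq_mat J R)" "B \<in> carrier (sq_mat J R)" "C \<in> carrier (sq_mat J R)"
    then have a: "A i j \<in> carrier R" and b: "B i j \<in> carrier R" and c: "C i j \<in> carrier R" for i j
      by (auto simp: sq_mat_simps)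
    have "finsum R (\<lambda>k. (A i k \<oplus> B i k) \<otimes> C k j) J
       = finsum R (\<lambda>k. A i k \<otimes> C k j) J \<oplus> finsum R (\<lambda>k. B i k \<otimes> C k j) J" for i j
      using a b c by (subst R.finsum_addf[symmetric]) (auto simp: R.l_distr intro!: R.finsum_cong')
    then show "(A \<oplus>\<^bsub>sq_mat J R\<^esub> B) \<otimes>\<^bsub>sq_mat J R\<^esub> C = A \<otimes>\<^bsub>sq_mat J R\<^esub> C \<oplus>\<^bsub>sq_mat J R\<^esub> B \<otimes>\<^bsub>sq_mat J R\<^esub> C"
      by (simp add: sq_mat_simps)
    have "finsum R (\<lambda>k. C i k \<otimes> (A k j \<oplus> B k j)) J
       = finsum R (\<lambda>k. C i k \<otimes> A k j) J \<oplus> finsum R (\<lambda>k. C i k \<otimes> B k j) J" for i j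
      using a b c by (subst R.finsum_addf[symmetric]) (auto simp: R.r_distr intro!: R.finsum_cong')
    then show "C \<otimes>\<^bsub>sq_mat J R\<^esub> (A \<oplus>\<^bsub>sq_mat J R\<^esub> B) = C \<otimes>\<^bsub>sq_mat J R\<^esub> A \<oplus>\<^bsub>sq_mat J R\<^esub> C \<otimes>\<^bsub>sq_mat J R\<^esub> B"
      by (simp add: sq_mat_simps)
  qed
qed

text \<open>
  The inverse is the geometric series.
\<close>

lemma (in ring) nilpotent_imp_unit:
  assumes y: "y \<in> carrier R" and n: "y [^] (n::nat) = \<zero>"
  shows "\<one> \<ominus> y \<in> Units R"
proof -
  have "\<exists>q\<in>carrier R. (\<one> \<ominus> y) \<otimes> q = \<one> \<ominus> y [^] k \<and> q \<otimes> (\<one> \<ominus> y) = \<one> \<ominus> y [^] k" for k :: nat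
  proof (induction k)
    case 0
    show ?case using y by (intro bexI[of _ \<zero>]) (auto simp: r_neg a_minus_def)
  next
    case (Suc k)
    then obtain q where q: "q \<in> carrier R" "(\<one> \<ominus> y) \<otimes> q = \<one> \<ominus> y [^] k" "q \<otimes> (\<one> \<ominus> y) = \<one> \<ominus> y [^] k" by blast
    have yk: "y [^] Suc k = y \<otimes> y [^] k" using y by (rule nat_pow_Suc2)
    have yy: "(\<one> \<ominus> y) \<otimes> y = y \<otimes> (\<one> \<ominus> y)" using y by (simp add: a_minus_def l_distr r_distr l_minus r_minus)
    have e: "(\<one> \<ominus> y) \<oplus> (y \<ominus> y [^] Suc k) = \<one> \<ominus> y [^] Suc k"
      using y nat_pow_closed[OF y, of "Suc k"] by (simp add: a_minus_def a_assoc a_lcomm[of "\<ominus> y"] r_neg1 r_neg2 del: nat_pow_Suc)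
    have d: "y \<otimes> (\<one> \<ominus> y [^] k) = y \<ominus> y [^] Suc k"
      using y unfolding yk by (simp add: a_minus_def r_distr r_minus)
    have "(\<one> \<ominus> y) \<otimes> (\<one> \<oplus> y \<otimes> q) = (\<one> \<ominus> y) \<oplus> (\<one> \<ominus> y) \<otimes> y \<otimes> q"
      using y q by (simp add: r_distr m_assoc)
    also have "(\<one> \<ominus> y) \<otimes> y \<otimes> q = y \<otimes> ((\<one> \<ominus> y) \<otimes> q)" using y q by (simp add: yy m_assoc)
    finally have 1: "(\<one> \<ominus> y) \<otimes> (\<one> \<oplus> y \<otimes> q) = \<one> \<ominus> y [^] Suc k" using q(2) d e by simp
    have "(\<one> \<oplus> y \<otimes> q) \<otimes> (\<one> \<ominus> y) = (\<one> \<ominus> y) \<oplus> y \<otimes> (q \<otimes> (\<one> \<ominus> y))"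
      using y q(1) by (simp add: l_distr m_assoc)
    then have 2: "(\<one> \<oplus> y \<otimes> q) \<otimes> (\<one> \<ominus> y) = \<one> \<ominus> y [^] Suc k" using q(3) d e by simp
    from 1 2 y q(1) show ?case by (intro bexI[of _ "\<one> \<oplus> y \<otimes> q"]) auto
  qed
  from this[of n] obtain q where "q \<in> carrier R" "(\<one> \<ominus> y) \<otimes> q = \<one>" "q \<otimes> (\<one> \<ominus> y) = \<one>"
    unfolding n by (auto simp: a_minus_def)
  then show ?thesis using y unfolding Units_def by blast
qed

lemma sq_mat_degree_pow:
  fixes R (structure) and dg :: "'j \<Rightarrow> nat"
  assumes R: "ring R" and J: "finite J" and A: "A \<in> carrier (sq_mat J R)"
    and deg: "\<And>i j. A i j \<noteq> \<zero> \<Longrightarrow> dg j = dg i + 2"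
    and nz: "(A [^]\<^bsub>sq_mat J R\<^esub> (k::nat)) i j \<noteq> \<zero>"
  shows "dg j = dg i + 2 * k"
  using nz
proof (induction k arbitrary: j)
  interpret S: ring "sq_mat J R" by (rule ring_sq_mat[OF R J])
  interpret R: ring R by fact
  case 0 then show ?case by (auto simp: sq_mat_simps split: if_splits)
next
  interpret S: ring "sq_mat J R" by (rule ring_sq_mat[OF R J])
  interpret R: ring R by fact
  case (Suc k)
  let ?B = "A [^]\<^bsub>sq_mat J R\<^esub> k"
  have B: "?B \<in> carrier (sq_mat J R)" using A by simp
  have nz: "finsum R (\<lambda>l. ?B i l \<otimes> A l j) J \<noteq> \<zero>" using Suc.prems by (simp add: sq_mat_simps)
  have "\<exists>l. ?B i l \<otimes> A l j \<noteq> \<zero>"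
  proof (rule ccontr)
    assume "\<not> ?thesis"
    then have "finsum R (\<lambda>l. ?B i l \<otimes> A l j) J = \<zero>" by (intro R.add.finprod_one_eqI) simp
    with nz show False by simp
  qed
  then obtain l where "?B i l \<otimes> A l j \<noteq> \<zero>" by blast
  then have "?B i l \<noteq> \<zero>" "A l j \<noteq> \<zero>"
    using A B by (auto simp: sq_mat_simps)
  then show ?case using Suc.IH deg by fastforce
qed

text \<open>
  If \<open>D\<close> is a differential and \<open>S\<close> a contraction, \<open>(D + S)^2 = 1 + S^2\<close>, and a square root of a
  unit is a unit.
\<close>

lemma (in ring) differential_plus_contraction:
  assumes D: "D \<in> carrier R" and S: "S \<in> carrier R" and DD: "D \<otimes> D = \<zero>" and DS: "D \<otimes> S \<oplus> S \<otimes> D = \<one>"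
    and n: "(\<ominus> (S \<otimes> S)) [^] (n::nat) = \<zero>"
  shows "D \<oplus> S \<in> Units R"
proof -
  let ?T = "D \<oplus> S" and ?Y = "\<ominus> (S \<otimes> S)"
  have T: "?T \<in> carrier R" and Y: "?Y \<in> carrier R" using D S by simp_all
  have "?T \<otimes> ?T = D \<otimes> D \<oplus> (D \<otimes> S \<oplus> S \<otimes> D) \<oplus> S \<otimes> S" using D S by (simp add: l_distr r_distr a_ac)
  also have "\<dots> = \<one> \<ominus> ?Y" using S by (simp add: DD DS a_minus_def)
  finally have "?T \<otimes> ?T \<in> Units R" using nilpotent_imp_unit[OF Y n] by simp
  then obtain v where v: "v \<in> carrier R" "v \<otimes> (?T \<otimes> ?T) = \<one>" "(?T \<otimes> ?T) \<otimes> v = \<one>" unfolding Units_def by blast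
  let ?l = "v \<otimes> ?T" and ?r = "?T \<otimes> v"
  have lc: "?l \<in> carrier R" and rc: "?r \<in> carrier R" using v(1) T by simp_all
  have l: "?l \<otimes> ?T = \<one>" and r: "?T \<otimes> ?r = \<one>" using v T by (simp_all add: m_assoc)
  have "?l = ?l \<otimes> (?T \<otimes> ?r)" unfolding r using lc by simp
  also have "\<dots> = (?l \<otimes> ?T) \<otimes> ?r" using lc T rc by (rule m_assoc[symmetric])
  also have "\<dots> = ?r" unfolding l using rc by simp
  finally have "?l = ?r" .
  then show ?thesis using l r v(1) T unfolding Units_def by (auto intro!: bexI[of _ ?l])
qed

text \<open>Here \<open>S^2\<close> raises degrees, so it is nilpotent on the finite index set.\<close>

lemma differential_plus_contraction_unit:
  fixes R (structure) and dg :: "'j \<Rightarrow> nat"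
  assumes R: "ring R" and J: "finite J"
    and D: "D \<in> carrier (sq_mat J R)" and S: "S \<in> carrier (sq_mat J R)"
    and DD: "D \<otimes>\<^bsub>sq_mat J R\<^esub> D = \<zero>\<^bsub>sq_mat J R\<^esub>"
    and DS: "D \<otimes>\<^bsub>sq_mat J R\<^esub> S \<oplus>\<^bsub>sq_mat J R\<^esub> S \<otimes>\<^bsub>sq_mat J R\<^esub> D = \<one>\<^bsub>sq_mat J R\<^esub>"
    and degS: "\<And>i j. S i j \<noteq> \<zero> \<Longrightarrow> dg j = Suc (dg i)"
  shows "D \<oplus>\<^bsub>sq_mat J R\<^esub> S \<in> Units (sq_mat J R)"
proof -
  interpret A: ring "sq_mat J R" by (rule ring_sq_mat[OF R J])
  interpret R: ring R by fact
  let ?P = "S \<otimes>\<^bsub>sq_mat J R\<^esub> S"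
  let ?Y = "\<ominus>\<^bsub>sq_mat J R\<^esub> ?P"
  have P: "?P \<in> carrier (sq_mat J R)" using S by simp
  have Y: "?Y \<in> carrier (sq_mat J R)" using P by simp
  have negY: "?Y = (\<lambda>i j. \<ominus> ?P i j)"
  proof -
    have "(\<lambda>i j. \<ominus> ?P i j) \<oplus>\<^bsub>sq_mat J R\<^esub> ?P = \<zero>\<^bsub>sq_mat J R\<^esub>"
      using P by (auto simp: sq_mat_simps(1,4,5) R.l_neg)
    moreover have "(\<lambda>i j. \<ominus> ?P i j) \<in> carrier (sq_mat J R)" using P by (auto simp: sq_mat_simps(1))
    ultimately show ?thesis using P A.minus_equality by blast
  qed
  have degY: "dg j = dg i + 2" if "?Y i j \<noteq> \<zero>" for i j
  proof -
    have nz: "?P i j \<noteq> \<zero>" using that unfolding negY by auto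
    have "\<exists>l. S i l \<otimes> S l j \<noteq> \<zero>"
    proof (rule ccontr)
      assume "\<not> ?thesis"
      then have "?P i j = \<zero>" unfolding sq_mat_simps by (intro R.add.finprod_one_eqI) simp
      with nz show False by simp
    qed
    then obtain l where "S i l \<otimes> S l j \<noteq> \<zero>" by blast
    then have "S i l \<noteq> \<zero>" "S l j \<noteq> \<zero>" using S by (auto simp: sq_mat_simps)
    then show ?thesis using degS by fastforce
  qed
  define n where "n = Suc (Max (insert 0 (dg ` J)))"
  have "?Y [^]\<^bsub>sq_mat J R\<^esub> n = \<zero>\<^bsub>sq_mat J R\<^esub>"
  proof -
    have "(?Y [^]\<^bsub>sq_mat J R\<^esub> n) i j = \<zero>" for i j
    proof (rule ccontr)
      assume nz: "(?Y [^]\<^bsub>sq_mat J R\<^esub> n) i j \<noteq> \<zero>"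
      have "dg j = dg i + 2 * n" by (rule sq_mat_degree_pow[where dg = dg, OF R J Y degY nz])
      moreover have "?Y [^]\<^bsub>sq_mat J R\<^esub> n \<in> carrier (sq_mat J R)" using Y by simp
      then have "j \<in> J" using nz by (auto simp: sq_mat_simps(1))
      then have "dg j < n" unfolding n_def using J by (auto simp: less_Suc_eq_le intro!: Max_ge)
      ultimately show False by simp
    qed
    then show ?thesis by (auto simp: sq_mat_simps(4))
  qed
  from A.differential_plus_contraction[OF D S DD DS this] show ?thesis .
qed

text \<open>
  The inverse of the block is a block of the inverse of \<open>T\<close>: in the entries of \<open>T W = 1\<close> and
  \<open>W T = 1\<close> with two odd, respectively two even, indices, only the products of these blocks survive.
\<close>

lemma odd_even_block_unit:
  fixes R (structure) and os es :: "'j list"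
  assumes R: "ring R" and J: "finite J" and T: "T \<in> Units (sq_mat J R)"
    and dist: "distinct os" "distinct es" and len: "length os = length es"
    and J_un: "J = set os \<union> set es" and disj: "set os \<inter> set es = {}"
    and oo: "\<And>i j. i \<in> set os \<Longrightarrow> j \<in> set os \<Longrightarrow> T i j = \<zero>"
    and ee: "\<And>i j. i \<in> set es \<Longrightarrow> j \<in> set es \<Longrightarrow> T i j = \<zero>"
    and r: "r = length os"
  shows "(\<lambda>i j. if i < r \<and> j < r then T (os ! i) (es ! j) else \<zero>) \<in> Units (mat_ring r R)"
proof -
  interpret A: ring "sq_mat J R" by (rule ring_sq_mat[OF R J])
  interpret R: ring R by fact
  obtain W where W: "W \<in> carrier (sq_mat J R)" "W \<otimes>\<^bsub>sq_mat J R\<^esub> T = \<one>\<^bsub>sq_mat J R\<^esub>" "T \<otimes>\<^bsub>sq_mat J R\<^esub> W = \<one>\<^bsub>sq_mat J R\<^esub>"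
    using T unfolding Units_def by blast
  have Tc: "T i j \<in> carrier R" and Wc: "W i j \<in> carrier R" for i j
    using T W(1) by (auto simp: Units_def sq_mat_simps)
  have part: "finsum R f J = finsum R (\<lambda>k. f (xs ! k)) {..<length xs}"
    if xs: "distinct xs" "set xs \<subseteq> J" and f: "\<And>j. f j \<in> carrier R" and z: "\<And>j. j \<in> J - set xs \<Longrightarrow> f j = \<zero>" for f xs
  proof -
    have "finsum R f J = finsum R f (set xs)"
      using xs f z J by (intro R.add.finprod_mono_neutral_cong_right) auto
    also have "set xs = (!) xs ` {..<length xs}" by (auto simp: set_conv_nth)
    also have "finsum R f ((!) xs ` {..<length xs}) = finsum R (\<lambda>k. f (xs ! k)) {..<length xs}"
      using xs f by (intro R.finsum_reindex) (auto simp: inj_on_nth)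
    finally show ?thesis .
  qed
  let ?A = "\<lambda>xs ys U i j. if i < r \<and> j < r then U (xs ! i) (ys ! j) else \<zero>"
  have AB: "?A xs ys U \<otimes>\<^bsub>mat_ring r R\<^esub> ?A ys xs V = \<one>\<^bsub>mat_ring r R\<^esub>"
    if c: "\<And>i j. U i j \<in> carrier R" "\<And>i j. V i j \<in> carrier R" and UV: "U \<otimes>\<^bsub>sq_mat J R\<^esub> V = \<one>\<^bsub>sq_mat J R\<^esub>"
      and xs: "distinct xs" "length xs = r" "set xs \<subseteq> J" and ys: "distinct ys" "length ys = r" "set ys \<subseteq> J"
      and z: "\<And>i m j. i \<in> set xs \<Longrightarrow> j \<in> set xs \<Longrightarrow> m \<in> J - set ys \<Longrightarrow> U i m \<otimes> V m j = \<zero>" for U V xs ys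
  proof -
    have "finsum R (\<lambda>k. ?A xs ys U i k \<otimes> ?A ys xs V k j) {..<r} = (if i = j \<and> i < r then \<one> else \<zero>)" for i j
    proof (cases "i < r \<and> j < r")
      case True
      have "finsum R (\<lambda>k. ?A xs ys U i k \<otimes> ?A ys xs V k j) {..<r} = finsum R (\<lambda>k. U (xs ! i) (ys ! k) \<otimes> V (ys ! k) (xs ! j)) {..<length ys}"
        using True c ys by (intro R.finsum_cong') auto
      also have "\<dots> = finsum R (\<lambda>m. U (xs ! i) m \<otimes> V m (xs ! j)) J"
        using True xs ys c by (intro part[symmetric]) (auto simp: z)
      also have "\<dots> = (U \<otimes>\<^bsub>sq_mat J R\<^esub> V) (xs ! i) (xs ! j)" by (simp add: sq_mat_simps)
      also have "\<dots> = (if i = j \<and> i < r then \<one> else \<zero>)"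
        unfolding UV using True xs subsetD[OF xs(3) nth_mem, of i] by (auto simp: sq_mat_simps nth_eq_iff_index_eq)
      finally show ?thesis .
    next
      case False
      then have "finsum R (\<lambda>k. ?A xs ys U i k \<otimes> ?A ys xs V k j) {..<r} = \<zero>"
        using c by (intro R.add.finprod_one_eqI) auto
      then show ?thesis using False by auto
    qed
    then show ?thesis by (simp add: mat_ring_def)
  qed
  have J: "set os \<subseteq> J" "set es \<subseteq> J" "\<And>m. m \<in> J - set es \<Longrightarrow> m \<in> set os" using J_un by auto
  have "?A os es T \<otimes>\<^bsub>mat_ring r R\<^esub> ?A es os W = \<one>\<^bsub>mat_ring r R\<^esub>"
    by (rule AB) (use Tc Wc W dist r len J in \<open>simp_all add: oo\<close>)
  moreover have "?A es os W \<otimes>\<^bsub>mat_ring r R\<^esub> ?A os es T = \<one>\<^bsub>mat_ring r R\<^esub>"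
    by (rule AB) (use Tc Wc W dist r len J J_un in \<open>auto simp: ee\<close>)
  moreover have "?A os es T \<in> carrier (mat_ring r R)" "?A es os W \<in> carrier (mat_ring r R)"
    using Tc Wc by (auto simp: mat_ring_def)
  ultimately show ?thesis unfolding Units_def by blast
qed

section \<open>The ring \<open>c0\<close>\<close>

definition null_fam :: "('a \<Rightarrow> 'p::prime_card padic) \<Rightarrow> bool" where
  "null_fam x \<longleftrightarrow> (\<forall>\<epsilon>>0. finite {g. padic_norm (x g) \<ge> \<epsilon>})"

lemma null_famD: "null_fam x \<Longrightarrow> e > 0 \<Longrightarrow> finite {g. padic_norm (x g) \<ge> e}"
  by (simp add: null_fam_def)

lemma null_fam_summable: "null_fam x \<Longrightarrow> x summable_on A"
  by (rule padic_summable_null) (auto dest!: null_famD elim: rev_finite_subset)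

lemma null_fam_bounded:
  assumes "null_fam x"
  obtains B where "B > 0" "\<And>g. padic_norm (x g) \<le> B"
proof -
  have f: "finite {g. padic_norm (x g) \<ge> 1}" using assms by (simp add: null_fam_def)
  let ?B = "Max (insert 1 ((\<lambda>g. padic_norm (x g)) ` {g. padic_norm (x g) \<ge> 1}))"
  have 1: "?B \<ge> 1" using f by (intro Max_ge) auto
  have 2: "padic_norm (x g) \<le> ?B" for g
  proof (cases "padic_norm (x g) \<ge> 1")
    case True then show ?thesis using f by (intro Max_ge) auto
  next
    case False then show ?thesis using 1 by linarith
  qed
  show ?thesis by (rule that[of ?B]) (use 1 in linarith, rule 2)
qed

lemma null_fam_mono:
  assumes "null_fam x" "c > 0" "\<And>g. padic_norm (y g) \<le> c * padic_norm (x g)"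
  shows "null_fam y"
  unfolding null_fam_def
proof (intro allI impI)
  fix e :: real assume "e > 0"
  then have "finite {g. padic_norm (x g) \<ge> e / c}" using assms by (intro null_famD) auto
  moreover have "{g. padic_norm (y g) \<ge> e} \<subseteq> {g. padic_norm (x g) \<ge> e / c}"
  proof
    fix g assume "g \<in> {g. padic_norm (y g) \<ge> e}"
    then have "e \<le> c * padic_norm (x g)" using assms(3)[of g] by simp
    then show "g \<in> {g. padic_norm (x g) \<ge> e / c}" using assms(2) by (simp add: field_simps)
  qed
  ultimately show "finite {g. padic_norm (y g) \<ge> e}" by (rule rev_finite_subset)
qed

lemma null_fam_add: "null_fam x \<Longrightarrow> null_fam y \<Longrightarrow> null_fam (\<lambda>g. x g + y g)"
  unfolding null_fam_def
proof (intro allI impI)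
  fix e :: real assume *: "\<forall>\<epsilon>>0. finite {g. padic_norm (x g) \<ge> \<epsilon>}" "\<forall>\<epsilon>>0. finite {g. padic_norm (y g) \<ge> \<epsilon>}" "e > 0"
  have "{g. padic_norm (x g + y g) \<ge> e} \<subseteq> {g. padic_norm (x g) \<ge> e} \<union> {g. padic_norm (y g) \<ge> e}"
    using padic_norm_add_less by (force simp: not_less[symmetric])
  then show "finite {g. padic_norm (x g + y g) \<ge> e}" using * by (auto intro: finite_subset)
qed

lemma null_fam_finite: "finite {g. x g \<noteq> 0} \<Longrightarrow> null_fam x"
  unfolding null_fam_def
proof (intro allI impI)
  fix e :: real assume f: "finite {g. x g \<noteq> 0}" and "e > 0"
  then have "{g. padic_norm (x g) \<ge> e} \<subseteq> {g. x g \<noteq> 0}" by auto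
  then show "finite {g. padic_norm (x g) \<ge> e}" using f by (rule finite_subset)
qed

lemma null_fam_prod:
  assumes x: "null_fam x" and y: "null_fam y"
  shows "null_fam (\<lambda>(g, h). x g * y h)"
  unfolding null_fam_def
proof (intro allI impI)
  fix e :: real assume e: "e > 0"
  obtain B where B: "B > 0" "\<And>g. padic_norm (x g) \<le> B" using null_fam_bounded[OF x] by blast
  obtain C where C: "C > 0" "\<And>g. padic_norm (y g) \<le> C" using null_fam_bounded[OF y] by blast
  have "{z. padic_norm (case z of (g, h) \<Rightarrow> x g * y h) \<ge> e}
      \<subseteq> {g. padic_norm (x g) \<ge> e / C} \<times> {h. padic_norm (y h) \<ge> e / B}"
  proof safe
    fix g h assume "padic_norm (x g * y h) \<ge> e"
    then have l: "e \<le> padic_norm (x g) * padic_norm (y h)" by (simp add: padic_norm_mult)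
    also have "\<dots> \<le> padic_norm (x g) * C" by (intro mult_left_mono C) simp
    finally show "padic_norm (x g) \<ge> e / C" using C by (simp add: field_simps)
    from l have "e \<le> padic_norm (x g) * padic_norm (y h)" .
    also have "\<dots> \<le> B * padic_norm (y h)" by (intro mult_right_mono B) simp
    finally show "padic_norm (y h) \<ge> e / B" using B by (simp add: field_simps)
  qed
  moreover have "finite ({g. padic_norm (x g) \<ge> e / C} \<times> {h. padic_norm (y h) \<ge> e / B})"
    using e B C by (intro finite_cartesian_product null_famD x y) auto
  ultimately show "finite {z. padic_norm (case z of (g, h) \<Rightarrow> x g * y h) \<ge> e}" by (rule finite_subset)
qed

lemma null_fam_infsum_prod:
  assumes x: "null_fam x" and y: "null_fam y"
  shows "infsum (\<lambda>z. x (fst z) * y (snd z)) (A \<times> B) = infsum x A * infsum y B"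
proof -
  have "infsum (\<lambda>z. x (fst z) * y (snd z)) (A \<times> B) = infsum (\<lambda>g. infsum (\<lambda>h. x g * y h) B) A"
  proof (rule padic_has_sum_Sigma(1))
    fix e :: real assume "e > 0"
    from null_famD[OF null_fam_prod[OF x y] this]
    show "finite {z \<in> A \<times> B. e \<le> padic_norm (x (fst z) * y (snd z))}"
      by (rule rev_finite_subset) (auto simp: case_prod_beta)
  qed
  then show ?thesis by (simp add: infsum_cmult_right' infsum_cmult_left')
qed

lemma null_fam_infsum_add: "null_fam x \<Longrightarrow> null_fam y \<Longrightarrow> infsum (\<lambda>g. x g + y g) A = infsum x A + infsum y A"
  by (intro infsum_add null_fam_summable)

lemma c0_simps:
  "carrier (c0 G) = {x. null_fam x \<and> (\<forall>g. g \<notin> carrier G \<longrightarrow> x g = 0)}"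
  "x \<otimes>\<^bsub>c0 G\<^esub> y = (\<lambda>g. if g \<in> carrier G then infsum (\<lambda>h. x h * y (inv\<^bsub>G\<^esub> h \<otimes>\<^bsub>G\<^esub> g)) (carrier G) else 0)"
  "\<one>\<^bsub>c0 G\<^esub> = group_elt \<one>\<^bsub>G\<^esub>" "\<zero>\<^bsub>c0 G\<^esub> = (\<lambda>_. 0)" "x \<oplus>\<^bsub>c0 G\<^esub> y = (\<lambda>g. x g + y g)"
  by (simp_all add: c0_def null_fam_def)

context group
begin

lemma inv_cancel:
  assumes "h \<in> carrier G" "g \<in> carrier G"
  shows "h \<otimes> (inv h \<otimes> g) = g" "inv h \<otimes> (h \<otimes> g) = g" "(g \<otimes> inv h) \<otimes> h = g" "(g \<otimes> h) \<otimes> inv h = g"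
  using assms by (simp_all add: m_assoc[symmetric]) (simp_all add: m_assoc)

text \<open>
  For a point \<open>C\<close> this is the symmetric form of the convolution, on which associativity can be read
  off; for a coset \<open>C\<close> it shows that passing to quotient groups is multiplicative.
\<close>

lemma c0_mult_sum:
  fixes x y :: "'a \<Rightarrow> 'p::prime_card padic"
  assumes x: "x \<in> carrier (c0 G)" and y: "y \<in> carrier (c0 G)" and C: "C \<subseteq> carrier G"
  shows "infsum (x \<otimes>\<^bsub>c0 G\<^esub> y) C = infsum (\<lambda>z. x (fst z) * y (snd z)) {(h, k). h \<in> carrier G \<and> k \<in> carrier G \<and> h \<otimes> k \<in> C}"
    "(\<lambda>z. x (fst z) * y (snd z)) summable_on A"
proof -
  have nx: "null_fam x" and ny: "null_fam y" using x y by (auto simp: c0_simps)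
  have np: "null_fam (\<lambda>z. x (fst z) * y (snd z))"
    using null_fam_prod[OF nx ny] by (simp add: case_prod_unfold)
  then show "(\<lambda>z. x (fst z) * y (snd z)) summable_on A" by (rule null_fam_summable)
  let ?f = "\<lambda>g h. x h * y (inv h \<otimes> g)"
  have inj: "inj_on (\<lambda>(g, h). (h, inv h \<otimes> g)) (C \<times> carrier G)"
    using C by (auto simp: inj_on_def subset_iff)
  have "infsum (x \<otimes>\<^bsub>c0 G\<^esub> y) C = infsum (\<lambda>g. infsum (?f g) (carrier G)) C"
    using C by (intro infsum_cong) (auto simp: c0_simps)
  also have "\<dots> = infsum (\<lambda>z. ?f (fst z) (snd z)) (C \<times> carrier G)"
  proof (rule padic_has_sum_Sigma(1)[symmetric])
    fix e :: real assume e: "e > 0"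
    have f: "finite {z. padic_norm (x (fst z) * y (snd z)) \<ge> e}" by (rule null_famD[OF np e])
    have s: "(\<lambda>(g, h). (h, inv h \<otimes> g)) ` {z \<in> C \<times> carrier G. e \<le> padic_norm (?f (fst z) (snd z))}
        \<subseteq> {z. padic_norm (x (fst z) * y (snd z)) \<ge> e}" by auto
    have i: "inj_on (\<lambda>(g, h). (h, inv h \<otimes> g)) {z \<in> C \<times> carrier G. e \<le> padic_norm (?f (fst z) (snd z))}"
      by (rule inj_on_subset[OF inj]) auto
    show "finite {z \<in> C \<times> carrier G. e \<le> padic_norm (?f (fst z) (snd z))}"
      by (rule finite_imageD[OF finite_subset[OF s f] i])
  qed
  also have "\<dots> = infsum (\<lambda>z. x (fst z) * y (snd z)) {(h, k). h \<in> carrier G \<and> k \<in> carrier G \<and> h \<otimes> k \<in> C}"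
  proof -
    have "bij_betw (\<lambda>(g, h). (h, inv h \<otimes> g)) (C \<times> carrier G) {(h, k). h \<in> carrier G \<and> k \<in> carrier G \<and> h \<otimes> k \<in> C}"
      by (rule bij_betw_byWitness[where f' = "\<lambda>(h, k). (h \<otimes> k, h)"])
        (use C in \<open>auto simp: subset_iff inv_cancel\<close>)
    from infsum_reindex_bij_betw[OF this, of "\<lambda>z. x (fst z) * y (snd z)"] show ?thesis
      by (simp add: case_prod_beta)
  qed
  finally show "infsum (x \<otimes>\<^bsub>c0 G\<^esub> y) C = infsum (\<lambda>z. x (fst z) * y (snd z)) {(h, k). h \<in> carrier G \<and> k \<in> carrier G \<and> h \<otimes> k \<in> C}" .
qed

lemma c0_mult_eq:
  fixes x y :: "'a \<Rightarrow> 'p::prime_card padic"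
  assumes x: "x \<in> carrier (c0 G)" and y: "y \<in> carrier (c0 G)" and g: "g \<in> carrier G"
  shows "(x \<otimes>\<^bsub>c0 G\<^esub> y) g = infsum (\<lambda>z. x (fst z) * y (snd z)) {(h, k). h \<in> carrier G \<and> k \<in> carrier G \<and> h \<otimes> k = g}"
  using c0_mult_sum(1)[OF x y, of "{g}"] g by simp

lemma c0_mult_eq_right:
  fixes x y :: "'a \<Rightarrow> 'p::prime_card padic"
  assumes x: "x \<in> carrier (c0 G)" and y: "y \<in> carrier (c0 G)" and g: "g \<in> carrier G"
  shows "(x \<otimes>\<^bsub>c0 G\<^esub> y) g = infsum (\<lambda>k. x (g \<otimes> inv k) * y k) (carrier G)"
proof -
  have "bij_betw (\<lambda>k. (g \<otimes> inv k, k)) (carrier G) {(h, k). h \<in> carrier G \<and> k \<in> carrier G \<and> h \<otimes> k = g}"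
    by (rule bij_betw_byWitness[where f' = snd]) (use g in \<open>auto simp: inv_cancel\<close>)
  from infsum_reindex_bij_betw[OF this, of "\<lambda>z. x (fst z) * y (snd z)"] show ?thesis
    by (simp add: c0_mult_eq[OF assms])
qed

lemma c0_mult_closed:
  fixes x y :: "'a \<Rightarrow> 'p::prime_card padic"
  assumes x: "x \<in> carrier (c0 G)" and y: "y \<in> carrier (c0 G)"
  shows "x \<otimes>\<^bsub>c0 G\<^esub> y \<in> carrier (c0 G)"
proof -
  have nx: "null_fam x" and ny: "null_fam y" using x y by (auto simp: c0_simps)
  have np: "null_fam (\<lambda>z. x (fst z) * y (snd z))"
    using null_fam_prod[OF nx ny] by (simp add: case_prod_unfold)
  have "null_fam (x \<otimes>\<^bsub>c0 G\<^esub> y)" unfolding null_fam_def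
  proof (intro allI impI)
    fix e :: real assume e: "e > 0"
    let ?S = "{z. padic_norm (x (fst z) * y (snd z)) \<ge> e / 2}"
    have "{g. padic_norm ((x \<otimes>\<^bsub>c0 G\<^esub> y) g) \<ge> e} \<subseteq> (\<lambda>(h, k). h \<otimes> k) ` ?S"
    proof (rule subsetI, rule ccontr)
      fix g assume g: "g \<in> {g. padic_norm ((x \<otimes>\<^bsub>c0 G\<^esub> y) g) \<ge> e}" "g \<notin> (\<lambda>(h, k). h \<otimes> k) ` ?S"
      then have gG: "g \<in> carrier G" using e by (auto simp: c0_simps split: if_splits)
      have "padic_norm ((x \<otimes>\<^bsub>c0 G\<^esub> y) g) \<le> e / 2"
        unfolding c0_mult_eq[OF x y gG]
        using c0_mult_sum(2)[OF x y, of "{}"] g(2) e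
        by (intro padic_infsum_norm_le c0_mult_sum(2)[OF x y, of "{}"]) (force simp: image_iff not_le)+
      with g(1) e show False by simp
    qed
    then show "finite {g. padic_norm ((x \<otimes>\<^bsub>c0 G\<^esub> y) g) \<ge> e}"
      by (rule finite_subset) (use null_famD[OF np, of "e / 2"] e in simp)
  qed
  then show ?thesis by (simp add: c0_simps)
qed

lemma null_fam_triple:
  fixes x y w :: "'a \<Rightarrow> 'p::prime_card padic"
  assumes "null_fam x" "null_fam y" "null_fam w"
  shows "null_fam (\<lambda>(g, h, k). x g * y h * w k)"
  using null_fam_prod[OF assms(1) null_fam_prod[OF assms(2,3)]] by (simp add: case_prod_unfold mult.assoc)

lemma c0_mult_assoc:
  fixes x y w :: "'a \<Rightarrow> 'p::prime_card padic"
  assumes x: "x \<in> carrier (c0 G)" and y: "y \<in> carrier (c0 G)" and w: "w \<in> carrier (c0 G)"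
  shows "(x \<otimes>\<^bsub>c0 G\<^esub> y) \<otimes>\<^bsub>c0 G\<^esub> w = x \<otimes>\<^bsub>c0 G\<^esub> (y \<otimes>\<^bsub>c0 G\<^esub> w)"
proof
  fix g
  show "((x \<otimes>\<^bsub>c0 G\<^esub> y) \<otimes>\<^bsub>c0 G\<^esub> w) g = (x \<otimes>\<^bsub>c0 G\<^esub> (y \<otimes>\<^bsub>c0 G\<^esub> w)) g"
  proof (cases "g \<in> carrier G")
    case g: True
    have n3: "null_fam (\<lambda>(g, h, k). x g * y h * w k)" using x y w by (intro null_fam_triple) (auto simp: c0_simps)
    let ?A = "carrier G"
    have fin: "finite {z \<in> ?A \<times> ?A. e \<le> padic_norm (x (f1 z) * y (f2 z) * w (f3 z))}"
      if e: "e > 0" and inj: "inj_on (\<lambda>z. (f1 z, f2 z, f3 z)) (?A \<times> ?A)" for e :: real and f1 f2 f3 :: "'a \<times> 'a \<Rightarrow> 'a"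
    proof -
      have s: "(\<lambda>z. (f1 z, f2 z, f3 z)) ` {z \<in> ?A \<times> ?A. e \<le> padic_norm (x (f1 z) * y (f2 z) * w (f3 z))}
        \<subseteq> {z. padic_norm (case z of (g, h, k) \<Rightarrow> x g * y h * w k) \<ge> e}" by auto
      have f: "finite {z. padic_norm (case z of (g, h, k) \<Rightarrow> x g * y h * w k) \<ge> e}"
        by (rule null_famD[OF n3 e])
      have i: "inj_on (\<lambda>z. (f1 z, f2 z, f3 z)) {z \<in> ?A \<times> ?A. e \<le> padic_norm (x (f1 z) * y (f2 z) * w (f3 z))}"
        by (rule inj_on_subset[OF inj]) auto
      show ?thesis by (rule finite_imageD[OF finite_subset[OF s f] i])
    qed
    have "((x \<otimes>\<^bsub>c0 G\<^esub> y) \<otimes>\<^bsub>c0 G\<^esub> w) g = infsum (\<lambda>k. (x \<otimes>\<^bsub>c0 G\<^esub> y) (g \<otimes> inv k) * w k) ?A"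
      using x y w g by (intro c0_mult_eq_right c0_mult_closed)
    also have "\<dots> = infsum (\<lambda>k. infsum (\<lambda>h. x h * y (inv h \<otimes> (g \<otimes> inv k)) * w k) ?A) ?A"
      using g by (intro infsum_cong) (auto simp: c0_simps infsum_cmult_left')
    also have "\<dots> = infsum (\<lambda>z. x (snd z) * y (inv (snd z) \<otimes> (g \<otimes> inv (fst z))) * w (fst z)) (?A \<times> ?A)"
      by (rule padic_has_sum_Sigma(1)[symmetric], rule fin) (auto simp: inj_on_def)
    also have "\<dots> = infsum (\<lambda>z. x (fst z) * y (inv (fst z) \<otimes> (g \<otimes> inv (snd z))) * w (snd z)) (?A \<times> ?A)"
    proof -
      have "bij_betw prod.swap (?A \<times> ?A) (?A \<times> ?A)" by (rule bij_betw_byWitness[where f' = prod.swap]) auto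
      from infsum_reindex_bij_betw[OF this, of "\<lambda>z. x (snd z) * y (inv (snd z) \<otimes> (g \<otimes> inv (fst z))) * w (fst z)"]
      show ?thesis by simp
    qed
    also have "\<dots> = infsum (\<lambda>h. infsum (\<lambda>k. x h * y (inv h \<otimes> (g \<otimes> inv k)) * w k) ?A) ?A"
      by (rule padic_has_sum_Sigma(1), rule fin) (auto simp: inj_on_def)
    also have "\<dots> = infsum (\<lambda>h. x h * (y \<otimes>\<^bsub>c0 G\<^esub> w) (inv h \<otimes> g)) ?A"
    proof (rule infsum_cong)
      fix h assume h: "h \<in> ?A"
      have "infsum (\<lambda>k. x h * y (inv h \<otimes> (g \<otimes> inv k)) * w k) ?A = infsum (\<lambda>k. x h * (y ((inv h \<otimes> g) \<otimes> inv k) * w k)) ?A"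
        using g h by (intro infsum_cong) (auto simp: m_assoc)
      also have "\<dots> = x h * infsum (\<lambda>k. y ((inv h \<otimes> g) \<otimes> inv k) * w k) ?A" by (rule infsum_cmult_right')
      also have "\<dots> = x h * (y \<otimes>\<^bsub>c0 G\<^esub> w) (inv h \<otimes> g)"
        using g h by (subst c0_mult_eq_right[OF y w]) auto
      finally show "infsum (\<lambda>k. x h * y (inv h \<otimes> (g \<otimes> inv k)) * w k) ?A = \<dots>" .
    qed
    also have "\<dots> = (x \<otimes>\<^bsub>c0 G\<^esub> (y \<otimes>\<^bsub>c0 G\<^esub> w)) g" using g by (simp add: c0_simps)
    finally show ?thesis .
  qed (simp add: c0_simps)
qed

lemma infsum_single: "infsum f A = (if a \<in> A then f a else 0)" if "\<And>b. b \<in> A \<Longrightarrow> b \<noteq> a \<Longrightarrow> f b = 0"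
  for f :: "'i \<Rightarrow> 'p::prime_card padic"
proof -
  have "infsum f A = infsum f (A \<inter> {a})" using that by (intro infsum_cong_neutral) auto
  then show ?thesis by (auto simp: Int_insert_right)
qed

lemma ring_c0: "ring (c0 G :: ('a \<Rightarrow> 'p::prime_card padic) ring)"
proof (rule ringI)
  let ?S = "c0 G :: ('a \<Rightarrow> 'p padic) ring"
  have n0: "null_fam (\<lambda>_. 0 :: 'p padic)" for x by (rule null_fam_finite) simp
  have ge: "null_fam (group_elt g :: 'a \<Rightarrow> 'p padic)" for g
    by (rule null_fam_finite) (auto simp: group_elt_def)
  have nm: "null_fam (\<lambda>g. - x g)" if "null_fam x" for x :: "'a \<Rightarrow> 'p padic"
    by (rule null_fam_mono[OF that, of 1]) (auto simp: padic_norm_minus)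
  show "abelian_group ?S"
  proof (rule abelian_groupI)
    fix x assume "x \<in> carrier ?S"
    then show "\<exists>y\<in>carrier ?S. y \<oplus>\<^bsub>?S\<^esub> x = \<zero>\<^bsub>?S\<^esub>"
      by (intro bexI[of _ "\<lambda>g. - x g"]) (auto simp: c0_simps nm)
  qed (auto simp: c0_simps null_fam_add n0 ac_simps)
  show "monoid ?S"
  proof (rule monoidI)
    fix x :: "'a \<Rightarrow> 'p padic" assume x: "x \<in> carrier ?S"
    then have z: "x g = 0" if "g \<notin> carrier G" for g using that by (simp add: c0_simps)
    have 1: "infsum (\<lambda>h. group_elt \<one> h * x (inv h \<otimes> g)) (carrier G) = x g" if "g \<in> carrier G" for g
      using that by (subst infsum_single[of _ "\<one>"]) (auto simp: group_elt_def)
    show "\<one>\<^bsub>?S\<^esub> \<otimes>\<^bsub>?S\<^esub> x = x" using 1 z by (auto simp: c0_simps)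
    have 2: "infsum (\<lambda>h. x h * group_elt \<one> (inv h \<otimes> g)) (carrier G) = x g" if "g \<in> carrier G" for g
      using that by (subst infsum_single[of _ g]) (auto simp: group_elt_def inv_solve_left')
    show "x \<otimes>\<^bsub>?S\<^esub> \<one>\<^bsub>?S\<^esub> = x" using 2 z by (auto simp: c0_simps)
  qed (auto simp: c0_mult_closed c0_mult_assoc, auto simp: c0_simps ge group_elt_def)
  fix x y z :: "'a \<Rightarrow> 'p padic" assume xyz: "x \<in> carrier ?S" "y \<in> carrier ?S" "z \<in> carrier ?S"
  have s: "(\<lambda>h. u h * v (inv h \<otimes> g)) summable_on carrier G"
    if uv: "u \<in> carrier ?S" "v \<in> carrier ?S" and g: "g \<in> carrier G" for u v g
  proof -
    have "null_fam v" using uv by (simp add: c0_simps)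
    then obtain C where C: "C > 0" "\<And>g. padic_norm (v g) \<le> C" using null_fam_bounded by blast
    have le: "padic_norm (u h * v (inv h \<otimes> g)) \<le> C * padic_norm (u h)" for h
      unfolding padic_norm_mult mult.commute[of "padic_norm (u h)"] by (intro mult_right_mono C) simp
    have "null_fam u" using uv(1) by (simp add: c0_simps)
    then have "null_fam (\<lambda>h. u h * v (inv h \<otimes> g))" using C(1) le by (rule null_fam_mono[of u C])
    then show ?thesis by (rule null_fam_summable)
  qed
  show "(x \<oplus>\<^bsub>?S\<^esub> y) \<otimes>\<^bsub>?S\<^esub> z = x \<otimes>\<^bsub>?S\<^esub> z \<oplus>\<^bsub>?S\<^esub> y \<otimes>\<^bsub>?S\<^esub> z"
  proof
    fix g
    show "((x \<oplus>\<^bsub>?S\<^esub> y) \<otimes>\<^bsub>?S\<^esub> z) g = (x \<otimes>\<^bsub>?S\<^esub> z \<oplus>\<^bsub>?S\<^esub> y \<otimes>\<^bsub>?S\<^esub> z) g"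
      using infsum_add[OF s[OF xyz(1,3)] s[OF xyz(2,3)], of g] by (simp add: c0_simps(2,5) distrib_right)
  qed
  show "z \<otimes>\<^bsub>?S\<^esub> (x \<oplus>\<^bsub>?S\<^esub> y) = z \<otimes>\<^bsub>?S\<^esub> x \<oplus>\<^bsub>?S\<^esub> z \<otimes>\<^bsub>?S\<^esub> y"
  proof
    fix g
    show "(z \<otimes>\<^bsub>?S\<^esub> (x \<oplus>\<^bsub>?S\<^esub> y)) g = (z \<otimes>\<^bsub>?S\<^esub> x \<oplus>\<^bsub>?S\<^esub> z \<otimes>\<^bsub>?S\<^esub> y) g"
      using infsum_add[OF s[OF xyz(3,1)] s[OF xyz(3,2)], of g] by (simp add: c0_simps(2,5) distrib_left)
  qed
qed

text \<open>
  Right multiplication by an element of the integral group ring, on functions without any condition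
  of convergence.
\<close>

definition rconv :: "('a \<Rightarrow> 'r::comm_ring_1) \<Rightarrow> ('a \<Rightarrow> int) \<Rightarrow> 'a \<Rightarrow> 'r" where
  "rconv x d g = (if g \<in> carrier G then \<Sum>u | d u \<noteq> 0. x (g \<otimes> inv u) * of_int (d u) else 0)"

lemma group_ring_simps:
  "carrier (group_ring G) = {x. finite {g. x g \<noteq> 0} \<and> (\<forall>g. g \<notin> carrier G \<longrightarrow> x g = 0)}"
  "x \<otimes>\<^bsub>group_ring G\<^esub> y = (\<lambda>g. if g \<in> carrier G then \<Sum>h | x h \<noteq> 0. x h * y (inv h \<otimes> g) else 0)"
  "\<one>\<^bsub>group_ring G\<^esub> = group_elt \<one>" "\<zero>\<^bsub>group_ring G\<^esub> = (\<lambda>_. 0)"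
  "x \<oplus>\<^bsub>group_ring G\<^esub> y = (\<lambda>g. x g + y g)"
  by (simp_all add: group_ring_def)

lemma group_ring_mult_eq_rconv:
  fixes x y :: "'a \<Rightarrow> int"
  assumes x: "x \<in> carrier (group_ring G)" and y: "y \<in> carrier (group_ring G)"
  shows "x \<otimes>\<^bsub>group_ring G\<^esub> y = rconv x y"
proof
  fix g
  have fx: "finite {h. x h \<noteq> 0}" and fy: "finite {h. y h \<noteq> 0}" and cx: "\<And>h. x h \<noteq> 0 \<Longrightarrow> h \<in> carrier G"
    and cy: "\<And>h. y h \<noteq> 0 \<Longrightarrow> h \<in> carrier G" using x y by (auto simp: group_ring_simps)
  show "(x \<otimes>\<^bsub>group_ring G\<^esub> y) g = rconv x y g"
  proof (cases "g \<in> carrier G")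
    case g: True
    have "(\<Sum>h | x h \<noteq> 0. x h * y (inv h \<otimes> g)) = (\<Sum>h | x h \<noteq> 0 \<and> y (inv h \<otimes> g) \<noteq> 0. x h * y (inv h \<otimes> g))"
      using fx by (intro sum.mono_neutral_right) auto
    also have "\<dots> = (\<Sum>u | y u \<noteq> 0 \<and> x (g \<otimes> inv u) \<noteq> 0. x (g \<otimes> inv u) * y u)"
      by (rule sum.reindex_bij_witness[of _ "\<lambda>u. g \<otimes> inv u" "\<lambda>h. inv h \<otimes> g"])
        (use g cx cy in \<open>auto simp: inv_mult_group inv_cancel m_assoc\<close>)
    also have "\<dots> = (\<Sum>u | y u \<noteq> 0. x (g \<otimes> inv u) * y u)"
      using fy by (intro sum.mono_neutral_left) auto
    finally show ?thesis using g by (simp add: group_ring_simps rconv_def)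
  qed (simp add: group_ring_simps rconv_def)
qed

lemma to_c0_closed: "x \<in> carrier (group_ring G) \<Longrightarrow> to_c0 x \<in> carrier (c0 G)"
  by (auto simp: c0_simps group_ring_simps to_c0_def intro!: null_fam_finite)

lemma c0_mult_to_c0:
  fixes x :: "'a \<Rightarrow> 'p::prime_card padic"
  assumes x: "x \<in> carrier (c0 G)" and d: "d \<in> carrier (group_ring G)"
  shows "x \<otimes>\<^bsub>c0 G\<^esub> to_c0 d = rconv x d"
proof
  fix g
  have fd: "finite {u. d u \<noteq> 0}" and cd: "\<And>u. d u \<noteq> 0 \<Longrightarrow> u \<in> carrier G" using d by (auto simp: group_ring_simps)
  show "(x \<otimes>\<^bsub>c0 G\<^esub> to_c0 d) g = rconv x d g"
  proof (cases "g \<in> carrier G")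
    case g: True
    have "(x \<otimes>\<^bsub>c0 G\<^esub> to_c0 d) g = infsum (\<lambda>k. x (g \<otimes> inv k) * to_c0 d k) (carrier G)"
      by (rule c0_mult_eq_right[OF x to_c0_closed[OF d] g])
    also have "\<dots> = infsum (\<lambda>k. x (g \<otimes> inv k) * to_c0 d k) {u. d u \<noteq> 0}"
      using cd by (intro infsum_cong_neutral) (auto simp: to_c0_def)
    finally show ?thesis using fd g by (simp add: rconv_def to_c0_def)
  qed (simp add: c0_simps rconv_def)
qed

lemma to_c0_mult:
  assumes "x \<in> carrier (group_ring G)" "y \<in> carrier (group_ring G)"
  shows "to_c0 (x \<otimes>\<^bsub>group_ring G\<^esub> y) = (to_c0 x \<otimes>\<^bsub>c0 G\<^esub> to_c0 y :: 'a \<Rightarrow> 'p::prime_card padic)"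
  unfolding group_ring_mult_eq_rconv[OF assms] c0_mult_to_c0[OF to_c0_closed[OF assms(1)] assms(2)]
  by (auto simp: to_c0_def rconv_def)

lemma to_c0_ring_hom: "to_c0 \<in> Ring.ring_hom (int_group_ring G) (c0 G)"
  by (rule ring_hom_memI)
    (auto simp: to_c0_closed to_c0_mult, auto simp: to_c0_def group_ring_simps c0_simps group_elt_def)

end

section \<open>Torsion of contracted lattices\<close>

text \<open>
  The order of a quotient, as the size of a set of representatives of an equivalence relation \<open>E\<close> on
  \<open>Z\<close>.  In this form it is carried along correspondences between cycles of different complexes, without
  any quotient group.
\<close>

definition transversal_card :: "'a set \<Rightarrow> ('a \<Rightarrow> 'a \<Rightarrow> bool) \<Rightarrow> nat \<Rightarrow> bool" where
  "transversal_card Z E n \<longleftrightarrow> (\<exists>X\<subseteq>Z. finite X \<and> card X = n \<and> (\<forall>z\<in>Z. \<exists>!x. x \<in> X \<and> E z x))"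

lemma transversal_card_transfer:
  assumes t: "transversal_card Z E n" and refl: "\<And>z. z \<in> Z \<Longrightarrow> E z z"
    and tot: "\<And>z. z \<in> Z \<Longrightarrow> \<exists>z'\<in>Z'. \<rho> z z'" and onto: "\<And>z'. z' \<in> Z' \<Longrightarrow> \<exists>z\<in>Z. \<rho> z z'"
    and eq: "\<And>z z' w w'. z \<in> Z \<Longrightarrow> w \<in> Z \<Longrightarrow> z' \<in> Z' \<Longrightarrow> w' \<in> Z' \<Longrightarrow> \<rho> z z' \<Longrightarrow> \<rho> w w' \<Longrightarrow> E z w \<longleftrightarrow> E' z' w'"
  shows "transversal_card Z' E' n"
proof -
  obtain X where X: "X \<subseteq> Z" "finite X" "card X = n" and uX: "\<forall>z\<in>Z. \<exists>!x. x \<in> X \<and> E z x"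
    using t unfolding transversal_card_def by (elim exE conjE) (rule that)
  note u = bspec[OF uX]
  have "\<forall>x\<in>X. \<exists>y. y \<in> Z' \<and> \<rho> x y" using tot X(1) by blast
  then have "\<exists>f. \<forall>x\<in>X. f x \<in> Z' \<and> \<rho> x (f x)" by (rule bchoice)
  then obtain f where f: "\<And>x. x \<in> X \<Longrightarrow> f x \<in> Z'" "\<And>x. x \<in> X \<Longrightarrow> \<rho> x (f x)" by blast
  have inj: "inj_on f X"
  proof (rule inj_onI)
    fix x y assume xy: "x \<in> X" "y \<in> X" "f x = f y"
    have xZ: "x \<in> Z" "y \<in> Z" using xy X by auto
    have "E x y \<longleftrightarrow> E' (f x) (f y)" "E x x \<longleftrightarrow> E' (f x) (f x)"
      by (rule eq[OF xZ f(1)[OF xy(1)] f(1)[OF xy(2)] f(2)[OF xy(1)] f(2)[OF xy(2)]])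
        (rule eq[OF xZ(1,1) f(1)[OF xy(1)] f(1)[OF xy(1)] f(2)[OF xy(1)] f(2)[OF xy(1)]])
    then have "E x y" using refl[OF xZ(1)] xy by simp
    moreover have "\<And>a b. a \<in> X \<and> E x a \<Longrightarrow> b \<in> X \<and> E x b \<Longrightarrow> a = b" using u[OF xZ(1)] by (elim ex1E) blast
    ultimately show "x = y" using xy(1,2) refl[OF xZ(1)] by simp
  qed
  have "\<exists>!y. y \<in> f ` X \<and> E' z' y" if z': "z' \<in> Z'" for z'
  proof -
    obtain z where z: "z \<in> Z" "\<rho> z z'" using onto z' by blast
    have e: "E z x \<longleftrightarrow> E' z' (f x)" if "x \<in> X" for x using z z' that X f by (intro eq) auto
    obtain x where x: "x \<in> X" "E z x" "\<forall>y. y \<in> X \<and> E z y \<longrightarrow> y = x" using u[OF z(1)] by (elim ex1E) blast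
    show ?thesis by (rule ex1I[of _ "f x"]) (use x e in auto)
  qed
  then show ?thesis unfolding transversal_card_def using X f inj
    by (intro exI[of _ "f ` X"]) (auto simp: card_image)
qed

definition lat_ch :: "'i set \<Rightarrow> ('i \<Rightarrow> nat) \<Rightarrow> nat \<Rightarrow> ('i \<Rightarrow> int) set" where
  "lat_ch I dg s = {x. \<forall>i. x i \<noteq> 0 \<longrightarrow> i \<in> I \<and> dg i = s}"

definition lat_bd :: "'i set \<Rightarrow> ('i \<Rightarrow> 'i \<Rightarrow> int) \<Rightarrow> ('i \<Rightarrow> int) \<Rightarrow> 'i \<Rightarrow> int" where
  "lat_bd I D x j = (if j \<in> I then \<Sum>i\<in>I. x i * D i j else 0)"

definition lat_cyc :: "'i set \<Rightarrow> ('i \<Rightarrow> nat) \<Rightarrow> ('i \<Rightarrow> 'i \<Rightarrow> int) \<Rightarrow> nat \<Rightarrow> ('i \<Rightarrow> int) set" where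
  "lat_cyc I dg D s = {x \<in> lat_ch I dg s. \<forall>j. lat_bd I D x j = 0}"

definition lat_eq :: "'i set \<Rightarrow> ('i \<Rightarrow> nat) \<Rightarrow> ('i \<Rightarrow> 'i \<Rightarrow> int) \<Rightarrow> nat \<Rightarrow> ('i \<Rightarrow> int) \<Rightarrow> ('i \<Rightarrow> int) \<Rightarrow> bool" where
  "lat_eq I dg D s x y \<longleftrightarrow> (\<exists>w\<in>lat_ch I dg (Suc s). \<forall>j. x j - y j = lat_bd I D w j)"

definition lat_hom :: "'i set \<Rightarrow> ('i \<Rightarrow> nat) \<Rightarrow> ('i \<Rightarrow> 'i \<Rightarrow> int) \<Rightarrow> nat \<Rightarrow> nat \<Rightarrow> bool" where
  "lat_hom I dg D s n \<longleftrightarrow> transversal_card (lat_cyc I dg D s) (lat_eq I dg D s) n"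

text \<open>
  A chain complex of free abelian groups with basis \<open>I\<close>, graded by \<open>dg\<close> and with differential \<open>D\<close>,
  together with a contraction \<open>S\<close> of its extension to a field.
\<close>

definition contracted :: "'i set \<Rightarrow> ('i \<Rightarrow> nat) \<Rightarrow> ('i \<Rightarrow> 'i \<Rightarrow> int) \<Rightarrow> ('i \<Rightarrow> 'i \<Rightarrow> 'k::field_char_0) \<Rightarrow> bool" where
  "contracted I dg D S \<longleftrightarrow> finite I \<and>
     (\<forall>i\<in>I. \<forall>j\<in>I. D i j \<noteq> 0 \<longrightarrow> dg i = Suc (dg j)) \<and>
     (\<forall>i\<in>I. \<forall>j\<in>I. S i j \<noteq> 0 \<longrightarrow> dg j = Suc (dg i)) \<and>
     (\<forall>i\<in>I. \<forall>k\<in>I. (\<Sum>j\<in>I. D i j * D j k) = 0) \<and>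
     (\<forall>i\<in>I. \<forall>k\<in>I. (\<Sum>j\<in>I. of_int (D i j) * S j k) + (\<Sum>j\<in>I. S i j * of_int (D j k)) = (if i = k then 1 else 0))"

lemma contractedD:
  assumes "contracted I dg D S"
  shows "finite I" "\<And>i j. i \<in> I \<Longrightarrow> j \<in> I \<Longrightarrow> dg i \<noteq> Suc (dg j) \<Longrightarrow> D i j = 0"
    "\<And>i j. i \<in> I \<Longrightarrow> j \<in> I \<Longrightarrow> dg j \<noteq> Suc (dg i) \<Longrightarrow> S i j = 0"
    "\<And>i k. i \<in> I \<Longrightarrow> k \<in> I \<Longrightarrow> (\<Sum>j\<in>I. D i j * D j k) = 0"
    "\<And>i k. i \<in> I \<Longrightarrow> k \<in> I \<Longrightarrow> (\<Sum>j\<in>I. of_int (D i j) * S j k) + (\<Sum>j\<in>I. S i j * of_int (D j k)) = (if i = k then 1 else 0)"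
  using assms unfolding contracted_def by blast+

definition ldet :: "'i list \<Rightarrow> 'i list \<Rightarrow> ('i \<Rightarrow> 'i \<Rightarrow> 'k::comm_ring_1) \<Rightarrow> 'k" where
  "ldet xs ys T = Determinant.det (mat (length xs) (length xs) (\<lambda>(i, j). T (xs ! i) (ys ! j)))"

abbreviation altprod :: "(nat \<Rightarrow> nat) \<Rightarrow> nat \<Rightarrow> 'k::field_char_0" where
  "altprod h K \<equiv> \<Prod>s<K. of_nat (h s) powi (-1) ^ s"

text \<open>
  Rows and columns come as lists, since a determinant between two different bases is defined only for
  ordered bases.  The order of a list affects the sign of the determinant, whence the two values.
\<close>

definition torsion_formula :: "'i set \<Rightarrow> ('i \<Rightarrow> nat) \<Rightarrow> ('i \<Rightarrow> 'i \<Rightarrow> int) \<Rightarrow> ('i \<Rightarrow> 'i \<Rightarrow> 'k::field_char_0) \<Rightarrow> bool" where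
  "torsion_formula I dg D S \<longleftrightarrow> (\<exists>h. (\<forall>s. lat_hom I dg D s (h s) \<and> h s > 0) \<and>
     (\<forall>xs ys. distinct xs \<longrightarrow> distinct ys \<longrightarrow> set xs = {i\<in>I. odd (dg i)} \<longrightarrow> set ys = {i\<in>I. even (dg i)} \<longrightarrow>
        length xs = length ys \<and>
        (\<forall>K. (\<forall>i\<in>I. dg i < K) \<longrightarrow> (\<forall>s\<ge>K. h s = 1) \<and>
          ldet xs ys (\<lambda>i j. of_int (D i j) + S i j) \<in>
            {altprod h K, - altprod h K})))"

lemma ldet_permute_rows:
  assumes "distinct xs" "distinct xs'" "set xs = set xs'"
  shows "ldet xs ys T \<in> {ldet xs' ys T, - ldet xs' ys T}"
proof -
  let ?n = "length xs'"
  have len: "length xs = ?n" using assms by (metis distinct_card)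
  have "mset xs = mset xs'" using assms by (simp add: set_eq_iff_mset_eq_distinct)
  then obtain p where p: "p permutes {..<?n}" "permute_list p xs' = xs" by (rule mset_eq_permutation)
  let ?A = "mat ?n ?n (\<lambda>(i, j). T (xs' ! i) (ys ! j))"
  have p': "p permutes {0..<?n}" using p by (simp add: lessThan_atLeast0)
  have "mat (length xs) (length xs) (\<lambda>(i, j). T (xs ! i) (ys ! j)) = mat ?n ?n (\<lambda>(i, j). ?A $$ (p i, j))"
  proof (rule eq_matI)
    fix i j assume ij: "i < dim_row (mat ?n ?n (\<lambda>(i, j). ?A $$ (p i, j)))" "j < dim_col (mat ?n ?n (\<lambda>(i, j). ?A $$ (p i, j)))"
    then have "i < ?n" "j < ?n" by simp_all
    moreover have "p i < ?n" using \<open>i < ?n\<close> p(1) permutes_in_image[of p "{..<?n}" i] by simp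
    moreover have "xs ! i = xs' ! p i" using permute_list_nth[OF p(1) \<open>i < ?n\<close>] p(2) by simp
    ultimately show "mat (length xs) (length xs) (\<lambda>(i, j). T (xs ! i) (ys ! j)) $$ (i, j) = mat ?n ?n (\<lambda>(i, j). ?A $$ (p i, j)) $$ (i, j)"
      using len by simp
  qed (simp_all add: len)
  then have "ldet xs ys T = signof p * ldet xs' ys T"
    unfolding ldet_def using det_permute_rows[of ?A ?n p] p' by simp
  then show ?thesis by (cases "sign p = 1") (auto simp: sign_def split: if_splits)
qed

lemma ldet_transpose: "length xs = length ys \<Longrightarrow> ldet xs ys T = ldet ys xs (\<lambda>i j. T j i)"
proof -
  assume l: "length xs = length ys"
  let ?A = "mat (length xs) (length xs) (\<lambda>(i, j). T (xs ! i) (ys ! j))"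
  have "transpose_mat ?A = mat (length ys) (length ys) (\<lambda>(i, j). T (xs ! j) (ys ! i))"
    using l by (intro eq_matI) auto
  then show ?thesis unfolding ldet_def using det_transpose[of ?A "length xs"] by simp
qed

lemma ldet_permute_cols:
  assumes "distinct ys" "distinct ys'" "set ys = set ys'" "length xs = length ys"
  shows "ldet xs ys T \<in> {ldet xs ys' T, - ldet xs ys' T}"
proof -
  have "length ys = length ys'" using assms by (metis distinct_card)
  then show ?thesis using ldet_permute_rows[OF assms(1-3), of xs "\<lambda>i j. T j i"] assms(4)
    by (simp add: ldet_transpose[of xs])
qed

lemma ldet_Cons:
  assumes z: "\<And>j. j \<in> set ys \<Longrightarrow> T x j = 0" and l: "length xs = length ys"
  shows "ldet (x # xs) (y # ys) T = T x y * ldet xs ys T"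
proof -
  let ?n = "Suc (length xs)"
  let ?A = "mat ?n ?n (\<lambda>(i, j). T ((x # xs) ! i) ((y # ys) ! j))"
  have A: "?A \<in> carrier_mat ?n ?n" by simp
  have "Determinant.det ?A = (\<Sum>j<?n. ?A $$ (0, j) * cofactor ?A 0 j)"
    by (rule laplace_expansion_row[OF A]) simp
  also have "\<dots> = (\<Sum>j\<in>{0}. ?A $$ (0, j) * cofactor ?A 0 j)"
  proof (rule sum.mono_neutral_right)
    show "\<forall>j\<in>{..<?n} - {0}. ?A $$ (0, j) * cofactor ?A 0 j = 0"
    proof
      fix j assume "j \<in> {..<?n} - {0}"
      then obtain k where "j = Suc k" "k < length ys" using l by (cases j) auto
      then show "?A $$ (0, j) * cofactor ?A 0 j = 0" using l z[of "ys ! k"] by simp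
    qed
  qed auto
  also have "\<dots> = T x y * Determinant.det (mat_delete ?A 0 0)" by (simp add: cofactor_def)
  also have "mat_delete ?A 0 0 = mat (length xs) (length xs) (\<lambda>(i, j). T (xs ! i) (ys ! j))"
    by (intro eq_matI) (auto simp: mat_delete_def)
  finally show ?thesis by (simp add: ldet_def)
qed

lemma ldet_add_row:
  assumes d: "distinct xs" and a: "a \<in> set xs" and b: "b \<in> set xs" and ab: "a \<noteq> b"
    and T': "\<And>i j. i \<in> set xs \<Longrightarrow> j \<in> set ys \<Longrightarrow> T' i j = T i j + (if i = b then t * T a j else 0)"
    and l: "length xs = length ys"
  shows "ldet xs ys T' = ldet xs ys T"
proof -
  let ?n = "length xs"
  obtain k where k: "k < ?n" "xs ! k = a" using a by (auto simp: in_set_conv_nth)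
  obtain m where m: "m < ?n" "xs ! m = b" using b by (auto simp: in_set_conv_nth)
  let ?A = "mat ?n ?n (\<lambda>(i, j). T (xs ! i) (ys ! j))"
  have km: "m \<noteq> k" using k m ab by auto
  have "mat ?n ?n (\<lambda>(i, j). T' (xs ! i) (ys ! j)) = addrow t m k ?A"
  proof (rule eq_matI)
    fix i j assume "i < dim_row (addrow t m k ?A)" "j < dim_col (addrow t m k ?A)"
    then have ij: "i < ?n" "j < ?n" by simp_all
    have "xs ! i = b \<longleftrightarrow> i = m" using ij m d by (metis nth_eq_iff_index_eq)
    then show "mat ?n ?n (\<lambda>(i, j). T' (xs ! i) (ys ! j)) $$ (i, j) = addrow t m k ?A $$ (i, j)"
      using ij k m l by (auto simp: T' add.commute)
  qed simp_all
  then show ?thesis unfolding ldet_def using det_addrow[of k ?n m ?A t] k km by simp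
qed

subsection \<open>Elementary changes of basis\<close>

text \<open>
  Replacing a basis element by its sum with a multiple of another one in the same degree conjugates
  \<open>D\<close> and \<open>S\<close> by an elementary matrix; homology and determinants stay the same.
\<close>

definition rowop :: "'i \<Rightarrow> 'i \<Rightarrow> 'k::comm_ring_1 \<Rightarrow> ('i \<Rightarrow> 'i \<Rightarrow> 'k) \<Rightarrow> 'i \<Rightarrow> 'i \<Rightarrow> 'k" where
  "rowop a b t A i j = A i j + (if i = b then t * A a j else 0)"

definition colop :: "'i \<Rightarrow> 'i \<Rightarrow> 'k::comm_ring_1 \<Rightarrow> ('i \<Rightarrow> 'i \<Rightarrow> 'k) \<Rightarrow> 'i \<Rightarrow> 'i \<Rightarrow> 'k" where
  "colop a b t A i j = A i j - (if j = a then t * A i b else 0)"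

definition mprod :: "'i set \<Rightarrow> ('i \<Rightarrow> 'i \<Rightarrow> 'k::comm_ring_1) \<Rightarrow> ('i \<Rightarrow> 'i \<Rightarrow> 'k) \<Rightarrow> 'i \<Rightarrow> 'i \<Rightarrow> 'k" where
  "mprod I A B i k = (\<Sum>j\<in>I. A i j * B j k)"

lemma colop_rowop: "colop a b t (rowop a b t A) = rowop a b t (colop a b t A)"
  by (auto simp: fun_eq_iff colop_def rowop_def algebra_simps)

lemma mprod_rowop: "mprod I (rowop a b t A) B = rowop a b t (mprod I A B)"
  by (auto simp: fun_eq_iff mprod_def rowop_def distrib_right sum.distrib sum_distrib_left mult.assoc)

lemma mprod_colop: "mprod I A (colop a b t B) = colop a b t (mprod I A B)"
  by (auto simp: fun_eq_iff mprod_def colop_def right_diff_distrib sum_subtractf sum_distrib_left algebra_simps)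

lemma mprod_colop_rowop:
  assumes "finite I" "a \<in> I" "b \<in> I" "a \<noteq> b"
  shows "mprod I (colop a b t A) (rowop a b t B) = mprod I A B"
proof (intro ext)
  fix i k
  have "mprod I (colop a b t A) (rowop a b t B) i k
    = (\<Sum>j\<in>I. A i j * B j k + (if j = b then A i b * t * B a k else 0) - (if j = a then t * A i b * B a k else 0))"
    unfolding mprod_def colop_def rowop_def using assms(4) by (intro sum.cong) (auto simp: algebra_simps)
  also have "\<dots> = mprod I A B i k"
    using assms by (simp add: sum.distrib sum_subtractf mprod_def)
  finally show "mprod I (colop a b t A) (rowop a b t B) i k = mprod I A B i k" .
qed

definition basechange :: "'i \<Rightarrow> 'i \<Rightarrow> 'k::comm_ring_1 \<Rightarrow> ('i \<Rightarrow> 'i \<Rightarrow> 'k) \<Rightarrow> 'i \<Rightarrow> 'i \<Rightarrow> 'k" where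
  "basechange a b t A = rowop a b t (colop a b t A)"

lemma mprod_basechange:
  assumes "finite I" "a \<in> I" "b \<in> I" "a \<noteq> b"
  shows "mprod I (basechange a b t A) (basechange a b t B) = basechange a b t (mprod I A B)"
    "mprod I (colop a b t A) (basechange a b t B) = colop a b t (mprod I A B)"
  by (simp_all only: basechange_def mprod_rowop)
    (simp_all only: colop_rowop[symmetric] mprod_colop mprod_colop_rowop[OF assms])

lemma basechange_apply:
  "basechange a b t A i j = A i j - (if j = a then t * A i b else 0)
     + (if i = b then t * (A a j - (if j = a then t * A a b else 0)) else 0)"
  by (simp add: basechange_def rowop_def colop_def)

lemma contracted_basechange:
  fixes S :: "'i \<Rightarrow> 'i \<Rightarrow> 'k::field_char_0"
  assumes c: "contracted I dg D S" and ab: "a \<in> I" "b \<in> I" "a \<noteq> b" "dg a = dg b"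
  shows "contracted I dg (basechange a b t D) (basechange a b (of_int t) S)"
proof -
  note D = contractedD[OF c]
  have mp: "mprod I (basechange a b (of_int t) A) (basechange a b (of_int t) B) i k
      = basechange a b (of_int t) (mprod I A B) i k" for A B :: "'i \<Rightarrow> 'i \<Rightarrow> 'k" and i k
    by (simp add: mprod_basechange D(1) ab)
  have mpi: "mprod I (basechange a b t D) (basechange a b t D) i k = basechange a b t (mprod I D D) i k" for i k
    by (simp add: mprod_basechange D(1) ab)
  let ?D = "\<lambda>i j. of_int (D i j) :: 'k"
  have oi: "of_int (basechange a b t D i j) = basechange a b (of_int t) ?D i j" for i j
    by (simp add: basechange_apply)
  show ?thesis unfolding contracted_def
  proof (intro conjI ballI impI D(1))
    fix i j assume ij: "i \<in> I" "j \<in> I"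
    show "dg i = Suc (dg j)" if "basechange a b t D i j \<noteq> 0"
    proof (rule ccontr)
      assume "dg i \<noteq> Suc (dg j)"
      then have "D i j = 0" "j = a \<Longrightarrow> D i b = 0" "i = b \<Longrightarrow> D a j = 0" "D a b = 0"
        using ij ab by (auto intro!: D(2))
      with that show False by (auto simp: basechange_apply split: if_splits)
    qed
    show "dg j = Suc (dg i)" if "basechange a b (of_int t) S i j \<noteq> 0"
    proof (rule ccontr)
      assume "dg j \<noteq> Suc (dg i)"
      then have "S i j = 0" "j = a \<Longrightarrow> S i b = 0" "i = b \<Longrightarrow> S a j = 0" "S a b = 0"
        using ij ab by (auto intro!: D(3))
      with that show False by (auto simp: basechange_apply split: if_splits)
    qed
    have "mprod I D D i j = 0" "mprod I D D i b = 0" "mprod I D D a j = 0" "mprod I D D a b = 0"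
      using D(4) ij ab by (simp_all add: mprod_def)
    then show "(\<Sum>k\<in>I. basechange a b t D i k * basechange a b t D k j) = 0"
      using mpi[of i j] by (simp add: mprod_def[of I "basechange a b t D"] basechange_apply[of a b t "mprod I D D"])
    have m: "mprod I ?D S i k + mprod I S ?D i k = (if i = k then 1 else 0)" if "i \<in> I" "k \<in> I" for i k
      using D(5)[OF that] by (simp add: mprod_def)
    have "(\<Sum>k\<in>I. of_int (basechange a b t D i k) * basechange a b (of_int t) S k j)
       + (\<Sum>k\<in>I. basechange a b (of_int t) S i k * of_int (basechange a b t D k j))
      = basechange a b (of_int t) (mprod I ?D S) i j + basechange a b (of_int t) (mprod I S ?D) i j"
      unfolding oi mp[symmetric] mprod_def ..
    also have "\<dots> = basechange a b (of_int t) (\<lambda>i k. mprod I ?D S i k + mprod I S ?D i k) i j"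
      by (simp add: basechange_apply algebra_simps)
    also have "\<dots> = (if i = j then 1 else 0)"
      unfolding basechange_apply using m[OF ij] m[OF ij(1) ab(2)] m[OF ab(1) ij(2)] m[OF ab(1,2)] ab(3)
      by auto
    finally show "(\<Sum>k\<in>I. of_int (basechange a b t D i k) * basechange a b (of_int t) S k j)
       + (\<Sum>k\<in>I. basechange a b (of_int t) S i k * of_int (basechange a b t D k j)) = (if i = j then 1 else 0)" .
  qed
qed

lemma lat_hom_basechange:
  fixes S :: "'i \<Rightarrow> 'i \<Rightarrow> 'k::field_char_0"
  assumes c: "contracted I dg D S" and ab: "a \<in> I" "b \<in> I" "a \<noteq> b" "dg a = dg b"
    and h: "lat_hom I dg (basechange a b t D) s n"
  shows "lat_hom I dg D s n"
proof -
  note D = contractedD[OF c]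
  let ?D = "basechange a b t D"
  define \<phi> where "\<phi> x = (\<lambda>j. x j - (if j = a then t * x b else 0))" for x :: "'i \<Rightarrow> int"
  define \<psi> where "\<psi> x = (\<lambda>j. x j + (if j = a then t * x b else 0))" for x :: "'i \<Rightarrow> int"
  have inv: "\<phi> (\<psi> x) = x" "\<psi> (\<phi> x) = x" for x using ab(3) by (auto simp: \<phi>_def \<psi>_def fun_eq_iff)
  have ch: "\<phi> x \<in> lat_ch I dg s" "\<psi> x \<in> lat_ch I dg s" if "x \<in> lat_ch I dg s" for x s
  proof -
    have x: "i \<in> I \<and> dg i = s" if "x i \<noteq> 0" for i using that \<open>x \<in> lat_ch I dg s\<close> by (auto simp: lat_ch_def)
    have "i \<in> I \<and> dg i = s" if "\<phi> x i \<noteq> 0 \<or> \<psi> x i \<noteq> 0" for i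
    proof -
      have "x i \<noteq> 0 \<or> (i = a \<and> x b \<noteq> 0)"
      proof (rule ccontr)
        assume "\<not> ?thesis"
        then have "x i = 0" "i = a \<longrightarrow> x b = 0" by simp_all
        then have "\<phi> x i = 0" "\<psi> x i = 0" by (simp_all add: \<phi>_def \<psi>_def)
        with that show False by simp
      qed
      then show ?thesis
      proof
        assume "x i \<noteq> 0" then show ?thesis by (rule x)
      next
        assume i: "i = a \<and> x b \<noteq> 0"
        then have "dg b = s" using x by blast
        then show ?thesis using i ab(1,4) by simp
      qed
    qed
    then show "\<phi> x \<in> lat_ch I dg s" "\<psi> x \<in> lat_ch I dg s" unfolding lat_ch_def by blast+
  qed
  have bd: "lat_bd I ?D (\<phi> x) = \<phi> (lat_bd I D x)" for x
  proof
    fix j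
    have "mprod I (colop a b t (\<lambda>i j. x j)) ?D j j = colop a b t (mprod I (\<lambda>i j. x j) D) j j"
      by (simp add: mprod_basechange D(1) ab)
    then show "lat_bd I ?D (\<phi> x) j = \<phi> (lat_bd I D x) j"
      using ab by (auto simp: lat_bd_def \<phi>_def mprod_def colop_def)
  qed
  have lin: "\<phi> (\<lambda>j. x j - y j) = (\<lambda>j. \<phi> x j - \<phi> y j)" for x y by (auto simp: \<phi>_def algebra_simps)
  have z: "(\<forall>j. \<phi> x j = 0) \<longleftrightarrow> (\<forall>j. x j = 0)" for x
  proof
    assume "\<forall>j. \<phi> x j = 0"
    then have "\<phi> x = (\<lambda>_. 0)" by auto
    then have "\<psi> (\<lambda>_. 0) = x" using inv(2)[of x] by simp
    then show "\<forall>j. x j = 0" by (auto simp: \<psi>_def)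
  qed (auto simp: \<phi>_def)
  have cyc: "\<phi> x \<in> lat_cyc I dg ?D s \<longleftrightarrow> x \<in> lat_cyc I dg D s" for x
    unfolding lat_cyc_def using ch[of x s] ch[of "\<phi> x" s] by (auto simp: bd z inv)
  have eq: "lat_eq I dg ?D s (\<phi> x) (\<phi> y) \<longleftrightarrow> lat_eq I dg D s x y" for x y
  proof
    assume "lat_eq I dg ?D s (\<phi> x) (\<phi> y)"
    then obtain w where w: "w \<in> lat_ch I dg (Suc s)" "\<And>j. \<phi> x j - \<phi> y j = lat_bd I ?D w j"
      by (auto simp: lat_eq_def)
    have "\<phi> (\<lambda>j. x j - y j) = \<phi> (lat_bd I D (\<psi> w))" unfolding lin bd[symmetric] inv using w(2) by auto
    then have "(\<lambda>j. x j - y j) = lat_bd I D (\<psi> w)" by (metis inv(2))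
    then show "lat_eq I dg D s x y" unfolding lat_eq_def using ch(2)[OF w(1)] by (auto simp: fun_eq_iff)
  next
    assume "lat_eq I dg D s x y"
    then obtain w where w: "w \<in> lat_ch I dg (Suc s)" "(\<lambda>j. x j - y j) = lat_bd I D w"
      by (auto simp: lat_eq_def fun_eq_iff)
    then have "(\<lambda>j. \<phi> x j - \<phi> y j) = lat_bd I ?D (\<phi> w)" by (simp add: bd lin[symmetric])
    then show "lat_eq I dg ?D s (\<phi> x) (\<phi> y)" unfolding lat_eq_def using ch(1)[OF w(1)] by (auto simp: fun_eq_iff)
  qed
  have refl: "lat_eq I dg ?D s x x" for x
    unfolding lat_eq_def by (intro bexI[of _ "\<lambda>_. 0"]) (auto simp: lat_bd_def lat_ch_def)
  show ?thesis unfolding lat_hom_def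
  proof (rule transversal_card_transfer[OF h[unfolded lat_hom_def], where \<rho> = "\<lambda>x y. x = \<phi> y"])
    fix x assume "x \<in> lat_cyc I dg ?D s"
    then show "\<exists>y\<in>lat_cyc I dg D s. x = \<phi> y" using cyc[of "\<psi> x"] inv by (intro bexI[of _ "\<psi> x"]) auto
  qed (auto simp: refl eq cyc)
qed

lemma torsion_formula_basechange:
  fixes S :: "'i \<Rightarrow> 'i \<Rightarrow> 'k::field_char_0"
  assumes c: "contracted I dg D S" and ab: "a \<in> I" "b \<in> I" "a \<noteq> b" "dg a = dg b"
    and f: "torsion_formula I dg (basechange a b t D) (basechange a b (of_int t) S)"
  shows "torsion_formula I dg D S"
proof -
  let ?T = "\<lambda>i j. of_int (D i j) + S i j"
  let ?T' = "\<lambda>i j. of_int (basechange a b t D i j) + basechange a b (of_int t) S i j"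
  have T': "?T' i j = ?T i j - (if j = a then of_int t * ?T i b else 0)
     + (if i = b then of_int t * (?T a j - (if j = a then of_int t * ?T a b else 0)) else 0)" for i j
    by (simp add: basechange_apply algebra_simps)
  have det: "ldet xs ys ?T' = ldet xs ys ?T"
    if xy: "distinct xs" "distinct ys" "set xs = {i\<in>I. odd (dg i)}" "set ys = {i\<in>I. even (dg i)}" "length xs = length ys" for xs ys
  proof (cases "odd (dg a)")
    case True
    then have "a \<in> set xs" "b \<in> set xs" "a \<notin> set ys" using xy ab by auto
    then show ?thesis using T' by (intro ldet_add_row[OF xy(1) _ _ ab(3) _ xy(5), where t = "of_int t"]) auto
  next
    case False
    then have n: "a \<in> set ys" "b \<in> set ys" "b \<notin> set xs" using xy ab by auto
    have "ldet ys xs (\<lambda>i j. ?T' j i) = ldet ys xs (\<lambda>i j. ?T j i)"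
      by (rule ldet_add_row[OF xy(2) n(2,1) ab(3)[symmetric] _ xy(5)[symmetric], where t = "- of_int t"])
        (use n T' in auto)
    then show ?thesis by (simp only: ldet_transpose[OF xy(5)])
  qed
  obtain h where h: "\<And>s. lat_hom I dg (basechange a b t D) s (h s)" "\<And>s. h s > 0"
    "\<And>xs ys. distinct xs \<Longrightarrow> distinct ys \<Longrightarrow> set xs = {i\<in>I. odd (dg i)} \<Longrightarrow> set ys = {i\<in>I. even (dg i)} \<Longrightarrow>
        length xs = length ys \<and>
        (\<forall>K. (\<forall>i\<in>I. dg i < K) \<longrightarrow> (\<forall>s\<ge>K. h s = 1) \<and>
          ldet xs ys ?T' \<in> {altprod h K, - altprod h K})"
    using f unfolding torsion_formula_def by blast
  show ?thesis unfolding torsion_formula_def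
  proof (intro exI[of _ h] conjI allI impI)
    fix s show "lat_hom I dg D s (h s)" using h(1) by (rule lat_hom_basechange[OF c ab])
    show "h s > 0" by (rule h(2))
  next
    fix xs ys
    assume xy: "distinct xs" "distinct ys" "set xs = {i\<in>I. odd (dg i)}" "set ys = {i\<in>I. even (dg i)}"
    note H = h(3)[OF xy]
    show "length xs = length ys" using H by blast
    fix K assume K: "\<forall>i\<in>I. dg i < K"
    show "h s = 1" if "K \<le> s" for s using H K that by blast
    show "ldet xs ys ?T \<in> {altprod h K, - altprod h K}"
      using H K det[OF xy] by auto
  qed
qed

lemma lat_cyc_top:
  fixes S :: "'i \<Rightarrow> 'i \<Rightarrow> 'k::field_char_0"
  assumes c: "contracted I dg D S" and d: "\<And>i. i \<in> I \<Longrightarrow> dg i \<le> d" and dn: "d \<le> s"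
  shows "lat_cyc I dg D s = {\<lambda>_. 0}"
proof -
  note D = contractedD[OF c]
  have "x k = 0" if x: "x \<in> lat_cyc I dg D s" for x k
  proof (cases "k \<in> I")
    case k: True
    have supp: "x i = 0" if "i \<in> I" "dg i \<noteq> s" for i using x that by (auto simp: lat_cyc_def lat_ch_def)
    have Sz: "of_int (x i) * S i j = 0" if "i \<in> I" "j \<in> I" for i j
      using supp[of i] D(3)[of i j] d[of j] dn that by (cases "dg i = s") auto
    have "(\<Sum>i\<in>I. of_int (x i) * (if i = k then 1 else 0)) = (of_int (x k) :: 'k)"
    proof -
      have "(\<Sum>i\<in>I. of_int (x i) * (if i = k then 1 else 0)) = (\<Sum>i\<in>I. if i = k then of_int (x k) else (0 :: 'k))"
        by (intro sum.cong) auto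
      then show ?thesis using k D(1) by simp
    qed
    moreover have "(\<Sum>i\<in>I. of_int (x i) * (if i = k then 1 else 0))
      = (\<Sum>i\<in>I. of_int (x i) * ((\<Sum>j\<in>I. of_int (D i j) * S j k) + (\<Sum>j\<in>I. S i j * of_int (D j k))))"
      using D(5) k by (intro sum.cong) auto
    also have "\<dots> = (\<Sum>i\<in>I. \<Sum>j\<in>I. of_int (x i * D i j) * S j k)"
    proof (rule sum.cong[OF refl])
      fix i assume i: "i \<in> I"
      have "of_int (x i) * (\<Sum>j\<in>I. S i j * of_int (D j k)) = (\<Sum>j\<in>I. of_int (x i) * S i j * of_int (D j k))"
        by (simp add: sum_distrib_left mult.assoc)
      also have "\<dots> = 0" by (rule sum.neutral, rule ballI) (simp only: Sz[OF i] mult_zero_left)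
      finally show "of_int (x i) * ((\<Sum>j\<in>I. of_int (D i j) * S j k) + (\<Sum>j\<in>I. S i j * of_int (D j k)))
        = (\<Sum>j\<in>I. of_int (x i * D i j) * S j k)"
        by (simp add: distrib_left sum_distrib_left mult.assoc)
    qed
    also have "\<dots> = (\<Sum>j\<in>I. of_int (\<Sum>i\<in>I. x i * D i j) * S j k)"
      by (subst sum.swap) (simp add: sum_distrib_right)
    also have "\<dots> = 0"
    proof (rule sum.neutral, rule ballI)
      fix j assume "j \<in> I"
      then have "(\<Sum>i\<in>I. x i * D i j) = 0" using x by (auto simp: lat_cyc_def lat_bd_def dest!: spec[of _ j])
      then show "of_int (\<Sum>i\<in>I. x i * D i j) * S j k = 0" by simp
    qed
    ultimately show ?thesis by simp
  qed (use x in \<open>auto simp: lat_cyc_def lat_ch_def\<close>)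
  moreover have "(\<lambda>_. 0) \<in> lat_cyc I dg D s" by (auto simp: lat_cyc_def lat_ch_def lat_bd_def)
  ultimately show ?thesis by (auto simp: fun_eq_iff)
qed

lemma lat_eq_refl: "lat_eq I dg D s x x"
  unfolding lat_eq_def by (intro bexI[of _ "\<lambda>_. 0"]) (auto simp: lat_bd_def lat_ch_def)

text \<open>
  A basis element \<open>e\<close> of top degree with boundary \<open>g a\<close>.  The pair \<open>e, a\<close> spans a subcomplex with
  homology \<open>Z/g\<close> in the degree of \<open>a\<close>, and the rest of the basis spans the quotient complex.
\<close>

locale lattice_removal =
  fixes I :: "'i set" and dg :: "'i \<Rightarrow> nat" and D :: "'i \<Rightarrow> 'i \<Rightarrow> int" and S :: "'i \<Rightarrow> 'i \<Rightarrow> 'k::field_char_0"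
    and d :: nat and e a :: 'i
  assumes c: "contracted I dg D S" and e: "e \<in> I" "dg e = d" and top: "\<And>i. i \<in> I \<Longrightarrow> dg i \<le> d"
    and a: "a \<in> I" "d = Suc (dg a)" "D e a \<noteq> 0" and only: "\<And>j. j \<in> I \<Longrightarrow> j \<noteq> a \<Longrightarrow> D e j = 0"
begin

abbreviation "g \<equiv> D e a"
abbreviation "I' \<equiv> I - {e, a}"

lemma ea: "e \<noteq> a" using e a by auto

lemma fin: "finite I" by (rule contractedD(1)[OF c])

lemma Die: "i \<in> I \<Longrightarrow> D i e = 0"
  using top[of i] e by (intro contractedD(2)[OF c]) auto

lemma Sek: "k \<in> I \<Longrightarrow> S e k = 0"
  using top[of k] e by (intro contractedD(3)[OF c]) auto

lemma Dak: "k \<in> I \<Longrightarrow> D a k = 0"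
proof -
  assume k: "k \<in> I"
  have "(\<Sum>j\<in>I. D e j * D j k) = (\<Sum>j\<in>{a}. D e j * D j k)"
    using a fin only by (intro sum.mono_neutral_right) auto
  then show ?thesis using contractedD(4)[OF c e(1) k] a by simp
qed

lemma Sak: "k \<in> I \<Longrightarrow> S a k = (if k = e then 1 / of_int g else 0)"
proof -
  assume k: "k \<in> I"
  have "(\<Sum>j\<in>I. of_int (D e j) * S j k) = (\<Sum>j\<in>{a}. of_int (D e j) * S j k)"
    using a fin only by (intro sum.mono_neutral_right) auto
  moreover have "(\<Sum>j\<in>I. S e j * of_int (D j k)) = 0" using Sek by (intro sum.neutral) auto
  ultimately have "of_int g * S a k = (if e = k then 1 else 0)" using contractedD(5)[OF c e(1) k] by simp
  then show ?thesis using a by (auto simp: field_simps split: if_splits)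
qed

lemma sum_I: "sum f I = f e + f a + sum f I'" for f :: "'i \<Rightarrow> 'r::comm_ring_1"
proof -
  have "sum f I = f e + sum f (I - {e})" using e fin by (simp add: sum.remove)
  also have "sum f (I - {e}) = f a + sum f (I - {e} - {a})" using a ea fin by (intro sum.remove) auto
  also have "I - {e} - {a} = I'" by auto
  finally show ?thesis by (simp add: add.assoc)
qed

lemma contracted': "contracted I' dg D S"
  unfolding contracted_def
proof (intro conjI ballI impI)
  fix i k assume ik: "i \<in> I'" "k \<in> I'"
  then have ik': "i \<in> I" "k \<in> I" "i \<noteq> e" "i \<noteq> a" "k \<noteq> e" "k \<noteq> a" by auto
  show "(\<Sum>j\<in>I'. D i j * D j k) = 0"
    using contractedD(4)[OF c ik'(1,2)] ik' by (simp add: sum_I Die Dak)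
  show "(\<Sum>j\<in>I'. of_int (D i j) * S j k) + (\<Sum>j\<in>I'. S i j * of_int (D j k)) = (if i = k then 1 else 0)"
    using contractedD(5)[OF c ik'(1,2)] ik' only[of k] by (simp add: sum_I Die Dak Sak)
qed (use contractedD(2,3)[OF c] fin in blast)+

lemma ch_restrict: "x \<in> lat_ch I dg s \<Longrightarrow> x(e := 0, a := 0) \<in> lat_ch I' dg s"
  by (auto simp: lat_ch_def)

lemma ch_mono: "x \<in> lat_ch I' dg s \<Longrightarrow> x \<in> lat_ch I dg s"
  by (auto simp: lat_ch_def)

lemma ch'_zero: "x \<in> lat_ch I' dg s \<Longrightarrow> x e = 0 \<and> x a = 0"
  by (auto simp: lat_ch_def)

text \<open>The boundary in terms of the boundary of the smaller complex.\<close>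

lemma bd_e: "lat_bd I D x e = 0"
  using Die by (simp add: lat_bd_def)

lemma bd_rest: "j \<in> I' \<Longrightarrow> lat_bd I D x j = lat_bd I' D x j"
  using only[of j] by (auto simp: lat_bd_def sum_I Dak)

lemma bd'_upd: "lat_bd I' D (x(e := u, a := v)) = lat_bd I' D x"
  by (intro ext) (auto simp: lat_bd_def intro!: sum.cong)

lemma bd_a: "lat_bd I D x a = x e * g + (\<Sum>i\<in>I'. x i * D i a)"
  using a by (simp add: lat_bd_def sum_I Dak)

lemma bd_a_zero: "x \<in> lat_ch I dg s \<Longrightarrow> s \<noteq> d \<Longrightarrow> lat_bd I D x a = 0"
proof -
  assume x: "x \<in> lat_ch I dg s" "s \<noteq> d"
  have "x i * D i a = 0" if "i \<in> I" for i
  proof (cases "x i = 0")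
    case False
    then have "dg i = s" using x by (auto simp: lat_ch_def)
    then have "D i a = 0" using that a x by (intro contractedD(2)[OF c]) auto
    then show ?thesis by simp
  qed simp
  then have "(\<Sum>i\<in>I. x i * D i a) = 0" by (intro sum.neutral) blast
  then show ?thesis by (simp add: lat_bd_def)
qed

lemma bd'_out: "j \<notin> I' \<Longrightarrow> lat_bd I' D x j = 0"
  by (simp only: lat_bd_def if_False)

lemma bd_eq: "x \<in> lat_ch I dg s \<Longrightarrow> s \<noteq> d \<Longrightarrow> lat_bd I D x = lat_bd I' D (x(e := 0, a := 0))"
proof
  fix j assume x: "x \<in> lat_ch I dg s" "s \<noteq> d"
  show "lat_bd I D x j = lat_bd I' D (x(e := 0, a := 0)) j"
  proof (cases "j \<in> I'")
    case True then show ?thesis by (simp add: bd_rest bd'_upd)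
  next
    case False
    have "lat_bd I D x j = 0"
    proof (cases "j \<in> I")
      case True
      then have "j = e \<or> j = a" using False by blast
      then show ?thesis using bd_a_zero[OF x] bd_e by blast
    qed (simp add: lat_bd_def)
    then show ?thesis by (simp only: bd'_out[OF False])
  qed
qed

lemma ch_eq: "s \<noteq> d \<Longrightarrow> s \<noteq> dg a \<Longrightarrow> lat_ch I dg s = lat_ch I' dg s"
  using e by (auto simp: lat_ch_def)

lemma cyc_eq: "s \<noteq> d \<Longrightarrow> s \<noteq> dg a \<Longrightarrow> lat_cyc I dg D s = lat_cyc I' dg D s"
proof -
  assume n: "s \<noteq> d" "s \<noteq> dg a"
  have "lat_bd I D x = lat_bd I' D x" if "x \<in> lat_ch I' dg s" for x
    using bd_eq[OF ch_mono[OF that] n(1)] by (simp add: bd'_upd)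
  then show ?thesis unfolding lat_cyc_def ch_eq[OF n] by auto
qed

lemma eq_eq:
  assumes n: "s \<noteq> d" "s \<noteq> dg a"
  shows "lat_eq I dg D s x y \<longleftrightarrow> lat_eq I' dg D s x y"
proof -
  have sn: "Suc s \<noteq> d" using n a by simp
  show ?thesis
  proof
    assume "lat_eq I dg D s x y"
    then obtain w where w: "w \<in> lat_ch I dg (Suc s)" "\<forall>j. x j - y j = lat_bd I D w j" by (auto simp: lat_eq_def)
    then show "lat_eq I' dg D s x y" unfolding lat_eq_def bd_eq[OF w(1) sn]
      using ch_restrict[OF w(1)] by blast
  next
    assume "lat_eq I' dg D s x y"
    then obtain w where w: "w \<in> lat_ch I' dg (Suc s)" "\<forall>j. x j - y j = lat_bd I' D w j" by (auto simp: lat_eq_def)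
    have "lat_bd I D w = lat_bd I' D w" using bd_eq[OF ch_mono[OF w(1)] sn] by (simp add: bd'_upd)
    then show "lat_eq I dg D s x y" unfolding lat_eq_def using w(2)
      by (intro bexI[OF _ ch_mono[OF w(1)]]) simp
  qed
qed

lemma cyc_top: "lat_cyc I dg D d = {\<lambda>_. 0}" "lat_cyc I' dg D d = {\<lambda>_. 0}"
  by (rule lat_cyc_top[OF c top order_refl], simp) (rule lat_cyc_top[OF contracted' _ order_refl], use top in auto)

text \<open>
  A cycle of degree \<open>dg a\<close> is a cycle of the smaller complex plus a multiple of \<open>a\<close>, and that multiple
  matters modulo \<open>g\<close>.
\<close>

lemma lat_hom_da:
  assumes h: "lat_hom I' dg D (dg a) n"
  shows "lat_hom I dg D (dg a) (nat \<bar>g\<bar> * n)"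
proof -
  have da: "dg a \<noteq> d" using a by simp
  obtain X where X: "X \<subseteq> lat_cyc I' dg D (dg a)" "finite X" "card X = n"
    and uX: "\<forall>z\<in>lat_cyc I' dg D (dg a). \<exists>!x. x \<in> X \<and> lat_eq I' dg D (dg a) z x"
    using h unfolding lat_hom_def transversal_card_def by (elim exE conjE) (rule that)
  have Xz: "x e = 0" "x a = 0" if "x \<in> X" for x using that X(1) ch'_zero by (auto simp: lat_cyc_def)
  define F where "F = (\<lambda>(x :: 'i \<Rightarrow> int, k :: int). x(a := k))"
  define Y where "Y = F ` (X \<times> {0..<\<bar>g\<bar>})"
  have injF: "inj_on F (X \<times> {0..<\<bar>g\<bar>})"
  proof (rule inj_onI, clarify)
    fix x k y l assume xy: "x \<in> X" "y \<in> X" "F (x, k) = F (y, l)"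
    then have E: "x(a := k) = y(a := l)" by (simp add: F_def)
    have "x j = y j" for j using fun_cong[OF E, of j] Xz(2)[OF xy(1)] Xz(2)[OF xy(2)] by (cases "j = a") auto
    then show "x = y \<and> k = l" using fun_cong[OF E, of a] by auto
  qed
  have Yc: "card Y = nat \<bar>g\<bar> * n" unfolding Y_def card_image[OF injF] using X by (simp add: card_cartesian_product)
  have chup: "x(a := k) \<in> lat_ch I dg (dg a)" if "x \<in> lat_ch I dg (dg a)" for x k
    using that a by (auto simp: lat_ch_def)
  have bdup: "lat_bd I D (x(a := k)) = lat_bd I' D x" if "x \<in> lat_ch I dg (dg a)" for x k
    using bd_eq[OF chup[OF that] da, of k] bd'_upd[of x 0 0] that e da by (simp add: bd'_upd fun_upd_twist[of e a] ea)
  have cycup: "x(a := k) \<in> lat_cyc I dg D (dg a)" if "x \<in> lat_cyc I' dg D (dg a)" for x k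
    using that ch_mono chup bdup by (auto simp: lat_cyc_def)
  have ex1: "\<exists>!y. y \<in> Y \<and> lat_eq I dg D (dg a) z y" if z: "z \<in> lat_cyc I dg D (dg a)" for z
  proof -
    have zch: "z \<in> lat_ch I dg (dg a)" "\<And>j. lat_bd I D z j = 0" using z by (auto simp: lat_cyc_def)
    have ze: "z e = 0" using zch(1) e da by (auto simp: lat_ch_def)
    define z' where "z' = z(e := 0, a := 0)"
    have z': "z' \<in> lat_cyc I' dg D (dg a)" unfolding z'_def lat_cyc_def
      using ch_restrict[OF zch(1)] zch(2) unfolding bd_eq[OF zch(1) da] by simp
    obtain x where x: "x \<in> X" "lat_eq I' dg D (dg a) z' x"
      and xu: "\<And>y. y \<in> X \<Longrightarrow> lat_eq I' dg D (dg a) z' y \<Longrightarrow> y = x"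
      using bspec[OF uX z'] by (elim ex1E) blast
    obtain w where w: "w \<in> lat_ch I' dg d" "\<And>j. z' j - x j = lat_bd I' D w j"
      using x(2) a(2) by (auto simp: lat_eq_def)
    define m where "m = z a - (\<Sum>i\<in>I'. w i * D i a)"
    define k q where "k = m mod \<bar>g\<bar>" and "q = (if g > 0 then m div \<bar>g\<bar> else - (m div \<bar>g\<bar>))"
    have mk: "m - k = q * g" proof -
      have "m - k = \<bar>g\<bar> * (m div \<bar>g\<bar>)" by (simp add: k_def minus_mod_eq_mult_div)
      also have "\<dots> = q * g" unfolding q_def by (cases "g > 0") auto
      finally show ?thesis .
    qed
    have kr: "k \<in> {0..<\<bar>g\<bar>}" using a by (simp add: k_def)
    have wq: "w(e := q) \<in> lat_ch I dg (Suc (dg a))" using ch_mono[OF w(1)] e a by (auto simp: lat_ch_def)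
    have "z j - (x(a := k)) j = lat_bd I D (w(e := q)) j" for j
    proof -
      consider "j = a" | "j = e" | "j \<in> I'" | "j \<notin> I" by blast
      then show ?thesis
      proof cases
        case 1
        have "(\<Sum>i\<in>I'. (w(e := q)) i * D i a) = (\<Sum>i\<in>I'. w i * D i a)" by (intro sum.cong) auto
        then show ?thesis using 1 mk ea by (simp add: bd_a m_def)
      next
        case 2 then show ?thesis using ea ze Xz[OF x(1)] by (simp add: bd_e)
      next
        case 3
        have "lat_bd I' D (w(e := q)) j = lat_bd I' D w j"
        proof -
          have "w(e := q, a := 0) = w(e := q)" using ch'_zero[OF w(1)] ea by (auto simp: fun_eq_iff)
          then show ?thesis using bd'_upd[of w q 0] by simp
        qed
        then show ?thesis using 3 w(2)[of j] by (simp add: bd_rest z'_def)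
      next
        case 4
        then have "z j = 0" "x j = 0" using zch(1) X(1) x(1) by (auto simp: lat_ch_def lat_cyc_def)
        then show ?thesis using 4 a by (auto simp: lat_bd_def)
      qed
    qed
    then have E: "lat_eq I dg D (dg a) z (x(a := k))" unfolding lat_eq_def using wq by blast
    have uniq: "y' = x(a := k)" if y': "y' \<in> Y" "lat_eq I dg D (dg a) z y'" for y'
    proof -
      obtain y l where y: "y \<in> X" "l \<in> {0..<\<bar>g\<bar>}" "y' = y(a := l)" using y'(1) by (auto simp: Y_def F_def)
      obtain v where v: "v \<in> lat_ch I dg d" "\<And>j. z j - y' j = lat_bd I D v j"
        using y'(2) a(2) by (auto simp: lat_eq_def)
      have "z' j - y j = lat_bd I' D (v(e := 0, a := 0)) j" for j
      proof (cases "j \<in> I'")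
        case True
        then show ?thesis using v(2)[of j] y by (auto simp: bd'_upd bd_rest z'_def)
      next
        case False
        then have "z' j = 0" "y j = 0" using z' X(1) y(1) by (auto simp: lat_cyc_def lat_ch_def)
        then show ?thesis using False by (simp add: bd'_out)
      qed
      then have "lat_eq I' dg D (dg a) z' y" unfolding lat_eq_def using ch_restrict[OF v(1)] a(2) by auto
      then have yx: "y = x" using xu y by blast
      define u where "u = (\<lambda>j. v j - (w(e := q)) j)"
      have uch: "u \<in> lat_ch I dg d" unfolding lat_ch_def
      proof (intro CollectI allI impI)
        fix j assume "u j \<noteq> 0"
        then have "v j \<noteq> 0 \<or> (w(e := q)) j \<noteq> 0" unfolding u_def by (rule_tac ccontr) simp
        then show "j \<in> I \<and> dg j = d" using v(1) wq unfolding lat_ch_def a(2) by blast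
      qed
      have ubd: "lat_bd I D u j = (x(a := k)) j - (y(a := l)) j" for j
      proof -
        have "lat_bd I D u j = lat_bd I D v j - lat_bd I D (w(e := q)) j"
          unfolding lat_bd_def u_def by (simp add: left_diff_distrib sum_subtractf)
        then show ?thesis using v(2)[of j] \<open>\<And>j. z j - (x(a := k)) j = lat_bd I D (w(e := q)) j\<close>[of j] y(3) by simp
      qed
      have "u(e := 0, a := 0) \<in> lat_cyc I' dg D d"
        unfolding lat_cyc_def
      proof (intro CollectI conjI allI ch_restrict[OF uch])
        fix j show "lat_bd I' D (u(e := 0, a := 0)) j = 0"
        proof (cases "j \<in> I'")
          case True
          then show ?thesis using ubd[of j] yx by (simp add: bd'_upd bd_rest[symmetric])
        qed (rule bd'_out)
      qed
      then have uz: "u(e := 0, a := 0) = (\<lambda>_. 0)" using cyc_top(2) by simp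
      have u0: "u i = 0" if "i \<in> I'" for i using that fun_cong[OF uz, of i] by auto
      have "k - l = u e * g" using ubd[of a] u0 by (simp add: bd_a)
      then have "\<bar>g\<bar> dvd k - l" by simp
      moreover have "\<bar>k - l\<bar> < \<bar>g\<bar>" using kr y(2) by auto
      ultimately have "k = l" using zdvd_imp_le[of "\<bar>g\<bar>" "\<bar>k - l\<bar>"] by fastforce
      then show ?thesis using yx y by simp
    qed
    have "x(a := k) \<in> Y" unfolding Y_def F_def using x(1) kr by (intro image_eqI[of _ _ "(x, k)"]) auto
    then show ?thesis using E uniq by (intro ex1I[of _ "x(a := k)"]) blast+
  qed
  have YZ: "Y \<subseteq> lat_cyc I dg D (dg a)" unfolding Y_def F_def using X(1) cycup by auto
  have Yf: "finite Y" unfolding Y_def using X(2) by simp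
  show ?thesis unfolding lat_hom_def transversal_card_def
    by (intro exI[of _ Y] conjI ballI YZ Yf Yc) (rule ex1)
qed

text \<open>
  In \<open>D + S\<close> the row of \<open>e\<close> has the single entry \<open>g\<close> and the row of \<open>a\<close> the single entry \<open>1/g\<close>.  One of the
  two rows belongs to the odd part, so the determinant changes by the factor \<open>g\<close> or \<open>1/g\<close>, depending on
  the parity of \<open>dg a\<close>.
\<close>

lemma torsion_formula_removal:
  assumes f: "torsion_formula I' dg D S"
  shows "torsion_formula I dg D S"
proof -
  let ?T = "\<lambda>i j. of_int (D i j) + S i j"
  obtain h where h: "\<And>s. lat_hom I' dg D s (h s)" "\<And>s. h s > 0"
    and H: "\<And>xs ys. distinct xs \<Longrightarrow> distinct ys \<Longrightarrow> set xs = {i\<in>I'. odd (dg i)} \<Longrightarrow> set ys = {i\<in>I'. even (dg i)} \<Longrightarrow>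
        length xs = length ys \<and>
        (\<forall>K. (\<forall>i\<in>I'. dg i < K) \<longrightarrow> (\<forall>s\<ge>K. h s = 1) \<and>
          ldet xs ys ?T \<in> {altprod h K, - altprod h K})"
    using f unfolding torsion_formula_def by blast
  define k where "k = h(dg a := nat \<bar>g\<bar> * h (dg a))"
  have k: "lat_hom I dg D s (k s)" for s
  proof -
    consider "s = dg a" | "s = d" | "s \<noteq> d" "s \<noteq> dg a" by blast
    then show ?thesis
    proof cases
      case 1 then show ?thesis using lat_hom_da[OF h(1)] by (simp add: k_def)
    next
      case 2
      have "transversal_card {\<lambda>_. 0} (lat_eq I' dg D d) (h d)" using h(1)[of d] by (simp add: lat_hom_def cyc_top)
      then have "transversal_card {\<lambda>_. 0} (lat_eq I dg D d) (h d)"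
        by (rule transversal_card_transfer[where \<rho> = "(=)"]) (auto simp: lat_eq_refl)
      moreover have "k d = h d" using a(2) by (simp add: k_def)
      ultimately show ?thesis unfolding 2 lat_hom_def cyc_top(1) by simp
    next
      case 3
      then have "lat_eq I dg D s = lat_eq I' dg D s" by (intro ext) (rule eq_eq)
      then show ?thesis using 3 h(1)[of s] by (simp add: lat_hom_def cyc_eq k_def)
    qed
  qed
  have k0: "k s > 0" for s using h(2) a by (simp add: k_def)
  have prod: "(\<Prod>s<K. of_nat (k s) powi (-1) ^ s :: 'k)
      = (of_nat (nat \<bar>g\<bar>) :: 'k) powi (-1) ^ dg a * altprod h K"
    if K: "dg a < K" for K
  proof -
    have "(\<Prod>s<K. of_nat (k s) powi (-1) ^ s :: 'k) = of_nat (k (dg a)) powi (-1) ^ dg a * (\<Prod>s\<in>{..<K} - {dg a}. of_nat (k s) powi (-1) ^ s)"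
      using K by (intro prod.remove) auto
    also have "(\<Prod>s\<in>{..<K} - {dg a}. of_nat (k s) powi (-1) ^ s :: 'k) = (\<Prod>s\<in>{..<K} - {dg a}. of_nat (h s) powi (-1) ^ s)"
      by (intro prod.cong) (auto simp: k_def)
    also have "of_nat (k (dg a)) powi (-1) ^ dg a = (of_nat (nat \<bar>g\<bar>) :: 'k) powi (-1) ^ dg a * of_nat (h (dg a)) powi (-1) ^ dg a"
      by (simp add: k_def power_int_mult_distrib)
    finally show ?thesis using K by (subst (2) prod.remove[of _ "dg a"]) (auto simp: mult.assoc)
  qed
  have gabs: "of_nat (nat \<bar>g\<bar>) \<in> {of_int g, - of_int g :: 'k}"
  proof -
    have "(of_nat (nat \<bar>g\<bar>) :: 'k) = of_int \<bar>g\<bar>" by simp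
    also have "\<dots> \<in> {of_int g, - of_int g}" by (auto simp: abs_if)
    finally show ?thesis .
  qed
  show ?thesis unfolding torsion_formula_def
  proof (intro exI[of _ k] conjI allI impI k k0)
    fix xs ys :: "'i list"
    assume xy: "distinct xs" "distinct ys" "set xs = {i\<in>I. odd (dg i)}" "set ys = {i\<in>I. even (dg i)}"
    define e1 a1 where "e1 = (if odd d then e else a)" and "a1 = (if odd d then a else e)"
    have ea1: "e1 \<in> set xs" "a1 \<in> set ys" "{e1, a1} = {e, a}" using xy e a by (auto simp: e1_def a1_def)
    define xs' ys' where "xs' = remove1 e1 xs" and "ys' = remove1 a1 ys"
    have dist: "distinct xs'" "distinct ys'" using xy by (simp_all add: xs'_def ys'_def)
    have sets: "set xs' = {i\<in>I'. odd (dg i)}" "set ys' = {i\<in>I'. even (dg i)}"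
      unfolding xs'_def ys'_def set_remove1_eq[OF xy(1)] set_remove1_eq[OF xy(2)] xy(3,4)
      using e a by (auto simp: e1_def a1_def)
    note H' = H[OF dist sets]
    have len': "length xs' = length ys'" using H' by blast
    have len: "length xs = Suc (length xs')" "length ys = Suc (length ys')"
      unfolding xs'_def ys'_def using ea1 length_pos_if_in_set[OF ea1(1)] length_pos_if_in_set[OF ea1(2)]
      by (simp_all add: length_remove1)
    then show l: "length xs = length ys" using len' by simp
    fix K assume K: "\<forall>i\<in>I. dg i < K"
    then have K': "\<forall>i\<in>I'. dg i < K" by blast
    show "k s = 1" if "K \<le> s" for s
    proof -
      have "s \<noteq> dg a" using K a that by auto
      then show ?thesis using H' K' that by (auto simp: k_def)
    qed
    define t where "t = ?T e1 a1"
    have sx: "set (e1 # xs') = set xs" "set (a1 # ys') = set ys"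
      unfolding xs'_def ys'_def using ea1 xy by (auto simp: set_remove1_eq)
    have dx: "distinct (e1 # xs')" "distinct (a1 # ys')"
      unfolding xs'_def ys'_def using xy by (simp_all add: set_remove1_eq)
    have zero: "?T e1 j = 0" if "j \<in> set ys'" for j
      using that sets only[of j] unfolding e1_def by (auto simp: Sek Dak Sak)
    have ta: "t = (if odd d then of_int g else 1 / of_int g)"
      unfolding t_def e1_def a1_def using e a by (simp add: Sek Dak Sak)
    have "ldet xs ys ?T \<in> {ldet (e1 # xs') ys ?T, - ldet (e1 # xs') ys ?T}"
      by (rule ldet_permute_rows[OF xy(1) dx(1) sx(1)[symmetric]])
    moreover have "ldet (e1 # xs') ys ?T \<in> {ldet (e1 # xs') (a1 # ys') ?T, - ldet (e1 # xs') (a1 # ys') ?T}"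
      by (rule ldet_permute_cols[OF xy(2) dx(2) sx(2)[symmetric]]) (use len l in simp)
    moreover have "ldet (e1 # xs') (a1 # ys') ?T = t * ldet xs' ys' ?T"
      unfolding t_def by (rule ldet_Cons[where T = ?T and x = e1 and ys = ys' and xs = xs', OF zero len'])
    ultimately have 1: "ldet xs ys ?T \<in> {t * ldet xs' ys' ?T, - (t * ldet xs' ys' ?T)}" by auto
    let ?P = "altprod h K :: 'k"
    have 2: "ldet xs' ys' ?T \<in> {?P, - ?P}" using H' K' by blast
    let ?c = "(of_nat (nat \<bar>g\<bar>) :: 'k) powi (-1) ^ dg a"
    have 3: "t \<in> {?c, - ?c}"
    proof (cases "odd d")
      case True
      then have "even (dg a)" using a by simp
      then show ?thesis using gabs True by (auto simp: ta)
    next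
      case False
      then have "odd (dg a)" using a by simp
      then show ?thesis using gabs False by (auto simp: ta power_int_minus inverse_eq_divide)
    qed
    have "(\<Prod>s<K. of_nat (k s) powi (-1) ^ s) = ?c * ?P" using K a by (intro prod) auto
    with 1 2 3 show "ldet xs ys ?T \<in> {\<Prod>s<K. of_nat (k s) powi (-1) ^ s, - (\<Prod>s<K. of_nat (k s) powi (-1) ^ s)}"
      by auto
  qed
qed

end

text \<open>
  Induction on the size of the basis.  The Euclidean algorithm on the row of a basis element \<open>e\<close> of
  top degree, carried out by elementary changes of basis, leaves one entry, which is not zero because
  \<open>D S\<close> has diagonal entry \<open>1\<close> at \<open>e\<close>; then a pair can be removed.
\<close>

theorem contracted_torsion_formula:
  fixes S :: "'i \<Rightarrow> 'i \<Rightarrow> 'k::field_char_0"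
  assumes "contracted I dg D S"
  shows "torsion_formula I dg D S"
  using assms
proof (induction "card I" arbitrary: I D S rule: less_induct)
  case (less I D S)
  note c0 = less.prems and IH = less.hyps
  show ?case
  proof (cases "I = {}")
    case True
    have z: "lat_cyc {} dg D s = {\<lambda>_. 0}" for s by (auto simp: lat_cyc_def lat_ch_def lat_bd_def)
    have "lat_hom {} dg D s 1" for s
      unfolding lat_hom_def transversal_card_def z
      by (intro exI[of _ "{\<lambda>_. 0}"]) (auto simp: lat_eq_refl)
    then show ?thesis unfolding torsion_formula_def True
      by (intro exI[of _ "\<lambda>_. 1"]) (auto simp: ldet_def)
  next
    case False
    have fin: "finite I" by (rule contractedD(1)[OF c0])
    define d where "d = Max (dg ` I)"
    have "Max (dg ` I) \<in> dg ` I" using fin False by (intro Max_in) auto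
    then obtain e where e: "e \<in> I" "dg e = d" unfolding d_def by (metis imageE)
    have top: "dg i \<le> d" if "i \<in> I" for i unfolding d_def using fin that by simp
    have "torsion_formula I dg D S" if "contracted I dg D S" "(\<Sum>j\<in>I. nat \<bar>D e j\<bar>) = n"
      for D and S :: "'i \<Rightarrow> 'i \<Rightarrow> 'k" and n
      using that
    proof (induction n arbitrary: D S rule: less_induct)
      case (less n D S)
      note c = less.prems(1)
      have Sek: "S e k = 0" if "k \<in> I" for k using top[of k] e that by (intro contractedD(3)[OF c]) auto
      have "\<exists>a\<in>I. D e a \<noteq> 0"
      proof (rule ccontr)
        assume "\<not> ?thesis"
        then have "(\<Sum>j\<in>I. of_int (D e j) * S j e) = 0" by (intro sum.neutral) auto
        moreover have "(\<Sum>j\<in>I. S e j * of_int (D j e)) = 0" using Sek by (intro sum.neutral) auto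
        ultimately show False using contractedD(5)[OF c e(1) e(1)] by simp
      qed
      then obtain a0 where a0: "a0 \<in> I" "D e a0 \<noteq> 0" by blast
      have da: "d = Suc (dg a)" if "a \<in> I" "D e a \<noteq> 0" for a
        using contractedD(2)[OF c e(1) that(1)] that e by auto
      show ?case
      proof (cases "\<forall>j\<in>I. j \<noteq> a0 \<longrightarrow> D e j = 0")
        case True
        interpret lattice_removal I dg D S d e a0
          by unfold_locales (use c e top a0 da True in auto)
        have "card (I - {e, a0}) < card I" using fin e by (intro psubset_card_mono) auto
        then have "torsion_formula (I - {e, a0}) dg D S" by (rule IH) (rule contracted')
        then show ?thesis by (rule torsion_formula_removal)
      next
        case False
        then obtain b0 where b0: "b0 \<in> I" "b0 \<noteq> a0" "D e b0 \<noteq> 0" by blast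
        define a b where "a = (if \<bar>D e b0\<bar> \<le> \<bar>D e a0\<bar> then a0 else b0)" and "b = (if \<bar>D e b0\<bar> \<le> \<bar>D e a0\<bar> then b0 else a0)"
        have ab: "a \<in> I" "b \<in> I" "a \<noteq> b" "D e a \<noteq> 0" "D e b \<noteq> 0" "\<bar>D e b\<bar> \<le> \<bar>D e a\<bar>"
          using a0 b0 by (auto simp: a_def b_def)
        have dab: "dg a = dg b" "e \<noteq> b" using da[OF ab(1,4)] da[OF ab(2,5)] e by auto
        define t where "t = sgn (D e a) * sgn (D e b)"
        let ?D = "basechange a b t D"
        have De: "?D e j = (if j = a then D e a - t * D e b else D e j)" for j
          using dab by (simp add: basechange_apply)
        have lt: "\<bar>D e a - t * D e b\<bar> < \<bar>D e a\<bar>"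
          using ab(4-6) by (auto simp: t_def sgn_if abs_if split: if_splits)
        have "(\<Sum>j\<in>I. nat \<bar>?D e j\<bar>) < (\<Sum>j\<in>I. nat \<bar>D e j\<bar>)"
          by (rule sum_strict_mono_ex1) (use fin ab lt in \<open>auto simp: De\<close>)
        then have "torsion_formula I dg ?D (basechange a b (of_int t) S)"
          using less.prems(2) contracted_basechange[OF c ab(1-3) dab(1)] by (intro less.IH) auto
        then show ?thesis by (rule torsion_formula_basechange[OF c ab(1-3) dab(1)])
      qed
    qed
    from this[OF c0 refl] show ?thesis .
  qed
qed

section \<open>Extension of scalars\<close>

abbreviation "keys \<equiv> Poly_Mapping.keys"
abbreviation "lookup \<equiv> Poly_Mapping.lookup"

text \<open>
  Maps out of the tensor product are maps out of the free abelian group that kill the relations;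
  everything about it is derived from this universal property.
\<close>

locale scalar_extension = S?: ring S + left_module R M
  for R :: "'r ring" and S :: "'s ring" and M :: "('r, 'm) module" +
  fixes \<iota> :: "'r \<Rightarrow> 's"
  assumes \<iota>: "\<iota> \<in> Ring.ring_hom R S"
begin

abbreviation "FA \<equiv> free_Abelian_group (carrier S \<times> carrier M)"
abbreviation "TR \<equiv> tensor_relations R S \<iota> M"
abbreviation "TG \<equiv> tensor_group R S \<iota> M"
abbreviation "T \<equiv> base_change R S \<iota> M"
abbreviation "tens \<equiv> tensor R S \<iota> M"

declare carrier_free_Abelian_group_iff [simp del]

lemma \<iota>_closed: "r \<in> carrier R \<Longrightarrow> \<iota> r \<in> carrier S"
  using ring_hom_closed[OF \<iota>] .

lemma FA_group: "comm_group FA" by (rule abelian_free_Abelian_group)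

sublocale FA: comm_group FA by (rule FA_group)

definition "rel_gens =
       ({frag_of (s \<oplus>\<^bsub>S\<^esub> s', m) - frag_of (s, m) - frag_of (s', m) | s s' m.
            s \<in> carrier S \<and> s' \<in> carrier S \<and> m \<in> carrier M} \<union>
        {frag_of (s, m \<oplus>\<^bsub>M\<^esub> m') - frag_of (s, m) - frag_of (s, m') | s m m'.
            s \<in> carrier S \<and> m \<in> carrier M \<and> m' \<in> carrier M} \<union>
        {frag_of (s \<otimes>\<^bsub>S\<^esub> \<iota> r, m) - frag_of (s, r \<odot>\<^bsub>M\<^esub> m) | s r m.
            s \<in> carrier S \<and> r \<in> carrier R \<and> m \<in> carrier M})"

lemma TR_eq: "TR = generate FA rel_gens" by (simp add: tensor_relations_def rel_gens_def)

lemma frag_of_FA: "s \<in> carrier S \<Longrightarrow> m \<in> carrier M \<Longrightarrow> frag_of (s, m) \<in> carrier FA"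
  by (simp add: free_Abelian_group_def)

lemma FA_diff: "x \<in> carrier FA \<Longrightarrow> y \<in> carrier FA \<Longrightarrow> x - y \<in> carrier FA"
  using keys_diff[of x y] by (auto simp: free_Abelian_group_def)

lemma FA_mult: "x \<otimes>\<^bsub>FA\<^esub> y = x + y" and FA_one: "\<one>\<^bsub>FA\<^esub> = 0"
  by (simp_all add: free_Abelian_group_def)

lemma rel_gens_FA: "rel_gens \<subseteq> carrier FA"
  unfolding rel_gens_def by (auto intro!: FA_diff frag_of_FA smult_closed \<iota>_closed)

lemma TR_subgroup: "subgroup TR FA"
  unfolding TR_eq by (rule FA.generate_is_subgroup[OF rel_gens_FA])

lemma TR_normal: "TR \<lhd> FA"
  using TR_subgroup by (simp add: FA.normal_iff_subgroup)

lemma TG_group: "comm_group TG"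
  unfolding tensor_group_def by (rule FA.abelian_FactGroup[OF TR_subgroup])

sublocale TG: comm_group TG by (rule TG_group)

lemma kills_relations:
  assumes H: "group H" and h: "h \<in> hom FA H" and gens: "\<And>x. x \<in> rel_gens \<Longrightarrow> h x = \<one>\<^bsub>H\<^esub>" and x: "x \<in> TR"
  shows "h x = \<one>\<^bsub>H\<^esub>"
proof -
  interpret h: group_hom FA H h using H h FA.group_axioms by (simp add: group_hom_def group_hom_axioms_def)
  have "rel_gens \<subseteq> kernel FA H h" using rel_gens_FA gens by (auto simp: kernel_def)
  then have "TR \<subseteq> kernel FA H h" unfolding TR_eq
    by (rule FA.generate_subgroup_incl[OF _ h.subgroup_kernel])
  then show ?thesis using x by (auto simp: kernel_def)
qed

lemma hom_ext_on_rel_gens: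
  assumes H: "comm_group H" and h: "h \<in> hom FA H"
    and f: "\<And>s m. s \<in> carrier S \<Longrightarrow> m \<in> carrier M \<Longrightarrow> h (frag_of (s, m)) = f s m"
    and fc: "\<And>s m. s \<in> carrier S \<Longrightarrow> m \<in> carrier M \<Longrightarrow> f s m \<in> carrier H"
    and a1: "\<And>s s' m. s \<in> carrier S \<Longrightarrow> s' \<in> carrier S \<Longrightarrow> m \<in> carrier M \<Longrightarrow> f (s \<oplus>\<^bsub>S\<^esub> s') m = f s m \<otimes>\<^bsub>H\<^esub> f s' m"
    and a2: "\<And>s m m'. s \<in> carrier S \<Longrightarrow> m \<in> carrier M \<Longrightarrow> m' \<in> carrier M \<Longrightarrow> f s (m \<oplus>\<^bsub>M\<^esub> m') = f s m \<otimes>\<^bsub>H\<^esub> f s m'"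
    and a3: "\<And>s r m. s \<in> carrier S \<Longrightarrow> r \<in> carrier R \<Longrightarrow> m \<in> carrier M \<Longrightarrow> f (s \<otimes>\<^bsub>S\<^esub> \<iota> r) m = f s (r \<odot>\<^bsub>M\<^esub> m)"
    and x: "x \<in> rel_gens"
  shows "h x = \<one>\<^bsub>H\<^esub>"
proof -
  interpret H: comm_group H by fact
  have hd: "h (x - y) = h x \<otimes>\<^bsub>H\<^esub> inv\<^bsub>H\<^esub> h y" and hc: "h x \<in> carrier H" if "x \<in> carrier FA" "y \<in> carrier FA" for x y
  proof -
    show c: "h x \<in> carrier H" using h that by (auto simp: hom_def)
    have c': "h y \<in> carrier H" "h (x - y) \<in> carrier H" using h that FA_diff by (auto simp: hom_def)
    have "h (x - y) \<otimes>\<^bsub>H\<^esub> h y = h ((x - y) + y)"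
      using hom_mult[OF h FA_diff[OF that] that(2)] by (simp add: FA_mult)
    then show "h (x - y) = h x \<otimes>\<^bsub>H\<^esub> inv\<^bsub>H\<^esub> h y" using c c' by (simp add: H.inv_solve_right)
  qed
  have c3: "h (x - y - z) = h x \<otimes>\<^bsub>H\<^esub> inv\<^bsub>H\<^esub> h y \<otimes>\<^bsub>H\<^esub> inv\<^bsub>H\<^esub> h z" if "x \<in> carrier FA" "y \<in> carrier FA" "z \<in> carrier FA" for x y z
    using that by (simp add: hd FA_diff)
  have e: "u \<otimes>\<^bsub>H\<^esub> v \<otimes>\<^bsub>H\<^esub> inv\<^bsub>H\<^esub> u \<otimes>\<^bsub>H\<^esub> inv\<^bsub>H\<^esub> v = \<one>\<^bsub>H\<^esub>" if "u \<in> carrier H" "v \<in> carrier H" for u v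
    using that by (simp add: H.m_comm[of u v] H.m_assoc H.inv_cancel)
  from x[unfolded rel_gens_def] show ?thesis
  proof (elim UnE CollectE exE conjE)
    fix s s' m
    assume "x = frag_of (s \<oplus>\<^bsub>S\<^esub> s', m) - frag_of (s, m) - frag_of (s', m)" "s \<in> carrier S" "s' \<in> carrier S" "m \<in> carrier M"
    then show ?thesis by (simp add: c3 frag_of_FA f a1 e fc)
  next
    fix s m m'
    assume "x = frag_of (s, m \<oplus>\<^bsub>M\<^esub> m') - frag_of (s, m) - frag_of (s, m')" "s \<in> carrier S" "m \<in> carrier M" "m' \<in> carrier M"
    then show ?thesis by (simp add: c3 frag_of_FA f a2 e fc)
  next
    fix s r m
    assume "x = frag_of (s \<otimes>\<^bsub>S\<^esub> \<iota> r, m) - frag_of (s, r \<odot>\<^bsub>M\<^esub> m)" "s \<in> carrier S" "r \<in> carrier R" "m \<in> carrier M"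
    then show ?thesis by (simp add: hd frag_of_FA f a3 fc smult_closed \<iota>_closed)
  qed
qed

lemma T_simps:
  "carrier T = carrier TG" "\<zero>\<^bsub>T\<^esub> = \<one>\<^bsub>TG\<^esub>" "x \<oplus>\<^bsub>T\<^esub> y = x \<otimes>\<^bsub>TG\<^esub> y"
  "s \<odot>\<^bsub>T\<^esub> x = tensor_induced R S \<iota> M (\<lambda>(t, m). (s \<otimes>\<^bsub>S\<^esub> t, m)) x"
  by (simp_all add: base_change_def)

definition cls :: "('s \<times> 'm \<Rightarrow>\<^sub>0 int) \<Rightarrow> ('s \<times> 'm \<Rightarrow>\<^sub>0 int) set" where
  "cls z = TR #>\<^bsub>FA\<^esub> z"

lemma tens_cls: "tens s m = cls (frag_of (s, m))"
  by (simp add: tensor_def cls_def)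

lemma TG_carrier: "carrier TG = cls ` carrier FA"
  by (auto simp: tensor_group_def carrier_FactGroup cls_def)

lemma cls_eq_iff: "x \<in> carrier FA \<Longrightarrow> y \<in> carrier FA \<Longrightarrow> cls x = cls y \<longleftrightarrow> x - y \<in> TR"
proof -
  assume xy: "x \<in> carrier FA" "y \<in> carrier FA"
  have iy: "inv\<^bsub>FA\<^esub> y = - y"
    by (rule FA.inv_equality) (use xy in \<open>auto simp: free_Abelian_group_def\<close>)
  have "cls x = cls y \<longleftrightarrow> x \<otimes>\<^bsub>FA\<^esub> inv\<^bsub>FA\<^esub> y \<in> TR"
  proof
    assume "cls x = cls y"
    then have "x \<in> TR #>\<^bsub>FA\<^esub> y" using FA.rcos_self[OF xy(1) TR_subgroup] by (simp add: cls_def)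
    then show "x \<otimes>\<^bsub>FA\<^esub> inv\<^bsub>FA\<^esub> y \<in> TR"
      using subgroup.rcos_module[OF TR_subgroup FA.group_axioms xy(2) xy(1)] by (rule iffD1[rotated])
  next
    assume "x \<otimes>\<^bsub>FA\<^esub> inv\<^bsub>FA\<^esub> y \<in> TR"
    then have "x \<in> TR #>\<^bsub>FA\<^esub> y"
      using subgroup.rcos_module[OF TR_subgroup FA.group_axioms xy(2) xy(1)] by (rule iffD2[rotated])
    from FA.repr_independence[OF this xy(2) TR_subgroup] show "cls x = cls y" by (simp add: cls_def)
  qed
  then show ?thesis by (simp add: iy FA_mult)
qed

lemma cls_mult: "x \<in> carrier FA \<Longrightarrow> y \<in> carrier FA \<Longrightarrow> cls x \<otimes>\<^bsub>TG\<^esub> cls y = cls (x + y)"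
  using normal.rcos_sum[OF TR_normal, of x y] by (simp add: tensor_group_def FactGroup_def cls_def FA_mult)

lemma cls_one: "\<one>\<^bsub>TG\<^esub> = cls 0"
  using FA.coset_mult_one[of TR] subgroup.subset[OF TR_subgroup]
  by (simp add: tensor_group_def FactGroup_def cls_def FA_one)

lemma cls_hom: "cls \<in> hom FA TG"
  by (auto simp: hom_def cls_mult FA_mult TG_carrier)

lemma tens_closed: "s \<in> carrier S \<Longrightarrow> m \<in> carrier M \<Longrightarrow> tens s m \<in> carrier TG"
  by (auto simp: tens_cls TG_carrier frag_of_FA)

lemma tens_bilinear:
  "s \<in> carrier S \<Longrightarrow> s' \<in> carrier S \<Longrightarrow> m \<in> carrier M \<Longrightarrow> tens (s \<oplus>\<^bsub>S\<^esub> s') m = tens s m \<otimes>\<^bsub>TG\<^esub> tens s' m"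
  "s \<in> carrier S \<Longrightarrow> m \<in> carrier M \<Longrightarrow> m' \<in> carrier M \<Longrightarrow> tens s (m \<oplus>\<^bsub>M\<^esub> m') = tens s m \<otimes>\<^bsub>TG\<^esub> tens s m'"
  "s \<in> carrier S \<Longrightarrow> r \<in> carrier R \<Longrightarrow> m \<in> carrier M \<Longrightarrow> tens (s \<otimes>\<^bsub>S\<^esub> \<iota> r) m = tens s (r \<odot>\<^bsub>M\<^esub> m)"
proof -
  have gen: "x \<in> TR" if "x \<in> rel_gens" for x unfolding TR_eq using that by (rule generate.incl)
  have pl: "x + y \<in> carrier FA" if "x \<in> carrier FA" "y \<in> carrier FA" for x y
    using FA.m_closed[OF that] by (simp add: FA_mult)
  show "tens (s \<oplus>\<^bsub>S\<^esub> s') m = tens s m \<otimes>\<^bsub>TG\<^esub> tens s' m" if a: "s \<in> carrier S" "s' \<in> carrier S" "m \<in> carrier M"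
  proof -
    have "frag_of (s \<oplus>\<^bsub>S\<^esub> s', m) - (frag_of (s, m) + frag_of (s', m)) \<in> TR"
      using a by (intro gen) (unfold diff_diff_add[symmetric], auto simp: rel_gens_def)
    then show ?thesis using a by (simp add: tens_cls cls_mult frag_of_FA cls_eq_iff pl)
  qed
  show "tens s (m \<oplus>\<^bsub>M\<^esub> m') = tens s m \<otimes>\<^bsub>TG\<^esub> tens s m'" if a: "s \<in> carrier S" "m \<in> carrier M" "m' \<in> carrier M"
  proof -
    have "frag_of (s, m \<oplus>\<^bsub>M\<^esub> m') - (frag_of (s, m) + frag_of (s, m')) \<in> TR"
      using a by (intro gen) (unfold diff_diff_add[symmetric], auto simp: rel_gens_def)
    then show ?thesis using a by (simp add: tens_cls cls_mult frag_of_FA cls_eq_iff pl)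
  qed
  show "tens (s \<otimes>\<^bsub>S\<^esub> \<iota> r) m = tens s (r \<odot>\<^bsub>M\<^esub> m)" if a: "s \<in> carrier S" "r \<in> carrier R" "m \<in> carrier M"
  proof -
    have "frag_of (s \<otimes>\<^bsub>S\<^esub> \<iota> r, m) - frag_of (s, r \<odot>\<^bsub>M\<^esub> m) \<in> TR"
      using a by (intro gen) (auto simp: rel_gens_def)
    then show ?thesis using a by (simp add: tens_cls frag_of_FA cls_eq_iff smult_closed \<iota>_closed)
  qed
qed

text \<open>Every element is a sum of pure tensors.\<close>

lemma TG_induct:
  assumes x: "x \<in> carrier TG"
    and one: "P \<one>\<^bsub>TG\<^esub>" and gen: "\<And>s m. s \<in> carrier S \<Longrightarrow> m \<in> carrier M \<Longrightarrow> P (tens s m)"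
    and diff: "\<And>x y. x \<in> carrier TG \<Longrightarrow> y \<in> carrier TG \<Longrightarrow> P x \<Longrightarrow> P y \<Longrightarrow> P (x \<otimes>\<^bsub>TG\<^esub> inv\<^bsub>TG\<^esub> y)"
  shows "P x"
proof -
  obtain z where z: "z \<in> carrier FA" "x = cls z" using x by (auto simp: TG_carrier)
  have c: "cls (a - b) = cls a \<otimes>\<^bsub>TG\<^esub> inv\<^bsub>TG\<^esub> cls b" if "a \<in> carrier FA" "b \<in> carrier FA" for a b
  proof -
    have "cls (a - b) \<otimes>\<^bsub>TG\<^esub> cls b = cls a" using that by (simp add: cls_mult FA_diff)
    moreover have "cls (a - b) \<in> carrier TG" "cls a \<in> carrier TG" "cls b \<in> carrier TG"
      using that FA_diff by (auto simp: TG_carrier)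
    ultimately show ?thesis by (simp add: TG.inv_solve_right)
  qed
  have "keys z \<subseteq> carrier S \<times> carrier M" using z(1) by (simp add: free_Abelian_group_def)
  then have "P (cls z) \<and> z \<in> carrier FA"
  proof (induction z rule: frag_induction)
    case zero then show ?case using one by (simp add: cls_one free_Abelian_group_def)
  next
    case (one x) then show ?case using gen by (cases x) (auto simp: tens_cls frag_of_FA)
  next
    case (diff a b) then show ?case using assms(4)[of "cls a" "cls b"] by (auto simp: c FA_diff TG_carrier)
  qed
  then show ?thesis using z by simp
qed

lemma TG_universal:
  assumes H: "comm_group H"
    and fc: "\<And>s m. s \<in> carrier S \<Longrightarrow> m \<in> carrier M \<Longrightarrow> f s m \<in> carrier H"
    and a1: "\<And>s s' m. s \<in> carrier S \<Longrightarrow> s' \<in> carrier S \<Longrightarrow> m \<in> carrier M \<Longrightarrow> f (s \<oplus>\<^bsub>S\<^esub> s') m = f s m \<otimes>\<^bsub>H\<^esub> f s' m"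
    and a2: "\<And>s m m'. s \<in> carrier S \<Longrightarrow> m \<in> carrier M \<Longrightarrow> m' \<in> carrier M \<Longrightarrow> f s (m \<oplus>\<^bsub>M\<^esub> m') = f s m \<otimes>\<^bsub>H\<^esub> f s m'"
    and a3: "\<And>s r m. s \<in> carrier S \<Longrightarrow> r \<in> carrier R \<Longrightarrow> m \<in> carrier M \<Longrightarrow> f (s \<otimes>\<^bsub>S\<^esub> \<iota> r) m = f s (r \<odot>\<^bsub>M\<^esub> m)"
  obtains h where "h \<in> hom TG H" "\<And>s m. s \<in> carrier S \<Longrightarrow> m \<in> carrier M \<Longrightarrow> h (tens s m) = f s m"
proof -
  interpret H: comm_group H by fact
  have im: "(\<lambda>(s, m). f s m) ` (carrier S \<times> carrier M) \<subseteq> carrier H" using fc by auto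
  obtain k where k: "k \<in> hom FA H" "\<And>x. x \<in> carrier S \<times> carrier M \<Longrightarrow> k (frag_of x) = (\<lambda>(s, m). f s m) x"
    by (rule H.free_Abelian_group_universal[OF im]) blast
  have kf: "k (frag_of (s, m)) = f s m" if "s \<in> carrier S" "m \<in> carrier M" for s m using k(2)[of "(s, m)"] that by simp
  have kill: "k x = \<one>\<^bsub>H\<^esub>" if "x \<in> TR" for x
    by (rule kills_relations[OF H.group_axioms k(1) _ that], rule hom_ext_on_rel_gens[OF H k(1) kf fc a1 a2 a3])
  define h where "h X = k (SOME z. z \<in> carrier FA \<and> cls z = X)" for X
  have hcls: "h (cls z) = k z" if z: "z \<in> carrier FA" for z
  proof -
    let ?w = "SOME w. w \<in> carrier FA \<and> cls w = cls z"
    have w: "?w \<in> carrier FA \<and> cls ?w = cls z" by (rule someI[of _ z]) (use z in simp)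
    then have "?w - z \<in> TR" using z cls_eq_iff by blast
    then have "k (?w - z) = \<one>\<^bsub>H\<^esub>" by (rule kill)
    moreover have "k ?w = k (?w - z) \<otimes>\<^bsub>H\<^esub> k z"
      using hom_mult[OF k(1) FA_diff[OF _ z] z, of ?w] w by (simp add: FA_mult)
    moreover have "k z \<in> carrier H" using k(1) z by (auto simp: hom_def)
    ultimately show ?thesis by (simp add: h_def)
  qed
  have "h \<in> hom TG H"
  proof (rule homI)
    fix x assume "x \<in> carrier TG"
    then show "h x \<in> carrier H" using k(1) by (auto simp: TG_carrier hcls hom_def)
  next
    fix x y assume "x \<in> carrier TG" "y \<in> carrier TG"
    then obtain a b where ab: "a \<in> carrier FA" "b \<in> carrier FA" "x = cls a" "y = cls b" by (auto simp: TG_carrier)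
    have "a + b \<in> carrier FA" using FA.m_closed[OF ab(1,2)] by (simp add: FA_mult)
    then show "h (x \<otimes>\<^bsub>TG\<^esub> y) = h x \<otimes>\<^bsub>H\<^esub> h y"
      using ab hom_mult[OF k(1) ab(1,2)] by (simp add: cls_mult hcls FA_mult)
  qed
  moreover have "h (tens s m) = f s m" if "s \<in> carrier S" "m \<in> carrier M" for s m
    using that by (simp add: tens_cls hcls frag_of_FA kf)
  ultimately show ?thesis by (rule that)
qed

end

lemma hom_closed: "h \<in> hom G H \<Longrightarrow> x \<in> carrier G \<Longrightarrow> h x \<in> carrier H"
  by (auto simp: hom_def)

lemma (in scalar_extension) TG_hom_eq:
  assumes H: "group H" and h: "h \<in> hom TG H" and k: "k \<in> hom TG H"
    and e: "\<And>s m. s \<in> carrier S \<Longrightarrow> m \<in> carrier M \<Longrightarrow> h (tens s m) = k (tens s m)" and x: "x \<in> carrier TG"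
  shows "h x = k x"
proof -
  interpret h: group_hom TG H h using H h TG.group_axioms by (simp add: group_hom_def group_hom_axioms_def)
  interpret k: group_hom TG H k using H k TG.group_axioms by (simp add: group_hom_def group_hom_axioms_def)
  show ?thesis using x by (rule TG_induct) (simp_all add: e)
qed

text \<open>
  The induced map fills the image of a coset up to a coset of the relations, so it is given by any
  representative as soon as it sends relations to relations.
\<close>

lemma tensor_induced_hom:
  assumes M: "scalar_extension R S M \<iota>" and N: "scalar_extension R S N \<iota>"
    and hc: "\<And>s m. s \<in> carrier S \<Longrightarrow> m \<in> carrier M \<Longrightarrow> h1 s m \<in> carrier S"
      "\<And>s m. s \<in> carrier S \<Longrightarrow> m \<in> carrier M \<Longrightarrow> h2 s m \<in> carrier N"
    and a1: "\<And>s s' m. s \<in> carrier S \<Longrightarrow> s' \<in> carrier S \<Longrightarrow> m \<in> carrier M \<Longrightarrow>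
      tensor R S \<iota> N (h1 (s \<oplus>\<^bsub>S\<^esub> s') m) (h2 (s \<oplus>\<^bsub>S\<^esub> s') m)
      = tensor R S \<iota> N (h1 s m) (h2 s m) \<otimes>\<^bsub>tensor_group R S \<iota> N\<^esub> tensor R S \<iota> N (h1 s' m) (h2 s' m)"
    and a2: "\<And>s m m'. s \<in> carrier S \<Longrightarrow> m \<in> carrier M \<Longrightarrow> m' \<in> carrier M \<Longrightarrow>
      tensor R S \<iota> N (h1 s (m \<oplus>\<^bsub>M\<^esub> m')) (h2 s (m \<oplus>\<^bsub>M\<^esub> m'))
      = tensor R S \<iota> N (h1 s m) (h2 s m) \<otimes>\<^bsub>tensor_group R S \<iota> N\<^esub> tensor R S \<iota> N (h1 s m') (h2 s m')"
    and a3: "\<And>s r m. s \<in> carrier S \<Longrightarrow> r \<in> carrier R \<Longrightarrow> m \<in> carrier M \<Longrightarrow>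
      tensor R S \<iota> N (h1 (s \<otimes>\<^bsub>S\<^esub> \<iota> r) m) (h2 (s \<otimes>\<^bsub>S\<^esub> \<iota> r) m) = tensor R S \<iota> N (h1 s (r \<odot>\<^bsub>M\<^esub> m)) (h2 s (r \<odot>\<^bsub>M\<^esub> m))"
  shows "tensor_induced R S \<iota> N (\<lambda>(s, m). (h1 s m, h2 s m)) \<in> hom (tensor_group R S \<iota> M) (tensor_group R S \<iota> N)"
    and "\<And>s m. s \<in> carrier S \<Longrightarrow> m \<in> carrier M \<Longrightarrow>
      tensor_induced R S \<iota> N (\<lambda>(s, m). (h1 s m, h2 s m)) (tensor R S \<iota> M s m) = tensor R S \<iota> N (h1 s m) (h2 s m)"
proof -
  let ?h = "\<lambda>(s, m). (h1 s m, h2 s m)" and ?t = "tensor_induced R S \<iota> N (\<lambda>(s, m). (h1 s m, h2 s m))"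
  interpret M: scalar_extension R S M \<iota> by fact
  interpret N: scalar_extension R S N \<iota> by fact
  define \<Phi> where "\<Phi> = frag_extend (\<lambda>sm. frag_of (?h sm))"
  have \<Phi>_closed: "\<Phi> z \<in> carrier N.FA" if "z \<in> carrier M.FA" for z
  proof -
    have "keys (\<Phi> z) \<subseteq> (\<Union>x\<in>keys z. keys (frag_of (?h x) :: _ \<Rightarrow>\<^sub>0 int))"
      unfolding \<Phi>_def by (rule keys_frag_extend)
    also have "\<dots> \<subseteq> carrier S \<times> carrier N"
    proof (rule UN_least)
      fix x assume "x \<in> keys z"
      then have "fst x \<in> carrier S" "snd x \<in> carrier M" using that by (auto simp: free_Abelian_group_def)
      then show "keys (frag_of (?h x) :: _ \<Rightarrow>\<^sub>0 int) \<subseteq> carrier S \<times> carrier N"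
        by (simp add: case_prod_unfold hc)
    qed
    finally show ?thesis by (simp add: free_Abelian_group_def)
  qed
  have \<Phi>_add: "\<Phi> (x + y) = \<Phi> x + \<Phi> y" for x y by (simp add: \<Phi>_def frag_extend_add)
  have \<Phi>_gen: "\<Phi> (frag_of (s, m)) = frag_of (h1 s m, h2 s m)" for s m by (simp add: \<Phi>_def)
  have cl: "(\<lambda>z. N.cls (\<Phi> z)) \<in> hom M.FA N.TG"
    using N.cls_hom \<Phi>_closed by (auto simp: hom_def N.cls_mult N.FA_mult M.FA_mult \<Phi>_add N.TG_carrier)
  have cg: "N.cls (\<Phi> (frag_of (s, m))) = N.tens (h1 s m) (h2 s m)" for s m by (simp add: \<Phi>_gen N.tens_cls)
  have "N.cls (\<Phi> x) = \<one>\<^bsub>N.TG\<^esub>" if "x \<in> M.TR" for x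
    by (rule M.kills_relations[OF N.TG.group_axioms cl _ that],
        rule M.hom_ext_on_rel_gens[OF N.TG_group cl cg _ a1 a2 a3]) (auto intro!: N.tens_closed hc)
  moreover have MTR: "x \<in> carrier M.FA" if "x \<in> M.TR" for x using subgroup.subset[OF M.TR_subgroup] that by blast
  moreover have z0: "0 \<in> carrier N.FA" using N.FA.one_closed by (simp only: N.FA_one)
  ultimately have \<Phi>_TR: "\<Phi> x \<in> N.TR" if "x \<in> M.TR" for x
    using that N.cls_eq_iff[OF \<Phi>_closed z0, of x] by (simp add: N.cls_one)
  have ind: "?t (M.cls z) = N.cls (\<Phi> z)" if z: "z \<in> carrier M.FA" for z
  proof -
    have im: "frag_extend (\<lambda>sm. frag_of (?h sm)) ` M.cls z = {\<Phi> t + \<Phi> z | t. t \<in> M.TR}"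
    proof -
      have "M.cls z = (\<lambda>t. t + z) ` M.TR" unfolding M.cls_def r_coset_def by (auto simp: M.FA_mult)
      then show ?thesis unfolding \<Phi>_def[symmetric] by (simp add: image_image \<Phi>_add setcompr_eq_image)
    qed
    have "N.TR <#>\<^bsub>N.FA\<^esub> {\<Phi> t + \<Phi> z | t. t \<in> M.TR} = N.TR #>\<^bsub>N.FA\<^esub> \<Phi> z"
    proof (rule equalityI; rule subsetI)
      fix x assume "x \<in> N.TR <#>\<^bsub>N.FA\<^esub> {\<Phi> t + \<Phi> z | t. t \<in> M.TR}"
      then obtain n t where nt: "n \<in> N.TR" "t \<in> M.TR" "x = n + (\<Phi> t + \<Phi> z)" by (auto simp: set_mult_def N.FA_mult)
      have "n + \<Phi> t \<in> N.TR" using subgroup.m_closed[OF N.TR_subgroup nt(1) \<Phi>_TR[OF nt(2)]] by (simp add: N.FA_mult)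
      then show "x \<in> N.TR #>\<^bsub>N.FA\<^esub> \<Phi> z" unfolding r_coset_def nt(3) by (force simp: N.FA_mult add.assoc)
    next
      fix x assume "x \<in> N.TR #>\<^bsub>N.FA\<^esub> \<Phi> z"
      then obtain n where n: "n \<in> N.TR" "x = n + \<Phi> z" by (auto simp: r_coset_def N.FA_mult)
      have "0 \<in> M.TR" using subgroup.one_closed[OF M.TR_subgroup] by (simp add: M.FA_one)
      moreover have "\<Phi> 0 = 0" by (simp add: \<Phi>_def)
      ultimately show "x \<in> N.TR <#>\<^bsub>N.FA\<^esub> {\<Phi> t + \<Phi> z | t. t \<in> M.TR}"
        unfolding set_mult_def using n by (force simp: N.FA_mult)
    qed
    then show ?thesis unfolding tensor_induced_def im N.cls_def by simp
  qed
  show "?t \<in> hom M.TG N.TG"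
  proof (rule homI)
    fix x assume "x \<in> carrier M.TG"
    then show "?t x \<in> carrier N.TG"
      using \<Phi>_closed by (auto simp: M.TG_carrier N.TG_carrier ind)
  next
    fix x y assume "x \<in> carrier M.TG" "y \<in> carrier M.TG"
    then obtain a b where ab: "a \<in> carrier M.FA" "b \<in> carrier M.FA" "x = M.cls a" "y = M.cls b" by (auto simp: M.TG_carrier)
    have "a + b \<in> carrier M.FA" using M.FA.m_closed[OF ab(1,2)] by (simp add: M.FA_mult)
    then show "?t (x \<otimes>\<^bsub>M.TG\<^esub> y)
      = ?t x \<otimes>\<^bsub>N.TG\<^esub> ?t y"
      using ab \<Phi>_closed by (simp add: M.cls_mult N.cls_mult ind \<Phi>_add)
  qed
  show "?t (M.tens s m) = N.tens (h1 s m) (h2 s m)"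
    if "s \<in> carrier S" "m \<in> carrier M" for s m
    using that by (simp add: M.tens_cls ind M.frag_of_FA \<Phi>_gen N.tens_cls)
qed

context scalar_extension
begin

lemma smul_hom: "s \<in> carrier S \<Longrightarrow> (\<lambda>x. s \<odot>\<^bsub>T\<^esub> x) \<in> hom TG TG"
  and smul_tens: "s \<in> carrier S \<Longrightarrow> t \<in> carrier S \<Longrightarrow> m \<in> carrier M \<Longrightarrow> s \<odot>\<^bsub>T\<^esub> tens t m = tens (s \<otimes>\<^bsub>S\<^esub> t) m"
proof -
  note * = tensor_induced_hom[OF scalar_extension_axioms scalar_extension_axioms, of "\<lambda>t m. s \<otimes>\<^bsub>S\<^esub> t" "\<lambda>t m. m"]
  show "(\<lambda>x. s \<odot>\<^bsub>T\<^esub> x) \<in> hom TG TG" if "s \<in> carrier S"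
    unfolding T_simps using that
    by (intro *(1)) (simp_all add: S.r_distr tens_bilinear S.m_assoc[symmetric] \<iota>_closed)
  show "s \<odot>\<^bsub>T\<^esub> tens t m = tens (s \<otimes>\<^bsub>S\<^esub> t) m" if "s \<in> carrier S" "t \<in> carrier S" "m \<in> carrier M"
    unfolding T_simps using that
    by (intro *(2)) (simp_all add: S.r_distr tens_bilinear S.m_assoc[symmetric] \<iota>_closed)
qed

lemma T_abelian_group: "abelian_group T"
proof (rule abelian_groupI)
  fix x assume x: "x \<in> carrier T"
  then show "\<exists>y\<in>carrier T. y \<oplus>\<^bsub>T\<^esub> x = \<zero>\<^bsub>T\<^esub>"
    unfolding T_simps by (intro bexI[of _ "inv\<^bsub>TG\<^esub> x"]) auto
qed (simp_all add: T_simps TG.m_ac)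

lemma TG_hom_comp: "h \<in> hom TG TG \<Longrightarrow> k \<in> hom TG TG \<Longrightarrow> (\<lambda>x. h (k x)) \<in> hom TG TG"
  by (auto simp: hom_def)

lemma TG_hom_add: "h \<in> hom TG TG \<Longrightarrow> k \<in> hom TG TG \<Longrightarrow> (\<lambda>x. h x \<otimes>\<^bsub>TG\<^esub> k x) \<in> hom TG TG"
  by (auto simp: hom_def Pi_def TG.m_assoc TG.m_lcomm)

lemma T_left_module: "left_module S T"
proof -
  interpret TA: abelian_group T by (rule T_abelian_group)
  show ?thesis
  proof (intro_locales)
    show "left_module_axioms S T"
    proof
      fix a x assume a: "a \<in> carrier S" and x: "x \<in> carrier T"
      show "a \<odot>\<^bsub>T\<^esub> x \<in> carrier T" using hom_closed[OF smul_hom[OF a]] x unfolding T_simps(1) by blast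
      fix b assume b: "b \<in> carrier S"
      have "(a \<oplus>\<^bsub>S\<^esub> b) \<odot>\<^bsub>T\<^esub> x = a \<odot>\<^bsub>T\<^esub> x \<otimes>\<^bsub>TG\<^esub> (b \<odot>\<^bsub>T\<^esub> x)"
        by (rule TG_hom_eq[OF TG.group_axioms smul_hom TG_hom_add[OF smul_hom smul_hom]])
          (use a b x in \<open>simp_all add: smul_tens S.l_distr tens_bilinear T_simps(1)\<close>)
      then show "(a \<oplus>\<^bsub>S\<^esub> b) \<odot>\<^bsub>T\<^esub> x = a \<odot>\<^bsub>T\<^esub> x \<oplus>\<^bsub>T\<^esub> b \<odot>\<^bsub>T\<^esub> x" by (simp only: T_simps(3))
      show "(a \<otimes>\<^bsub>S\<^esub> b) \<odot>\<^bsub>T\<^esub> x = a \<odot>\<^bsub>T\<^esub> (b \<odot>\<^bsub>T\<^esub> x)"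
        by (rule TG_hom_eq[OF TG.group_axioms smul_hom TG_hom_comp[OF smul_hom smul_hom]])
          (use a b x in \<open>simp_all add: smul_tens S.m_assoc T_simps(1)\<close>)
    next
      fix a x y assume a: "a \<in> carrier S" and x: "x \<in> carrier T" "y \<in> carrier T"
      then show "a \<odot>\<^bsub>T\<^esub> (x \<oplus>\<^bsub>T\<^esub> y) = a \<odot>\<^bsub>T\<^esub> x \<oplus>\<^bsub>T\<^esub> a \<odot>\<^bsub>T\<^esub> y"
        using hom_mult[OF smul_hom[OF a]] unfolding T_simps(1,3) by blast
    next
      fix x assume x: "x \<in> carrier T"
      have "(\<lambda>x. x) \<in> hom TG TG" by (auto simp: hom_def)
      from TG_hom_eq[OF TG.group_axioms smul_hom this]
      show "\<one>\<^bsub>S\<^esub> \<odot>\<^bsub>T\<^esub> x = x" using x by (simp add: smul_tens T_simps(1))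
    qed
  qed
qed

lemma T_tens_finsum:
  assumes "finite A" "\<And>i. i \<in> A \<Longrightarrow> f i \<in> carrier M" "s \<in> carrier S"
  shows "tens s (finsum M f A) = finsum T (\<lambda>i. tens s (f i)) A"
proof -
  interpret TA: abelian_group T by (rule T_abelian_group)
  have z: "tens s \<zero>\<^bsub>M\<^esub> = \<one>\<^bsub>TG\<^esub>"
    using tens_bilinear(2)[OF assms(3) M.zero_closed M.zero_closed] tens_closed[OF assms(3) M.zero_closed] by simp
  show ?thesis using assms(1,2)
  proof (induction A rule: finite_induct)
    case empty then show ?case by (simp add: z T_simps)
  next
    case (insert a A)
    have "finsum T (\<lambda>i. tens s (f i)) (insert a A) = tens s (f a) \<oplus>\<^bsub>T\<^esub> finsum T (\<lambda>i. tens s (f i)) A"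
      using insert assms(3) by (intro TA.finsum_insert) (auto simp: T_simps(1) intro!: tens_closed)
    then show ?case using insert assms(3)
      by (simp add: M.finsum_insert tens_bilinear T_simps(3) Pi_def M.finsum_closed)
  qed
qed

end

locale based_extension = scalar_extension R S M \<iota> + based_module R M bs
  for R :: "'r ring" and S :: "'s ring" and M :: "('r, 'm) module" and \<iota> :: "'r \<Rightarrow> 's" and bs :: "'m list"
begin

abbreviation "tbs \<equiv> map (tens \<one>\<^bsub>S\<^esub>) bs"

lemma coordinate_hom:
  assumes i: "i < rk"
  obtains \<kappa> where "\<kappa> \<in> hom TG (add_monoid S)" "\<And>s m. s \<in> carrier S \<Longrightarrow> m \<in> carrier M \<Longrightarrow> \<kappa> (tens s m) = s \<otimes>\<^bsub>S\<^esub> \<iota> (co m i)"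
proof (rule TG_universal[where H = "add_monoid S" and f = "\<lambda>s m. s \<otimes>\<^bsub>S\<^esub> \<iota> (co m i)"])
  show "comm_group (add_monoid S)" by (rule S.a_comm_group)
qed (use i that in \<open>auto simp: \<iota>_closed co_closed S.l_distr co_add ring_hom_add[OF \<iota>] S.r_distr co_smult ring_hom_mult[OF \<iota>] S.m_assoc\<close>)

text \<open>
  The coordinate functions of the tensor product come from the bilinear maps \<open>(s, m) \<mapsto> s \<iota>(co m i)\<close>.
\<close>

lemma T_based: "based_module S T tbs"
  and T_co_tens: "s \<in> carrier S \<Longrightarrow> m \<in> carrier M \<Longrightarrow> i < rk \<Longrightarrow> coords S T tbs (tens s m) i = s \<otimes>\<^bsub>S\<^esub> \<iota> (co m i)"
proof -
  interpret T: left_module S T by (rule T_left_module)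
  define K where "K i k \<longleftrightarrow> k \<in> hom TG (add_monoid S) \<and> (\<forall>s\<in>carrier S. \<forall>m\<in>carrier M. k (tens s m) = s \<otimes>\<^bsub>S\<^esub> \<iota> (co m i))" for i k
  have "\<exists>k. i < rk \<longrightarrow> K i k" for i
  proof (cases "i < rk")
    case True
    obtain k where "k \<in> hom TG (add_monoid S)" "\<And>s m. s \<in> carrier S \<Longrightarrow> m \<in> carrier M \<Longrightarrow> k (tens s m) = s \<otimes>\<^bsub>S\<^esub> \<iota> (co m i)"
      using coordinate_hom[OF True] by blast
    then have "K i k" by (simp add: K_def)
    then show ?thesis by blast
  qed simp
  then have "\<forall>i. \<exists>k. i < rk \<longrightarrow> K i k" by (rule allI)
  then have "\<exists>\<kappa>. \<forall>i. i < rk \<longrightarrow> K i (\<kappa> i)" by (rule choice)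
  then obtain \<kappa> where \<kappa>: "\<And>i. i < rk \<Longrightarrow> \<kappa> i \<in> hom TG (add_monoid S)"
    "\<And>i s m. i < rk \<Longrightarrow> s \<in> carrier S \<Longrightarrow> m \<in> carrier M \<Longrightarrow> \<kappa> i (tens s m) = s \<otimes>\<^bsub>S\<^esub> \<iota> (co m i)"
    unfolding K_def by blast
  let ?f = "\<lambda>x. finsum T (\<lambda>i. \<kappa> i x \<odot>\<^bsub>T\<^esub> tbs ! i) {..<rk}"
  have ag: "group (add_monoid S)" using S.a_group .
  have \<kappa>c: "\<kappa> i x \<in> carrier S" if "i < rk" "x \<in> carrier T" for i x
    using hom_closed[OF \<kappa>(1)[OF that(1)]] that(2) by (simp add: T_simps(1))
  have \<kappa>a: "\<kappa> i (x \<oplus>\<^bsub>T\<^esub> y) = \<kappa> i x \<oplus>\<^bsub>S\<^esub> \<kappa> i y" if "i < rk" "x \<in> carrier T" "y \<in> carrier T" for i x y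
    using hom_mult[OF \<kappa>(1)[OF that(1)]] that(2,3) by (simp add: T_simps(1,3))
  have \<kappa>s: "\<kappa> i (s \<odot>\<^bsub>T\<^esub> x) = s \<otimes>\<^bsub>S\<^esub> \<kappa> i x" if i: "i < rk" and s: "s \<in> carrier S" and x: "x \<in> carrier T" for i s x
  proof (rule TG_hom_eq[OF ag])
    show "(\<lambda>x. \<kappa> i (s \<odot>\<^bsub>T\<^esub> x)) \<in> hom TG (add_monoid S)"
      using smul_hom[OF s] \<kappa>(1)[OF i] by (auto simp: hom_def Pi_def)
    show "(\<lambda>x. s \<otimes>\<^bsub>S\<^esub> \<kappa> i x) \<in> hom TG (add_monoid S)"
      using \<kappa>(1)[OF i] s by (auto simp: hom_def Pi_def S.r_distr)
  qed (use i s x in \<open>simp_all add: smul_tens \<kappa>(2) T_simps(1) S.m_assoc \<iota>_closed co_closed\<close>)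
  have \<kappa>f: "\<kappa> i (finsum T f A) = finsum S (\<lambda>k. \<kappa> i (f k)) A" if i: "i < rk" and A: "finite A" "\<And>k. k \<in> A \<Longrightarrow> f k \<in> carrier T" for i f A
    using A
  proof (induction A rule: finite_induct)
    case empty
    have "\<kappa> i (tens \<zero>\<^bsub>S\<^esub> \<zero>\<^bsub>M\<^esub>) = \<zero>\<^bsub>S\<^esub>" using i by (simp add: \<kappa>(2) \<iota>_closed co_closed)
    moreover have "tens \<zero>\<^bsub>S\<^esub> \<zero>\<^bsub>M\<^esub> = \<zero>\<^bsub>T\<^esub>"
      using tens_bilinear(2)[OF S.zero_closed M.zero_closed M.zero_closed] tens_closed[OF S.zero_closed M.zero_closed]
      by (simp add: T_simps(2))
    ultimately show ?case by simp
  next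
    case (insert a A)
    then show ?case using i by (simp add: T.M.finsum_insert S.finsum_insert \<kappa>a \<kappa>c Pi_def T.M.finsum_closed)
  qed
  have bT: "tbs ! i \<in> carrier T" if "i < rk" for i using that by (simp add: T_simps(1) tens_closed bs_closed)
  have uniq: "\<kappa> j (finsum T (\<lambda>i. a i \<odot>\<^bsub>T\<^esub> tbs ! i) {..<rk}) = a j" if a: "\<And>i. i < rk \<Longrightarrow> a i \<in> carrier S" and j: "j < rk" for a j
  proof -
    have "\<kappa> j (finsum T (\<lambda>i. a i \<odot>\<^bsub>T\<^esub> tbs ! i) {..<rk}) = finsum S (\<lambda>i. \<kappa> j (a i \<odot>\<^bsub>T\<^esub> tbs ! i)) {..<rk}"
      using a j bT by (intro \<kappa>f) (auto intro!: T.smult_closed)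
    also have "\<dots> = finsum S (\<lambda>i. if i = j then a j else \<zero>\<^bsub>S\<^esub>) {..<rk}"
      using a j bT by (intro S.finsum_cong')
        (auto simp: \<kappa>s \<kappa>(2) bs_closed co_bs ring_hom_one[OF \<iota>] ring_hom_zero[OF \<iota> R.ring_axioms S.ring_axioms])
    finally show ?thesis using a j by (simp add: S.finsum_delta)
  qed
  have ex: "?f x = x" if x: "x \<in> carrier T" for x
  proof (rule TG_hom_eq[OF TG.group_axioms])
    show "(\<lambda>x. ?f x) \<in> hom TG TG"
    proof (rule homI)
      fix x assume x: "x \<in> carrier TG"
      then have "?f x \<in> carrier T"
        by (intro T.M.finsum_closed Pi_I T.smult_closed \<kappa>c bT) (simp_all add: T_simps(1))
      then show "?f x \<in> carrier TG" by (simp only: T_simps(1))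
    next
      fix x y assume xy: "x \<in> carrier TG" "y \<in> carrier TG"
      then have xy': "x \<in> carrier T" "y \<in> carrier T" by (simp_all only: T_simps(1))
      have "?f (x \<oplus>\<^bsub>T\<^esub> y)
        = finsum T (\<lambda>i. \<kappa> i x \<odot>\<^bsub>T\<^esub> tbs ! i \<oplus>\<^bsub>T\<^esub> \<kappa> i y \<odot>\<^bsub>T\<^esub> tbs ! i) {..<rk}"
        using xy' bT by (intro T.M.finsum_cong') (auto simp: \<kappa>a \<kappa>c T.smult_l_distr intro!: T.smult_closed T.M.a_closed simp del: nth_map)
      also have "\<dots> = ?f x \<oplus>\<^bsub>T\<^esub> ?f y"
        using xy' bT by (intro T.M.finsum_addf) (auto simp: \<kappa>c intro!: T.smult_closed simp del: nth_map)
      finally show "?f (x \<otimes>\<^bsub>TG\<^esub> y)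
         = ?f x \<otimes>\<^bsub>TG\<^esub> ?f y"
        by (simp only: T_simps(3))
    qed
    show "(\<lambda>x. x) \<in> hom TG TG" by (auto simp: hom_def)
    show "x \<in> carrier TG" using x by (simp only: T_simps(1))
    fix s m assume sm: "s \<in> carrier S" "m \<in> carrier M"
    have "tens s m = tens s (lin M bs (co m))" using sm by (simp add: lin_co)
    also have "\<dots> = finsum T (\<lambda>i. tens s (co m i \<odot>\<^bsub>M\<^esub> bs ! i)) {..<rk}"
      unfolding lin_def using sm by (intro T_tens_finsum) (auto intro!: smult_closed co_closed bs_closed)
    also have "\<dots> = ?f (tens s m)"
    proof (intro T.M.finsum_cong')
      fix i assume "i \<in> {..<rk}"
      then have i: "i < rk" by simp
      show "tens s (co m i \<odot>\<^bsub>M\<^esub> bs ! i) = \<kappa> i (tens s m) \<odot>\<^bsub>T\<^esub> tbs ! i"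
        using i sm by (simp add: \<kappa>(2) smul_tens \<iota>_closed co_closed bs_closed tens_bilinear(3)[symmetric])
    next
      show "(\<lambda>i. \<kappa> i (tens s m) \<odot>\<^bsub>T\<^esub> tbs ! i) \<in> {..<rk} \<rightarrow> carrier T"
        using sm by (intro Pi_I T.smult_closed \<kappa>c bT) (simp_all add: T_simps(1) tens_closed)
    qed (rule refl)
    finally show "?f (tens s m) = tens s m" by (rule sym)
  qed
  have basis: "lmod_basis S T tbs" unfolding lmod_basis_def
  proof (intro conjI ballI)
    show "set tbs \<subseteq> carrier T" using bT by (auto simp: set_conv_nth)
    fix x assume x: "x \<in> carrier T"
    show "\<exists>!a. is_coords S T tbs x a"
    proof (rule ex1I[of _ "restrict (\<lambda>i. \<kappa> i x) {..<rk}"])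
      have "finsum T (\<lambda>i. restrict (\<lambda>i. \<kappa> i x) {..<rk} i \<odot>\<^bsub>T\<^esub> tbs ! i) {..<rk} = ?f x"
        using x bT by (intro T.M.finsum_cong') (auto intro!: T.smult_closed \<kappa>c simp del: nth_map)
      then show "is_coords S T tbs x (restrict (\<lambda>i. \<kappa> i x) {..<rk})"
        using ex[OF x] \<kappa>c[OF _ x] unfolding is_coords_def by auto
      fix a assume a: "is_coords S T tbs x a"
      then have ac: "a i \<in> carrier S" if "i < rk" for i using that by (auto simp: is_coords_def)
      show "a = restrict (\<lambda>i. \<kappa> i x) {..<rk}"
      proof
        fix i show "a i = restrict (\<lambda>i. \<kappa> i x) {..<rk} i"
          using a uniq[of a i, OF ac] by (cases "i < rk") (auto simp: is_coords_def)
      qed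
    qed
  qed
  show based: "based_module S T tbs" using T_left_module basis by (simp add: based_module_def based_module_axioms_def)
  interpret TB: based_module S T tbs by (rule based)
  show "coords S T tbs (tens s m) i = s \<otimes>\<^bsub>S\<^esub> \<iota> (co m i)" if "s \<in> carrier S" "m \<in> carrier M" "i < rk"
  proof -
    have x: "tens s m \<in> carrier T" using that by (simp add: T_simps(1) tens_closed)
    have "coords S T tbs (tens s m) i = coords S T tbs (lin T tbs (\<lambda>i. \<kappa> i (tens s m))) i"
      using ex[OF x] by (simp add: lin_def)
    also have "\<dots> = \<kappa> i (tens s m)" using that \<kappa>c[OF _ x] by (intro TB.co_lin) auto
    finally show ?thesis using that by (simp add: \<kappa>(2))
  qed
qed

end

lemma base_change_map_hom:
  assumes M: "scalar_extension R S M \<iota>" and N: "scalar_extension R S N \<iota>" and h: "h \<in> lmod_hom R M N"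
  shows "base_change_map R S \<iota> N h \<in> lmod_hom S (base_change R S \<iota> M) (base_change R S \<iota> N)"
    and "\<And>s m. s \<in> carrier S \<Longrightarrow> m \<in> carrier M \<Longrightarrow> base_change_map R S \<iota> N h (tensor R S \<iota> M s m) = tensor R S \<iota> N s (h m)"
proof -
  interpret M: scalar_extension R S M \<iota> by fact
  interpret N: scalar_extension R S N \<iota> by fact
  note hD = lmod_homD[OF h]
  note * = tensor_induced_hom[OF M N, of "\<lambda>s m. s" "\<lambda>s m. h m"]
  let ?h = "base_change_map R S \<iota> N h"
  have hom: "?h \<in> hom M.TG N.TG"
    unfolding base_change_map_def by (intro *(1)) (simp_all add: hD N.tens_bilinear)
  show tens: "?h (M.tens s m) = N.tens s (h m)" if "s \<in> carrier S" "m \<in> carrier M" for s m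
    unfolding base_change_map_def using that by (intro *(2)) (simp_all add: hD N.tens_bilinear)
  show "?h \<in> lmod_hom S (base_change R S \<iota> M) (base_change R S \<iota> N)" unfolding lmod_hom_def
  proof (intro CollectI conjI ballI)
    show "?h \<in> carrier M.T \<rightarrow> carrier N.T" using hom_closed[OF hom] unfolding M.T_simps(1) N.T_simps(1) by blast
    fix x y assume "x \<in> carrier M.T" "y \<in> carrier M.T"
    then show "?h (x \<oplus>\<^bsub>M.T\<^esub> y) = ?h x \<oplus>\<^bsub>N.T\<^esub> ?h y"
      using hom_mult[OF hom] unfolding M.T_simps(1,3) N.T_simps(3) by blast
  next
    fix a x assume a: "a \<in> carrier S" and x: "x \<in> carrier M.T"
    show "?h (a \<odot>\<^bsub>M.T\<^esub> x) = a \<odot>\<^bsub>N.T\<^esub> ?h x"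
    proof (rule M.TG_hom_eq[OF N.TG.group_axioms])
      show "(\<lambda>x. ?h (a \<odot>\<^bsub>M.T\<^esub> x)) \<in> hom M.TG N.TG"
        using hom M.smul_hom[OF a] by (auto simp: hom_def Pi_def)
      show "(\<lambda>x. a \<odot>\<^bsub>N.T\<^esub> ?h x) \<in> hom M.TG N.TG"
        using hom N.smul_hom[OF a] by (auto simp: hom_def Pi_def)
    qed (use a x in \<open>simp_all add: M.smul_tens N.smul_tens tens hD M.T_simps(1)\<close>)
  qed
qed

section \<open>Acyclicity of the completed complex\<close>

lemma choice2: "(\<And>k g. \<exists>z. P k g z) \<Longrightarrow> \<exists>v. \<forall>k g. P k g (v k g)"
  by metis

lemma padic_norm_pos: "a \<noteq> 0 \<Longrightarrow> padic_norm a > 0" for a :: "'p::prime_card padic"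
  using padic_norm_eq_0_iff[of a] padic_norm_nonneg[of a] by (simp add: less_le)

lemma padic_series:
  fixes a :: "nat \<Rightarrow> int"
  shows "\<exists>L :: 'p::prime_card padic. \<forall>m. padic_norm (L - (\<Sum>n<m. of_nat CARD('p) ^ n * of_int (a n))) \<le> (1 / CARD('p)) ^ m"
proof -
  let ?p = "of_nat CARD('p) :: 'p padic"
  let ?Y = "\<lambda>m. \<Sum>n<m. ?p ^ n * of_int (a n)"
  have p1: "real CARD('p) > 1" using padic_prime_gt_1[where 'p = 'p] by simp
  have d: "padic_norm (?Y k - ?Y m) \<le> (1 / CARD('p)) ^ m" if "m \<le> k" for k m
  proof -
    have "?Y k - ?Y m = (\<Sum>n\<in>{..<k} - {..<m}. ?p ^ n * of_int (a n))"
      using that by (subst sum_diff) auto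
    moreover have "padic_norm (?p ^ n * of_int (a n)) \<le> (1 / CARD('p)) ^ m" if "n \<in> {..<k} - {..<m}" for n
    proof -
      have "padic_norm (?p ^ n * of_int (a n)) \<le> (1 / CARD('p)) ^ n * 1"
        unfolding padic_norm_mult padic_norm_power padic_norm_prime by (intro mult_left_mono padic_norm_of_int_le) auto
      also have "\<dots> \<le> (1 / CARD('p)) ^ m * 1"
        using that p1 by (intro mult_right_mono power_decreasing) auto
      finally show ?thesis by simp
    qed
    ultimately show ?thesis by (simp only:) (rule padic_norm_sum_le, auto)
  qed
  have sm: "\<exists>k. (1 / CARD('p)) ^ k < e" if "e > 0" for e :: real
    using that p1 by (intro real_arch_pow_inv) auto
  have "Cauchy ?Y" unfolding Cauchy_def dist_padic_def
  proof (intro allI impI)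
    fix e :: real assume "e > 0"
    then obtain k where k: "(1 / CARD('p)) ^ k < e" using sm by blast
    have "padic_norm (?Y m - ?Y n) < e" if "m \<ge> k" "n \<ge> k" for m n
      using padic_norm_diff_le[OF d[OF that(1)] d[OF that(2)]] k by simp
    then show "\<exists>k. \<forall>m\<ge>k. \<forall>n\<ge>k. padic_norm (?Y m - ?Y n) < e" by blast
  qed
  then obtain L where L: "?Y \<longlonglongrightarrow> L" using Cauchy_convergent convergent_def by blast
  have "padic_norm (L - ?Y m) \<le> (1 / CARD('p)) ^ m" for m
  proof -
    have "eventually (\<lambda>n. dist (?Y n) L < (1 / CARD('p)) ^ m) sequentially"
      using L p1 unfolding tendsto_iff by (auto dest!: spec[of _ "(1 / CARD('p)) ^ m"])
    then obtain N where N: "\<And>n. n \<ge> N \<Longrightarrow> padic_norm (?Y n - L) < (1 / CARD('p)) ^ m"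
      unfolding eventually_sequentially dist_padic_def by blast
    have "padic_norm ((?Y (max N m) - ?Y m) - (?Y (max N m) - L)) \<le> (1 / CARD('p)) ^ m"
      using N[of "max N m"] by (intro padic_norm_diff_le[OF d, of m "max N m"]) auto
    then show ?thesis by simp
  qed
  then show ?thesis by blast
qed

context group
begin

text \<open>
  The coordinates of a boundary: a row vector over a group ring times a matrix of integral group ring
  elements.  Integral and \<open>p\<close>-adic coefficients are treated alike.
\<close>

definition act :: "nat \<Rightarrow> (nat \<Rightarrow> nat \<Rightarrow> 'a \<Rightarrow> int) \<Rightarrow> (nat \<Rightarrow> 'a \<Rightarrow> 'r::comm_ring_1) \<Rightarrow> nat \<Rightarrow> 'a \<Rightarrow> 'r" where
  "act r d x l g = (\<Sum>k<r. rconv (x k) (d k l) g)"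

lemma rconv_linear:
  "rconv (\<lambda>g. a g + b g) d g = rconv a d g + rconv b d g"
  "rconv (\<lambda>g. a g - b g) d g = rconv a d g - rconv b d g"
  "rconv (\<lambda>g. c * a g) d g = c * rconv a d g"
  by (auto simp: rconv_def distrib_right left_diff_distrib sum.distrib sum_subtractf sum_distrib_left mult.assoc)

lemma act_linear:
  "act r d (\<lambda>k g. a k g + b k g) l g = act r d a l g + act r d b l g"
  "act r d (\<lambda>k g. a k g - b k g) l g = act r d a l g - act r d b l g"
  "act r d (\<lambda>k g. c * a k g) l g = c * act r d a l g"
  by (auto simp: act_def rconv_linear sum.distrib sum_subtractf sum_distrib_left)

lemma act_of_int: "act r d (\<lambda>k g. of_int (a k g)) l g = (of_int (act r d a l g) :: 'r::comm_ring_1)"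
proof -
  have "rconv (\<lambda>g. of_int (a g)) d g = (of_int (rconv a d g) :: 'r)" for a d by (simp add: rconv_def)
  then show ?thesis by (simp add: act_def)
qed

lemma act_cong: "(\<And>k g. k < r \<Longrightarrow> g \<in> carrier G \<Longrightarrow> a k g = b k g) \<Longrightarrow>
    (\<And>k u. k < r \<Longrightarrow> d k l u \<noteq> 0 \<Longrightarrow> u \<in> carrier G) \<Longrightarrow> act r d a l g = act r d b l g"
  unfolding act_def rconv_def by (intro sum.cong refl if_cong) auto

lemma act_norm_le:
  fixes x :: "nat \<Rightarrow> 'a \<Rightarrow> 'p::prime_card padic"
  assumes "\<And>k g. k < r \<Longrightarrow> padic_norm (x k g) \<le> e" "e \<ge> 0"
  shows "padic_norm (act r d x l g) \<le> e"
proof -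
  have "padic_norm (rconv (x k) (d k l) g) \<le> e" if k: "k < r" for k
  proof -
    have "padic_norm (x k (g \<otimes> inv u) * of_int (d k l u)) \<le> e * 1" for u
      unfolding padic_norm_mult using assms k by (intro mult_mono padic_norm_of_int_le) auto
    then show ?thesis unfolding rconv_def using assms(2) by (auto intro!: padic_norm_sum_le)
  qed
  then show ?thesis unfolding act_def using assms(2) by (intro padic_norm_sum_le) auto
qed

definition int_vec :: "nat \<Rightarrow> (nat \<Rightarrow> 'a \<Rightarrow> int) \<Rightarrow> bool" where
  "int_vec r v \<longleftrightarrow> (\<forall>k<r. v k \<in> carrier (int_group_ring G))"

definition c0_vec :: "nat \<Rightarrow> (nat \<Rightarrow> 'a \<Rightarrow> 'p::prime_card padic) \<Rightarrow> bool" where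
  "c0_vec r x \<longleftrightarrow> (\<forall>k<r. x k \<in> carrier (c0 G))"

text \<open>
  Approximation by integral vectors modulo \<open>p^n\<close>.  Entries divisible by \<open>p^n\<close> are approximated by
  zero, so that the support becomes finite.
\<close>

lemma int_vec_approx:
  fixes x :: "nat \<Rightarrow> 'a \<Rightarrow> 'p::prime_card padic"
  assumes x: "c0_vec r x" and le: "\<And>k g. k < r \<Longrightarrow> padic_norm (x k g) \<le> 1"
  shows "\<exists>v x'. int_vec r v \<and> c0_vec r x' \<and> (\<forall>k<r. \<forall>g. padic_norm (x' k g) \<le> 1) \<and>
     (\<forall>k<r. \<forall>g. x k g = of_int (v k g) + of_nat CARD('p) ^ n * x' k g)"
proof -
  let ?p = "of_nat CARD('p) ^ n :: 'p padic"
  have pn: "padic_norm ?p = (1 / CARD('p)) ^ n" by (simp add: padic_norm_power padic_norm_prime)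
  have pnz: "?p \<noteq> 0" using padic_prime_neq_0[where 'p = 'p] by simp
  have pp: "(1 / real CARD('p)) ^ n > 0" using padic_prime_gt_1[where 'p = 'p] by simp
  have ex: "\<exists>z b. k < r \<longrightarrow> x k g = of_int z + ?p * b \<and> padic_norm b \<le> 1 \<and> (padic_norm (x k g) \<le> padic_norm ?p \<longrightarrow> z = 0)" for k g
  proof (cases "k < r")
    case k: True
    show ?thesis
    proof (cases "padic_norm (x k g) \<le> padic_norm ?p")
      case True
      then have "padic_norm (x k g / ?p) \<le> 1" unfolding padic_norm_divide pn using pp by (simp add: divide_le_eq)
      then show ?thesis using True pnz by (intro exI[of _ 0] exI[of _ "x k g / ?p"]) auto
    next
      case False
      then show ?thesis using padic_int_approx[OF le[OF k, of g], of n] by metis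
    qed
  qed simp
  then have "\<exists>v. \<forall>k g. \<exists>b. k < r \<longrightarrow> x k g = of_int (v k g) + ?p * b \<and> padic_norm b \<le> 1 \<and> (padic_norm (x k g) \<le> padic_norm ?p \<longrightarrow> v k g = 0)"
    by (intro choice2 ex)
  then obtain v where v: "\<And>k g. \<exists>b. k < r \<longrightarrow> x k g = of_int (v k g) + ?p * b \<and> padic_norm b \<le> 1 \<and> (padic_norm (x k g) \<le> padic_norm ?p \<longrightarrow> v k g = 0)"
    by blast
  define x' where "x' k g = (x k g - of_int (v k g)) / ?p" for k g
  have e: "x k g = of_int (v k g) + ?p * x' k g" for k g using pnz by (simp add: x'_def)
  have x'le: "padic_norm (x' k g) \<le> 1" if "k < r" for k g
    using v[of k g] that pnz by (auto simp: x'_def)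
  have v0: "v k g = 0" if "k < r" "padic_norm (x k g) \<le> padic_norm ?p" for k g using v[of k g] that by auto
  have iv: "int_vec r v" unfolding int_vec_def group_ring_simps
  proof (intro allI impI CollectI conjI)
    fix k assume k: "k < r"
    have nx: "null_fam (x k)" and ox: "\<And>g. g \<notin> carrier G \<Longrightarrow> x k g = 0" using x k by (auto simp: c0_vec_def c0_simps)
    have "{g. v k g \<noteq> 0} \<subseteq> {g. padic_norm (x k g) \<ge> padic_norm ?p}" using v0[OF k] by force
    then show "finite {g. v k g \<noteq> 0}" by (rule finite_subset) (rule null_famD[OF nx], use pp pn in simp)
    show "v k g = 0" if "g \<notin> carrier G" for g using v0[OF k, of g] ox[OF that] by simp
  qed
  have "c0_vec r x'" unfolding c0_vec_def c0_simps
  proof (intro allI impI CollectI conjI)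
    fix k assume k: "k < r"
    have nx: "null_fam (x k)" and ox: "\<And>g. g \<notin> carrier G \<Longrightarrow> x k g = 0" using x k by (auto simp: c0_vec_def c0_simps)
    have "null_fam (\<lambda>g. - of_int (v k g) :: 'p padic)"
      using iv k by (intro null_fam_finite) (simp add: int_vec_def group_ring_simps)
    from null_fam_add[OF nx this] have "null_fam (\<lambda>g. x k g - of_int (v k g))" by simp
    then show "null_fam (x' k)"
    proof (rule null_fam_mono[where c = "inverse (padic_norm ?p)"])
      show "padic_norm (x' k g) \<le> inverse (padic_norm ?p) * padic_norm (x k g - of_int (v k g))" for g
        unfolding x'_def padic_norm_divide by (simp only: divide_inverse mult.commute order_refl)
    qed (use pp pn in simp)
    show "x' k g = 0" if "g \<notin> carrier G" for g
      using ox[OF that] iv k that by (simp add: x'_def int_vec_def group_ring_simps)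
  qed
  then show ?thesis using iv x'le e by blast
qed

text \<open>
  Successive approximation: if every integral cycle is, up to a multiple of \<open>p\<close>, the boundary of an
  integral vector, then summing up the successive corrections shows that every cycle is a boundary.
\<close>

lemma padic_exact_of_approx:
  fixes x :: "nat \<Rightarrow> 'a \<Rightarrow> 'p::prime_card padic"
  assumes d2: "\<And>k l. k < r2 \<Longrightarrow> l < r1 \<Longrightarrow> d2 k l \<in> carrier (int_group_ring G)"
    and step: "\<And>x :: nat \<Rightarrow> 'a \<Rightarrow> 'p padic. c0_vec r1 x \<Longrightarrow> (\<And>k g. k < r1 \<Longrightarrow> padic_norm (x k g) \<le> 1) \<Longrightarrow>
       (\<And>l g. l < r0 \<Longrightarrow> act r1 d1 x l g = 0) \<Longrightarrow>
       \<exists>v x'. int_vec r2 v \<and> c0_vec r1 x' \<and> (\<forall>k<r1. \<forall>g. padic_norm (x' k g) \<le> 1) \<and>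
         (\<forall>l<r0. \<forall>g. act r1 d1 x' l g = 0) \<and>
         (\<forall>k<r1. \<forall>g. x k g = of_int (act r2 d2 v k g) + of_nat CARD('p) * x' k g)"
    and x: "c0_vec r1 x" and cyc: "\<And>l g. l < r0 \<Longrightarrow> act r1 d1 x l g = 0"
  shows "\<exists>y. c0_vec r2 y \<and> (\<forall>k<r1. \<forall>g. x k g = act r2 d2 y k g)"
proof -
  let ?p = "of_nat CARD('p) :: 'p padic"
  have p1: "real CARD('p) > 1" using padic_prime_gt_1[where 'p = 'p] by simp
  have pnz: "?p \<noteq> 0" by (rule padic_prime_neq_0)
  have sm: "\<exists>k. (1 / CARD('p)) ^ k < e" if "e > 0" for e :: real
    using that p1 by (intro real_arch_pow_inv) auto
  have pn: "padic_norm (?p ^ n) = (1 / CARD('p)) ^ n" for n by (simp add: padic_norm_power padic_norm_prime)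
  define good where "good x \<longleftrightarrow> c0_vec r1 x \<and> (\<forall>k<r1. \<forall>g. padic_norm (x k g) \<le> 1) \<and> (\<forall>l<r0. \<forall>g. act r1 d1 x l g = 0)"
    for x :: "nat \<Rightarrow> 'a \<Rightarrow> 'p padic"
  have main: "\<exists>y. c0_vec r2 y \<and> (\<forall>k<r1. \<forall>g. x k g = act r2 d2 y k g)" if x: "good x" for x
  proof -
    define Q where "Q x vx \<longleftrightarrow> int_vec r2 (fst vx) \<and> good (snd vx) \<and>
         (\<forall>k<r1. \<forall>g. x k g = of_int (act r2 d2 (fst vx) k g) + ?p * snd vx k g)" for x and vx :: "(nat \<Rightarrow> 'a \<Rightarrow> int) \<times> (nat \<Rightarrow> 'a \<Rightarrow> 'p padic)"
    have Qex: "\<exists>vx. Q x vx" if "good x" for x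
    proof -
      obtain v x' where "int_vec r2 v" "c0_vec r1 x'" "\<forall>k<r1. \<forall>g. padic_norm (x' k g) \<le> 1"
        "\<forall>l<r0. \<forall>g. act r1 d1 x' l g = 0" "\<forall>k<r1. \<forall>g. x k g = of_int (act r2 d2 v k g) + ?p * x' k g"
        using step[of x] \<open>good x\<close> unfolding good_def by blast
      then have "Q x (v, x')" by (simp add: Q_def good_def)
      then show ?thesis by blast
    qed
    define nxt where "nxt x = (SOME vx. Q x vx)" for x
    have nxt: "Q x (nxt x)" if "good x" for x unfolding nxt_def using Qex[OF that] by (rule someI_ex)
    define X where "X n = ((\<lambda>x. snd (nxt x)) ^^ n) x" for n
    define V where "V n = fst (nxt (X n))" for n
    have X0: "X 0 = x" and XS: "X (Suc n) = snd (nxt (X n))" for n by (simp_all add: X_def)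
    have gX: "good (X n)" for n
    proof (induction n)
      case (Suc n) then show ?case using nxt[of "X n"] by (simp add: XS Q_def)
    qed (simp add: X0 x)
    have iV: "int_vec r2 (V n)" for n using nxt[OF gX, of n] by (simp add: Q_def V_def)
    have stp: "X n k g = of_int (act r2 d2 (V n) k g) + ?p * X (Suc n) k g" if "k < r1" for n k g
      using nxt[OF gX, of n] that by (simp add: Q_def V_def XS)
    define Y where "Y m k g = (\<Sum>n<m. ?p ^ n * of_int (V n k g))" for m k g
    have "\<exists>L. \<forall>m. padic_norm (L - Y m k g) \<le> (1 / CARD('p)) ^ m" for k g
      unfolding Y_def by (rule padic_series)
    then have "\<exists>y. \<forall>k g. \<forall>m. padic_norm (y k g - Y m k g) \<le> (1 / CARD('p)) ^ m"
      by (rule choice2)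
    then obtain y where y: "\<And>k g m. padic_norm (y k g - Y m k g) \<le> (1 / CARD('p)) ^ m" by blast
    have xY: "x k g = act r2 d2 (Y m) k g + ?p ^ m * X m k g" if k: "k < r1" for m k g
    proof (induction m)
      case 0
      have "act r2 d2 (Y 0) k g = 0" by (cases "g \<in> carrier G") (simp_all add: act_def rconv_def Y_def)
      then show ?case by (simp add: X0)
    next
      case (Suc m)
      have "Y (Suc m) = (\<lambda>k g. Y m k g + ?p ^ m * of_int (V m k g))" by (simp add: Y_def fun_eq_iff)
      then have "act r2 d2 (Y (Suc m)) k g = act r2 d2 (Y m) k g + ?p ^ m * of_int (act r2 d2 (V m) k g)"
        by (simp only: act_linear act_of_int)
      then show ?case using Suc stp[OF k, of m g] by (simp add: algebra_simps)
    qed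
    have Yout: "Y m k g = 0" if "k < r2" "g \<notin> carrier G" for m k g
      using iV that by (simp add: Y_def int_vec_def group_ring_simps)
    have Yfin: "finite {g. Y m k g \<noteq> 0}" if "k < r2" for m k
    proof -
      have "{g. Y m k g \<noteq> 0} \<subseteq> (\<Union>n<m. {g. V n k g \<noteq> 0})"
        unfolding Y_def by (auto simp: sum.neutral) (metis (mono_tags, lifting) lessThan_iff mult_zero_right of_int_0 sum.neutral)
      moreover have "finite (\<Union>n<m. {g. V n k g \<noteq> 0})" using iV that by (auto simp: int_vec_def group_ring_simps)
      ultimately show ?thesis by (rule finite_subset)
    qed
    have "c0_vec r2 y" unfolding c0_vec_def c0_simps
    proof (intro allI impI CollectI conjI)
      fix k assume k: "k < r2"
      show "null_fam (y k)" unfolding null_fam_def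
      proof (intro allI impI)
        fix e :: real assume "e > 0"
        then obtain m where m: "(1 / CARD('p)) ^ m < e" using sm by blast
        have "{g. padic_norm (y k g) \<ge> e} \<subseteq> {g. Y m k g \<noteq> 0}"
          using y[of k _ m] m by (auto simp: not_le[symmetric]) (metis diff_zero le_less_trans not_le)
        then show "finite {g. padic_norm (y k g) \<ge> e}" using Yfin[OF k] by (rule finite_subset)
      qed
      show "y k g = 0" if g: "g \<notin> carrier G" for g
      proof (rule ccontr)
        assume "y k g \<noteq> 0"
        then have "padic_norm (y k g) > 0" by (rule padic_norm_pos)
        then obtain m where "(1 / CARD('p)) ^ m < padic_norm (y k g)" using sm by blast
        then show False using y[of k g m] Yout[OF k g, of m] by simp
      qed
    qed
    moreover have "x k g = act r2 d2 y k g" if k: "k < r1" for k g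
    proof (rule ccontr)
      assume ne: "x k g \<noteq> act r2 d2 y k g"
      then have "padic_norm (x k g - act r2 d2 y k g) > 0"
        by (intro padic_norm_pos) simp
      then obtain m where m: "(1 / CARD('p)) ^ m < padic_norm (x k g - act r2 d2 y k g)" using sm by blast
      have e: "x k g - act r2 d2 y k g = ?p ^ m * X m k g - act r2 d2 (\<lambda>k g. y k g - Y m k g) k g"
        unfolding act_linear using xY[OF k, of g m] by simp
      have "padic_norm (?p ^ m * X m k g) \<le> (1 / CARD('p)) ^ m"
        using gX[of m] k unfolding padic_norm_mult pn good_def by (intro mult_left_le) auto
      moreover have "padic_norm (act r2 d2 (\<lambda>k g. y k g - Y m k g) k g) \<le> (1 / CARD('p)) ^ m"
        by (rule act_norm_le) (use y in auto)
      ultimately have "padic_norm (x k g - act r2 d2 y k g) \<le> (1 / CARD('p)) ^ m"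
        unfolding e by (rule padic_norm_diff_le)
      with m show False by simp
    qed
    ultimately show ?thesis by blast
  qed
  have "\<exists>B>0. \<forall>k<r1. \<forall>g. padic_norm (x k g) \<le> B"
  proof -
    have "\<exists>B. k < r1 \<longrightarrow> B > 0 \<and> (\<forall>g. padic_norm (x k g) \<le> B)" for k
    proof (cases "k < r1")
      case True
      then have "null_fam (x k)" using x by (simp add: c0_vec_def c0_simps)
      then show ?thesis using null_fam_bounded[of "x k"] by blast
    qed simp
    then obtain B where B: "\<And>k. k < r1 \<Longrightarrow> B k > 0 \<and> (\<forall>g. padic_norm (x k g) \<le> B k)" by metis
    have "padic_norm (x k g) \<le> 1 + (\<Sum>k<r1. B k)" if "k < r1" for k g
    proof -
      have "padic_norm (x k g) \<le> B k" using B[OF that] by simp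
      also have "B k \<le> (\<Sum>k<r1. B k)" using B that by (intro member_le_sum) (auto simp: less_imp_le)
      finally show ?thesis by simp
    qed
    moreover have "1 + (\<Sum>k<r1. B k) > 0" using B by (intro add_pos_nonneg sum_nonneg) (auto simp: less_imp_le)
    ultimately show ?thesis by blast
  qed
  then obtain B where B: "B > 0" "\<And>k g. k < r1 \<Longrightarrow> padic_norm (x k g) \<le> B" by blast
  have "1 / B > 0" using B by simp
  then obtain m where m: "(1 / CARD('p)) ^ m < 1 / B" using sm by blast
  define z where "z k g = ?p ^ m * x k g" for k g
  have "good z" unfolding good_def
  proof (intro conjI allI impI)
    show "c0_vec r1 z" unfolding c0_vec_def
    proof (intro allI impI)
      fix k assume "k < r1"
      then have "x k \<in> carrier (c0 G)" using x by (simp add: c0_vec_def)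
      then show "z k \<in> carrier (c0 G)" unfolding c0_simps
        using p1 by (auto simp: z_def padic_norm_mult pn intro!: null_fam_mono[of "x k" "padic_norm (?p ^ m)" "z k"])
    qed
    show "padic_norm (z k g) \<le> 1" if "k < r1" for k g
    proof -
      have "padic_norm (z k g) \<le> (1 / B) * B" unfolding z_def padic_norm_mult pn
        using m B that by (intro mult_mono) auto
      then show ?thesis using B by simp
    qed
    show "act r1 d1 z l g = 0" if "l < r0" for l g
      using cyc[OF that] unfolding z_def[abs_def] act_linear by simp
  qed
  from main[OF this] obtain y where y: "c0_vec r2 y" "\<forall>k<r1. \<forall>g. z k g = act r2 d2 y k g" by blast
  define w where "w k g = inverse (?p ^ m) * y k g" for k g
  have "c0_vec r2 w" unfolding c0_vec_def
  proof (intro allI impI)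
    fix k assume "k < r2"
    then have "y k \<in> carrier (c0 G)" using y by (simp add: c0_vec_def)
    then have ny: "null_fam (y k)" and oy: "\<forall>g. g \<notin> carrier G \<longrightarrow> y k g = 0" by (auto simp: c0_simps)
    have "padic_norm (inverse (?p ^ m)) > 0" unfolding padic_norm_inverse pn using p1 by simp
    from null_fam_mono[OF ny this, of "w k"] have "null_fam (w k)" by (simp add: w_def padic_norm_mult)
    then show "w k \<in> carrier (c0 G)" using oy by (simp add: c0_simps w_def)
  qed
  moreover have "x k g = act r2 d2 w k g" if "k < r1" for k g
    using y(2) that pnz unfolding w_def[abs_def] act_linear by (auto simp: z_def field_simps)
  ultimately show ?thesis by blast
qed

end

lemma padic_norm_int_dvd:
  assumes "padic_norm (of_int m :: 'p::prime_card padic) \<le> (1 / CARD('p)) ^ n"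
  shows "int CARD('p) ^ n dvd m"
  using assms
proof (induction n arbitrary: m)
  case (Suc n)
  have p1: "real CARD('p) > 1" using padic_prime_gt_1[where 'p = 'p] by simp
  have "(1 / real CARD('p)) ^ Suc n < 1" using p1 by (intro power_Suc_less_one) auto
  then have "int CARD('p) dvd m" using Suc.prems padic_norm_int_less_1_iff[of m, where 'p = 'p] by linarith
  then obtain k where k: "m = int CARD('p) * k" by auto
  have "1 / CARD('p) * padic_norm (of_int k :: 'p padic) \<le> (1 / CARD('p)) * (1 / CARD('p)) ^ n"
    using Suc.prems unfolding k by (simp add: padic_norm_mult padic_norm_prime)
  then have "padic_norm (of_int k :: 'p padic) \<le> (1 / CARD('p)) ^ n"
    by (rule mult_left_le_imp_le) (use p1 in simp)
  from Suc.IH[OF this] show ?case unfolding k by simp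
qed simp

lemma finsum_pointwise:
  assumes R: "abelian_monoid R" and z: "\<zero>\<^bsub>R\<^esub> = (\<lambda>_. 0)" and a: "\<And>x y. x \<oplus>\<^bsub>R\<^esub> y = (\<lambda>g. x g + y g)"
    and A: "finite A" "\<And>i. i \<in> A \<Longrightarrow> f i \<in> carrier R"
  shows "finsum R f A g = (\<Sum>i\<in>A. f i g :: 'r::comm_monoid_add)"
proof -
  interpret abelian_monoid R by fact
  show ?thesis using A
    by (induction A rule: finite_induct) (simp_all add: z a finsum_insert Pi_def)
qed

locale fl_resolution = group G for G :: "'g monoid" (structure) +
  fixes M :: "('g \<Rightarrow> int, 'm) module" and F :: "('g \<Rightarrow> int, 'f) based_complex" and \<epsilon> :: "'f \<Rightarrow> 'm"
  assumes lm: "left_module (int_group_ring G) M" and res: "based_resolution (int_group_ring G) M F \<epsilon>"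
begin

abbreviation "R \<equiv> int_group_ring G"
abbreviation "r \<nu> \<equiv> length (basis_at F \<nu>)"

abbreviation "coord \<nu> \<equiv> coords R (chain F \<nu>) (basis_at F \<nu>)"
abbreviation "comb \<nu> \<equiv> lin (chain F \<nu>) (basis_at F \<nu>)"

definition dm :: "nat \<Rightarrow> nat \<Rightarrow> nat \<Rightarrow> 'g \<Rightarrow> int" where
  "dm \<nu> k l = coord \<nu> (boundary F (Suc \<nu>) (basis_at F (Suc \<nu>) ! k)) l"

abbreviation bd :: "nat \<Rightarrow> (nat \<Rightarrow> 'g \<Rightarrow> 'r::comm_ring_1) \<Rightarrow> nat \<Rightarrow> 'g \<Rightarrow> 'r" where
  "bd \<nu> \<equiv> act (r (Suc \<nu>)) (dm \<nu>)"

lemma mod: "based_module R (chain F \<nu>) (basis_at F \<nu>)"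
  using res by (simp add: based_resolution_def based_module_def based_module_axioms_def)

lemma lmod: "left_module R (chain F \<nu>)" using mod by (simp add: based_module_def)

lemma R_ring: "ring R" using lm by (simp add: left_module_def)

lemma bd_hom: "boundary F (Suc \<nu>) \<in> lmod_hom R (chain F (Suc \<nu>)) (chain F \<nu>)"
  using res by (simp add: based_resolution_def)

lemma \<epsilon>_hom: "\<epsilon> \<in> lmod_hom R (chain F 0) M" using res by (simp add: based_resolution_def)

lemma \<epsilon>_surj: "\<epsilon> ` carrier (chain F 0) = carrier M" using res by (simp add: based_resolution_def)

lemma exact0: "{x \<in> carrier (chain F 0). \<epsilon> x = \<zero>\<^bsub>M\<^esub>} = boundary F (Suc 0) ` carrier (chain F (Suc 0))"
  using res by (simp add: based_resolution_def)

lemma exactS: "{x \<in> carrier (chain F (Suc \<nu>)). boundary F (Suc \<nu>) x = \<zero>\<^bsub>chain F \<nu>\<^esub>}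
          = boundary F (Suc (Suc \<nu>)) ` carrier (chain F (Suc (Suc \<nu>)))"
  using res by (simp add: based_resolution_def)

lemma r_top: "\<nu> > top_degree F \<Longrightarrow> r \<nu> = 0" using res by (simp add: based_resolution_def)

lemma dm_closed:
  assumes "k < r (Suc \<nu>)" "l < r \<nu>"
  shows "dm \<nu> k l \<in> carrier R"
proof -
  interpret A: based_module R "chain F \<nu>" "basis_at F \<nu>" by (rule mod)
  interpret B: based_module R "chain F (Suc \<nu>)" "basis_at F (Suc \<nu>)" by (rule mod)
  show ?thesis unfolding dm_def using assms lmod_homD(1)[OF bd_hom] B.bs_closed by (intro A.co_closed) auto
qed

lemma finsum_R: "finite A \<Longrightarrow> (\<And>i. i \<in> A \<Longrightarrow> f i \<in> carrier R) \<Longrightarrow> finsum R f A g = (\<Sum>i\<in>A. f i g)"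
  by (rule finsum_pointwise) (auto simp: group_ring_simps intro!: ring.is_abelian_group abelian_group.axioms R_ring)

lemma co_bd:
  assumes x: "x \<in> carrier (chain F (Suc \<nu>))" and l: "l < r \<nu>"
  shows "coord \<nu> (boundary F (Suc \<nu>) x) l g
    = bd \<nu> (coord (Suc \<nu>) x) l g"
proof -
  interpret R: ring R by (rule R_ring)
  interpret B: based_module R "chain F (Suc \<nu>)" "basis_at F (Suc \<nu>)" by (rule mod)
  have c: "B.co x k \<otimes>\<^bsub>R\<^esub> dm \<nu> k l = rconv (B.co x k) (dm \<nu> k l)" "B.co x k \<otimes>\<^bsub>R\<^esub> dm \<nu> k l \<in> carrier R" if "k < r (Suc \<nu>)" for k
    using that l x by (simp_all add: group_ring_mult_eq_rconv[symmetric] B.co_closed dm_closed)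
  show ?thesis
    unfolding coords_hom[OF mod mod bd_hom x l] dm_def[symmetric] act_def
    using c by (subst finsum_R) (auto intro!: sum.cong simp: fun_eq_iff)
qed

lemma lin_vec:
  assumes "int_vec (r \<nu>) v"
  shows "comb \<nu> v \<in> carrier (chain F \<nu>)"
    "k < r \<nu> \<Longrightarrow> coord \<nu> (comb \<nu> v) k = v k"
proof -
  interpret A: based_module R "chain F \<nu>" "basis_at F \<nu>" by (rule mod)
  show "comb \<nu> v \<in> carrier (chain F \<nu>)"
    using assms by (intro A.lin_closed) (simp add: int_vec_def)
  show "k < r \<nu> \<Longrightarrow> A.co (comb \<nu> v) k = v k"
    using assms by (intro A.co_lin) (simp_all add: int_vec_def)
qed

lemma co_vec: "x \<in> carrier (chain F \<nu>) \<Longrightarrow> int_vec (r \<nu>) (coord \<nu> x)"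
  using based_module.co_closed[OF mod] by (simp add: int_vec_def)

lemma dm_support: "k < r (Suc \<nu>) \<Longrightarrow> l < r \<nu> \<Longrightarrow> dm \<nu> k l u \<noteq> 0 \<Longrightarrow> u \<in> carrier G"
  using dm_closed[of k \<nu> l] by (auto simp: group_ring_simps)

lemma co_bd_lin:
  assumes "int_vec (r (Suc \<nu>)) v" "l < r \<nu>"
  shows "coord \<nu> (boundary F (Suc \<nu>) (comb (Suc \<nu>) v)) l g
    = bd \<nu> v l g"
  unfolding co_bd[OF lin_vec(1)[OF assms(1)] assms(2)]
  using assms dm_support by (intro act_cong) (auto simp: lin_vec(2))

lemma act_vec:
  assumes "int_vec (r (Suc \<nu>)) v"
  shows "int_vec (r \<nu>) (bd \<nu> v)"
  unfolding int_vec_def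
proof (intro allI impI)
  fix l assume l: "l < r \<nu>"
  let ?x = "boundary F (Suc \<nu>) (comb (Suc \<nu>) v)"
  have "?x \<in> carrier (chain F \<nu>)" using lin_vec(1)[OF assms] by (rule lmod_homD(1)[OF bd_hom])
  from co_vec[OF this] have "coord \<nu> ?x l \<in> carrier R" using l by (simp add: int_vec_def)
  moreover have "coord \<nu> ?x l = bd \<nu> v l"
    by (rule ext) (rule co_bd_lin[OF assms l])
  ultimately show "bd \<nu> v l \<in> carrier R" by simp
qed

lemma vec_eq_boundary:
  assumes v: "int_vec (r \<nu>) v" and y: "y \<in> carrier (chain F (Suc \<nu>))"
    and e: "comb \<nu> v = boundary F (Suc \<nu>) y"
  shows "\<exists>w. int_vec (r (Suc \<nu>)) w \<and> (\<forall>k<r \<nu>. \<forall>g. v k g = bd \<nu> w k g)"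
  using co_vec[OF y] co_bd[OF y] lin_vec(2)[OF v] unfolding e by metis

lemma int_cycle_boundary:
  assumes v: "int_vec (r (Suc \<nu>)) v" and c: "\<And>l g. l < r \<nu> \<Longrightarrow> bd \<nu> v l g = 0"
  shows "\<exists>w. int_vec (r (Suc (Suc \<nu>))) w \<and> (\<forall>k<r (Suc \<nu>). \<forall>g. v k g = bd (Suc \<nu>) w k g)"
proof -
  interpret A: based_module R "chain F \<nu>" "basis_at F \<nu>" by (rule mod)
  let ?x = "comb (Suc \<nu>) v"
  have x: "?x \<in> carrier (chain F (Suc \<nu>))" by (rule lin_vec(1)[OF v])
  have "boundary F (Suc \<nu>) ?x = \<zero>\<^bsub>chain F \<nu>\<^esub>"
  proof (rule A.eq_iff_co)
    show "A.co (boundary F (Suc \<nu>) ?x) l = A.co \<zero>\<^bsub>chain F \<nu>\<^esub> l" if "l < r \<nu>" for l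
      using that by (auto simp: co_bd_lin[OF v] c A.co_zero group_ring_simps fun_eq_iff)
  qed (use x lmod_homD(1)[OF bd_hom] in auto)
  then have "?x \<in> boundary F (Suc (Suc \<nu>)) ` carrier (chain F (Suc (Suc \<nu>)))" using x exactS[of \<nu>] by blast
  then show ?thesis using vec_eq_boundary[OF v] by blast
qed

lemma act_act:
  assumes w: "int_vec (r (Suc (Suc \<nu>))) w" and l: "l < r \<nu>"
  shows "bd \<nu> (bd (Suc \<nu>) w) l g = 0"
proof -
  interpret A: based_module R "chain F \<nu>" "basis_at F \<nu>" by (rule mod)
  let ?y = "comb (Suc (Suc \<nu>)) w"
  have y: "?y \<in> carrier (chain F (Suc (Suc \<nu>)))" by (rule lin_vec(1)[OF w])
  let ?x = "boundary F (Suc (Suc \<nu>)) ?y"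
  have x: "?x \<in> carrier (chain F (Suc \<nu>))" and bx: "boundary F (Suc \<nu>) ?x = \<zero>\<^bsub>chain F \<nu>\<^esub>" using y exactS[of \<nu>] by blast+
  have "bd \<nu> (bd (Suc \<nu>) w) l g
    = bd \<nu> (coord (Suc \<nu>) ?x) l g"
    using l dm_support by (intro act_cong) (auto simp: co_bd_lin[OF w])
  also have "\<dots> = A.co \<zero>\<^bsub>chain F \<nu>\<^esub> l g" unfolding co_bd[OF x l, symmetric] bx ..
  finally show ?thesis using l by (simp add: A.co_zero group_ring_simps)
qed

text \<open>
  The image in \<open>M\<close> of a coordinate vector of \<open>F_0\<close>.
\<close>

definition ev :: "(nat \<Rightarrow> 'g \<Rightarrow> int) \<Rightarrow> 'm" where
  "ev v = \<epsilon> (comb 0 v)"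

lemma ev_closed: "int_vec (r 0) v \<Longrightarrow> ev v \<in> carrier M"
  unfolding ev_def by (intro lmod_homD(1)[OF \<epsilon>_hom] lin_vec)

lemma int_vec_add: "int_vec n a \<Longrightarrow> int_vec n b \<Longrightarrow> int_vec n (\<lambda>k g. a k g + b k g)"
  and int_vec_diff: "int_vec n a \<Longrightarrow> int_vec n b \<Longrightarrow> int_vec n (\<lambda>k g. a k g - b k g)"
  and int_vec_scale: "int_vec n a \<Longrightarrow> int_vec n (\<lambda>k g. c * a k g)"
proof -
  have *: "(\<lambda>g. f (x g) (y g)) \<in> carrier R" if "x \<in> carrier R" "y \<in> carrier R" "f 0 0 = 0" for x y :: "'g \<Rightarrow> int" and f
  proof -
    have "{g. f (x g) (y g) \<noteq> 0} \<subseteq> {g. x g \<noteq> 0} \<union> {g. y g \<noteq> 0}" using that(3) by auto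
    then show ?thesis using that unfolding group_ring_simps by (auto intro: finite_subset)
  qed
  show "int_vec n a \<Longrightarrow> int_vec n b \<Longrightarrow> int_vec n (\<lambda>k g. a k g + b k g)"
    unfolding int_vec_def using *[of _ _ "(+)"] by auto
  show "int_vec n a \<Longrightarrow> int_vec n b \<Longrightarrow> int_vec n (\<lambda>k g. a k g - b k g)"
    unfolding int_vec_def using *[of _ _ "(-)"] by auto
  show "int_vec n a \<Longrightarrow> int_vec n (\<lambda>k g. c * a k g)"
    unfolding int_vec_def using *[of _ _ "\<lambda>x _. c * x"] by auto
qed

lemma ev_add: "int_vec (r 0) a \<Longrightarrow> int_vec (r 0) b \<Longrightarrow> ev (\<lambda>k g. a k g + b k g) = ev a \<oplus>\<^bsub>M\<^esub> ev b"
proof -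
  assume ab: "int_vec (r 0) a" "int_vec (r 0) b"
  interpret A: based_module R "chain F 0" "basis_at F 0" by (rule mod)
  have "comb 0 (\<lambda>k. a k \<oplus>\<^bsub>R\<^esub> b k) = comb 0 a \<oplus>\<^bsub>chain F 0\<^esub> comb 0 b"
    using ab by (intro A.lin_add) (auto simp: int_vec_def)
  then show ?thesis unfolding ev_def by (simp add: group_ring_simps lmod_homD(2)[OF \<epsilon>_hom] lin_vec ab)
qed

lemma ev_cong: "(\<And>k. k < r 0 \<Longrightarrow> a k = b k) \<Longrightarrow> int_vec (r 0) b \<Longrightarrow> ev a = ev b"
  unfolding ev_def using based_module.lin_cong[OF mod[of 0], of a b] by (simp add: int_vec_def)

lemma ev_zero: "ev (\<lambda>k g. 0) = \<zero>\<^bsub>M\<^esub>"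
proof -
  interpret M: left_module R M by (rule lm)
  have z: "int_vec (r 0) (\<lambda>k g. 0)" by (simp add: int_vec_def group_ring_simps)
  have "ev (\<lambda>k g. 0) = ev (\<lambda>k g. 0) \<oplus>\<^bsub>M\<^esub> ev (\<lambda>k g. 0)" using ev_add[OF z z] by simp
  then show ?thesis using ev_closed[OF z] by (metis M.M.add.l_cancel_one')
qed

lemma ev_scale: "int_vec (r 0) a \<Longrightarrow> ev (\<lambda>k g. int n * a k g) = add_pow M n (ev a)"
proof (induction n)
  interpret M: left_module R M by (rule lm)
  case 0 then show ?case by (simp add: ev_zero)
next
  interpret M: left_module R M by (rule lm)
  case (Suc n)
  have "ev (\<lambda>k g. int (Suc n) * a k g) = ev (\<lambda>k g. int n * a k g + a k g)" by (simp add: algebra_simps)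
  also have "\<dots> = add_pow M n (ev a) \<oplus>\<^bsub>M\<^esub> ev a" using Suc by (simp add: ev_add int_vec_scale)
  finally show ?case by simp
qed

lemma ev_boundary_iff:
  assumes v: "int_vec (r 0) v"
  shows "ev v = \<zero>\<^bsub>M\<^esub> \<longleftrightarrow> (\<exists>w. int_vec (r (Suc 0)) w \<and> (\<forall>k<r 0. \<forall>g. v k g = bd 0 w k g))"
proof
  assume "ev v = \<zero>\<^bsub>M\<^esub>"
  then have "comb 0 v \<in> boundary F (Suc 0) ` carrier (chain F (Suc 0))"
    using exact0 lin_vec(1)[OF v] unfolding ev_def by blast
  then show "\<exists>w. int_vec (r (Suc 0)) w \<and> (\<forall>k<r 0. \<forall>g. v k g = bd 0 w k g)"
    using vec_eq_boundary[OF v] by blast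
next
  assume "\<exists>w. int_vec (r (Suc 0)) w \<and> (\<forall>k<r 0. \<forall>g. v k g = bd 0 w k g)"
  then obtain w where w: "int_vec (r (Suc 0)) w" "\<And>k g. k < r 0 \<Longrightarrow> v k g = bd 0 w k g" by blast
  interpret A: based_module R "chain F 0" "basis_at F 0" by (rule mod)
  let ?y = "comb (Suc 0) w"
  have y: "?y \<in> carrier (chain F (Suc 0))" by (rule lin_vec(1)[OF w(1)])
  have by': "boundary F (Suc 0) ?y \<in> carrier (chain F 0)" "\<epsilon> (boundary F (Suc 0) ?y) = \<zero>\<^bsub>M\<^esub>" using y exact0 by blast+
  have "comb 0 v = boundary F (Suc 0) ?y"
    by (rule A.eq_iff_co) (use v by' w in \<open>auto simp: lin_vec co_bd_lin fun_eq_iff\<close>)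
  then show "ev v = \<zero>\<^bsub>M\<^esub>" using by' by (simp add: ev_def)
qed

text \<open>
  The approximation step.  In degree one, dividing the boundary of an approximation modulo \<open>p^n\<close> by
  \<open>p^n\<close> gives a \<open>p^n\<close>-torsion element of \<open>M\<close>; these form a point of the inverse limit.
\<close>

lemma approx_step:
  fixes x :: "nat \<Rightarrow> 'g \<Rightarrow> 'p::prime_card padic"
  assumes tl: "torsion_limit CARD('p) M = {\<lambda>_. \<zero>\<^bsub>M\<^esub>}"
    and x: "c0_vec (r (Suc \<nu>)) x" and le: "\<And>k g. k < r (Suc \<nu>) \<Longrightarrow> padic_norm (x k g) \<le> 1"
    and cyc: "\<And>l g. l < r \<nu> \<Longrightarrow> bd \<nu> x l g = 0"
  shows "\<exists>v x'. int_vec (r (Suc (Suc \<nu>))) v \<and> c0_vec (r (Suc \<nu>)) x' \<and> (\<forall>k<r (Suc \<nu>). \<forall>g. padic_norm (x' k g) \<le> 1) \<and>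
         (\<forall>l<r \<nu>. \<forall>g. bd \<nu> x' l g = 0) \<and>
         (\<forall>k<r (Suc \<nu>). \<forall>g. x k g = of_int (bd (Suc \<nu>) v k g) + of_nat CARD('p) * x' k g)"
proof -
  let ?p = "CARD('p)"
  let ?r = "r (Suc \<nu>)" and ?d = "bd \<nu>"
  have p0: "int ?p \<noteq> 0" "(of_nat ?p :: 'p padic) \<noteq> 0" using padic_prime_gt_1[where 'p = 'p] padic_prime_neq_0[where 'p = 'p] by auto
  define AP where "AP n vx \<longleftrightarrow> int_vec ?r (fst vx) \<and> c0_vec ?r (snd vx) \<and> (\<forall>k<?r. \<forall>g. padic_norm (snd vx k g) \<le> 1) \<and>
     (\<forall>k<?r. \<forall>g. x k g = of_int (fst vx k g) + of_nat ?p ^ n * snd vx k g)" for n and vx :: "(nat \<Rightarrow> 'g \<Rightarrow> int) \<times> (nat \<Rightarrow> 'g \<Rightarrow> 'p padic)"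
  have "\<exists>vx. AP n vx" for n
  proof -
    obtain v x' where "int_vec ?r v" "c0_vec ?r x'" "\<forall>k<?r. \<forall>g. padic_norm (x' k g) \<le> 1"
      "\<forall>k<?r. \<forall>g. x k g = of_int (v k g) + of_nat ?p ^ n * x' k g"
      using int_vec_approx[OF x le, of n] by blast
    then have "AP n (v, x')" by (simp add: AP_def)
    then show ?thesis by blast
  qed
  then obtain VX where VX: "\<And>n. AP n (VX n)" by metis
  define V where "V n = fst (VX n)" for n
  define X where "X n = snd (VX n)" for n
  have V: "int_vec ?r (V n)" and X: "c0_vec ?r (X n)" and Xle: "k < ?r \<Longrightarrow> padic_norm (X n k g) \<le> 1"
    and xe: "k < ?r \<Longrightarrow> x k g = of_int (V n k g) + of_nat ?p ^ n * X n k g" for n k g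
    using VX[of n] by (simp_all add: AP_def V_def X_def)
  have supp: "dm \<nu> k l u \<noteq> 0 \<Longrightarrow> u \<in> carrier G" if "k < ?r" "l < r \<nu>" for k l u using that dm_support by blast
  have cong: "?d a l g = ?d b l g" if "\<And>k g. k < ?r \<Longrightarrow> a k g = b k g" "l < r \<nu>" for a b :: "nat \<Rightarrow> 'g \<Rightarrow> 's::comm_ring_1" and l g
    using that supp by (intro act_cong) auto
  have dV: "(of_int (?d (V n) l g) :: 'p padic) = - (of_nat ?p ^ n * ?d (X n) l g)" if l: "l < r \<nu>" for n l g
  proof -
    have "?d x l g = ?d (\<lambda>k g. of_int (V n k g) + of_nat ?p ^ n * X n k g) l g" using l xe by (intro cong)
    also have "\<dots> = of_int (?d (V n) l g) + of_nat ?p ^ n * ?d (X n) l g"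
      by (simp only: act_linear act_of_int)
    finally show ?thesis using cyc[OF l, of g] by (simp add: eq_neg_iff_add_eq_0)
  qed
  have dX: "padic_norm (?d (X n) l g) \<le> 1" if "l < r \<nu>" for n l g by (rule act_norm_le) (use Xle in auto)
  have pd: "int ?p ^ n dvd ?d (V n) l g" if l: "l < r \<nu>" for n l g
  proof (rule padic_norm_int_dvd[where 'p = 'p])
    show "padic_norm (of_int (?d (V n) l g) :: 'p padic) \<le> (1 / ?p) ^ n"
      unfolding dV[OF l] padic_norm_minus padic_norm_mult padic_norm_power padic_norm_prime
      using dX[OF l] by (intro mult_left_le) auto
  qed
  define Y where "Y n l g = ?d (V n) l g div int ?p ^ n" for n l g
  have Y: "int ?p ^ n * Y n l g = ?d (V n) l g" if "l < r \<nu>" for n l g using pd[OF that] by (simp add: Y_def)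
  have Yv: "int_vec (r \<nu>) (Y n)" for n
  proof -
    have "{g. Y n l g \<noteq> 0} \<subseteq> {g. ?d (V n) l g \<noteq> 0}" for l by (auto simp: Y_def)
    then show ?thesis using act_vec[OF V[of n]] unfolding int_vec_def group_ring_simps
      by (auto simp: Y_def intro: finite_subset)
  qed
  have "\<exists>z. int_vec ?r z \<and> (\<forall>k<r \<nu>. \<forall>g. Y 1 k g = ?d z k g)"
  proof (cases \<nu>)
    case 0
    define m where "m n = ev (Y n)" for n
    have dV0: "int_vec (r 0) (?d (V n))" for n using act_vec[OF V[of n]] 0 by simp
    have t0: "add_pow M (?p ^ n) (m n) = \<zero>\<^bsub>M\<^esub>" for n
    proof -
      have "add_pow M (?p ^ n) (m n) = ev (\<lambda>k g. int (?p ^ n) * Y n k g)" unfolding m_def using Yv[of n] 0 by (simp only: ev_scale)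
      also have "\<dots> = ev (?d (V n))" 
      proof (rule ev_cong[OF _ dV0], rule ext)
        show "int (?p ^ n) * Y n k g = ?d (V n) k g" if "k < r 0" for k g using Y[of k n g] that 0 by simp
      qed
      also have "\<dots> = \<zero>\<^bsub>M\<^esub>" using ev_boundary_iff[OF dV0] V[of n] 0 by blast
      finally show ?thesis .
    qed
    have t1: "add_pow M ?p (m (Suc n)) = m n" for n
    proof -
      interpret M: left_module R M by (rule lm)
      have dvd: "int ?p ^ n dvd V (Suc n) k g - V n k g" if k: "k < ?r" for k g
      proof (rule padic_norm_int_dvd[where 'p = 'p])
        have "(of_int (V (Suc n) k g - V n k g) :: 'p padic) = of_nat ?p ^ n * (X n k g - of_nat ?p * X (Suc n) k g)"
          using xe[OF k, of g n] xe[OF k, of g "Suc n"] by (simp add: algebra_simps)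
        moreover have "padic_norm (X n k g - of_nat ?p * X (Suc n) k g) \<le> 1"
          using Xle[OF k] by (intro padic_norm_diff_le) (auto simp: padic_norm_mult intro!: mult_le_one padic_norm_of_nat_le)
        ultimately show "padic_norm (of_int (V (Suc n) k g - V n k g) :: 'p padic) \<le> (1 / ?p) ^ n"
          by (simp only: padic_norm_mult padic_norm_power padic_norm_prime) (intro mult_left_le, auto)
      qed
      define t where "t k g = (V (Suc n) k g - V n k g) div int ?p ^ n" for k g
      have te: "int ?p ^ n * t k g = V (Suc n) k g - V n k g" if "k < ?r" for k g using dvd[OF that] by (simp add: t_def)
      have tv: "int_vec ?r t"
      proof -
        have "{g. t k g \<noteq> 0} \<subseteq> {g. V (Suc n) k g - V n k g \<noteq> 0}" for k by (auto simp: t_def)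
        then show ?thesis using int_vec_diff[OF V[of "Suc n"] V[of n]] unfolding int_vec_def group_ring_simps
          by (auto simp: t_def intro: finite_subset)
      qed
      have yy: "int ?p * Y (Suc n) l g = Y n l g + ?d t l g" if l: "l < r 0" for l g
      proof -
        have l': "l < r \<nu>" using l 0 by simp
        have "?d (\<lambda>k g. int ?p ^ n * t k g) l g = ?d (\<lambda>k g. V (Suc n) k g - V n k g) l g"
          using l' te by (intro cong) auto
        then have "int ?p ^ n * ?d t l g = int ?p ^ Suc n * Y (Suc n) l g - int ?p ^ n * Y n l g"
          unfolding act_linear Y[OF l'] .
        then have "int ?p ^ n * (int ?p * Y (Suc n) l g) = int ?p ^ n * (Y n l g + ?d t l g)" by (simp add: algebra_simps)
        then show ?thesis using p0 by simp
      qed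
      have dt: "int_vec (r 0) (?d t)" using act_vec[OF tv] 0 by simp
      have "add_pow M ?p (m (Suc n)) = ev (\<lambda>k g. int ?p * Y (Suc n) k g)" unfolding m_def using Yv 0 by (simp only: ev_scale)
      also have "\<dots> = ev (\<lambda>k g. Y n k g + ?d t k g)" using Yv[of n] dt 0 yy by (intro ev_cong int_vec_add) auto
      also have "\<dots> = m n \<oplus>\<^bsub>M\<^esub> ev (?d t)" unfolding m_def using Yv[of n] dt 0 by (intro ev_add) auto
      also have "ev (?d t) = \<zero>\<^bsub>M\<^esub>" using ev_boundary_iff[OF dt] tv 0 by blast
      finally show ?thesis using ev_closed Yv[of n] 0 by (simp add: m_def)
    qed
    have "m \<in> torsion_limit ?p M" using t0 t1 ev_closed Yv 0 by (simp add: torsion_limit_def m_def)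
    then have "m 1 = \<zero>\<^bsub>M\<^esub>" using tl by auto
    then show ?thesis using ev_boundary_iff[of "Y 1"] Yv[of 1] 0 by (simp add: m_def)
  next
    case (Suc \<mu>)
    have "bd \<mu> (Y 1) l g = 0" if l: "l < r \<mu>" for l g
    proof -
      have "bd \<mu> (\<lambda>k g. int ?p * Y 1 k g) l g = bd \<mu> (?d (V 1)) l g"
        using l dm_support Y[of _ 1] Suc by (intro act_cong) auto
      also have "\<dots> = 0" using act_act[of \<mu> "V 1" l g] V[of 1] l Suc by simp
      finally show ?thesis unfolding act_linear using p0 by simp
    qed
    from int_cycle_boundary[of \<mu> "Y 1", OF _ this] show ?thesis using Yv[of 1] Suc by simp
  qed
  then obtain z where z: "int_vec ?r z" "\<And>k g. k < r \<nu> \<Longrightarrow> Y 1 k g = ?d z k g" by blast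
  define u where "u k g = V 1 k g - int ?p * z k g" for k g
  have uv: "int_vec ?r u" unfolding u_def by (intro int_vec_diff int_vec_scale V z)
  have "?d u l g = 0" if "l < r \<nu>" for l g
    unfolding u_def act_linear using z(2)[OF that, of g] Y[OF that, of 1 g] by simp
  from int_cycle_boundary[OF uv this] obtain w where w: "int_vec (r (Suc (Suc \<nu>))) w"
    "\<And>k g. k < ?r \<Longrightarrow> u k g = bd (Suc \<nu>) w k g" by blast
  define x' where "x' k g = X 1 k g + of_int (z k g)" for k g
  have xx: "x k g = of_int (bd (Suc \<nu>) w k g) + of_nat ?p * x' k g" if "k < ?r" for k g
    unfolding w(2)[OF that, symmetric] using xe[OF that, of g 1] by (simp add: u_def x'_def algebra_simps)
  have "c0_vec ?r x'" unfolding c0_vec_def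
  proof (intro allI impI)
    fix k assume k: "k < ?r"
    have "X 1 k \<in> carrier (c0 G)" "to_c0 (z k) \<in> carrier (c0 G :: ('g \<Rightarrow> 'p padic) ring)"
      using X[of 1] z(1) k to_c0_closed by (auto simp: c0_vec_def int_vec_def)
    moreover have "x' k = (\<lambda>g. X 1 k g + to_c0 (z k) g)" by (auto simp: x'_def to_c0_def)
    ultimately show "x' k \<in> carrier (c0 G)" by (simp add: c0_simps null_fam_add)
  qed
  moreover have "padic_norm (x' k g) \<le> 1" if "k < ?r" for k g
    unfolding x'_def by (intro padic_norm_add_le Xle that padic_norm_of_int_le)
  moreover have "?d x' l g = 0" if l: "l < r \<nu>" for l g
  proof -
    have "?d x l g = ?d (\<lambda>k g. of_int (bd (Suc \<nu>) w k g) + of_nat ?p * x' k g) l g"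
      using l xx by (intro cong)
    also have "\<dots> = of_int (?d (bd (Suc \<nu>) w) l g) + of_nat ?p * ?d x' l g"
      by (simp only: act_linear act_of_int)
    finally show ?thesis using cyc[OF l, of g] act_act[OF w(1) l, of g] p0 by simp
  qed
  ultimately show ?thesis using w(1) xx by blast
qed

end

locale completed_resolution = fl_resolution G M F \<epsilon>
  for G :: "'g monoid" (structure) and M :: "('g \<Rightarrow> int, 'm) module"
    and F :: "('g \<Rightarrow> int, 'f) based_complex" and \<epsilon> :: "'f \<Rightarrow> 'm" +
  fixes S :: "('g \<Rightarrow> 'p::prime_card padic) ring"
  assumes S_eq: "S = c0 G"
begin

abbreviation "C \<equiv> base_change_complex R S to_c0 F"
abbreviation "Cx p \<equiv> chain C p"
abbreviation "tb p \<equiv> basis_at C p"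
abbreviation "ccoord p \<equiv> coords S (Cx p) (tb p)"

lemma C_eq: "c0_complex G F = C" by (simp add: c0_complex_def S_eq)

lemma C_simps:
  "top_degree C = top_degree F" "Cx p = base_change R S to_c0 (chain F p)"
  "boundary C (Suc p) = base_change_map R S to_c0 (chain F p) (boundary F (Suc p))"
  "tb p = map (tensor R S to_c0 (chain F p) \<one>\<^bsub>S\<^esub>) (basis_at F p)"
  by (simp_all add: base_change_complex_def)

lemma S_ring: "ring S" unfolding S_eq by (rule ring_c0)

lemma ext_loc: "scalar_extension R S (chain F p) to_c0"
  using lmod[of p] S_ring to_c0_ring_hom unfolding S_eq
  by (simp add: scalar_extension_def scalar_extension_axioms_def)

lemma extM_loc: "scalar_extension R S M to_c0"
  using lm S_ring to_c0_ring_hom unfolding S_eq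
  by (simp add: scalar_extension_def scalar_extension_axioms_def)

lemma bext_loc: "based_extension R S (chain F p) to_c0 (basis_at F p)"
  using ext_loc mod by (simp add: based_extension_def)

lemma C_mod: "based_module S (Cx p) (tb p)"
  unfolding C_simps by (rule based_extension.T_based[OF bext_loc])

lemma to_c0_S: "x \<in> carrier R \<Longrightarrow> to_c0 x \<in> carrier S" unfolding S_eq by (rule to_c0_closed)

lemma c0_vec_S: "c0_vec n x \<longleftrightarrow> (\<forall>k<n. x k \<in> carrier S)" unfolding S_eq c0_vec_def ..

lemma C_hom: "boundary C (Suc p) \<in> lmod_hom S (Cx (Suc p)) (Cx p)"
  unfolding C_simps by (rule base_change_map_hom(1)[OF ext_loc ext_loc bd_hom])

lemma C_len: "length (tb p) = r p" by (simp add: C_simps)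

lemma C_matrix:
  assumes "k < r (Suc p)" "l < r p"
  shows "ccoord p (boundary C (Suc p) (tb (Suc p) ! k)) l = to_c0 (dm p k l)"
proof -
  interpret B: based_extension R S "chain F p" to_c0 "basis_at F p" by (rule bext_loc)
  interpret B': based_extension R S "chain F (Suc p)" to_c0 "basis_at F (Suc p)" by (rule bext_loc)
  have b: "basis_at F (Suc p) ! k \<in> carrier (chain F (Suc p))" using assms by (intro B'.bs_closed)
  have "boundary C (Suc p) (tb (Suc p) ! k) = tensor R S to_c0 (chain F p) \<one>\<^bsub>S\<^esub> (boundary F (Suc p) (basis_at F (Suc p) ! k))"
    unfolding C_simps using assms b by (simp add: base_change_map_hom(2)[OF ext_loc ext_loc bd_hom])
  moreover interpret S: ring S by (rule S_ring)
  have "\<one>\<^bsub>S\<^esub> \<otimes>\<^bsub>S\<^esub> to_c0 (dm p k l) = to_c0 (dm p k l)" using to_c0_S[OF dm_closed[OF assms]] by simp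
  ultimately show ?thesis
    unfolding C_simps using assms lmod_homD(1)[OF bd_hom b] by (simp add: B.T_co_tens dm_def[symmetric])
qed

lemma finsum_S: "finite A \<Longrightarrow> (\<And>i. i \<in> A \<Longrightarrow> f i \<in> carrier S) \<Longrightarrow> finsum S f A g = (\<Sum>i\<in>A. f i g)"
  by (rule finsum_pointwise)
    (auto simp: S_eq c0_simps intro!: ring.is_abelian_group[OF S_ring, unfolded S_eq] abelian_group.axioms)

lemma C_co_bd:
  assumes x: "x \<in> carrier (Cx (Suc p))" and l: "l < r p"
  shows "ccoord p (boundary C (Suc p) x) l g
    = bd p (ccoord (Suc p) x) l g"
proof -
  interpret S: ring S by (rule S_ring)
  interpret B: based_module S "Cx (Suc p)" "tb (Suc p)" by (rule C_mod)
  have c: "B.co x k \<otimes>\<^bsub>S\<^esub> to_c0 (dm p k l) = rconv (B.co x k) (dm p k l)" "B.co x k \<otimes>\<^bsub>S\<^esub> to_c0 (dm p k l) \<in> carrier S"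
    if k: "k < r (Suc p)" for k
  proof -
    have xk: "B.co x k \<in> carrier S" using k x by (intro B.co_closed) (simp_all add: C_len)
    show "B.co x k \<otimes>\<^bsub>S\<^esub> to_c0 (dm p k l) = rconv (B.co x k) (dm p k l)"
      using c0_mult_to_c0[OF xk[unfolded S_eq] dm_closed[OF k l]] by (simp only: S_eq[symmetric])
    show "B.co x k \<otimes>\<^bsub>S\<^esub> to_c0 (dm p k l) \<in> carrier S"
      by (rule S.m_closed[OF xk to_c0_S[OF dm_closed[OF k l]]])
  qed
  have "ccoord p (boundary C (Suc p) x) l
     = finsum S (\<lambda>k. B.co x k \<otimes>\<^bsub>S\<^esub> ccoord p (boundary C (Suc p) (tb (Suc p) ! k)) l) {..<r (Suc p)}"
    using coords_hom[OF C_mod C_mod C_hom x] l by (simp add: C_len)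
  also have "\<dots> = finsum S (\<lambda>k. B.co x k \<otimes>\<^bsub>S\<^esub> to_c0 (dm p k l)) {..<r (Suc p)}"
    using l c(2) by (intro S.finsum_cong') (auto simp: C_matrix)
  finally have e: "ccoord p (boundary C (Suc p) x) l = \<dots>" .
  show ?thesis unfolding e act_def using c by (subst finsum_S) (auto intro!: sum.cong)
qed

lemma C_bd_bd:
  assumes "x \<in> carrier (Cx (Suc (Suc p)))"
  shows "boundary C (Suc p) (boundary C (Suc (Suc p)) x) = \<zero>\<^bsub>Cx p\<^esub>"
proof -
  interpret A: scalar_extension R S "chain F p" to_c0 by (rule ext_loc)
  interpret B: scalar_extension R S "chain F (Suc p)" to_c0 by (rule ext_loc)
  interpret D: scalar_extension R S "chain F (Suc (Suc p))" to_c0 by (rule ext_loc)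
  have h: "boundary C (Suc p) \<in> hom B.TG A.TG" and h': "boundary C (Suc (Suc p)) \<in> hom D.TG B.TG"
    using C_hom[of p] C_hom[of "Suc p"] unfolding C_simps lmod_hom_def A.T_simps B.T_simps D.T_simps
    by (auto simp: hom_def)
  have z: "A.tens s \<zero>\<^bsub>chain F p\<^esub> = \<one>\<^bsub>A.TG\<^esub>" if "s \<in> carrier S" for s
  proof -
    have "A.tens s \<zero>\<^bsub>chain F p\<^esub> = A.tens s \<zero>\<^bsub>chain F p\<^esub> \<otimes>\<^bsub>A.TG\<^esub> A.tens s \<zero>\<^bsub>chain F p\<^esub>"
      using A.tens_bilinear(2)[OF that A.M.zero_closed A.M.zero_closed] by simp
    then show ?thesis using A.tens_closed[OF that A.M.zero_closed] by (metis A.TG.l_cancel_one')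
  qed
  have "boundary C (Suc p) (boundary C (Suc (Suc p)) x) = \<one>\<^bsub>A.TG\<^esub>"
  proof (rule D.TG_hom_eq[OF A.TG.group_axioms, where h = "\<lambda>x. boundary C (Suc p) (boundary C (Suc (Suc p)) x)" and k = "\<lambda>_. \<one>\<^bsub>A.TG\<^esub>"])
    show "(\<lambda>x. boundary C (Suc p) (boundary C (Suc (Suc p)) x)) \<in> hom D.TG A.TG" using h h' by (auto simp: hom_def Pi_def)
    show "(\<lambda>x. \<one>\<^bsub>A.TG\<^esub>) \<in> hom D.TG A.TG" by (auto simp: hom_def)
    fix s m assume sm: "s \<in> carrier S" "m \<in> carrier (chain F (Suc (Suc p)))"
    have bm: "boundary F (Suc (Suc p)) m \<in> carrier (chain F (Suc p))"
      "boundary F (Suc p) (boundary F (Suc (Suc p)) m) = \<zero>\<^bsub>chain F p\<^esub>" using sm(2) exactS[of p] by blast+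
    show "boundary C (Suc p) (boundary C (Suc (Suc p)) (D.tens s m)) = \<one>\<^bsub>A.TG\<^esub>"
      unfolding C_simps using sm bm z
      by (simp add: base_change_map_hom(2)[OF ext_loc ext_loc bd_hom])
  qed (use assms in \<open>simp add: C_simps D.T_simps\<close>)
  then show ?thesis by (simp add: C_simps A.T_simps)
qed

lemma C_exact_pos:
  assumes tl: "torsion_limit CARD('p) M = {\<lambda>_. \<zero>\<^bsub>M\<^esub>}"
  shows "{x \<in> carrier (Cx (Suc p)). boundary C (Suc p) x = \<zero>\<^bsub>Cx p\<^esub>}
          = boundary C (Suc (Suc p)) ` carrier (Cx (Suc (Suc p)))"
proof (intro equalityI subsetI)
  fix x assume "x \<in> boundary C (Suc (Suc p)) ` carrier (Cx (Suc (Suc p)))"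
  then show "x \<in> {x \<in> carrier (Cx (Suc p)). boundary C (Suc p) x = \<zero>\<^bsub>Cx p\<^esub>}"
    by (intro CollectI conjI; elim imageE; simp only: C_bd_bd lmod_homD(1)[OF C_hom])
next
  interpret A: based_module S "Cx p" "tb p" by (rule C_mod)
  interpret B: based_module S "Cx (Suc p)" "tb (Suc p)" by (rule C_mod)
  interpret D: based_module S "Cx (Suc (Suc p))" "tb (Suc (Suc p))" by (rule C_mod)
  fix x assume "x \<in> {x \<in> carrier (Cx (Suc p)). boundary C (Suc p) x = \<zero>\<^bsub>Cx p\<^esub>}"
  then have x: "x \<in> carrier (Cx (Suc p))" and bx: "boundary C (Suc p) x = \<zero>\<^bsub>Cx p\<^esub>" by auto
  have xv: "c0_vec (r (Suc p)) (B.co x)" using B.co_closed[OF x] unfolding c0_vec_S C_len by blast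
  have cyc: "bd p (B.co x) l g = 0" if "l < r p" for l g
  proof -
    have "A.co \<zero>\<^bsub>Cx p\<^esub> l = \<zero>\<^bsub>S\<^esub>" using that by (intro A.co_zero) (simp add: C_len)
    moreover have "\<zero>\<^bsub>S\<^esub> g = 0" by (simp add: S_eq c0_simps)
    ultimately show ?thesis using C_co_bd[OF x that, of g] unfolding bx by simp
  qed
  have "\<exists>y. c0_vec (r (Suc (Suc p))) y \<and> (\<forall>k<r (Suc p). \<forall>g. B.co x k g = bd (Suc p) y k g)"
    by (rule padic_exact_of_approx[where ?d1.0 = "dm p" and ?r0.0 = "r p"])
      (use approx_step[OF tl] dm_closed xv cyc in auto)
  then obtain y where y: "c0_vec (r (Suc (Suc p))) y"
    "\<And>k g. k < r (Suc p) \<Longrightarrow> B.co x k g = bd (Suc p) y k g" by blast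
  let ?y = "lin (Cx (Suc (Suc p))) (tb (Suc (Suc p))) y"
  have yc: "k < D.rk \<Longrightarrow> y k \<in> carrier S" for k using y(1) unfolding c0_vec_S C_len by blast
  have yC: "?y \<in> carrier (Cx (Suc (Suc p)))" using yc by (rule D.lin_closed)
  have "x = boundary C (Suc (Suc p)) ?y"
  proof (rule B.eq_iff_co[OF x lmod_homD(1)[OF C_hom yC]])
    fix k assume "k < B.rk"
    then have k: "k < r (Suc p)" by (simp add: C_len)
    have "bd (Suc p) (D.co ?y) k g = bd (Suc p) y k g" for g
    proof (rule act_cong)
      fix j g assume "j < r (Suc (Suc p))"
      then show "D.co ?y j g = y j g" using D.co_lin[of y j] yc by (simp add: C_len)
    qed (use k dm_support in auto)
    then show "B.co x k = B.co (boundary C (Suc (Suc p)) ?y) k"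
      using k by (auto simp: C_co_bd[OF yC k] y(2) fun_eq_iff)
  qed
  then show "x \<in> boundary C (Suc (Suc p)) ` carrier (Cx (Suc (Suc p)))" using yC by blast
qed

text \<open>
  Right exactness of the tensor product: modulo the image of the boundary, a pure tensor \<open>s \<otimes> x\<close>
  depends only on \<open>s\<close> and \<open>\<epsilon> x\<close>, so it factors through the tensor product with \<open>M\<close>.
\<close>

lemma C_exact_zero:
  assumes T0: "carrier (base_change R S to_c0 M) = {\<zero>\<^bsub>base_change R S to_c0 M\<^esub>}"
  shows "carrier (Cx 0) = boundary C (Suc 0) ` carrier (Cx (Suc 0))"
proof -
  interpret A: scalar_extension R S "chain F 0" to_c0 by (rule ext_loc)
  interpret B: scalar_extension R S "chain F (Suc 0)" to_c0 by (rule ext_loc)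
  interpret N: scalar_extension R S M to_c0 by (rule extM_loc)
  let ?b = "boundary C (Suc 0)"
  let ?B = "?b ` carrier B.TG"
  have h: "?b \<in> hom B.TG A.TG"
    using C_hom[of 0] unfolding C_simps lmod_hom_def A.T_simps B.T_simps by (auto simp: hom_def)
  interpret b: group_hom B.TG A.TG ?b
    using h B.TG.group_axioms A.TG.group_axioms by (simp add: group_hom_def group_hom_axioms_def)
  have Bsub: "subgroup ?B A.TG" by (rule b.img_is_subgroup)
  have Bn: "?B \<lhd> A.TG" using Bsub by (simp add: A.TG.normal_iff_subgroup)
  define Q where "Q = A.TG Mod ?B"
  have Qg: "comm_group Q" unfolding Q_def by (rule A.TG.abelian_FactGroup[OF Bsub])
  interpret Q: comm_group Q by (rule Qg)
  define \<pi> where "\<pi> x = ?B #>\<^bsub>A.TG\<^esub> x" for x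
  have \<pi>c: "\<pi> x \<in> carrier Q" if "x \<in> carrier A.TG" for x using that by (auto simp: Q_def \<pi>_def carrier_FactGroup)
  have \<pi>m: "\<pi> (x \<otimes>\<^bsub>A.TG\<^esub> y) = \<pi> x \<otimes>\<^bsub>Q\<^esub> \<pi> y" if "x \<in> carrier A.TG" "y \<in> carrier A.TG" for x y
    using normal.rcos_sum[OF Bn that] by (simp add: Q_def \<pi>_def FactGroup_def)
  have \<pi>1: "\<pi> x = \<one>\<^bsub>Q\<^esub>" if "x \<in> ?B" for x
    using subgroup.rcos_const[OF Bsub A.TG.group_axioms that] by (simp add: Q_def \<pi>_def)
  have \<pi>0: "x \<in> ?B" if "x \<in> carrier A.TG" "\<pi> x = \<one>\<^bsub>Q\<^esub>" for x
    using that A.TG.rcos_self[OF that(1) Bsub] by (simp add: Q_def \<pi>_def)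
  define lift where "lift m = (SOME x. x \<in> carrier (chain F 0) \<and> \<epsilon> x = m)" for m
  have lift: "lift m \<in> carrier (chain F 0) \<and> \<epsilon> (lift m) = m" if "m \<in> carrier M" for m
    unfolding lift_def using that \<epsilon>_surj by (intro someI_ex[of "\<lambda>x. x \<in> carrier (chain F 0) \<and> \<epsilon> x = m"]) (auto simp: image_iff set_eq_iff, metis)
  have key: "\<pi> (A.tens s x) = \<pi> (A.tens s y)"
    if s: "s \<in> carrier S" and xy: "x \<in> carrier (chain F 0)" "y \<in> carrier (chain F 0)" "\<epsilon> x = \<epsilon> y" for s x y
  proof -
    interpret F0: left_module R "chain F 0" by (rule lmod)
    interpret LM: left_module R M by (rule lm)
    have d: "x \<oplus>\<^bsub>chain F 0\<^esub> (\<ominus>\<^bsub>chain F 0\<^esub> y) \<in> carrier (chain F 0)" using xy by simp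
    have "\<epsilon> (x \<oplus>\<^bsub>chain F 0\<^esub> (\<ominus>\<^bsub>chain F 0\<^esub> y)) = \<zero>\<^bsub>M\<^esub>"
      using xy lmod_homD(1)[OF \<epsilon>_hom xy(2)] by (simp add: lmod_homD(2)[OF \<epsilon>_hom] lmod_hom_minus[OF lmod lm \<epsilon>_hom] N.M.r_neg)
    then obtain w where w: "w \<in> carrier (chain F (Suc 0))" "x \<oplus>\<^bsub>chain F 0\<^esub> (\<ominus>\<^bsub>chain F 0\<^esub> y) = boundary F (Suc 0) w"
      using d exact0 by blast
    have bw: "boundary F (Suc 0) w \<in> carrier (chain F 0)" using w(1) by (rule lmod_homD(1)[OF bd_hom])
    have "x = boundary F (Suc 0) w \<oplus>\<^bsub>chain F 0\<^esub> y" unfolding w(2)[symmetric] using xy by (simp add: A.M.a_assoc A.M.l_neg)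
    then have "A.tens s x = A.tens s (boundary F (Suc 0) w) \<otimes>\<^bsub>A.TG\<^esub> A.tens s y"
      using s bw xy by (simp add: A.tens_bilinear)
    moreover have "A.tens s (boundary F (Suc 0) w) = ?b (B.tens s w)"
      unfolding C_simps using s w(1) by (simp add: base_change_map_hom(2)[OF ext_loc ext_loc bd_hom])
    then have "\<pi> (A.tens s (boundary F (Suc 0) w)) = \<one>\<^bsub>Q\<^esub>" using s w(1) B.tens_closed by (intro \<pi>1) auto
    ultimately show ?thesis using s xy bw by (simp add: \<pi>m \<pi>c A.tens_closed)
  qed
  interpret F0: left_module R "chain F 0" by (rule lmod)
  interpret LM: left_module R M by (rule lm)
  obtain k where k: "k \<in> hom N.TG Q" "\<And>s m. s \<in> carrier S \<Longrightarrow> m \<in> carrier M \<Longrightarrow> k (N.tens s m) = \<pi> (A.tens s (lift m))"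
  proof (rule N.TG_universal[OF Qg, of "\<lambda>s m. \<pi> (A.tens s (lift m))"])
    fix s m m' assume a: "s \<in> carrier S" "m \<in> carrier M" "m' \<in> carrier M"
    have "\<pi> (A.tens s (lift (m \<oplus>\<^bsub>M\<^esub> m'))) = \<pi> (A.tens s (lift m \<oplus>\<^bsub>chain F 0\<^esub> lift m'))"
      using a lift by (intro key) (auto simp: lmod_homD(2)[OF \<epsilon>_hom])
    then show "\<pi> (A.tens s (lift (m \<oplus>\<^bsub>M\<^esub> m'))) = \<pi> (A.tens s (lift m)) \<otimes>\<^bsub>Q\<^esub> \<pi> (A.tens s (lift m'))"
      using a lift by (simp add: A.tens_bilinear \<pi>m A.tens_closed)
  next
    fix s a m assume a: "s \<in> carrier S" "a \<in> carrier R" "m \<in> carrier M"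
    have "\<pi> (A.tens s (lift (a \<odot>\<^bsub>M\<^esub> m))) = \<pi> (A.tens s (a \<odot>\<^bsub>chain F 0\<^esub> lift m))"
      using a lift N.smult_closed by (intro key) (auto simp: lmod_homD(3)[OF \<epsilon>_hom] A.smult_closed)
    then show "\<pi> (A.tens (s \<otimes>\<^bsub>S\<^esub> to_c0 a) (lift m)) = \<pi> (A.tens s (lift (a \<odot>\<^bsub>M\<^esub> m)))"
      using a lift by (simp add: A.tens_bilinear)
  qed (use lift in \<open>auto simp: A.tens_bilinear \<pi>m \<pi>c A.tens_closed\<close>)
  have gen: "A.tens s x \<in> ?B" if s: "s \<in> carrier S" and x: "x \<in> carrier (chain F 0)" for s x
  proof -
    have ex: "\<epsilon> x \<in> carrier M" using x by (rule lmod_homD(1)[OF \<epsilon>_hom])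
    have "N.tens s (\<epsilon> x) = \<one>\<^bsub>N.TG\<^esub>" using N.tens_closed[OF s ex] T0 by (simp add: N.T_simps)
    then have "\<pi> (A.tens s (lift (\<epsilon> x))) = \<one>\<^bsub>Q\<^esub>"
      using k(2)[OF s ex] hom_one[OF k(1) N.TG.group_axioms Q.group_axioms] by simp
    moreover have "\<pi> (A.tens s (lift (\<epsilon> x))) = \<pi> (A.tens s x)" using s x lift[OF ex] by (intro key) auto
    ultimately show ?thesis using s x by (intro \<pi>0 A.tens_closed) auto
  qed
  have "x \<in> ?B" if "x \<in> carrier A.TG" for x
    using that
  proof (rule A.TG_induct)
    fix x y assume "x \<in> ?B" "y \<in> ?B"
    then show "x \<otimes>\<^bsub>A.TG\<^esub> inv\<^bsub>A.TG\<^esub> y \<in> ?B" by (intro subgroup.m_closed[OF Bsub] subgroup.m_inv_closed[OF Bsub])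
  qed (use gen subgroup.one_closed[OF Bsub] in auto)
  then show ?thesis using subgroup.subset[OF Bsub] by (auto simp: C_simps A.T_simps B.T_simps)
qed

lemma C_acyclic:
  assumes "torsion_limit CARD('p) M = {\<lambda>_. \<zero>\<^bsub>M\<^esub>}" "padically_expansive TYPE('p) G M"
  shows "acyclic_complex C"
  unfolding acyclic_complex_def One_nat_def
proof (intro conjI allI)
  show "carrier (Cx 0) = boundary C (Suc 0) ` carrier (Cx (Suc 0))"
    using assms(2) by (intro C_exact_zero) (simp add: padically_expansive_def S_eq Let_def)
qed (rule C_exact_pos[OF assms(1)])

end

section \<open>The torsion matrix\<close>

lemma distinct_basis_index: "distinct (basis_index C P)"
  unfolding basis_index_def
proof -
  have *: "distinct xs \<Longrightarrow> distinct (concat (map (\<lambda>p. map (Pair p) [0..<n p]) xs))" for n :: "nat \<Rightarrow> nat" and xs :: "nat list"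
    by (induction xs) (auto simp: distinct_map inj_on_def)
  show "distinct (concat (map (\<lambda>p. map (Pair p) [0..<length (basis_at C p)]) (filter P [0..<Suc (top_degree C)])))"
    by (rule *) simp
qed

lemma set_basis_index: "set (basis_index C P) = {(p, k). P p \<and> p \<le> top_degree C \<and> k < length (basis_at C p)}"
  unfolding basis_index_def by (force simp: less_Suc_eq_le simp del: upt_Suc)

context completed_resolution
begin

text \<open>
  The basis of the whole complex, in all degrees; \<open>Dmat\<close> and \<open>Smat\<close> are the matrices of the boundary
  and of a contraction with respect to it.
\<close>

definition "J = {(p, k). k < r p}"

lemma J_top: "(p, k) \<in> J \<Longrightarrow> p \<le> top_degree F"
  using r_top[of p] by (auto simp: J_def not_less[symmetric])

lemma finite_J: "finite J"
proof -
  have "J \<subseteq> Sigma {..top_degree F} (\<lambda>p. {..<r p})" using J_top by (auto simp: J_def)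
  then show ?thesis by (rule finite_subset) auto
qed

lemma set_basis_index_J: "set (basis_index C P) = {i \<in> J. P (fst i)}"
  using J_top by (auto simp: set_basis_index C_simps(1) C_len J_def)

definition Dmat :: "nat \<times> nat \<Rightarrow> nat \<times> nat \<Rightarrow> 'g \<Rightarrow> 'p padic" where
  "Dmat i j = (if i \<in> J \<and> j \<in> J \<and> fst i = Suc (fst j) then to_c0 (dm (fst j) (snd i) (snd j)) else \<zero>\<^bsub>S\<^esub>)"

definition Smat :: "(nat \<Rightarrow> (('g \<Rightarrow> 'p padic) \<times> 'f \<Rightarrow>\<^sub>0 int) set \<Rightarrow> (('g \<Rightarrow> 'p padic) \<times> 'f \<Rightarrow>\<^sub>0 int) set) \<Rightarrow> nat \<times> nat \<Rightarrow> nat \<times> nat \<Rightarrow> 'g \<Rightarrow> 'p padic" where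
  "Smat \<delta> i j = (if i \<in> J \<and> j \<in> J \<and> fst j = Suc (fst i)
     then ccoord (fst j) (\<delta> (fst i) (tb (fst i) ! snd i)) (snd j) else \<zero>\<^bsub>S\<^esub>)"

lemma finsum_J:
  assumes f: "\<And>j. f j \<in> carrier S" and z: "\<And>j. j \<in> J \<Longrightarrow> fst j \<noteq> p \<Longrightarrow> f j = \<zero>\<^bsub>S\<^esub>"
  shows "finsum S f J = finsum S (\<lambda>k. f (p, k)) {..<r p}"
proof -
  interpret S: ring S by (rule S_ring)
  have "finsum S f J = finsum S f (Pair p ` {..<r p})"
  proof (rule S.add.finprod_mono_neutral_cong_right)
    show "f i = \<zero>\<^bsub>S\<^esub>" if "i \<in> J - Pair p ` {..<r p}" for i
      using that by (intro z) (auto simp: J_def)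
  qed (use finite_J f in \<open>auto simp: J_def\<close>)
  also have "\<dots> = finsum S (\<lambda>k. f (p, k)) {..<r p}"
    by (rule S.finsum_reindex) (use f in \<open>auto simp: inj_on_def\<close>)
  finally show ?thesis .
qed

lemma finsum_J_zero: "(\<And>j. j \<in> J \<Longrightarrow> f j = \<zero>\<^bsub>S\<^esub>) \<Longrightarrow> finsum S f J = \<zero>\<^bsub>S\<^esub>"
proof -
  interpret S: ring S by (rule S_ring)
  show "(\<And>j. j \<in> J \<Longrightarrow> f j = \<zero>\<^bsub>S\<^esub>) \<Longrightarrow> finsum S f J = \<zero>\<^bsub>S\<^esub>"
    by (rule S.add.finprod_one_eqI)
qed

lemma tb_closed: "k < r p \<Longrightarrow> tb p ! k \<in> carrier (Cx p)"
  using based_module.bs_closed[OF C_mod] by (simp add: C_len)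

context
  fixes \<delta> assumes \<delta>: "chain_contraction S C \<delta>"
begin

lemma \<delta>_hom: "\<delta> p \<in> lmod_hom S (Cx p) (Cx (Suc p))"
  using \<delta> by (simp add: chain_contraction_def)

lemma Dmat_closed: "Dmat i j \<in> carrier S" and Smat_closed: "Smat \<delta> i j \<in> carrier S"
proof -
  interpret S: ring S by (rule S_ring)
  show "Dmat i j \<in> carrier S" by (auto simp: Dmat_def J_def intro!: to_c0_S dm_closed)
  show "Smat \<delta> i j \<in> carrier S"
    by (auto simp: Smat_def J_def C_len intro!: based_module.co_closed[OF C_mod] lmod_homD(1)[OF \<delta>_hom] tb_closed)
qed

lemma Dmat_sq: "Dmat \<in> carrier (sq_mat J S)" and Smat_sq: "Smat \<delta> \<in> carrier (sq_mat J S)"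
  by (auto simp: sq_mat_simps Dmat_closed Smat_closed) (auto simp: Dmat_def Smat_def)

lemma Dmat_coords: "k < r (Suc p) \<Longrightarrow> l < r p \<Longrightarrow>
    Dmat (Suc p, k) (p, l) = ccoord p (boundary C (Suc p) (tb (Suc p) ! k)) l"
  by (simp add: Dmat_def J_def C_matrix)

lemma Smat_coords: "k < r p \<Longrightarrow> l < r (Suc p) \<Longrightarrow>
    Smat \<delta> (p, k) (Suc p, l) = ccoord (Suc p) (\<delta> p (tb p ! k)) l"
  by (simp add: Smat_def J_def)

lemma finsum_coords:
  assumes h: "h \<in> lmod_hom S (Cx p) (Cx \<mu>)" and x: "x \<in> carrier (Cx p)" and m: "m < r \<mu>"
    and A: "\<And>l. l < r p \<Longrightarrow> A l = ccoord p x l"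
    and B: "\<And>l. l < r p \<Longrightarrow> B l = ccoord \<mu> (h (tb p ! l)) m"
  shows "finsum S (\<lambda>l. A l \<otimes>\<^bsub>S\<^esub> B l) {..<r p} = ccoord \<mu> (h x) m"
proof -
  interpret S: ring S by (rule S_ring)
  interpret B: based_module S "Cx p" "tb p" by (rule C_mod)
  interpret A: based_module S "Cx \<mu>" "tb \<mu>" by (rule C_mod)
  show ?thesis
    using m coords_hom[OF C_mod C_mod h x, of m] x
    by (auto simp: C_len A B intro!: S.finsum_cong' S.m_closed B.co_closed A.co_closed lmod_homD(1)[OF h] tb_closed)
qed

lemma Dmat_Dmat: "Dmat \<otimes>\<^bsub>sq_mat J S\<^esub> Dmat = \<zero>\<^bsub>sq_mat J S\<^esub>"
  unfolding sq_mat_simps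
proof (rule ext, rule ext)
  interpret S: ring S by (rule S_ring)
  fix i k
  show "finsum S (\<lambda>j. Dmat i j \<otimes>\<^bsub>S\<^esub> Dmat j k) J = \<zero>\<^bsub>S\<^esub>"
  proof (cases "i \<in> J \<and> k \<in> J \<and> fst i = Suc (Suc (fst k))")
    case True
    then obtain p a c where ik: "i = (Suc (Suc p), a)" "k = (p, c)" and a: "a < r (Suc (Suc p))" and c: "c < r p"
      by (cases i, cases k) (auto simp: J_def)
    have "finsum S (\<lambda>j. Dmat i j \<otimes>\<^bsub>S\<^esub> Dmat j k) J = finsum S (\<lambda>l. Dmat i (Suc p, l) \<otimes>\<^bsub>S\<^esub> Dmat (Suc p, l) k) {..<r (Suc p)}"
      by (rule finsum_J) (auto simp: Dmat_closed S.m_closed, auto simp: Dmat_def ik)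
    also have "\<dots> = ccoord p (boundary C (Suc p) (boundary C (Suc (Suc p)) (tb (Suc (Suc p)) ! a))) c"
      unfolding ik by (rule finsum_coords[OF C_hom lmod_homD(1)[OF C_hom] c]) (auto simp: a c Dmat_coords tb_closed)
    also have "\<dots> = \<zero>\<^bsub>S\<^esub>" unfolding C_bd_bd[OF tb_closed[OF a]]
      using based_module.co_zero[OF C_mod, of c] c by (simp add: C_len)
    finally show ?thesis .
  next
    case False
    have "Dmat i j = \<zero>\<^bsub>S\<^esub> \<or> Dmat j k = \<zero>\<^bsub>S\<^esub>" for j using False by (auto simp: Dmat_def)
    then show ?thesis by (intro finsum_J_zero) (metis S.l_null S.r_null Dmat_closed)
  qed
qed

lemma Dmat_Smat:
  "Dmat \<otimes>\<^bsub>sq_mat J S\<^esub> Smat \<delta> \<oplus>\<^bsub>sq_mat J S\<^esub> Smat \<delta> \<otimes>\<^bsub>sq_mat J S\<^esub> Dmat = \<one>\<^bsub>sq_mat J S\<^esub>"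
  unfolding sq_mat_simps
proof (rule ext, rule ext)
  interpret S: ring S by (rule S_ring)
  fix i k
  let ?DS = "finsum S (\<lambda>j. Dmat i j \<otimes>\<^bsub>S\<^esub> Smat \<delta> j k) J" and ?SD = "finsum S (\<lambda>j. Smat \<delta> i j \<otimes>\<^bsub>S\<^esub> Dmat j k) J"
  show "?DS \<oplus>\<^bsub>S\<^esub> ?SD = (if i = k \<and> i \<in> J then \<one>\<^bsub>S\<^esub> else \<zero>\<^bsub>S\<^esub>)"
  proof (cases "i \<in> J \<and> k \<in> J \<and> fst i = fst k")
    case True
    then obtain p a c where ik: "i = (p, a)" "k = (p, c)" and a: "a < r p" and c: "c < r p"
      by (cases i, cases k) (auto simp: J_def)
    interpret B: based_module S "Cx p" "tb p" by (rule C_mod)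
    let ?b = "tb p ! a"
    have b: "?b \<in> carrier (Cx p)" by (rule tb_closed[OF a])
    have "?SD = finsum S (\<lambda>l. Smat \<delta> i (Suc p, l) \<otimes>\<^bsub>S\<^esub> Dmat (Suc p, l) k) {..<r (Suc p)}"
      by (rule finsum_J) (auto simp: Dmat_closed Smat_closed S.m_closed, auto simp: Dmat_def Smat_def ik)
    also have "\<dots> = B.co (boundary C (Suc p) (\<delta> p ?b)) c"
      unfolding ik by (rule finsum_coords[OF C_hom lmod_homD(1)[OF \<delta>_hom] c]) (auto simp: a c Dmat_coords Smat_coords tb_closed)
    finally have SD: "?SD = B.co (boundary C (Suc p) (\<delta> p ?b)) c" .
    have one: "B.co ?b c = (if i = k \<and> i \<in> J then \<one>\<^bsub>S\<^esub> else \<zero>\<^bsub>S\<^esub>)"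
      using a c B.co_bs[of a c] by (auto simp: ik J_def C_len)
    show ?thesis
    proof (cases p)
      case 0
      have "?DS = \<zero>\<^bsub>S\<^esub>" using Smat_closed
        by (intro finsum_J_zero) (auto simp: Dmat_def ik 0)
      moreover have "boundary C (Suc p) (\<delta> p ?b) = ?b" using \<delta> b 0 by (simp add: chain_contraction_def)
      moreover have "?SD \<in> carrier S" by (intro S.finsum_closed) (auto simp: Dmat_closed Smat_closed S.m_closed)
      ultimately show ?thesis using SD one by simp
    next
      case (Suc \<mu>)
      have bb: "boundary C (Suc \<mu>) ?b \<in> carrier (Cx \<mu>)" using lmod_homD(1)[OF C_hom[of \<mu>]] b Suc by simp
      have "?DS = finsum S (\<lambda>l. Dmat i (\<mu>, l) \<otimes>\<^bsub>S\<^esub> Smat \<delta> (\<mu>, l) k) {..<r \<mu>}"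
        by (rule finsum_J) (auto simp: Dmat_closed Smat_closed S.m_closed, auto simp: Dmat_def Smat_def ik Suc)
      also have "\<dots> = B.co (\<delta> \<mu> (boundary C (Suc \<mu>) ?b)) c"
        using a c unfolding ik Suc by (intro finsum_coords[OF \<delta>_hom bb[unfolded Suc]]) (auto simp: Dmat_coords Smat_coords)
      finally have DS: "?DS = B.co (\<delta> \<mu> (boundary C (Suc \<mu>) ?b)) c" .
      have "\<delta> \<mu> (boundary C (Suc \<mu>) ?b) \<oplus>\<^bsub>Cx p\<^esub> boundary C (Suc p) (\<delta> p ?b) = ?b"
        using \<delta> b unfolding Suc by (simp add: chain_contraction_def)
      moreover have "B.co (\<delta> \<mu> (boundary C (Suc \<mu>) ?b) \<oplus>\<^bsub>Cx p\<^esub> boundary C (Suc p) (\<delta> p ?b)) c = ?DS \<oplus>\<^bsub>S\<^esub> ?SD"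
        unfolding DS SD using lmod_homD(1)[OF \<delta>_hom bb] lmod_homD(1)[OF C_hom lmod_homD(1)[OF \<delta>_hom b]] c Suc
        by (intro B.co_add) (simp_all add: C_len)
      ultimately show ?thesis using one by simp
    qed
  next
    case False
    have "Dmat i j = \<zero>\<^bsub>S\<^esub> \<or> Smat \<delta> j k = \<zero>\<^bsub>S\<^esub>" "Smat \<delta> i j = \<zero>\<^bsub>S\<^esub> \<or> Dmat j k = \<zero>\<^bsub>S\<^esub>" for j
      using False by (auto simp: Dmat_def Smat_def)
    then have "?DS = \<zero>\<^bsub>S\<^esub>" "?SD = \<zero>\<^bsub>S\<^esub>"
      by (intro finsum_J_zero; metis S.l_null S.r_null Dmat_closed Smat_closed)+
    then show ?thesis using False by auto
  qed
qed

lemma torsion_matrix_eq: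
  "torsion_matrix S C \<delta> = (\<lambda>i j. if i < length (basis_index C odd) \<and> j < length (basis_index C even)
     then Dmat (basis_index C odd ! i) (basis_index C even ! j) \<oplus>\<^bsub>S\<^esub> Smat \<delta> (basis_index C odd ! i) (basis_index C even ! j)
     else \<zero>\<^bsub>S\<^esub>)"
proof (rule ext, rule ext)
  interpret S: ring S by (rule S_ring)
  fix i j
  let ?os = "basis_index C odd" and ?es = "basis_index C even"
  show "torsion_matrix S C \<delta> i j = (if i < length ?os \<and> j < length ?es then Dmat (?os ! i) (?es ! j) \<oplus>\<^bsub>S\<^esub> Smat \<delta> (?os ! i) (?es ! j) else \<zero>\<^bsub>S\<^esub>)"
  proof (cases "i < length ?os \<and> j < length ?es")
    case True
    obtain p k \<mu> l where e: "?os ! i = (p, k)" "?es ! j = (\<mu>, l)" by (cases "?os ! i", cases "?es ! j")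
    have J: "(p, k) \<in> J" "(\<mu>, l) \<in> J"
      using True nth_mem[of i ?os] nth_mem[of j ?es] unfolding e set_basis_index_J by auto
    have c1: "Smat \<delta> (p, k) (\<mu>, l) = \<zero>\<^bsub>S\<^esub>" "Dmat (p, k) (\<mu>, l) = ccoord \<mu> (boundary C p (tb p ! k)) l" if "p = Suc \<mu>"
      using that J by (simp_all add: Smat_def Dmat_coords J_def)
    have c2: "Dmat (p, k) (\<mu>, l) = \<zero>\<^bsub>S\<^esub>" "Smat \<delta> (p, k) (\<mu>, l) = ccoord \<mu> (\<delta> p (tb p ! k)) l" if "\<mu> = Suc p"
      using that J by (simp_all add: Dmat_def Smat_coords J_def)
    have c3: "Dmat (p, k) (\<mu>, l) = \<zero>\<^bsub>S\<^esub>" "Smat \<delta> (p, k) (\<mu>, l) = \<zero>\<^bsub>S\<^esub>" if "p \<noteq> Suc \<mu>" "\<mu> \<noteq> Suc p"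
      using that by (simp_all add: Dmat_def Smat_def)
    have *: "torsion_matrix S C \<delta> i j = (if p = Suc \<mu> then ccoord \<mu> (boundary C p (tb p ! k)) l
        else if \<mu> = Suc p then ccoord \<mu> (\<delta> p (tb p ! k)) l else \<zero>\<^bsub>S\<^esub>)"
      using True by (simp add: torsion_matrix_def e)
    note cl = Dmat_closed[of "(p, k)" "(\<mu>, l)"] Smat_closed[of "(p, k)" "(\<mu>, l)"]
    have "torsion_matrix S C \<delta> i j = Dmat (p, k) (\<mu>, l) \<oplus>\<^bsub>S\<^esub> Smat \<delta> (p, k) (\<mu>, l)"
    proof (cases "p = Suc \<mu>")
      case True then show ?thesis unfolding * using cl c1[OF True] S.r_zero by (metis (full_types))
    next
      case nA: False
      show ?thesis
      proof (cases "\<mu> = Suc p")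
        case True then show ?thesis unfolding * using nA cl c2[OF True] S.l_zero by (metis (full_types))
      next
        case False then show ?thesis unfolding * using nA c3[OF nA False] S.l_zero S.zero_closed by (metis (full_types))
      qed
    qed
    then show ?thesis using True by (simp add: e)
  qed (auto simp: torsion_matrix_def)
qed

lemma torsion_matrix_unit:
  assumes len: "length (basis_index C odd) = length (basis_index C even)"
  shows "torsion_matrix S C \<delta> \<in> Units (mat_ring (length (basis_index C odd)) S)"
proof -
  interpret S: ring S by (rule S_ring)
  let ?os = "basis_index C odd" and ?es = "basis_index C even"
  have u: "Dmat \<oplus>\<^bsub>sq_mat J S\<^esub> Smat \<delta> \<in> Units (sq_mat J S)"
    by (rule differential_plus_contraction_unit[where dg = fst, OF S_ring finite_J Dmat_sq Smat_sq Dmat_Dmat Dmat_Smat])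
      (auto simp: Smat_def split: if_splits)
  have "(\<lambda>i j. if i < length ?os \<and> j < length ?os then (Dmat \<oplus>\<^bsub>sq_mat J S\<^esub> Smat \<delta>) (?os ! i) (?es ! j) else \<zero>\<^bsub>S\<^esub>)
     \<in> Units (mat_ring (length ?os) S)"
  proof (rule odd_even_block_unit[OF S_ring finite_J u distinct_basis_index distinct_basis_index len])
    show "J = set ?os \<union> set ?es" "set ?os \<inter> set ?es = {}" unfolding set_basis_index_J by auto
    show "(Dmat \<oplus>\<^bsub>sq_mat J S\<^esub> Smat \<delta>) i j = \<zero>\<^bsub>S\<^esub>" if "i \<in> set ?os" "j \<in> set ?os" for i j
      using that unfolding set_basis_index_J sq_mat_simps by (auto simp: Dmat_def Smat_def)
    show "(Dmat \<oplus>\<^bsub>sq_mat J S\<^esub> Smat \<delta>) i j = \<zero>\<^bsub>S\<^esub>" if "i \<in> set ?es" "j \<in> set ?es" for i j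
      using that unfolding set_basis_index_J sq_mat_simps by (auto simp: Dmat_def Smat_def)
  qed simp
  then show ?thesis unfolding torsion_matrix_eq sq_mat_simps(5) len[symmetric] .
qed

end

end

section \<open>Passing to a finite quotient\<close>

lemma det_on_eq_ldet:
  assumes d: "distinct zs"
  shows "det_on (set zs) A = ldet zs zs A"
proof -
  let ?n = "length zs"
  have bij: "bij_betw ((!) zs) {0..<?n} (set zs)"
    using bij_betw_nth[OF d, of "{..<?n}" "set zs"] by (simp add: lessThan_atLeast0)
  let ?m = "\<lambda>\<pi> x. if x \<in> set zs then zs ! (\<pi> (inv_into {0..<?n} ((!) zs) x)) else x"
  have mp: "?m \<pi> = map_permutation {0..<?n} ((!) zs) \<pi>" for \<pi>
    using bij by (auto simp: map_permutation_def restrict_id_def bij_betw_def fun_eq_iff)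
  have inv: "inv_into {0..<?n} ((!) zs) (zs ! i) = i" if "i < ?n" for i
    using bij that by (intro inv_into_f_f) (auto simp: bij_betw_def)
  have "det_on (set zs) A = (\<Sum>\<pi> | \<pi> permutes {0..<?n}. of_int (sign (?m \<pi>)) * (\<Prod>x\<in>set zs. A x (?m \<pi> x)))"
    unfolding det_on_def by (rule sum.reindex_bij_betw[OF bij_betw_permutations[OF bij], symmetric])
  also have "\<dots> = (\<Sum>\<pi> | \<pi> permutes {0..<?n}. of_int (sign \<pi>) * (\<Prod>i = 0..<?n. A (zs ! i) (zs ! \<pi> i)))"
  proof (rule sum.cong[OF refl])
    fix \<pi> assume "\<pi> \<in> {\<pi>. \<pi> permutes {0..<?n}}"
    then have p: "\<pi> permutes {0..<?n}" by simp
    have "sign (?m \<pi>) = sign \<pi>"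
      unfolding mp by (rule sign_map_permutation[OF _ p]) (use bij in \<open>auto simp: bij_betw_def\<close>)
    moreover have "(\<Prod>x\<in>set zs. A x (?m \<pi> x)) = (\<Prod>i = 0..<?n. A (zs ! i) (?m \<pi> (zs ! i)))"
      by (rule prod.reindex_bij_betw[OF bij, symmetric])
    moreover have "\<dots> = (\<Prod>i = 0..<?n. A (zs ! i) (zs ! \<pi> i))"
      by (rule prod.cong) (auto simp: inv)
    ultimately show "of_int (sign (?m \<pi>)) * (\<Prod>x\<in>set zs. A x (?m \<pi> x)) = of_int (sign \<pi>) * (\<Prod>i = 0..<?n. A (zs ! i) (zs ! \<pi> i))"
      by simp
  qed
  also have "\<dots> = ldet zs zs A"
  proof -
    have "\<pi> i < ?n" if "\<pi> permutes {0..<?n}" "i < ?n" for \<pi> i using permutes_in_image[OF that(1), of i] that(2) by simp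
    then show ?thesis unfolding ldet_def Determinant.det_def by (auto intro!: sum.cong prod.cong)
  qed
  finally show ?thesis .
qed

locale finite_quotient = group G for G :: "'a monoid" (structure) +
  fixes N :: "'a set"
  assumes normal: "N \<lhd> G" and fin_index: "finite (rcosets N)"
begin

definition Q :: "'a set monoid" where "Q = G Mod N"

definition \<pi> :: "'a \<Rightarrow> 'a set" where "\<pi> g = N #> g"

lemma N_sub: "subgroup N G" using normal by (rule normal_imp_subgroup)

lemma Q_group: "group Q" unfolding Q_def by (rule normal.factorgroup_is_group[OF normal])

lemma Q_carrier: "carrier Q = rcosets N" by (simp add: FactGroup_def Q_def)

lemma finite_Q: "finite (carrier Q)" using fin_index by (simp add: Q_carrier)

lemma \<pi>_hom: "\<pi> \<in> hom G Q" unfolding \<pi>_def Q_def by (rule normal.r_coset_hom_Mod[OF normal])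

lemma \<pi>_closed: "g \<in> carrier G \<Longrightarrow> \<pi> g \<in> carrier Q" using \<pi>_hom by (auto simp: hom_def)

lemma \<pi>_mult: "g \<in> carrier G \<Longrightarrow> h \<in> carrier G \<Longrightarrow> \<pi> (g \<otimes> h) = \<pi> g \<otimes>\<^bsub>Q\<^esub> \<pi> h" using \<pi>_hom by (auto simp: hom_def)

lemma \<pi>_one: "\<pi> \<one> = \<one>\<^bsub>Q\<^esub>" by (rule hom_one[OF \<pi>_hom group_axioms Q_group])

lemma \<pi>_inv: "g \<in> carrier G \<Longrightarrow> \<pi> (inv g) = inv\<^bsub>Q\<^esub> \<pi> g"
  using group_hom.hom_inv[of G Q \<pi> g] \<pi>_hom Q_group group_axioms by (simp add: group_hom_def group_hom_axioms_def)

lemma \<pi>_surj: "C \<in> carrier Q \<Longrightarrow> \<exists>g\<in>carrier G. \<pi> g = C"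
  by (auto simp: Q_carrier RCOSETS_def \<pi>_def)

lemma coset_eq: "C \<in> carrier Q \<Longrightarrow> C = {g \<in> carrier G. \<pi> g = C}"
proof (intro equalityI subsetI)
  fix g assume C: "C \<in> carrier Q" and g: "g \<in> C"
  obtain h where h: "h \<in> carrier G" "C = \<pi> h" using \<pi>_surj[OF C] by blast
  have gG: "g \<in> carrier G" using g h r_coset_subset_G[OF subgroup.subset[OF N_sub], of h] by (auto simp: \<pi>_def)
  have "\<pi> h = \<pi> g" using g h repr_independence[OF _ h(1) N_sub, of g] by (simp add: \<pi>_def)
  then show "g \<in> {g \<in> carrier G. \<pi> g = C}" using gG h by simp
next
  fix g assume "C \<in> carrier Q" "g \<in> {g \<in> carrier G. \<pi> g = C}"
  then show "g \<in> C" using rcos_self[OF _ N_sub, of g] by (auto simp: \<pi>_def)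
qed

lemma coset_iff: "C \<in> carrier Q \<Longrightarrow> g \<in> C \<longleftrightarrow> g \<in> carrier G \<and> \<pi> g = C"
  using coset_eq[of C] by blast

lemma \<pi>_in_N: "g \<in> carrier G \<Longrightarrow> \<pi> g = \<one>\<^bsub>Q\<^esub> \<longleftrightarrow> g \<in> N"
  using coset_iff[of "\<one>\<^bsub>Q\<^esub>" g] group.is_monoid[OF Q_group] monoid.one_closed[of Q] by (simp add: FactGroup_def Q_def)

text \<open>
  The matrix of right multiplication by the image of \<open>x\<close> on the group ring of the quotient.
\<close>

definition fl :: "('a \<Rightarrow> 'p::prime_card padic) \<Rightarrow> 'a set \<Rightarrow> 'a set \<Rightarrow> 'p padic" where
  "fl x a b = infsum x (inv\<^bsub>Q\<^esub> a \<otimes>\<^bsub>Q\<^esub> b)"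

text \<open>
  A factorization \<open>h k\<close> of an element of the coset \<open>a^{-1} c\<close> is sorted by the coset \<open>b\<close> of \<open>a h\<close>.
\<close>

lemma fl_mult:
  fixes x y :: "'a \<Rightarrow> 'p::prime_card padic"
  assumes x: "x \<in> carrier (c0 G)" and y: "y \<in> carrier (c0 G)" and a: "a \<in> carrier Q" and c: "c \<in> carrier Q"
  shows "fl (x \<otimes>\<^bsub>c0 G\<^esub> y) a c = (\<Sum>b\<in>carrier Q. fl x a b * fl y b c)"
proof -
  interpret Q: group Q by (rule Q_group)
  let ?f = "\<lambda>z. x (fst z) * y (snd z)"
  define B where "B b = (inv\<^bsub>Q\<^esub> a \<otimes>\<^bsub>Q\<^esub> b) \<times> (inv\<^bsub>Q\<^esub> b \<otimes>\<^bsub>Q\<^esub> c)" for b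
  have nx: "null_fam x" and ny: "null_fam y" using x y by (auto simp: c0_simps)
  have ac: "inv\<^bsub>Q\<^esub> a \<otimes>\<^bsub>Q\<^esub> c \<in> carrier Q" using a c by simp
  have sub: "inv\<^bsub>Q\<^esub> a \<otimes>\<^bsub>Q\<^esub> c \<subseteq> carrier G" using coset_iff[OF ac] by blast
  have Bm: "(h, k) \<in> B b \<longleftrightarrow> h \<in> carrier G \<and> k \<in> carrier G \<and> \<pi> h = inv\<^bsub>Q\<^esub> a \<otimes>\<^bsub>Q\<^esub> b \<and> \<pi> k = inv\<^bsub>Q\<^esub> b \<otimes>\<^bsub>Q\<^esub> c"
    if "b \<in> carrier Q" for h k b using that a c by (auto simp: B_def coset_iff)
  have U: "{(h, k). h \<in> carrier G \<and> k \<in> carrier G \<and> h \<otimes> k \<in> inv\<^bsub>Q\<^esub> a \<otimes>\<^bsub>Q\<^esub> c} = (\<Union>b\<in>carrier Q. B b)"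
  proof (intro equalityI subsetI; clarify)
    fix h k assume hk: "h \<in> carrier G" "k \<in> carrier G" "h \<otimes> k \<in> inv\<^bsub>Q\<^esub> a \<otimes>\<^bsub>Q\<^esub> c"
    have e: "\<pi> h \<otimes>\<^bsub>Q\<^esub> \<pi> k = inv\<^bsub>Q\<^esub> a \<otimes>\<^bsub>Q\<^esub> c" using hk coset_iff[OF ac] by (simp add: \<pi>_mult)
    let ?b = "a \<otimes>\<^bsub>Q\<^esub> \<pi> h"
    have b: "?b \<in> carrier Q" using a hk by (simp add: \<pi>_closed)
    have "\<pi> k = inv\<^bsub>Q\<^esub> \<pi> h \<otimes>\<^bsub>Q\<^esub> (inv\<^bsub>Q\<^esub> a \<otimes>\<^bsub>Q\<^esub> c)" unfolding e[symmetric] using hk by (simp add: \<pi>_closed Q.inv_cancel)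
    then have "(h, k) \<in> B ?b" unfolding Bm[OF b] using hk a c by (simp add: \<pi>_closed Q.inv_cancel Q.inv_mult_group Q.m_assoc)
    then show "(h, k) \<in> (\<Union>b\<in>carrier Q. B b)" using b by blast
  next
    fix b h k assume b: "b \<in> carrier Q" and "(h, k) \<in> B b"
    then show "h \<in> carrier G \<and> k \<in> carrier G \<and> h \<otimes> k \<in> inv\<^bsub>Q\<^esub> a \<otimes>\<^bsub>Q\<^esub> c"
      unfolding Bm[OF b] coset_iff[OF ac] using a b c by (simp add: \<pi>_mult Q.m_assoc Q.inv_cancel)
  qed
  have "fl (x \<otimes>\<^bsub>c0 G\<^esub> y) a c = infsum ?f (\<Union>b\<in>carrier Q. B b)"
    unfolding fl_def c0_mult_sum(1)[OF x y sub] U ..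
  also have "\<dots> = (\<Sum>b\<in>carrier Q. infsum ?f (B b))"
  proof (rule sum_infsum[symmetric, OF finite_Q])
    show "?f summable_on B b" for b by (rule c0_mult_sum(2)[OF x y subset_refl])
    show "B b \<inter> B b' = {}" if b: "b \<in> carrier Q" "b' \<in> carrier Q" "b \<noteq> b'" for b b'
    proof -
      have "inv\<^bsub>Q\<^esub> a \<otimes>\<^bsub>Q\<^esub> b \<noteq> inv\<^bsub>Q\<^esub> a \<otimes>\<^bsub>Q\<^esub> b'" using a b by simp
      then show ?thesis using Bm[OF b(1)] Bm[OF b(2)] by auto
    qed
  qed
  also have "\<dots> = (\<Sum>b\<in>carrier Q. fl x a b * fl y b c)"
    unfolding B_def fl_def null_fam_infsum_prod[OF nx ny] ..
  finally show ?thesis .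
qed

lemma fl_add:
  "x \<in> carrier (c0 G) \<Longrightarrow> y \<in> carrier (c0 G) \<Longrightarrow> fl (x \<oplus>\<^bsub>c0 G\<^esub> y) a b = fl x a b + fl y a b"
  unfolding fl_def c0_simps by (intro null_fam_infsum_add) auto

lemma fl_zero: "fl \<zero>\<^bsub>c0 G\<^esub> a b = 0"
  by (simp add: fl_def c0_simps)

lemma fl_one:
  assumes "a \<in> carrier Q" "b \<in> carrier Q"
  shows "fl \<one>\<^bsub>c0 G\<^esub> a b = (if a = b then 1 else 0)"
proof -
  interpret Q: group Q by (rule Q_group)
  have "fl \<one>\<^bsub>c0 G\<^esub> a b = (if \<one> \<in> inv\<^bsub>Q\<^esub> a \<otimes>\<^bsub>Q\<^esub> b then 1 else 0)"
    unfolding fl_def c0_simps by (subst infsum_single[of _ \<one>]) (auto simp: group_elt_def)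
  also have "\<one> \<in> inv\<^bsub>Q\<^esub> a \<otimes>\<^bsub>Q\<^esub> b \<longleftrightarrow> \<one>\<^bsub>Q\<^esub> = inv\<^bsub>Q\<^esub> a \<otimes>\<^bsub>Q\<^esub> b"
    using coset_iff[OF Q.m_closed[OF Q.inv_closed[OF assms(1)] assms(2)], of \<one>] by (simp only: one_closed \<pi>_one simp_thms)
  also have "\<dots> \<longleftrightarrow> a = b"
  proof
    assume "\<one>\<^bsub>Q\<^esub> = inv\<^bsub>Q\<^esub> a \<otimes>\<^bsub>Q\<^esub> b"
    then have "a \<otimes>\<^bsub>Q\<^esub> \<one>\<^bsub>Q\<^esub> = b" using Q.inv_cancel(1)[OF assms] by (simp only:)
    then show "a = b" using assms(1) by (simp only: Q.r_one)
  qed (use Q.l_inv[OF assms(1)] in \<open>simp only:\<close>)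
  finally show ?thesis .
qed

lemma fl_finsum:
  fixes f :: "'i \<Rightarrow> 'a \<Rightarrow> 'p::prime_card padic"
  assumes "finite A" "\<And>i. i \<in> A \<Longrightarrow> f i \<in> carrier (c0 G)"
  shows "fl (finsum (c0 G) f A) a b = (\<Sum>i\<in>A. fl (f i) a b)"
proof -
  interpret S: ring "c0 G :: ('a \<Rightarrow> 'p padic) ring" by (rule ring_c0)
  show ?thesis using assms
    by (induction A rule: finite_induct) (auto simp: fl_zero fl_add S.finsum_insert S.finsum_closed Pi_def)
qed

definition ifl :: "('a \<Rightarrow> int) \<Rightarrow> 'a set \<Rightarrow> 'a set \<Rightarrow> int" where
  "ifl d a b = (\<Sum>u | d u \<noteq> 0 \<and> u \<in> inv\<^bsub>Q\<^esub> a \<otimes>\<^bsub>Q\<^esub> b. d u)"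

lemma fl_to_c0:
  assumes "d \<in> carrier (group_ring G)"
  shows "fl (to_c0 d) a b = (of_int (ifl d a b) :: 'p::prime_card padic)"
proof -
  let ?C = "inv\<^bsub>Q\<^esub> a \<otimes>\<^bsub>Q\<^esub> b"
  have f: "finite {u. d u \<noteq> 0 \<and> u \<in> ?C}" using assms by (auto simp: group_ring_simps)
  have "infsum (to_c0 d :: 'a \<Rightarrow> 'p padic) ?C = infsum (to_c0 d) {u. d u \<noteq> 0 \<and> u \<in> ?C}"
    by (rule infsum_cong_neutral) (auto simp: to_c0_def)
  then show ?thesis using f by (simp add: fl_def ifl_def to_c0_def)
qed

lemma group_ring_entry:
  fixes x :: "'a \<Rightarrow> 'p::prime_card padic"
  assumes a: "a \<in> carrier Q" and b: "b \<in> carrier Q"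
  shows "(group_elt a \<otimes>\<^bsub>group_ring Q\<^esub> c0_quotient_map G N x) b = fl x a b"
proof -
  interpret Q: group Q by (rule Q_group)
  have "{h. (group_elt a h :: 'p padic) \<noteq> 0} = {a}" by (auto simp: group_elt_def)
  then show ?thesis using a b
    by (simp add: Q.group_ring_simps c0_quotient_map_def fl_def Q_def[symmetric]) (simp add: group_elt_def)
qed

end

locale quotient_resolution = completed_resolution G M F \<epsilon> S + finite_quotient G N
  for G :: "'g monoid" (structure) and M :: "('g \<Rightarrow> int, 'm) module"
    and F :: "('g \<Rightarrow> int, 'f) based_complex" and \<epsilon> :: "'f \<Rightarrow> 'm" and S :: "('g \<Rightarrow> 'p::prime_card padic) ring"
    and N :: "'g set"
begin

definition I :: "((nat \<times> nat) \<times> 'g set) set" where "I = J \<times> carrier Q"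

definition DI :: "(nat \<times> nat) \<times> 'g set \<Rightarrow> (nat \<times> nat) \<times> 'g set \<Rightarrow> int" where
  "DI i j = (if i \<in> I \<and> j \<in> I \<and> fst (fst i) = Suc (fst (fst j))
     then ifl (dm (fst (fst j)) (snd (fst i)) (snd (fst j))) (snd i) (snd j) else 0)"

abbreviation "idg \<equiv> \<lambda>i :: (nat \<times> nat) \<times> 'g set. fst (fst i)"

lemma flS:
  "fl \<zero>\<^bsub>S\<^esub> a b = 0"
  "x \<in> carrier S \<Longrightarrow> y \<in> carrier S \<Longrightarrow> fl (x \<oplus>\<^bsub>S\<^esub> y) a b = fl x a b + fl y a b"
  "a \<in> carrier Q \<Longrightarrow> b \<in> carrier Q \<Longrightarrow> fl \<one>\<^bsub>S\<^esub> a b = (if a = b then 1 else 0)"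
  "x \<in> carrier S \<Longrightarrow> y \<in> carrier S \<Longrightarrow> a \<in> carrier Q \<Longrightarrow> b \<in> carrier Q \<Longrightarrow>
     fl (x \<otimes>\<^bsub>S\<^esub> y) a b = (\<Sum>c\<in>carrier Q. fl x a c * fl y c b)"
  "finite A \<Longrightarrow> (\<And>i. i \<in> A \<Longrightarrow> f i \<in> carrier S) \<Longrightarrow> fl (finsum S f A) a b = (\<Sum>i\<in>A. fl (f i) a b)"
  unfolding S_eq by (rule fl_zero fl_add fl_one fl_mult fl_finsum; assumption)+

lemma finite_I: "finite I" by (simp add: I_def finite_J finite_Q)

lemma DI_fl: "i \<in> I \<Longrightarrow> j \<in> I \<Longrightarrow> of_int (DI i j) = fl (Dmat (fst i) (fst j)) (snd i) (snd j)"
  by (cases i; cases j)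
    (auto simp: DI_def Dmat_def I_def J_def fl_to_c0[OF dm_closed] flS(1))

context
  fixes \<delta> assumes \<delta>: "chain_contraction S C \<delta>"
begin

definition SI :: "(nat \<times> nat) \<times> 'g set \<Rightarrow> (nat \<times> nat) \<times> 'g set \<Rightarrow> 'p padic" where
  "SI i j = fl (Smat \<delta> (fst i) (fst j)) (snd i) (snd j)"

lemma fl_matrix_mult:
  assumes A: "\<And>i j. A i j \<in> carrier S" and B: "\<And>i j. B i j \<in> carrier S" and ik: "i \<in> I" "k \<in> I"
  shows "(\<Sum>j\<in>I. fl (A (fst i) (fst j)) (snd i) (snd j) * fl (B (fst j) (fst k)) (snd j) (snd k))
     = fl ((A \<otimes>\<^bsub>sq_mat J S\<^esub> B) (fst i) (fst k)) (snd i) (snd k)"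
proof -
  interpret S: ring S by (rule S_ring)
  have q: "snd i \<in> carrier Q" "snd k \<in> carrier Q" using ik by (auto simp: I_def)
  have "fl ((A \<otimes>\<^bsub>sq_mat J S\<^esub> B) (fst i) (fst k)) (snd i) (snd k)
     = (\<Sum>j\<in>J. fl (A (fst i) j \<otimes>\<^bsub>S\<^esub> B j (fst k)) (snd i) (snd k))"
    unfolding sq_mat_simps using A B by (intro flS(5) finite_J) auto
  also have "\<dots> = (\<Sum>j\<in>J. \<Sum>b\<in>carrier Q. fl (A (fst i) j) (snd i) b * fl (B j (fst k)) b (snd k))"
    by (intro sum.cong refl flS(4) A B q)
  also have "\<dots> = (\<Sum>z\<in>I. fl (A (fst i) (fst z)) (snd i) (snd z) * fl (B (fst z) (fst k)) (snd z) (snd k))"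
    unfolding I_def by (simp add: sum.cartesian_product case_prod_unfold)
  finally show ?thesis ..
qed

lemma quotient_contracted: "contracted I idg DI SI"
  unfolding contracted_def
proof (intro conjI ballI impI)
  interpret S: ring S by (rule S_ring)
  note cl = Dmat_closed[OF \<delta>] Smat_closed[OF \<delta>]
  show "finite I" by (rule finite_I)
  show "idg i = Suc (idg j)" if "DI i j \<noteq> 0" for i j using that by (auto simp: DI_def split: if_splits)
  show "idg j = Suc (idg i)" if "SI i j \<noteq> 0" for i j
    using that by (auto simp: SI_def Smat_def flS(1) split: if_splits)
  fix i k assume ik: "i \<in> I" "k \<in> I"
  have "(of_int (\<Sum>j\<in>I. DI i j * DI j k) :: 'p padic) = (\<Sum>j\<in>I. of_int (DI i j) * of_int (DI j k))" by simp
  also have "\<dots> = (\<Sum>j\<in>I. fl (Dmat (fst i) (fst j)) (snd i) (snd j) * fl (Dmat (fst j) (fst k)) (snd j) (snd k))"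
    using ik by (intro sum.cong refl) (simp add: DI_fl)
  also have "\<dots> = 0"
    unfolding fl_matrix_mult[where A = Dmat and B = Dmat, OF cl(1) cl(1) ik] Dmat_Dmat[OF \<delta>] by (simp add: sq_mat_simps flS(1))
  finally show "(\<Sum>j\<in>I. DI i j * DI j k) = 0" by (simp only: of_int_eq_0_iff)
  have "(\<Sum>j\<in>I. of_int (DI i j) * SI j k) + (\<Sum>j\<in>I. SI i j * of_int (DI j k))
     = (\<Sum>j\<in>I. fl (Dmat (fst i) (fst j)) (snd i) (snd j) * fl (Smat \<delta> (fst j) (fst k)) (snd j) (snd k))
     + (\<Sum>j\<in>I. fl (Smat \<delta> (fst i) (fst j)) (snd i) (snd j) * fl (Dmat (fst j) (fst k)) (snd j) (snd k))"
    using ik by (intro arg_cong2[of _ _ _ _ "(+)"] sum.cong refl) (simp_all add: DI_fl SI_def)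
  also have "\<dots> = fl ((Dmat \<otimes>\<^bsub>sq_mat J S\<^esub> Smat \<delta> \<oplus>\<^bsub>sq_mat J S\<^esub> Smat \<delta> \<otimes>\<^bsub>sq_mat J S\<^esub> Dmat) (fst i) (fst k)) (snd i) (snd k)"
    unfolding fl_matrix_mult[where A = Dmat and B = "Smat \<delta>", OF cl(1) cl(2) ik]
      fl_matrix_mult[where A = "Smat \<delta>" and B = Dmat, OF cl(2) cl(1) ik] sq_mat_simps
    by (intro flS(2)[symmetric] S.finsum_closed) (auto intro: cl)
  also have "\<dots> = fl (if fst i = fst k then \<one>\<^bsub>S\<^esub> else \<zero>\<^bsub>S\<^esub>) (snd i) (snd k)"
    unfolding Dmat_Smat[OF \<delta>] using ik by (auto simp: sq_mat_simps I_def)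
  also have "\<dots> = (if i = k then 1 else 0)"
    using ik by (cases i; cases k) (simp add: flS(3) flS(1) I_def)
  finally show "(\<Sum>j\<in>I. of_int (DI i j) * SI j k) + (\<Sum>j\<in>I. SI i j * of_int (DI j k)) = (if i = k then 1 else 0)" .
qed

text \<open>
  With bases listed as pairs of a basis element of the complex and a coset, the determinant over the
  group ring of the quotient is literally that of \<open>D + S\<close> from the odd to the even part.
\<close>

lemma quotient_det:
  "\<exists>h. (\<forall>n. lat_hom I idg DI n (h n) \<and> h n > 0) \<and> (\<forall>n>top_degree F. h n = 1) \<and>
     length (basis_index C odd) = length (basis_index C even) \<and>
     group_ring_det Q (length (basis_index C odd)) (\<lambda>i j. c0_quotient_map G N (torsion_matrix S C \<delta> i j))
       \<in> {\<Prod>n\<le>top_degree F. of_nat (h n) powi (-1) ^ n, - (\<Prod>n\<le>top_degree F. of_nat (h n) powi (-1) ^ n)}"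
proof -
  interpret Q: group Q by (rule Q_group)
  let ?os = "basis_index C odd" and ?es = "basis_index C even" and ?K = "Suc (top_degree F)"
  obtain qs where qs: "set qs = carrier Q" "distinct qs" using finite_distinct_list[OF finite_Q] by blast
  let ?xs = "List.product ?os qs" and ?ys = "List.product ?es qs"
  obtain h where h: "\<And>n. lat_hom I idg DI n (h n) \<and> h n > 0"
    and H: "\<And>xs ys. distinct xs \<Longrightarrow> distinct ys \<Longrightarrow> set xs = {i\<in>I. odd (idg i)} \<Longrightarrow> set ys = {i\<in>I. even (idg i)} \<Longrightarrow>
        length xs = length ys \<and>
        (\<forall>K. (\<forall>i\<in>I. idg i < K) \<longrightarrow> (\<forall>n\<ge>K. h n = 1) \<and>
          ldet xs ys (\<lambda>i j. of_int (DI i j) + SI i j) \<in>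
            {altprod h K, - (altprod h K)})"
    using contracted_torsion_formula[OF quotient_contracted] unfolding torsion_formula_def by (elim exE conjE) blast
  have sets: "set ?xs = {i\<in>I. odd (idg i)}" "set ?ys = {i\<in>I. even (idg i)}"
    using qs by (auto simp: I_def set_basis_index_J)
  have dist: "distinct ?xs" "distinct ?ys" using qs by (auto intro!: distinct_product distinct_basis_index)
  have K: "\<forall>i\<in>I. idg i < ?K" using J_top by (auto simp: I_def less_Suc_eq_le)
  note H' = H[OF dist sets]
  have lenxy: "length ?xs = length ?ys" using H' by blast
  have q0: "length qs > 0" using qs Q.one_closed by (cases qs) auto
  then have len: "length ?os = length ?es" using lenxy by simp
  let ?n = "length ?os"
  let ?zs = "List.product [0..<?n] qs"
  let ?A = "\<lambda>i j. c0_quotient_map G N (torsion_matrix S C \<delta> i j)"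
  let ?M = "\<lambda>(i, a) (j, b). (group_elt a \<otimes>\<^bsub>group_ring Q\<^esub> ?A i j) b"
  have zs: "set ?zs = {..<?n} \<times> carrier Q" "distinct ?zs" using qs by (auto intro!: distinct_product)
  have "group_ring_det Q ?n ?A = ldet ?zs ?zs ?M"
    unfolding group_ring_det_def zs(1)[symmetric] by (rule det_on_eq_ldet[OF zs(2)])
  also have "\<dots> = ldet ?xs ?ys (\<lambda>i j. of_int (DI i j) + SI i j)"
  proof -
    let ?q = "length qs"
    have nth: "?zs ! i = (i div ?q, qs ! (i mod ?q))" "?xs ! i = (?os ! (i div ?q), qs ! (i mod ?q))" "?ys ! i = (?es ! (i div ?q), qs ! (i mod ?q))"
      "i div ?q < ?n" "i mod ?q < ?q" if "i < ?n * ?q" for i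
    proof -
      show a: "i div ?q < ?n" using that by (simp add: less_mult_imp_div_less)
      show b: "i mod ?q < ?q" using q0 by simp
      show "?zs ! i = (i div ?q, qs ! (i mod ?q))" "?xs ! i = (?os ! (i div ?q), qs ! (i mod ?q))" "?ys ! i = (?es ! (i div ?q), qs ! (i mod ?q))"
        using that a len by (simp_all add: product_nth)
    qed
    have e: "?M (?zs ! i) (?zs ! j) = of_int (DI (?xs ! i) (?ys ! j)) + SI (?xs ! i) (?ys ! j)"
      if ij: "i < ?n * ?q" "j < ?n * ?q" for i j
    proof -
      have xI: "?xs ! i \<in> I" "?ys ! j \<in> I" using sets dist ij len nth_mem[of i ?xs] nth_mem[of j ?ys] by auto
      have a: "qs ! (i mod ?q) \<in> carrier Q" "qs ! (j mod ?q) \<in> carrier Q" using qs nth ij nth_mem by blast+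
      show ?thesis
        unfolding DI_fl[OF xI] unfolding nth(1)[OF ij(1)] nth(1)[OF ij(2)] nth(2)[OF ij(1)] nth(3)[OF ij(2)] SI_def fst_conv snd_conv case_prod_conv
          group_ring_entry[OF a] torsion_matrix_eq[OF \<delta>]
        using nth(4)[OF ij(1)] nth(4)[OF ij(2)] len by (simp add: flS(2) Dmat_closed[OF \<delta>] Smat_closed[OF \<delta>])
    qed
    show ?thesis
      unfolding ldet_def using len e by (intro arg_cong[of _ _ Determinant.det] eq_matI) auto
  qed
  also have "\<dots> \<in> {\<Prod>n<?K. of_nat (h n) powi (-1) ^ n, - (\<Prod>n<?K. of_nat (h n) powi (-1) ^ n)}"
    using H' K by blast
  finally have "group_ring_det Q ?n ?A \<in> {\<Prod>n\<le>top_degree F. of_nat (h n) powi (-1) ^ n, - (\<Prod>n\<le>top_degree F. of_nat (h n) powi (-1) ^ n)}"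
    unfolding lessThan_Suc_atMost .
  moreover have "\<forall>n>top_degree F. h n = 1" using H' K by (auto simp: Suc_le_eq)
  ultimately show ?thesis using h len by blast
qed

end

end

section \<open>The double complex of the bar construction and the resolution\<close>

type_synonym 'g cell = "'g list \<times> nat \<times> 'g"

lemma frag_additive_eq:
  fixes f g :: "('a \<Rightarrow>\<^sub>0 int) \<Rightarrow> 'b::ab_group_add"
  assumes c: "keys c \<subseteq> X" and f: "\<And>a b. f (a - b) = f a - f b" and g: "\<And>a b. g (a - b) = g a - g b"
    and e: "\<And>x. x \<in> X \<Longrightarrow> f (frag_of x) = g (frag_of x)"
  shows "f c = g c"
  using c
proof (induction rule: frag_induction)
  case zero show ?case using f[of 0 0] g[of 0 0] by simp
qed (simp_all add: e f g)

text \<open>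
  A cell \<open>(gs, k, \<gamma>)\<close> is the element \<open>\<gamma> e_k \<otimes> [gs]\<close> of the bar complex of \<open>N\<close> with coefficients in
  the module of \<open>F\<close> in degree \<open>p\<close>, with basis \<open>e\<close>.  Both the columns \<open>(dv, bar complex)\<close> and the rows \<open>(dh, resolution)\<close> of this double complex are
  exact away from the edges; the edges are the bar complex of \<open>M\<close> and the lattices of coinvariants.
\<close>

context quotient_resolution
begin

definition X :: "nat \<Rightarrow> nat \<Rightarrow> ('g cell) set" where
  "X q p = {(gs, k, \<gamma>). length gs = q \<and> set gs \<subseteq> N \<and> k < r p \<and> \<gamma> \<in> carrier G}"

definition Ch :: "nat \<Rightarrow> nat \<Rightarrow> ('g cell \<Rightarrow>\<^sub>0 int) set" where
  "Ch q p = {c. keys c \<subseteq> X q p}"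

lemma Ch_closed:
  "0 \<in> Ch q p" "c \<in> Ch q p \<Longrightarrow> c' \<in> Ch q p \<Longrightarrow> c - c' \<in> Ch q p" "c \<in> Ch q p \<Longrightarrow> c' \<in> Ch q p \<Longrightarrow> c + c' \<in> Ch q p"
  "c \<in> Ch q p \<Longrightarrow> frag_cmul n c \<in> Ch q p" "frag_of x \<in> Ch q p \<longleftrightarrow> x \<in> X q p"
  unfolding Ch_def using keys_diff[of c c'] Poly_Mapping.keys_add[of c c'] keys_cmul[of n c] by auto

lemma Ch_sum: "(\<And>j. j \<in> A \<Longrightarrow> f j \<in> Ch q p) \<Longrightarrow> sum f A \<in> Ch q p"
  by (induction A rule: infinite_finite_induct) (auto intro: Ch_closed)

lemma Ch_extend:
  assumes "c \<in> Ch q p" "\<And>x. x \<in> X q p \<Longrightarrow> f x \<in> Ch q' p'"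
  shows "frag_extend f c \<in> Ch q' p'"
  using assms keys_frag_extend[of f c] unfolding Ch_def by blast

lemma Ch_eq:
  fixes f g :: "('g cell \<Rightarrow>\<^sub>0 int) \<Rightarrow> 'b::ab_group_add"
  assumes "c \<in> Ch q p" "\<And>a b. f (a - b) = f a - f b" "\<And>a b. g (a - b) = g a - g b"
    "\<And>gs k \<gamma>. (gs, k, \<gamma>) \<in> X q p \<Longrightarrow> f (frag_of (gs, k, \<gamma>)) = g (frag_of (gs, k, \<gamma>))"
  shows "f c = g c"
  by (rule frag_additive_eq[of c "X q p"]) (use assms in \<open>auto simp: Ch_def\<close>)

definition tw :: "nat \<Rightarrow> 'g list \<Rightarrow> 'g \<Rightarrow> 'g" where
  "tw j gs \<gamma> = (if j = 0 then inv (hd gs) \<otimes> \<gamma> else \<gamma>)"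

definition dv1 :: "'g cell \<Rightarrow> 'g cell \<Rightarrow>\<^sub>0 int" where
  "dv1 = (\<lambda>(gs, k, \<gamma>). if gs = [] then 0
     else \<Sum>j\<le>length gs. frag_cmul ((-1) ^ j) (frag_of (bar_face G j gs, k, tw j gs \<gamma>)))"

abbreviation "dv \<equiv> frag_extend dv1"

definition dh1 :: "nat \<Rightarrow> 'g cell \<Rightarrow> 'g cell \<Rightarrow>\<^sub>0 int" where
  "dh1 p = (\<lambda>(gs, k, \<gamma>). \<Sum>l<r p. \<Sum>u | dm p k l u \<noteq> 0. frag_cmul (dm p k l u) (frag_of (gs, l, \<gamma> \<otimes> u)))"

abbreviation "dh p \<equiv> frag_extend (dh1 p)"

lemma N_carrier: "g \<in> N \<Longrightarrow> g \<in> carrier G" using subgroup.mem_carrier[OF N_sub] .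

lemma \<pi>_N: "g \<in> N \<Longrightarrow> \<pi> g = \<one>\<^bsub>Q\<^esub>" using \<pi>_in_N N_carrier by blast

lemma bar_face_N:
  assumes gs: "length gs = Suc q" "set gs \<subseteq> N" and j: "j \<le> Suc q"
  shows "length (bar_face G j gs) = q" "set (bar_face G j gs) \<subseteq> N"
proof -
  show "length (bar_face G j gs) = q" using gs j by (auto simp: bar_face_def)
  have m: "gs ! (j - 1) \<otimes> gs ! j \<in> N" if "j \<noteq> 0" "j \<noteq> length gs"
    using that gs j by (intro subgroup.m_closed[OF N_sub] subsetD[OF gs(2)] nth_mem) auto
  show "set (bar_face G j gs) \<subseteq> N"
  proof -
    have "set (tl gs) \<subseteq> set gs" by (cases gs) auto
    moreover have "set (butlast gs) \<subseteq> set gs" by (auto dest: in_set_butlastD)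
    ultimately show ?thesis
      using gs(2) m set_take_subset[of "j - 1" gs] set_drop_subset[of "Suc j" gs] by (auto simp: bar_face_def)
  qed
qed

lemma tw_closed: "(gs, k, \<gamma>) \<in> X (Suc q) p \<Longrightarrow> tw j gs \<gamma> \<in> carrier G"
  using N_carrier[of "hd gs"] by (cases gs) (auto simp: tw_def X_def)

lemma tw_\<pi>: "(gs, k, \<gamma>) \<in> X (Suc q) p \<Longrightarrow> \<pi> (tw j gs \<gamma>) = \<pi> \<gamma>"
proof -
  interpret Q: group Q by (rule Q_group)
  show "(gs, k, \<gamma>) \<in> X (Suc q) p \<Longrightarrow> \<pi> (tw j gs \<gamma>) = \<pi> \<gamma>"
    using N_carrier[of "hd gs"] \<pi>_N[of "hd gs"] by (cases gs) (auto simp: tw_def X_def \<pi>_mult \<pi>_inv \<pi>_closed)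
qed

lemma face_X: "(gs, k, \<gamma>) \<in> X (Suc q) p \<Longrightarrow> j \<le> Suc q \<Longrightarrow> (bar_face G j gs, k, tw j gs \<gamma>) \<in> X q p"
  using bar_face_N[of gs q j] tw_closed[of gs k \<gamma> q p j] by (auto simp: X_def)

lemma dv1_Suc: "(gs, k, \<gamma>) \<in> X (Suc q) p \<Longrightarrow>
    dv1 (gs, k, \<gamma>) = (\<Sum>j\<le>Suc q. frag_cmul ((-1) ^ j) (frag_of (bar_face G j gs, k, tw j gs \<gamma>)))"
  by (auto simp: dv1_def X_def simp del: sum.atMost_Suc)

lemma dv_closed: "c \<in> Ch (Suc q) p \<Longrightarrow> dv c \<in> Ch q p"
proof (erule Ch_extend)
  fix x assume "x \<in> X (Suc q) p"
  then show "dv1 x \<in> Ch q p"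
    by (cases x) (auto simp: dv1_Suc Ch_closed face_X simp del: sum.atMost_Suc intro!: Ch_sum Ch_closed(4))
qed

lemma dh_closed: "c \<in> Ch q (Suc p) \<Longrightarrow> dh p c \<in> Ch q p"
proof (erule Ch_extend)
  fix x assume "x \<in> X q (Suc p)"
  then show "dh1 p x \<in> Ch q p"
    using dm_support[of _ p] by (cases x) (auto simp: dh1_def Ch_closed X_def intro!: Ch_sum Ch_closed(4))
qed

lemma dv_dh:
  assumes c: "c \<in> Ch (Suc q) (Suc p)"
  shows "dv (dh p c) = dh p (dv c)"
proof (rule Ch_eq[OF c])
  fix gs k \<gamma> assume x: "(gs, k, \<gamma>) \<in> X (Suc q) (Suc p)"
  let ?f = "\<lambda>j l u. frag_cmul (dm p k l u) (frag_cmul ((-1) ^ j) (frag_of (bar_face G j gs, l, tw j gs \<gamma> \<otimes> u)))"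
  have k: "k < r (Suc p)" using x by (simp add: X_def)
  have fin: "finite {u. dm p k l u \<noteq> 0}" if "l < r p" for l using dm_closed[OF k that] by (simp add: group_ring_simps)
  have 1: "dv1 (gs, l, \<gamma> \<otimes> u) = (\<Sum>j\<le>Suc q. frag_cmul ((-1) ^ j) (frag_of (bar_face G j gs, l, tw j gs \<gamma> \<otimes> u)))"
    if "l < r p" "dm p k l u \<noteq> 0" for l u
  proof -
    have u: "u \<in> carrier G" using dm_support[OF k that] .
    have "(gs, l, \<gamma> \<otimes> u) \<in> X (Suc q) p" using x that u by (simp add: X_def)
    moreover have "tw j gs (\<gamma> \<otimes> u) = tw j gs \<gamma> \<otimes> u" for j
      using x u N_carrier[of "hd gs"] by (cases gs) (auto simp: tw_def X_def m_assoc)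
    ultimately show ?thesis by (simp add: dv1_Suc del: sum.atMost_Suc)
  qed
  have "dv (dh p (frag_of (gs, k, \<gamma>))) = (\<Sum>l<r p. \<Sum>u | dm p k l u \<noteq> 0. \<Sum>j\<le>Suc q. ?f j l u)"
    using fin by (simp add: dh1_def frag_extend_sum o_def frag_extend_cmul 1 frag_cmul_sum del: sum.atMost_Suc frag_cmul_cmul)
  also have "\<dots> = (\<Sum>l<r p. \<Sum>j\<le>Suc q. \<Sum>u | dm p k l u \<noteq> 0. ?f j l u)"
    by (intro sum.cong refl sum.swap)
  also have "\<dots> = (\<Sum>j\<le>Suc q. \<Sum>l<r p. \<Sum>u | dm p k l u \<noteq> 0. ?f j l u)"
    by (rule sum.swap)
  also have "\<dots> = dh p (dv (frag_of (gs, k, \<gamma>)))"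
    using x by (simp add: dv1_Suc frag_extend_sum o_def frag_extend_cmul dh1_def frag_cmul_sum mult.commute del: sum.atMost_Suc)
  finally show "dv (dh p (frag_of (gs, k, \<gamma>))) = dh p (dv (frag_of (gs, k, \<gamma>)))" .
qed (simp_all add: frag_extend_diff)

text \<open>
  A choice \<open>T\<close> of coset representatives contracts the bar complex of \<open>N\<close> with coefficients in the free
  \<open>N\<close>-set \<open>G\<close>: writing \<open>\<gamma> = g^{-1} t\<close> with \<open>t\<close> the representative, the contraction \<open>hc\<close> puts \<open>g\<close> in front.
\<close>

definition sel :: "('g set \<Rightarrow> 'g) \<Rightarrow> bool" where
  "sel T \<longleftrightarrow> (\<forall>C\<in>carrier Q. T C \<in> carrier G \<and> \<pi> (T C) = C)"

lemma sel_exists: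
  assumes "t \<in> carrier G"
  shows "\<exists>T. sel T \<and> T (\<pi> t) = t"
proof -
  obtain T0 where T0: "\<And>C. C \<in> carrier Q \<Longrightarrow> T0 C \<in> carrier G \<and> \<pi> (T0 C) = C" using \<pi>_surj by metis
  have "sel (T0(\<pi> t := t)) \<and> (T0(\<pi> t := t)) (\<pi> t) = t" using T0 assms by (simp add: sel_def)
  then show ?thesis by blast
qed

definition hc :: "('g set \<Rightarrow> 'g) \<Rightarrow> ('g cell \<Rightarrow>\<^sub>0 int) \<Rightarrow> 'g cell \<Rightarrow>\<^sub>0 int" where
  "hc T = frag_extend (\<lambda>(gs, k, \<gamma>). frag_of ((T (\<pi> \<gamma>) \<otimes> inv \<gamma>) # gs, k, T (\<pi> \<gamma>)))"

definition ht :: "('g set \<Rightarrow> 'g) \<Rightarrow> ('g cell \<Rightarrow>\<^sub>0 int) \<Rightarrow> 'g cell \<Rightarrow>\<^sub>0 int" where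
  "ht T = frag_extend (\<lambda>(gs, k, \<gamma>). frag_of ([], k, T (\<pi> \<gamma>)))"

lemma hc_diff: "hc T (a - b) = hc T a - hc T b" and ht_diff: "ht T (a - b) = ht T a - ht T b"
  by (simp_all add: hc_def ht_def frag_extend_diff)

lemma hc_X:
  assumes "sel T" "(gs, k, \<gamma>) \<in> X q p"
  shows "((T (\<pi> \<gamma>) \<otimes> inv \<gamma>) # gs, k, T (\<pi> \<gamma>)) \<in> X (Suc q) p" "inv (T (\<pi> \<gamma>) \<otimes> inv \<gamma>) \<otimes> T (\<pi> \<gamma>) = \<gamma>"
proof -
  interpret Q: group Q by (rule Q_group)
  have g: "\<gamma> \<in> carrier G" using assms by (simp add: X_def)
  have t: "T (\<pi> \<gamma>) \<in> carrier G" "\<pi> (T (\<pi> \<gamma>)) = \<pi> \<gamma>" using assms(1) \<pi>_closed[OF g] by (simp_all add: sel_def)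
  have "T (\<pi> \<gamma>) \<otimes> inv \<gamma> \<in> N" using g t by (subst \<pi>_in_N[symmetric]) (simp_all add: \<pi>_mult \<pi>_inv \<pi>_closed)
  then show "((T (\<pi> \<gamma>) \<otimes> inv \<gamma>) # gs, k, T (\<pi> \<gamma>)) \<in> X (Suc q) p" using assms t by (simp add: X_def)
  show "inv (T (\<pi> \<gamma>) \<otimes> inv \<gamma>) \<otimes> T (\<pi> \<gamma>) = \<gamma>" using g t by (simp add: inv_mult_group inv_cancel)
qed

lemma hc_closed: "sel T \<Longrightarrow> c \<in> Ch q p \<Longrightarrow> hc T c \<in> Ch (Suc q) p"
  unfolding hc_def by (erule Ch_extend) (auto simp: Ch_closed hc_X)

lemma bar_face_Cons:
  "gs \<noteq> [] \<Longrightarrow> bar_face G (Suc 0) (g # gs) = (g \<otimes> hd gs) # tl gs"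
  "gs \<noteq> [] \<Longrightarrow> 0 < j \<Longrightarrow> bar_face G (Suc j) (g # gs) = g # bar_face G j gs"
   by (cases gs; simp add: bar_face_def) (cases gs; cases j; simp add: bar_face_def)

lemma contraction:
  assumes T: "sel T" and c: "c \<in> Ch (Suc q) p"
  shows "dv (hc T c) = c - hc T (dv c)"
proof (rule Ch_eq[OF c])
  fix gs k \<gamma> assume x: "(gs, k, \<gamma>) \<in> X (Suc q) p"
  let ?t = "T (\<pi> \<gamma>)"
  let ?g = "?t \<otimes> inv \<gamma>"
  let ?b = "\<lambda>j. frag_of (bar_face G (Suc j) (?g # gs), k, ?t)"
  have gs: "gs \<noteq> []" "hd gs \<in> carrier G" "\<gamma> \<in> carrier G" using x N_carrier[of "hd gs"] by (cases gs; auto simp: X_def)+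
  have t: "?t \<in> carrier G" using T \<pi>_closed[OF gs(3)] by (simp add: sel_def)
  have b: "hc T (frag_of (bar_face G j gs, k, tw j gs \<gamma>)) = ?b j" if "j \<le> Suc q" for j
  proof (cases "j = 0")
    case True
    have "?t \<otimes> inv (inv (hd gs) \<otimes> \<gamma>) = ?g \<otimes> hd gs" using gs t by (simp add: inv_mult_group m_assoc)
    then show ?thesis using True tw_\<pi>[OF x, of 0] gs
      by (simp add: hc_def bar_face_Cons tw_def) (simp add: bar_face_def)
  next
    case False then show ?thesis using gs by (simp add: hc_def bar_face_Cons tw_def)
  qed
  have "dv (hc T (frag_of (gs, k, \<gamma>))) = dv1 (?g # gs, k, ?t)" by (simp add: hc_def)
  also have "\<dots> = (\<Sum>j\<le>Suc (Suc q). frag_cmul ((-1) ^ j) (frag_of (bar_face G j (?g # gs), k, tw j (?g # gs) ?t)))"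
    using hc_X(1)[OF T x] by (rule dv1_Suc)
  also have "\<dots> = frag_of (gs, k, \<gamma>) + (\<Sum>j\<le>Suc q. frag_cmul ((-1) ^ Suc j) (?b j))"
    unfolding sum.atMost_Suc_shift[of _ "Suc q"] using hc_X(2)[OF T x]
    by (simp add: tw_def bar_face_def[of _ 0] del: sum.atMost_Suc power_Suc)
  also have "(\<Sum>j\<le>Suc q. frag_cmul ((-1) ^ Suc j) (?b j)) = - (\<Sum>j\<le>Suc q. frag_cmul ((-1) ^ j) (?b j))"
    by (simp only: power_Suc mult_minus_left mult_1_left minus_frag_cmul[symmetric] sum_negf)
  also have "(\<Sum>j\<le>Suc q. frag_cmul ((-1) ^ j) (?b j)) = hc T (dv (frag_of (gs, k, \<gamma>)))"
    using b by (simp add: dv1_Suc[OF x] hc_def frag_extend_sum o_def frag_extend_cmul del: sum.atMost_Suc)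
  finally show "dv (hc T (frag_of (gs, k, \<gamma>))) = frag_of (gs, k, \<gamma>) - hc T (dv (frag_of (gs, k, \<gamma>)))" by simp
qed (simp_all add: frag_extend_diff hc_diff)

lemma dv1_single: "dv1 ([g], k, \<gamma>) = frag_of ([], k, inv g \<otimes> \<gamma>) - frag_of ([], k, \<gamma>)"
  by (simp add: dv1_def bar_face_def tw_def)

lemma contraction_zero:
  assumes T: "sel T" and c: "c \<in> Ch 0 p"
  shows "dv (hc T c) = c - ht T c"
proof (rule Ch_eq[OF c])
  fix gs k \<gamma> assume x: "(gs, k, \<gamma>) \<in> X 0 p"
  then have [simp]: "gs = []" by (simp add: X_def)
  show "dv (hc T (frag_of (gs, k, \<gamma>))) = frag_of (gs, k, \<gamma>) - ht T (frag_of (gs, k, \<gamma>))"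
    using hc_X(2)[OF T x] by (simp add: hc_def ht_def dv1_single)
qed (simp_all add: frag_extend_diff hc_diff ht_diff)

text \<open>The map to the lattice of coinvariants.\<close>

definition aug :: "nat \<Rightarrow> ('g cell \<Rightarrow>\<^sub>0 int) \<Rightarrow> (nat \<times> nat) \<times> 'g set \<Rightarrow>\<^sub>0 int" where
  "aug p = frag_extend (\<lambda>(gs, k, \<gamma>). frag_of ((p, k), \<pi> \<gamma>))"

lemma aug_diff: "aug p (a - b) = aug p a - aug p b" by (simp add: aug_def frag_extend_diff)

lemma ht_aug: "ht T c = frag_extend (\<lambda>((\<mu>, k), C). frag_of ([], k, T C)) (aug p c)"
  by (rule frag_additive_eq[of c UNIV]) (auto simp: ht_def aug_def frag_extend_diff)

lemma aug_dv:
  assumes c: "c \<in> Ch (Suc 0) p"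
  shows "aug p (dv c) = 0"
proof (rule Ch_eq[OF c, where g = "\<lambda>_. 0"])
  fix gs k \<gamma> assume x: "(gs, k, \<gamma>) \<in> X (Suc 0) p"
  then obtain g where gs: "gs = [g]" by (auto simp: X_def length_Suc_conv)
  show "aug p (dv (frag_of (gs, k, \<gamma>))) = 0"
    using tw_\<pi>[OF x, of 0] by (simp add: gs dv1_single aug_def frag_extend_diff tw_def)
qed (simp_all add: aug_diff frag_extend_diff)

text \<open>
  For suitable representatives every cell is a value of \<open>hc\<close>, and \<open>dv hc = 1 - hc dv\<close> reduces
  \<open>dv dv = 0\<close> to lower degree.  This replaces the computation with pairs of faces.
\<close>

lemma dv_dv_step:
  assumes c: "c \<in> Ch (Suc (Suc q)) p" and lower: "q = 0 \<or> (\<forall>c\<in>Ch (Suc q) p. dv (dv c) = 0)"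
  shows "dv (dv c) = 0"
  proof (rule Ch_eq[OF c, where g = "\<lambda>_. 0"])
    fix gs k t assume x: "(gs, k, t) \<in> X (Suc (Suc q)) p"
    then obtain g gs' where gs: "gs = g # gs'" by (auto simp: X_def length_Suc_conv)
    have t: "t \<in> carrier G" and g: "g \<in> N" "g \<in> carrier G" using x gs N_carrier by (auto simp: X_def)
    obtain T where T: "sel T" "T (\<pi> t) = t" using sel_exists[OF t] by blast
    let ?y = "frag_of (gs', k, inv g \<otimes> t)"
    have "(gs', k, inv g \<otimes> t) \<in> X (Suc q) p" using x g t by (simp add: X_def gs)
    then have y: "?y \<in> Ch (Suc q) p" by (simp add: Ch_closed)
    have "\<pi> (inv g \<otimes> t) = \<pi> t" using tw_\<pi>[OF x, of 0] by (simp add: tw_def gs)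
    then have e: "frag_of (gs, k, t) = hc T ?y" using g t by (simp add: hc_def T inv_mult_group inv_cancel gs)
    have z: "dv ?y \<in> Ch q p" by (rule dv_closed[OF y])
    have "dv (hc T (dv ?y)) = dv ?y"
    proof (cases q)
      case 0
      have "aug p (dv ?y) = 0" by (rule aug_dv) (use y 0 in simp)
      then have "ht T (dv ?y) = 0" using ht_aug[of T "dv ?y" p] by (simp only: frag_extend_0)
      then show ?thesis using contraction_zero[OF T(1)] z 0 by simp
    next
      case (Suc q')
      have "dv (dv ?y) = 0" using lower y Suc by blast
      then show ?thesis using contraction[OF T(1), of "dv ?y" q' p] z Suc by (simp add: hc_def)
    qed
    moreover have "dv (hc T ?y) = ?y - hc T (dv ?y)" by (rule contraction[OF T(1) y])
    ultimately show "dv (dv (frag_of (gs, k, t))) = 0" unfolding e by (simp only: frag_extend_diff) simp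
  qed (simp_all add: frag_extend_diff)

lemma dv_dv: "c \<in> Ch (Suc (Suc q)) p \<Longrightarrow> dv (dv c) = 0"
proof (induction q arbitrary: c)
  case 0
  show ?case by (rule dv_dv_step[OF 0]) simp
next
  case (Suc q)
  show ?case by (rule dv_dv_step[OF Suc.prems]) (use Suc.IH in blast)
qed

lemma column_exact:
  assumes "c \<in> Ch (Suc q) p" "dv c = 0"
  shows "c \<in> dv ` Ch (Suc (Suc q)) p"
proof -
  obtain T where T: "sel T" using sel_exists[OF one_closed] by blast
  have "c = dv (hc T c)" using contraction[OF T assms(1)] assms(2) by (simp add: hc_def)
  then show ?thesis using hc_closed[OF T assms(1)] by blast
qed

lemma column_exact_zero:
  assumes "c \<in> Ch 0 p" "aug p c = 0"
  shows "c \<in> dv ` Ch (Suc 0) p"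
proof -
  obtain T where T: "sel T" using sel_exists[OF one_closed] by blast
  have "c = dv (hc T c)" using contraction_zero[OF T assms(1)] assms(2) by (simp add: ht_aug[of T c p])
  then show ?thesis using hc_closed[OF T assms(1)] by blast
qed

abbreviation "al p c \<equiv> lookup (aug p c)"

lemma al_ch: "c \<in> Ch 0 p \<Longrightarrow> al p c \<in> lat_ch I idg p"
proof -
  assume c: "c \<in> Ch 0 p"
  have "keys (aug p c) \<subseteq> {i \<in> I. idg i = p}"
    using keys_frag_extend[of "\<lambda>(gs, k, \<gamma>). frag_of ((p, k), \<pi> \<gamma>)" c] c
    by (fastforce simp: aug_def Ch_def X_def I_def J_def \<pi>_closed keys_frag_of)
  then show "al p c \<in> lat_ch I idg p" by (auto simp: lat_ch_def in_keys_iff)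
qed

lemma al_surj:
  assumes x: "x \<in> lat_ch I idg p"
  shows "\<exists>c\<in>Ch 0 p. al p c = x"
proof -
  obtain T where T: "sel T" using sel_exists[OF one_closed] by blast
  let ?y = "Abs_poly_mapping x"
  have "{i. x i \<noteq> 0} \<subseteq> I" using x by (auto simp: lat_ch_def)
  then have fx: "finite {i. x i \<noteq> 0}" by (rule finite_subset[OF _ finite_I])
  have y: "lookup ?y = x" using fx by simp
  have ky: "keys ?y \<subseteq> {i \<in> I. idg i = p}"
    using x by (auto simp: in_keys_iff y lat_ch_def)
  let ?c = "frag_extend (\<lambda>((\<mu>, k), C). frag_of ([], k, T C)) ?y"
  have "keys ?c \<subseteq> X 0 p"
    using keys_frag_extend[of "\<lambda>((\<mu>, k), C). frag_of ([], k, T C)" ?y] ky T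
    by (fastforce simp: X_def I_def J_def sel_def keys_frag_of)
  moreover have "aug p ?c = ?y"
  proof (rule frag_additive_eq[OF ky])
    show "aug p (frag_extend (\<lambda>((\<mu>, k), C). frag_of ([], k, T C)) (frag_of i)) = frag_of i" if "i \<in> {i \<in> I. idg i = p}" for i
      using that T by (cases i) (auto simp: aug_def I_def sel_def)
  qed (simp_all add: aug_def frag_extend_diff)
  ultimately show ?thesis using y by (auto simp: Ch_def)
qed

lemma al_bd:
  assumes c: "c \<in> Ch 0 (Suc p)"
  shows "al p (dh p c) j = lat_bd I DI (al (Suc p) c) j"
proof (rule Ch_eq[OF c])
  fix gs k \<gamma> assume x: "(gs, k, \<gamma>) \<in> X 0 (Suc p)"
  interpret Q: group Q by (rule Q_group)
  have k: "k < r (Suc p)" and g: "\<gamma> \<in> carrier G" using x by (simp_all add: X_def)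
  obtain \<mu> l C where j: "j = ((\<mu>, l), C)" by (metis surj_pair)
  let ?i = "((Suc p, k), \<pi> \<gamma>)"
  have i: "?i \<in> I" using k g by (simp add: I_def J_def \<pi>_closed)
  have fin: "finite {u. dm p k l u \<noteq> 0}" if "l < r p" for l using dm_closed[OF k that] by (simp add: group_ring_simps)
  have "al p (dh p (frag_of (gs, k, \<gamma>))) j
      = (\<Sum>l'<r p. \<Sum>u | dm p k l' u \<noteq> 0. dm p k l' u * (if j = ((p, l'), \<pi> (\<gamma> \<otimes> u)) then 1 else 0))"
    using fin by (simp add: dh1_def aug_def frag_extend_sum o_def frag_extend_cmul lookup_sum)
  also have "\<dots> = (if j \<in> I then DI ?i j else 0)"
  proof (cases "j \<in> I \<and> \<mu> = p")
    case True
    then have l: "l < r p" and C: "C \<in> carrier Q" and mu: "\<mu> = p" by (auto simp: j I_def J_def)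
    have eq: "C = \<pi> (\<gamma> \<otimes> u) \<longleftrightarrow> u \<in> inv\<^bsub>Q\<^esub> \<pi> \<gamma> \<otimes>\<^bsub>Q\<^esub> C" if "u \<in> carrier G" for u
    proof -
      have "u \<in> inv\<^bsub>Q\<^esub> \<pi> \<gamma> \<otimes>\<^bsub>Q\<^esub> C \<longleftrightarrow> \<pi> u = inv\<^bsub>Q\<^esub> \<pi> \<gamma> \<otimes>\<^bsub>Q\<^esub> C" using that g C by (simp add: coset_iff \<pi>_closed)
      also have "\<dots> \<longleftrightarrow> C = \<pi> (\<gamma> \<otimes> u)"
        using Q.inv_cancel(1)[OF \<pi>_closed[OF g] C] Q.inv_cancel(2)[OF \<pi>_closed[OF g] \<pi>_closed[OF that]] \<pi>_mult[OF g that] by metis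
      finally show ?thesis by simp
    qed
    have "(\<Sum>l'<r p. \<Sum>u | dm p k l' u \<noteq> 0. dm p k l' u * (if j = ((p, l'), \<pi> (\<gamma> \<otimes> u)) then 1 else 0))
       = (\<Sum>l'<r p. if l' = l then \<Sum>u | dm p k l u \<noteq> 0. dm p k l u * (if C = \<pi> (\<gamma> \<otimes> u) then 1 else 0) else 0)"
      by (intro sum.cong) (auto simp: j mu)
    also have "\<dots> = (\<Sum>u | dm p k l u \<noteq> 0. if u \<in> inv\<^bsub>Q\<^esub> \<pi> \<gamma> \<otimes>\<^bsub>Q\<^esub> C then dm p k l u else 0)"
      using l dm_support[OF k l] by (auto simp: eq intro!: sum.cong)
    also have "\<dots> = ifl (dm p k l) (\<pi> \<gamma>) C"
      unfolding ifl_def sum.inter_filter[OF fin[OF l], symmetric] by (simp only: mem_Collect_eq)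
    finally have e: "(\<Sum>l'<r p. \<Sum>u | dm p k l' u \<noteq> 0. dm p k l' u * (if j = ((p, l'), \<pi> (\<gamma> \<otimes> u)) then 1 else 0)) = ifl (dm p k l) (\<pi> \<gamma>) C" .
    have jI: "j \<in> I" using True by blast
    have "DI ?i j = ifl (dm p k l) (\<pi> \<gamma>) C" using i jI unfolding DI_def j mu by simp
    then show ?thesis unfolding e by (simp only: jI if_True)
  next
    case False
    have "(\<Sum>l'<r p. \<Sum>u | dm p k l' u \<noteq> 0. dm p k l' u * (if j = ((p, l'), \<pi> (\<gamma> \<otimes> u)) then 1 else 0)) = 0"
      using False g dm_support[OF k] by (intro sum.neutral ballI) (auto simp: j I_def J_def \<pi>_closed)
    moreover have "(if j \<in> I then DI ?i j else 0) = 0" using False by (auto simp: DI_def j)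
    ultimately show ?thesis by simp
  qed
  also have "\<dots> = lat_bd I DI (al (Suc p) (frag_of (gs, k, \<gamma>))) j"
    using i finite_I by (simp add: lat_bd_def aug_def if_distrib[of "\<lambda>z. z * _"] cong: if_cong)
  finally show "al p (dh p (frag_of (gs, k, \<gamma>))) j = lat_bd I DI (al (Suc p) (frag_of (gs, k, \<gamma>))) j" .
qed (simp_all add: frag_extend_diff aug_diff lookup_minus lat_bd_def left_diff_distrib sum_subtractf)

text \<open>The rows are copies of the resolution.\<close>

definition slice :: "'g list \<Rightarrow> ('g cell \<Rightarrow>\<^sub>0 int) \<Rightarrow> nat \<Rightarrow> 'g \<Rightarrow> int" where
  "slice gs c k \<gamma> = lookup c (gs, k, \<gamma>)"

lemma slice_diff: "slice gs (a - b) = (\<lambda>k \<gamma>. slice gs a k \<gamma> - slice gs b k \<gamma>)"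
  by (simp add: slice_def lookup_minus fun_eq_iff)

lemma slice_vec:
  assumes c: "c \<in> Ch q p"
  shows "int_vec (r p) (slice gs c)"
  unfolding int_vec_def
proof (intro allI impI)
  fix k
  have "{\<gamma>. slice gs c k \<gamma> \<noteq> 0} \<subseteq> (snd \<circ> snd) ` keys c"
    by (auto simp: slice_def in_keys_iff[symmetric] image_iff) force
  then have "finite {\<gamma>. slice gs c k \<gamma> \<noteq> 0}" by (rule finite_subset) simp
  moreover have "slice gs c k \<gamma> = 0" if "\<gamma> \<notin> carrier G" for \<gamma>
    using c that unfolding Ch_def X_def slice_def by (auto simp: not_in_keys_iff_lookup_eq_zero[symmetric])
  ultimately show "slice gs c k \<in> carrier R" by (simp add: group_ring_simps)
qed

lemma slice_dh:
  assumes c: "c \<in> Ch q (Suc p)" and l: "l < r p"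
  shows "slice gs (dh p c) l g = bd p (slice gs c) l g"
proof (rule Ch_eq[OF c])
  fix gs0 k0 \<gamma> assume x: "(gs0, k0, \<gamma>) \<in> X q (Suc p)"
  have k: "k0 < r (Suc p)" and \<gamma>: "\<gamma> \<in> carrier G" using x by (simp_all add: X_def)
  let ?s = "\<Sum>u | dm p k0 l u \<noteq> 0. if gs = gs0 \<and> g = \<gamma> \<otimes> u then dm p k0 l u else 0"
  have "slice gs (dh p (frag_of (gs0, k0, \<gamma>))) l g
      = (\<Sum>l'<r p. \<Sum>u | dm p k0 l' u \<noteq> 0. dm p k0 l' u * (if gs = gs0 \<and> l = l' \<and> g = \<gamma> \<otimes> u then 1 else 0))"
    by (simp add: dh1_def slice_def lookup_sum)
  also have "\<dots> = (\<Sum>l'<r p. if l' = l then ?s else 0)"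
    by (intro sum.cong refl) (auto intro!: sum.cong)
  also have "\<dots> = ?s" using l by simp
  also have "\<dots> = (if g \<in> carrier G then \<Sum>u | dm p k0 l u \<noteq> 0. if gs = gs0 \<and> g \<otimes> inv u = \<gamma> then dm p k0 l u else 0 else 0)"
    using dm_support[OF k l] \<gamma> by (auto intro!: sum.cong sum.neutral simp: inv_cancel)
  also have "\<dots> = (\<Sum>k<r (Suc p). if k = k0 then (if g \<in> carrier G then \<Sum>u | dm p k0 l u \<noteq> 0. if gs = gs0 \<and> g \<otimes> inv u = \<gamma> then dm p k0 l u else 0 else 0) else 0)"
    using k by simp
  also have "\<dots> = bd p (slice gs (frag_of (gs0, k0, \<gamma>))) l g"
    unfolding act_def rconv_def slice_def by (intro sum.cong refl) (auto intro!: sum.cong sum.neutral)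
  finally show "slice gs (dh p (frag_of (gs0, k0, \<gamma>))) l g = bd p (slice gs (frag_of (gs0, k0, \<gamma>))) l g" .
qed (simp_all add: frag_extend_diff slice_diff act_linear)

lemma Ch_eqI:
  assumes "a \<in> Ch q p" "b \<in> Ch q p" "\<And>gs k \<gamma>. k < r p \<Longrightarrow> slice gs a k \<gamma> = slice gs b k \<gamma>"
  shows "a = b"
proof (rule poly_mapping_eqI)
  fix x :: "'g cell"
  obtain gs k \<gamma> where x: "x = (gs, k, \<gamma>)" by (metis surj_pair)
  show "lookup a x = lookup b x"
  proof (cases "k < r p")
    case True then show ?thesis using assms(3) by (simp add: x slice_def)
  next
    case False
    then have "x \<notin> keys a" "x \<notin> keys b" using assms(1,2) by (auto simp: Ch_def X_def x)
    then show ?thesis by (simp add: in_keys_iff)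
  qed
qed

lemma Ch_assemble:
  assumes K: "finite K" "\<And>gs. gs \<in> K \<Longrightarrow> length gs = q \<and> set gs \<subseteq> N" and w: "\<And>gs. gs \<in> K \<Longrightarrow> int_vec (r p) (w gs)"
  shows "\<exists>b\<in>Ch q p. \<forall>gs k \<gamma>. slice gs b k \<gamma> = (if gs \<in> K \<and> k < r p then w gs k \<gamma> else 0)"
proof -
  define f where "f = (\<lambda>(gs, k, \<gamma>). if gs \<in> K \<and> k < r p then w gs k \<gamma> else 0)"
  have fw: "finite {\<gamma>. w gs k \<gamma> \<noteq> 0}" and cw: "\<And>\<gamma>. w gs k \<gamma> \<noteq> 0 \<Longrightarrow> \<gamma> \<in> carrier G" if "gs \<in> K" "k < r p" for gs k
    using w[OF that(1)] that(2) by (auto simp: int_vec_def group_ring_simps)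
  have "{x. f x \<noteq> 0} \<subseteq> (\<Union>gs\<in>K. \<Union>k<r p. (\<lambda>\<gamma>. (gs, k, \<gamma>)) ` {\<gamma>. w gs k \<gamma> \<noteq> 0})" 
  proof
    fix x assume x: "x \<in> {x. f x \<noteq> 0}"
    obtain gs k \<gamma> where e: "x = (gs, k, \<gamma>)" by (metis surj_pair)
    have "gs \<in> K" "k < r p" "w gs k \<gamma> \<noteq> 0" using x by (auto simp: e f_def split: if_splits)
    then show "x \<in> (\<Union>gs\<in>K. \<Union>k<r p. (\<lambda>\<gamma>. (gs, k, \<gamma>)) ` {\<gamma>. w gs k \<gamma> \<noteq> 0})" unfolding e by blast
  qed
  then have fin: "finite {x. f x \<noteq> 0}" by (rule finite_subset) (use K fw in auto)
  then have l: "lookup (Abs_poly_mapping f) = f" by simp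
  have "keys (Abs_poly_mapping f) \<subseteq> X q p"
  proof
    fix x assume "x \<in> keys (Abs_poly_mapping f)"
    then have x: "f x \<noteq> 0" by (simp only: in_keys_iff l not_False_eq_True)
    obtain gs k \<gamma> where e: "x = (gs, k, \<gamma>)" by (metis surj_pair)
    have m: "gs \<in> K" "k < r p" "w gs k \<gamma> \<noteq> 0" using x by (auto simp: e f_def split: if_splits)
    show "x \<in> X q p" unfolding e X_def using m K(2)[OF m(1)] cw[OF m] by simp
  qed
  moreover have "slice gs (Abs_poly_mapping f) k \<gamma> = (if gs \<in> K \<and> k < r p then w gs k \<gamma> else 0)" for gs k \<gamma>
    unfolding slice_def l by (simp add: f_def)
  ultimately show ?thesis unfolding Ch_def by blast
qed

lemma keys_fst_Ch: "c \<in> Ch q p \<Longrightarrow> gs \<in> fst ` keys c \<Longrightarrow> length gs = q \<and> set gs \<subseteq> N"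
  by (force simp: Ch_def X_def)

lemma slice_zero: "gs \<notin> fst ` keys c \<Longrightarrow> slice gs c k \<gamma> = 0"
  by (force simp: slice_def in_keys_iff image_iff)

lemma boundary_from_slices:
  assumes c: "c \<in> Ch q p"
    and w: "\<And>gs. gs \<in> fst ` keys c \<Longrightarrow>
      \<exists>w. int_vec (r (Suc p)) w \<and> (\<forall>k<r p. \<forall>g. slice gs c k g = bd p w k g)"
  shows "c \<in> dh p ` Ch q (Suc p)"
proof -
  let ?K = "fst ` keys c"
  obtain w where w: "\<And>gs. gs \<in> ?K \<Longrightarrow> int_vec (r (Suc p)) (w gs) \<and> (\<forall>k<r p. \<forall>g. slice gs c k g = bd p (w gs) k g)"
    using w by metis
  have "\<exists>b\<in>Ch q (Suc p). \<forall>gs k \<gamma>. slice gs b k \<gamma> = (if gs \<in> ?K \<and> k < r (Suc p) then w gs k \<gamma> else 0)"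
    by (rule Ch_assemble) (use keys_fst_Ch[OF c] w in auto)
  then obtain b where b: "b \<in> Ch q (Suc p)" "\<And>gs k \<gamma>. slice gs b k \<gamma> = (if gs \<in> ?K \<and> k < r (Suc p) then w gs k \<gamma> else 0)"
    by blast
  have "c = dh p b"
  proof (rule Ch_eqI[OF c dh_closed[OF b(1)]])
    fix gs l g assume l: "l < r p"
    have "slice gs (dh p b) l g = bd p (slice gs b) l g" by (rule slice_dh[OF b(1) l])
    also have "\<dots> = slice gs c l g"
    proof (cases "gs \<in> ?K")
      case True
      have "bd p (slice gs b) l g = bd p (w gs) l g"
        using True l dm_support by (intro act_cong) (auto simp: b)
      then show ?thesis using w[OF True] l by simp
    next
      case False
      have "slice gs b = (\<lambda>_ _. 0)" using False by (simp add: b fun_eq_iff)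
      then have "bd p (slice gs b) l g = 0" by (simp add: act_def rconv_def cong: if_cong)
      then show ?thesis using slice_zero[OF False] by simp
    qed
    finally show "slice gs c l g = slice gs (dh p b) l g" by simp
  qed
  then show ?thesis using b(1) by blast
qed

lemma row_exact:
  assumes c: "c \<in> Ch q (Suc p)" and z: "dh p c = 0"
  shows "c \<in> dh (Suc p) ` Ch q (Suc (Suc p))"
proof (rule boundary_from_slices[OF c])
  fix gs
  have "bd p (slice gs c) l g = 0" if "l < r p" for l g
    using slice_dh[OF c that, of gs g] z by (simp add: slice_def)
  then show "\<exists>w. int_vec (r (Suc (Suc p))) w \<and> (\<forall>k<r (Suc p). \<forall>g. slice gs c k g = bd (Suc p) w k g)"
    by (intro int_cycle_boundary slice_vec[OF c])
qed

lemma dh_dh: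
  assumes b: "b \<in> Ch q (Suc (Suc p))"
  shows "dh p (dh (Suc p) b) = 0"
proof (rule Ch_eqI[OF dh_closed[OF dh_closed[OF b]] Ch_closed(1)])
  fix gs l g assume l: "l < r p"
  have "slice gs (dh p (dh (Suc p) b)) l g = bd p (slice gs (dh (Suc p) b)) l g"
    by (rule slice_dh[OF dh_closed[OF b] l])
  also have "\<dots> = bd p (bd (Suc p) (slice gs b)) l g"
    using l dm_support by (intro act_cong) (auto simp: slice_dh[OF b])
  also have "\<dots> = 0" by (rule act_act[OF slice_vec[OF b] l])
  finally show "slice gs (dh p (dh (Suc p) b)) l g = slice gs 0 l g" by (simp add: slice_def)
qed

end

lemma transversal_card_image:
  assumes t: "transversal_card Z E n" and e: "\<And>z w. z \<in> Z \<Longrightarrow> w \<in> Z \<Longrightarrow> E z w \<longleftrightarrow> f z = f w"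
  shows "finite (f ` Z)" "card (f ` Z) = n"
proof -
  obtain Y where Y: "Y \<subseteq> Z" "finite Y" "card Y = n" and u': "\<forall>z\<in>Z. \<exists>!x. x \<in> Y \<and> E z x"
    using t unfolding transversal_card_def by (elim exE conjE) (rule that)
  have u: "\<exists>!x. x \<in> Y \<and> E z x" if "z \<in> Z" for z using u' that by (rule bspec)
  have im: "f ` Z = f ` Y"
  proof (intro equalityI image_mono[OF Y(1)] subsetI)
    fix a assume "a \<in> f ` Z"
    then obtain z where z: "z \<in> Z" "a = f z" by blast
    obtain x where x: "x \<in> Y" "E z x" using ex1_implies_ex[OF u[OF z(1)]] by (elim exE conjE) (rule that)
    have "f z = f x" using e[OF z(1) subsetD[OF Y(1) x(1)]] x(2) by simp
    then show "a \<in> f ` Y" using x(1) z(2) by simp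
  qed
  have "inj_on f Y"
  proof (rule inj_onI)
    fix x x' assume x: "x \<in> Y" "x' \<in> Y" "f x = f x'"
    have Z: "x \<in> Z" "x' \<in> Z" using x Y(1) by blast+
    have "E x x'" "E x x" using e[OF Z] e[OF Z(1) Z(1)] x(3) by simp_all
    with u[OF Z(1)] x(1,2) show "x = x'" by (elim ex1E) blast
  qed
  then show "finite (f ` Z)" "card (f ` Z) = n" using Y by (simp_all add: im card_image)
qed

context quotient_resolution
begin

text \<open>
  The map from the first column of the double complex to the bar complex of \<open>M\<close>.
\<close>

definition th :: "('g cell \<Rightarrow>\<^sub>0 int) \<Rightarrow> 'g list \<Rightarrow> 'm" where
  "th c gs = ev (slice gs c)"

lemma th_point_closed: "c \<in> Ch q 0 \<Longrightarrow> th c gs \<in> carrier M"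
  unfolding th_def by (intro ev_closed slice_vec)

lemma th_off: "gs \<notin> fst ` keys c \<Longrightarrow> th c gs = \<zero>\<^bsub>M\<^esub>"
proof -
  assume "gs \<notin> fst ` keys c"
  then have "slice gs c = (\<lambda>_ _. 0)" using slice_zero by (simp add: fun_eq_iff)
  then show ?thesis by (simp add: th_def ev_zero)
qed

lemma th_add: "c \<in> Ch q 0 \<Longrightarrow> c' \<in> Ch q 0 \<Longrightarrow> th (c + c') gs = th c gs \<oplus>\<^bsub>M\<^esub> th c' gs"
proof -
  assume c: "c \<in> Ch q 0" "c' \<in> Ch q 0"
  have "slice gs (c + c') = (\<lambda>k \<gamma>. slice gs c k \<gamma> + slice gs c' k \<gamma>)" by (simp add: slice_def lookup_add fun_eq_iff)
  then show ?thesis using c by (simp add: th_def ev_add[OF slice_vec slice_vec])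
qed

lemma th_diff: "c \<in> Ch q 0 \<Longrightarrow> c' \<in> Ch q 0 \<Longrightarrow> th (c - c') gs \<oplus>\<^bsub>M\<^esub> th c' gs = th c gs"
  using th_add[of "c - c'" q c' gs] Ch_closed(2)[of c q 0 c'] by simp

lemma th_zero: "th 0 gs = \<zero>\<^bsub>M\<^esub>" by (rule th_off) simp

lemma th_sum:
  assumes "finite A" "\<And>j. j \<in> A \<Longrightarrow> f j \<in> Ch q 0"
  shows "th (sum f A) gs = finsum M (\<lambda>j. th (f j) gs) A"
proof -
  interpret LM: left_module R M by (rule lm)
  show ?thesis using assms
  proof (induction A rule: finite_induct)
    case (insert x A)
    have "th (sum f (insert x A)) gs = th (f x) gs \<oplus>\<^bsub>M\<^esub> th (sum f A) gs"
      using insert th_add[of "f x" q "sum f A" gs] Ch_sum[of A f q 0] by simp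
    then show ?case using insert th_point_closed[of _ q gs] by (simp add: LM.M.finsum_insert Pi_def)
  qed (simp add: th_zero)
qed

lemma th_closed:
  assumes c: "c \<in> Ch q 0"
  shows "th c \<in> bar_chains N M q"
proof -
  have "{gs. th c gs \<noteq> \<zero>\<^bsub>M\<^esub>} \<subseteq> fst ` keys c" using th_off[of _ c] by blast
  then have "finite {gs. th c gs \<noteq> \<zero>\<^bsub>M\<^esub>}" by (rule finite_subset) simp
  moreover have "length gs = q \<and> set gs \<subseteq> N" if "th c gs \<noteq> \<zero>\<^bsub>M\<^esub>" for gs
    using that keys_fst_Ch[OF c] th_off[of gs c] by blast
  ultimately show ?thesis using th_point_closed[OF c] by (simp add: bar_chains_def)
qed

lemma ev_surj: "m \<in> carrier M \<Longrightarrow> \<exists>v. int_vec (r 0) v \<and> ev v = m"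
proof -
  assume "m \<in> carrier M"
  then have "m \<in> \<epsilon> ` carrier (chain F 0)" by (simp only: \<epsilon>_surj)
  then obtain x where x: "x \<in> carrier (chain F 0)" "\<epsilon> x = m" by blast
  then show ?thesis
    using co_vec[OF x(1)] based_module.lin_co[OF mod[of 0] x(1)] by (intro exI[of _ "coord 0 x"]) (simp add: ev_def)
qed

lemma th_surj:
  assumes c: "c \<in> bar_chains N M q"
  shows "\<exists>b\<in>Ch q 0. th b = c"
proof -
  have cm: "c gs \<in> carrier M" for gs using c by (simp add: bar_chains_def)
  obtain w where w: "\<And>gs. int_vec (r 0) (w gs) \<and> ev (w gs) = c gs" using ev_surj[OF cm] by metis
  let ?K = "{gs. c gs \<noteq> \<zero>\<^bsub>M\<^esub>}"
  have "\<exists>b\<in>Ch q 0. \<forall>gs k \<gamma>. slice gs b k \<gamma> = (if gs \<in> ?K \<and> k < r 0 then w gs k \<gamma> else 0)"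
    by (rule Ch_assemble) (use c w in \<open>auto simp: bar_chains_def\<close>)
  then obtain b where b: "b \<in> Ch q 0" "\<And>gs k \<gamma>. slice gs b k \<gamma> = (if gs \<in> ?K \<and> k < r 0 then w gs k \<gamma> else 0)" by blast
  have "th b gs = c gs" for gs
  proof (cases "gs \<in> ?K")
    case True
    have "ev (slice gs b) = ev (w gs)" by (rule ev_cong) (use True w b in \<open>auto simp: fun_eq_iff\<close>)
    then show ?thesis using w by (simp add: th_def)
  next
    case False
    then have "slice gs b = (\<lambda>_ _. 0)" by (auto simp: b fun_eq_iff)
    then show ?thesis using False by (simp add: th_def ev_zero)
  qed
  then show ?thesis using b(1) by blast
qed

lemma th_dh: "b \<in> Ch q (Suc 0) \<Longrightarrow> th (dh 0 b) = (\<lambda>_. \<zero>\<^bsub>M\<^esub>)"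
proof
  fix gs assume b: "b \<in> Ch q (Suc 0)"
  show "th (dh 0 b) gs = \<zero>\<^bsub>M\<^esub>"
    unfolding th_def ev_boundary_iff[OF slice_vec[OF dh_closed[OF b]]]
    using slice_vec[OF b, of gs] slice_dh[OF b, of _ gs] by blast
qed

lemma th_exact: "c \<in> Ch q 0 \<Longrightarrow> th c = (\<lambda>_. \<zero>\<^bsub>M\<^esub>) \<Longrightarrow> c \<in> dh 0 ` Ch q (Suc 0)"
  by (rule boundary_from_slices) (auto simp: th_def fun_eq_iff ev_boundary_iff[OF slice_vec, symmetric])

subsection \<open>The boundary of the bar complex\<close>

definition bar_term :: "('g list \<Rightarrow> 'm) \<Rightarrow> 'g list \<times> nat \<Rightarrow> 'm" where
  "bar_term c = (\<lambda>(gs, j). let m = if j = 0 then group_elt (inv (hd gs)) \<odot>\<^bsub>M\<^esub> c gs else c gs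
                  in if even j then m else \<ominus>\<^bsub>M\<^esub> m)"

lemma group_elt_R: "g \<in> carrier G \<Longrightarrow> group_elt g \<in> carrier R"
  by (auto simp: group_ring_simps group_elt_def)

abbreviation "NL q \<equiv> {gs. length gs = Suc q \<and> set gs \<subseteq> N}"

lemma NL_hd: "gs \<in> NL q \<Longrightarrow> inv (hd gs) \<in> carrier G"
  using N_carrier[of "hd gs"] by (cases gs) auto

lemma bar_term_closed: "gs \<in> NL q \<Longrightarrow> (\<And>gs. c gs \<in> carrier M) \<Longrightarrow> bar_term c (gs, j) \<in> carrier M"
proof -
  interpret LM: left_module R M by (rule lm)
  show "gs \<in> NL q \<Longrightarrow> (\<And>gs. c gs \<in> carrier M) \<Longrightarrow> bar_term c (gs, j) \<in> carrier M"
    using NL_hd[of gs q] by (simp add: bar_term_def Let_def LM.smult_closed group_elt_R)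
qed

lemma bar_boundary_eq:
  assumes c: "\<And>gs. c gs \<in> carrier M" and K: "finite K" "K \<subseteq> NL q" "\<And>gs. c gs \<noteq> \<zero>\<^bsub>M\<^esub> \<Longrightarrow> gs \<in> K"
  shows "bar_boundary G M (Suc q) c hs = finsum M (bar_term c) {(gs, j). gs \<in> K \<and> j \<le> Suc q \<and> bar_face G j gs = hs}"
proof -
  interpret LM: left_module R M by (rule lm)
  have fin: "finite {(gs, j). gs \<in> K \<and> j \<le> Suc q \<and> bar_face G j gs = hs}"
    by (rule finite_subset[of _ "K \<times> {..Suc q}"]) (use K in auto)
  show ?thesis
    unfolding bar_boundary_def bar_term_def[symmetric]
  proof (rule LM.M.add.finprod_mono_neutral_cong_left[OF fin])
    fix i assume i: "i \<in> {(gs, j). gs \<in> K \<and> j \<le> Suc q \<and> bar_face G j gs = hs} -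
        {(gs, j). c gs \<noteq> \<zero>\<^bsub>M\<^esub> \<and> j \<le> Suc q \<and> bar_face G j gs = hs}"
    obtain gs j where e: "i = (gs, j)" by (metis surj_pair)
    have "c gs = \<zero>\<^bsub>M\<^esub>" "inv (hd gs) \<in> carrier G" using i K(2) NL_hd[of gs q] by (auto simp: e)
    then show "bar_term c i = \<zero>\<^bsub>M\<^esub>" by (simp add: e bar_term_def Let_def LM.smult_r_null group_elt_R)
  next
    show "bar_term c \<in> {(gs, j). gs \<in> K \<and> j \<le> Suc q \<and> bar_face G j gs = hs} \<rightarrow> carrier M"
      using K(2) bar_term_closed[where q = q and c = c] c by blast
  qed (use K in auto)
qed

lemma bar_boundary_add:
  assumes c: "c \<in> bar_chains N M (Suc q)" and c': "c' \<in> bar_chains N M (Suc q)"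
  shows "bar_boundary G M (Suc q) (\<lambda>gs. c gs \<oplus>\<^bsub>M\<^esub> c' gs) hs = bar_boundary G M (Suc q) c hs \<oplus>\<^bsub>M\<^esub> bar_boundary G M (Suc q) c' hs"
proof -
  interpret LM: left_module R M by (rule lm)
  let ?K = "{gs. c gs \<noteq> \<zero>\<^bsub>M\<^esub>} \<union> {gs. c' gs \<noteq> \<zero>\<^bsub>M\<^esub>}"
  have K: "finite ?K" "?K \<subseteq> NL q" and cc: "\<And>gs. c gs \<in> carrier M" "\<And>gs. c' gs \<in> carrier M" using c c' by (auto simp: bar_chains_def)
  let ?A = "{(gs, j). gs \<in> ?K \<and> j \<le> Suc q \<and> bar_face G j gs = hs}"
  have m: "x \<in> ?A \<Longrightarrow> bar_term a x \<in> carrier M" if "\<And>gs. a gs \<in> carrier M" for a x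
    using K(2) bar_term_closed[of _ q a] that by (cases x) blast
  have "finsum M (bar_term (\<lambda>gs. c gs \<oplus>\<^bsub>M\<^esub> c' gs)) ?A = finsum M (\<lambda>x. bar_term c x \<oplus>\<^bsub>M\<^esub> bar_term c' x) ?A"
  proof (rule LM.M.finsum_cong'[OF refl])
    fix x assume x: "x \<in> ?A"
    then have "inv (hd (fst x)) \<in> carrier G" using K(2) NL_hd[of "fst x" q] by auto
    then show "bar_term (\<lambda>gs. c gs \<oplus>\<^bsub>M\<^esub> c' gs) x = bar_term c x \<oplus>\<^bsub>M\<^esub> bar_term c' x"
      using cc by (cases x) (simp add: bar_term_def Let_def LM.smult_r_distr group_elt_R LM.smult_closed LM.M.minus_add)
  qed (use m cc in auto)
  also have "\<dots> = finsum M (bar_term c) ?A \<oplus>\<^bsub>M\<^esub> finsum M (bar_term c') ?A"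
    by (rule LM.M.finsum_addf) (use m cc in auto)
  finally show ?thesis using cc K
    by (subst (1 2 3) bar_boundary_eq[where K = ?K]) auto
qed

definition dlt :: "nat \<Rightarrow> 'g \<Rightarrow> nat \<Rightarrow> 'g \<Rightarrow> int" where
  "dlt k \<gamma> k' \<gamma>' = (if k' = k \<and> \<gamma>' = \<gamma> then 1 else 0)"

lemma dlt_vec: "\<gamma> \<in> carrier G \<Longrightarrow> int_vec n (dlt k \<gamma>)"
  by (auto simp: int_vec_def group_ring_simps dlt_def)

lemma ev_dlt:
  assumes g: "g \<in> carrier G" and \<gamma>: "\<gamma> \<in> carrier G"
  shows "group_elt g \<odot>\<^bsub>M\<^esub> ev (dlt k \<gamma>) = ev (dlt k (g \<otimes> \<gamma>))"
proof -
  interpret A: based_module R "chain F 0" "basis_at F 0" by (rule mod)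
  have e: "group_elt g \<otimes>\<^bsub>R\<^esub> dlt k \<gamma> k' = dlt k (g \<otimes> \<gamma>) k'" for k'
  proof
    fix h
    have s: "{h'. group_elt g h' \<noteq> (0::int)} = {g}" by (auto simp: group_elt_def)
    have "h \<in> carrier G \<Longrightarrow> inv g \<otimes> h = \<gamma> \<longleftrightarrow> h = g \<otimes> \<gamma>" using g \<gamma> by (auto simp: inv_cancel)
    then show "(group_elt g \<otimes>\<^bsub>R\<^esub> dlt k \<gamma> k') h = dlt k (g \<otimes> \<gamma>) k' h"
      using g \<gamma> by (auto simp: group_ring_simps s dlt_def) (auto simp: group_elt_def)
  qed
  have d: "\<And>i. i < r 0 \<Longrightarrow> dlt k \<gamma> i \<in> carrier R" using dlt_vec[OF \<gamma>] by (simp add: int_vec_def)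
  have "comb 0 (dlt k (g \<otimes> \<gamma>)) = group_elt g \<odot>\<^bsub>chain F 0\<^esub> comb 0 (dlt k \<gamma>)"
    using A.lin_smult[of "dlt k \<gamma>" "group_elt g"] d group_elt_R[OF g] by (simp add: e)
  then show ?thesis
    unfolding ev_def using lmod_homD(3)[OF \<epsilon>_hom group_elt_R[OF g] A.lin_closed[of "dlt k \<gamma>"]] d by simp
qed

lemma slice_of: "slice hs (frag_of (gs, k, \<gamma>)) = (if hs = gs then dlt k \<gamma> else (\<lambda>_ _. 0))"
  by (auto simp: slice_def dlt_def fun_eq_iff)

lemma th_of: "th (frag_of (gs, k, \<gamma>)) hs = (if hs = gs then ev (dlt k \<gamma>) else \<zero>\<^bsub>M\<^esub>)"
  by (simp add: th_def slice_of ev_zero)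

lemma th_signed:
  assumes x: "(gs, k, \<gamma>) \<in> X q 0"
  shows "th (frag_cmul ((-1) ^ j) (frag_of (gs, k, \<gamma>))) hs
    = (if hs = gs then if even j then ev (dlt k \<gamma>) else \<ominus>\<^bsub>M\<^esub> ev (dlt k \<gamma>) else \<zero>\<^bsub>M\<^esub>)"
proof (cases "even j")
  case True then show ?thesis by (simp add: th_of)
next
  case False
  interpret LM: left_module R M by (rule lm)
  have f: "frag_of (gs, k, \<gamma>) \<in> Ch q 0" using x by (simp add: Ch_closed)
  have m: "ev (dlt k \<gamma>) \<in> carrier M" using x by (intro ev_closed dlt_vec) (simp add: X_def)
  have "th (- frag_of (gs, k, \<gamma>)) hs \<oplus>\<^bsub>M\<^esub> th (frag_of (gs, k, \<gamma>)) hs = \<zero>\<^bsub>M\<^esub>"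
    using th_diff[OF Ch_closed(1) f] by (simp add: th_zero)
  moreover have "th (- frag_of (gs, k, \<gamma>)) hs \<in> carrier M"
    using th_point_closed[OF Ch_closed(2)[OF Ch_closed(1) f]] by simp
  ultimately have "th (- frag_of (gs, k, \<gamma>)) hs = \<ominus>\<^bsub>M\<^esub> th (frag_of (gs, k, \<gamma>)) hs"
    using m by (intro LM.M.minus_equality[symmetric]) (auto simp: th_of)
  then show ?thesis using False by (simp add: th_of)
qed

lemma th_dv_of:
  assumes x: "(gs, k, \<gamma>) \<in> X (Suc q) 0"
  shows "bar_boundary G M (Suc q) (th (frag_of (gs, k, \<gamma>))) hs = th (dv (frag_of (gs, k, \<gamma>))) hs"
proof -
  interpret LM: left_module R M by (rule lm)
  let ?f = "frag_of (gs, k, \<gamma>)"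
  have f: "?f \<in> Ch (Suc q) 0" using x by (simp add: Ch_closed)
  have gs: "gs \<in> NL q" "\<gamma> \<in> carrier G" using x by (auto simp: X_def)
  let ?m = "\<lambda>j. if even j then ev (dlt k (tw j gs \<gamma>)) else \<ominus>\<^bsub>M\<^esub> ev (dlt k (tw j gs \<gamma>))"
  have m: "?m j \<in> carrier M" for j using ev_closed[OF dlt_vec[OF tw_closed[OF x]]] by auto
  let ?A = "{j. j \<le> Suc q \<and> bar_face G j gs = hs}"
  have set: "{(gs', j). gs' \<in> {gs} \<and> j \<le> Suc q \<and> bar_face G j gs' = hs} = Pair gs ` ?A" by auto
  have bt: "bar_term (th ?f) (gs, j) = ?m j" for j
    using ev_dlt[OF NL_hd[OF gs(1)] gs(2), of k] by (simp add: bar_term_def th_of tw_def)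
  have "bar_boundary G M (Suc q) (th ?f) hs = finsum M (bar_term (th ?f)) (Pair gs ` ?A)"
    unfolding set[symmetric] by (rule bar_boundary_eq) (use gs th_point_closed[OF f] in \<open>auto simp: th_of split: if_splits\<close>)
  also have "\<dots> = finsum M (\<lambda>j. bar_term (th ?f) (gs, j)) ?A"
    by (rule LM.M.finsum_reindex) (auto simp: inj_on_def bt m simp del: split_paired_All intro!: m[THEN back_subst[of "\<lambda>z. z \<in> carrier M"]])
  also have "\<dots> = finsum M ?m ?A" by (simp only: bt)
  also have "\<dots> = finsum M (\<lambda>j. if hs = bar_face G j gs then ?m j else \<zero>\<^bsub>M\<^esub>) {..Suc q}"
    by (rule LM.M.add.finprod_mono_neutral_cong_left) (use m in auto)
  also have "\<dots> = finsum M (\<lambda>j. th (frag_cmul ((-1) ^ j) (frag_of (bar_face G j gs, k, tw j gs \<gamma>))) hs) {..Suc q}"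
    using m by (intro LM.M.finsum_cong') (auto simp: th_signed[OF face_X[OF x]])
  also have "\<dots> = th (dv ?f) hs"
    unfolding frag_extend_of dv1_Suc[OF x] by (rule th_sum[symmetric, where q = q]) (auto intro!: Ch_closed(4) simp: Ch_closed face_X[OF x])
  finally show ?thesis .
qed

lemma th_dv:
  assumes c: "c \<in> Ch (Suc q) 0"
  shows "bar_boundary G M (Suc q) (th c) = th (dv c)"
proof -
  interpret LM: left_module R M by (rule lm)
  have "keys c \<subseteq> X (Suc q) 0" using c by (simp add: Ch_def)
  then have "c \<in> Ch (Suc q) 0 \<and> (\<forall>hs. bar_boundary G M (Suc q) (th c) hs = th (dv c) hs)"
  proof (induction rule: frag_induction)
    case zero
    have z: "th 0 = (\<lambda>_. \<zero>\<^bsub>M\<^esub>)" by (simp add: th_zero fun_eq_iff)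
    have "bar_boundary G M (Suc q) (th 0) hs = \<zero>\<^bsub>M\<^esub>" for hs unfolding z by (simp add: bar_boundary_def)
    then show ?case unfolding z frag_extend_0 by (simp add: Ch_closed)
  next
    case (one x)
    then show ?case using th_dv_of by (cases x) (auto simp: Ch_closed)
  next
    case (diff a b)
    have ab: "a - b \<in> Ch (Suc q) 0" using diff by (simp add: Ch_closed)
    have ea: "th a = (\<lambda>gs. th (a - b) gs \<oplus>\<^bsub>M\<^esub> th b gs)" using th_diff[of a "Suc q" b] diff by (simp add: fun_eq_iff)
    have "bar_boundary G M (Suc q) (th (a - b)) hs = th (dv (a - b)) hs" for hs
    proof -
      have cl: "bar_boundary G M (Suc q) (th (a - b)) hs \<in> carrier M"
      proof -
        have "bar_boundary G M (Suc q) (th (a - b)) hs = finsum M (bar_term (th (a - b)))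
            {(gs, j). gs \<in> {gs. th (a - b) gs \<noteq> \<zero>\<^bsub>M\<^esub>} \<and> j \<le> Suc q \<and> bar_face G j gs = hs}"
          by (rule bar_boundary_eq) (use th_closed[OF ab] in \<open>auto simp: bar_chains_def\<close>)
        then show ?thesis
          using bar_term_closed[of _ q "th (a - b)"] th_closed[OF ab]
          by (auto intro!: LM.M.finsum_closed simp: bar_chains_def)
      qed
      have "bar_boundary G M (Suc q) (th (a - b)) hs \<oplus>\<^bsub>M\<^esub> th (dv b) hs = th (dv a) hs"
        using bar_boundary_add[OF th_closed[OF ab] th_closed[of b], of hs] diff by (simp add: ea[symmetric])
      moreover have "th (dv (a - b)) hs \<oplus>\<^bsub>M\<^esub> th (dv b) hs = th (dv a) hs"
        using th_diff[OF dv_closed dv_closed, of a q b] diff by (simp add: frag_extend_diff)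
      ultimately have "bar_boundary G M (Suc q) (th (a - b)) hs \<oplus>\<^bsub>M\<^esub> th (dv b) hs = th (dv (a - b)) hs \<oplus>\<^bsub>M\<^esub> th (dv b) hs" by simp
      then show ?thesis
        using cl th_point_closed[OF dv_closed[OF ab]] th_point_closed[OF dv_closed, of b q] diff
        by (simp only: LM.M.add.right_cancel) 
    qed
    then show ?case using ab by blast
  qed
  then show ?thesis by (simp add: fun_eq_iff)
qed

subsection \<open>The zigzag from the lattices to the bar complex\<close>

text \<open>
  The homology at an interior point of the double complex.  A chain in \<open>NA\<close> has a continuation
  \<open>dv c = dh c'\<close> in the next column, one in \<open>NB\<close> a continuation \<open>dh c = dv c'\<close> in the previous one; in the
  interior both conditions say \<open>dv (dh c) = 0\<close>.
\<close>

definition zz_eq :: "nat \<Rightarrow> nat \<Rightarrow> ('g cell \<Rightarrow>\<^sub>0 int) \<Rightarrow> ('g cell \<Rightarrow>\<^sub>0 int) \<Rightarrow> bool" where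
  "zz_eq q p c w \<longleftrightarrow> (\<exists>u\<in>Ch (Suc q) p. \<exists>v\<in>Ch q (Suc p). c - w = dv u + dh p v)"

definition NA :: "nat \<Rightarrow> nat \<Rightarrow> ('g cell \<Rightarrow>\<^sub>0 int) set" where
  "NA q p = {c \<in> Ch q p. \<forall>q'. q = Suc q' \<longrightarrow> dv c \<in> dh p ` Ch q' (Suc p)}"

definition NB :: "nat \<Rightarrow> nat \<Rightarrow> ('g cell \<Rightarrow>\<^sub>0 int) set" where
  "NB q p = {c \<in> Ch q p. \<forall>p'. p = Suc p' \<longrightarrow> dh p' c \<in> dv ` Ch (Suc q) p'}"

lemma zz_eq_refl: "zz_eq q p c c"
  unfolding zz_eq_def by (intro bexI[of _ 0]) (auto simp: Ch_closed)

lemma lattice_to_double: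
  assumes t: "lat_hom I idg DI p n"
  shows "transversal_card (NB 0 p) (zz_eq 0 p) n"
proof (rule transversal_card_transfer[OF t[unfolded lat_hom_def], where \<rho> = "\<lambda>x c. al p c = x"])
  have cyc: "al p c \<in> lat_cyc I idg DI p \<longleftrightarrow> c \<in> NB 0 p" if c: "c \<in> Ch 0 p" for c
  proof (cases p)
    case 0
    have "x i * DI i j = 0" if x: "x \<in> lat_ch I idg 0" for x i j
    proof (cases "x i = 0")
      case False
      then have "idg i = 0" using x unfolding lat_ch_def by blast
      then show ?thesis by (simp add: DI_def)
    qed simp
    then have "lat_bd I DI x j = 0" if "x \<in> lat_ch I idg 0" for x j
      using that unfolding lat_bd_def by (simp only: sum.neutral_const if_cancel cong: if_cong)
    then show ?thesis using c al_ch[OF c] 0 by (simp add: lat_cyc_def NB_def del: split_paired_All)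
  next
    case (Suc p')
    have "(\<forall>j. lat_bd I DI (al p c) j = 0) \<longleftrightarrow> aug p' (dh p' c) = 0"
      using al_bd[of c p'] c Suc by (auto intro: poly_mapping_eqI)
    also have "\<dots> \<longleftrightarrow> dh p' c \<in> dv ` Ch (Suc 0) p'"
      using column_exact_zero[OF dh_closed[of c 0 p']] aug_dv[of _ p'] c Suc by auto
    finally show ?thesis using c al_ch[OF c] Suc by (simp add: lat_cyc_def NB_def)
  qed
  show "lat_eq I idg DI p z z" if "z \<in> lat_cyc I idg DI p" for z
    unfolding lat_eq_def by (intro bexI[of _ "\<lambda>_. 0"]) (auto simp: lat_ch_def lat_bd_def)
  show "\<exists>z'\<in>NB 0 p. al p z' = z" if zc: "z \<in> lat_cyc I idg DI p" for z
  proof -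
    obtain c where c: "c \<in> Ch 0 p" "al p c = z" using zc al_surj[of z p] unfolding lat_cyc_def by blast
    then have "c \<in> NB 0 p" using cyc[OF c(1)] zc by simp
    then show ?thesis using c(2) by blast
  qed
  show "\<exists>z\<in>lat_cyc I idg DI p. al p z' = z" if "z' \<in> NB 0 p" for z'
    using that cyc[of z'] by (auto simp: NB_def)
  fix z z' w w'
  assume a: "z' \<in> NB 0 p" "w' \<in> NB 0 p" "al p z' = z" "al p w' = w"
  then have zw: "z' \<in> Ch 0 p" "w' \<in> Ch 0 p" by (auto simp: NB_def)
  have e: "z j - w j = al p (z' - w') j" for j using a by (auto simp: aug_diff lookup_minus)
  show "lat_eq I idg DI p z w \<longleftrightarrow> zz_eq 0 p z' w'"
  proof
    assume "lat_eq I idg DI p z w"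
    then obtain y where y: "y \<in> lat_ch I idg (Suc p)" "\<And>j. z j - w j = lat_bd I DI y j" by (auto simp: lat_eq_def)
    obtain v where v: "v \<in> Ch 0 (Suc p)" "al (Suc p) v = y" using al_surj[OF y(1)] by blast
    have cl: "z' - w' - dh p v \<in> Ch 0 p" using zw dh_closed[OF v(1)] by (intro Ch_closed(2))
    have "aug p (z' - w' - dh p v) = 0"
      by (rule poly_mapping_eqI) (simp add: aug_diff[of p "z' - w'"] lookup_minus e[symmetric] al_bd[OF v(1)] v(2) y(2))
    then obtain u where u: "u \<in> Ch (Suc 0) p" "z' - w' - dh p v = dv u" using column_exact_zero[OF cl] by blast
    then have "z' - w' = dv u + dh p v" by (simp add: algebra_simps)
    then show "zz_eq 0 p z' w'" unfolding zz_eq_def using u v by blast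
  next
    assume "zz_eq 0 p z' w'"
    then obtain u v where uv: "u \<in> Ch (Suc 0) p" "v \<in> Ch 0 (Suc p)" "z' - w' = dv u + dh p v" by (auto simp: zz_eq_def)
    have "aug p (z' - w') = aug p (dh p v)" unfolding uv(3) using aug_dv[OF uv(1)] by (simp add: aug_def frag_extend_add)
    then show "lat_eq I idg DI p z w" unfolding lat_eq_def e using al_ch[OF uv(2)] al_bd[OF uv(2)] by auto
  qed
qed

text \<open>
  Exactness of the column through \<open>c\<close> and of the row through \<open>c'\<close> makes the correspondence
  \<open>dv c = dh c'\<close> bijective on classes.
\<close>

lemma zigzag_step:
  assumes t: "transversal_card (NB q (Suc p)) (zz_eq q (Suc p)) n"
  shows "transversal_card (NA (Suc q) p) (zz_eq (Suc q) p) n"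
proof (rule transversal_card_transfer[OF t, where \<rho> = "\<lambda>c' c. dv c = dh p c'"])
  show "zz_eq q (Suc p) z z" for z by (rule zz_eq_refl)
  show "\<exists>c\<in>NA (Suc q) p. dv c = dh p c'" if "c' \<in> NB q (Suc p)" for c'
  proof -
    have "c' \<in> Ch q (Suc p)" "dh p c' \<in> dv ` Ch (Suc q) p" using that by (auto simp: NB_def)
    then obtain c where c: "c \<in> Ch (Suc q) p" "dv c = dh p c'" "c' \<in> Ch q (Suc p)" by (elim imageE) simp
    have "c \<in> NA (Suc q) p" unfolding NA_def using c(1,3) by (simp add: c(2))
    then show ?thesis using c(2) by blast
  qed
  show "\<exists>c'\<in>NB q (Suc p). dv c = dh p c'" if "c \<in> NA (Suc q) p" for c
  proof -
    have "c \<in> Ch (Suc q) p" "dv c \<in> dh p ` Ch q (Suc p)" using that by (auto simp: NA_def)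
    then obtain c' where c: "c \<in> Ch (Suc q) p" "dh p c' = dv c" "c' \<in> Ch q (Suc p)" by (elim imageE) simp
    have "c' \<in> NB q (Suc p)" unfolding NB_def using c(1,3) by (simp add: c(2))
    then show ?thesis using c(2) by (intro bexI[of _ c']) simp_all
  qed
  fix c' w' c w
  assume a: "c' \<in> NB q (Suc p)" "w' \<in> NB q (Suc p)" "c \<in> NA (Suc q) p" "w \<in> NA (Suc q) p" "dv c = dh p c'" "dv w = dh p w'"
  then have cl: "c' - w' \<in> Ch q (Suc p)" "c - w \<in> Ch (Suc q) p" by (auto simp: NA_def NB_def Ch_closed)
  have e: "dv (c - w) = dh p (c' - w')" using a by (simp add: frag_extend_diff)
  show "zz_eq q (Suc p) c' w' \<longleftrightarrow> zz_eq (Suc q) p c w"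
  proof
    assume "zz_eq q (Suc p) c' w'"
    then obtain u v where uv: "u \<in> Ch (Suc q) (Suc p)" "v \<in> Ch q (Suc (Suc p))" "c' - w' = dv u + dh (Suc p) v" by (auto simp: zz_eq_def)
    have "dv (c - w - dh p u) = 0"
      unfolding frag_extend_diff[of _ "c - w"] e uv(3) dv_dh[OF uv(1)] by (simp add: frag_extend_add dh_dh[OF uv(2)])
    moreover have "c - w - dh p u \<in> Ch (Suc q) p" by (rule Ch_closed(2)[OF cl(2) dh_closed[OF uv(1)]])
    ultimately obtain y where y: "y \<in> Ch (Suc (Suc q)) p" "c - w - dh p u = dv y" using column_exact by blast
    then have "c - w = dv y + dh p u" by (simp add: algebra_simps)
    then show "zz_eq (Suc q) p c w" unfolding zz_eq_def using y uv by blast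
  next
    assume "zz_eq (Suc q) p c w"
    then obtain u v where uv: "u \<in> Ch (Suc (Suc q)) p" "v \<in> Ch (Suc q) (Suc p)" "c - w = dv u + dh p v" by (auto simp: zz_eq_def)
    have "dh p (c' - w' - dv v) = 0"
      unfolding frag_extend_diff[of _ "c' - w'"] e[symmetric] uv(3) dv_dh[OF uv(2), symmetric] by (simp add: frag_extend_add dv_dv[OF uv(1)])
    moreover have "c' - w' - dv v \<in> Ch q (Suc p)" by (rule Ch_closed(2)[OF cl(1) dv_closed[OF uv(2)]])
    ultimately obtain y where y: "y \<in> Ch q (Suc (Suc p))" "c' - w' - dv v = dh (Suc p) y" using row_exact by blast
    then have "c' - w' = dv v + dh (Suc p) y" by (simp add: algebra_simps)
    then show "zz_eq q (Suc p) c' w'" unfolding zz_eq_def using y uv by blast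
  qed
qed

lemma NA_eq_NB: "NA (Suc q) (Suc p) = NB (Suc q) (Suc p)"
proof -
  have "dv c \<in> dh (Suc p) ` Ch q (Suc (Suc p)) \<longleftrightarrow> dh p c \<in> dv ` Ch (Suc (Suc q)) p" if c: "c \<in> Ch (Suc q) (Suc p)" for c
  proof -
    have "dv c \<in> dh (Suc p) ` Ch q (Suc (Suc p)) \<longleftrightarrow> dh p (dv c) = 0"
      using row_exact[OF dv_closed[OF c]] dh_dh[of _ q p] by auto
    also have "\<dots> \<longleftrightarrow> dh p c \<in> dv ` Ch (Suc (Suc q)) p"
      unfolding dv_dh[OF c, symmetric] using column_exact[OF dh_closed[OF c]] dv_dv[of _ q p] by auto
    finally show ?thesis .
  qed
  then show ?thesis by (auto simp: NA_def NB_def)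
qed

lemma zigzag:
  "transversal_card (NB 0 (q + Suc p)) (zz_eq 0 (q + Suc p)) n \<Longrightarrow> transversal_card (NB q (Suc p)) (zz_eq q (Suc p)) n"
proof (induction q arbitrary: p)
  case (Suc q)
  have "transversal_card (NB q (Suc (Suc p))) (zz_eq q (Suc (Suc p))) n" by (rule Suc.IH) (use Suc.prems in simp)
  from zigzag_step[OF this] show ?case unfolding NA_eq_NB .
qed simp

lemma double_to_NA:
  assumes "lat_hom I idg DI p n"
  shows "transversal_card (NA p 0) (zz_eq p 0) n"
proof (cases p)
  case 0
  have "NA 0 0 = NB 0 0" by (simp add: NA_def NB_def)
  then show ?thesis using lattice_to_double[OF assms] 0 by simp
next
  case (Suc q)
  have "transversal_card (NB q (Suc 0)) (zz_eq q (Suc 0)) n"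
    by (rule zigzag) (use lattice_to_double[OF assms] Suc in simp)
  from zigzag_step[OF this] show ?thesis using Suc by simp
qed

lemma homology_card:
  assumes h: "lat_hom I idg DI p n"
  shows "finite (carrier (group_homology G N M p)) \<and> card (carrier (group_homology G N M p)) = n"
proof -
  interpret LM: left_module R M by (rule lm)
  let ?G = "\<lparr>carrier = bar_cycles G N M p, monoid.mult = (\<lambda>c c' gs. c gs \<oplus>\<^bsub>M\<^esub> c' gs), one = (\<lambda>_. \<zero>\<^bsub>M\<^esub>)\<rparr>"
  let ?H = "bar_boundary G M (Suc p) ` bar_chains N M (Suc p)"
  define f where "f c = ?H #>\<^bsub>?G\<^esub> th c" for c
  have H: "?H = (\<lambda>u. th (dv u)) ` Ch (Suc p) 0"
  proof (intro equalityI subsetI; elim imageE)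
    fix x b assume b: "x = bar_boundary G M (Suc p) b" "b \<in> bar_chains N M (Suc p)"
    obtain u where "u \<in> Ch (Suc p) 0" "th u = b" using th_surj[OF b(2)] by blast
    then show "x \<in> (\<lambda>u. th (dv u)) ` Ch (Suc p) 0" using b(1) th_dv[of u p] by (intro image_eqI[of _ _ u]) simp_all
  next
    fix x u assume u: "x = th (dv u)" "u \<in> Ch (Suc p) 0"
    then show "x \<in> ?H" using th_dv[OF u(2)] th_closed[OF u(2)] by (intro image_eqI[of _ _ "th u"]) simp_all
  qed
  have f: "f c = (\<lambda>u. th (dv u + c)) ` Ch (Suc p) 0" if c: "c \<in> Ch p 0" for c
  proof -
    have "th (dv u + c) = (\<lambda>gs. th (dv u) gs \<oplus>\<^bsub>M\<^esub> th c gs)" if "u \<in> Ch (Suc p) 0" for u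
      using th_add[OF dv_closed[OF that] c] by (simp add: fun_eq_iff)
    then show ?thesis unfolding f_def H r_coset_def by (auto simp: image_iff)
  qed
  have cyc: "c \<in> NA p 0 \<longleftrightarrow> th c \<in> bar_cycles G N M p" if c: "c \<in> Ch p 0" for c
  proof (cases p)
    case 0 then show ?thesis using c th_closed[OF c] by (simp add: NA_def bar_cycles_def)
  next
    case (Suc q)
    have "bar_boundary G M p (th c) = (\<lambda>_. \<zero>\<^bsub>M\<^esub>) \<longleftrightarrow> th (dv c) = (\<lambda>_. \<zero>\<^bsub>M\<^esub>)" using th_dv[of c q] c Suc by simp
    also have "\<dots> \<longleftrightarrow> dv c \<in> dh 0 ` Ch q (Suc 0)"
      using th_exact[OF dv_closed, of c q] th_dh[of _ q] c Suc by auto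
    finally show ?thesis using c th_closed[OF c] Suc by (simp add: NA_def bar_cycles_def)
  qed
  have "bar_cycles G N M p = th ` NA p 0"
  proof (intro equalityI subsetI)
    fix x assume x: "x \<in> bar_cycles G N M p"
    then have "x \<in> bar_chains N M p" unfolding bar_cycles_def by (rule CollectE) (erule conjunct1)
    then obtain c where c: "c \<in> Ch p 0" "th c = x" using th_surj by blast
    then show "x \<in> th ` NA p 0" using cyc[OF c(1)] x by (intro image_eqI[of _ _ c]) simp_all
  next
    fix x assume "x \<in> th ` NA p 0"
    then obtain c where c: "c \<in> NA p 0" "x = th c" by blast
    have "c \<in> Ch p 0" using c(1) unfolding NA_def by (rule CollectE) (erule conjunct1)
    then show "x \<in> bar_cycles G N M p" using cyc c by simp
  qed
  then have carr: "carrier (group_homology G N M p) = f ` NA p 0"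
    by (simp add: group_homology_def carrier_FactGroup f_def image_image)
  have eq: "zz_eq p 0 c w \<longleftrightarrow> f c = f w" if cw: "c \<in> NA p 0" "w \<in> NA p 0" for c w
  proof -
    have c: "c \<in> Ch p 0" and w: "w \<in> Ch p 0" using cw by (auto simp: NA_def)
    show ?thesis
    proof
      assume "zz_eq p 0 c w"
      then obtain u0 v where uv: "u0 \<in> Ch (Suc p) 0" "v \<in> Ch p (Suc 0)" "c - w = dv u0 + dh 0 v" by (auto simp: zz_eq_def)
      have k: "th (a + dh 0 v) = th a" if "a \<in> Ch p 0" for a
        using th_add[OF that dh_closed[OF uv(2)]] th_dh[OF uv(2)] th_point_closed[OF that] by (simp add: fun_eq_iff)
      have "c = dv u0 + w + dh 0 v" using uv(3) by (simp add: algebra_simps)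
      then have 1: "th (dv u + c) = th (dv (u + u0) + w)" if "u \<in> Ch (Suc p) 0" for u
        using k[of "dv (u + u0) + w"] that uv(1) w dv_closed by (simp add: Ch_closed frag_extend_add algebra_simps)
      show "f c = f w" unfolding f[OF c] f[OF w]
      proof (intro equalityI subsetI; elim imageE)
        fix x u assume "x = th (dv u + c)" "u \<in> Ch (Suc p) 0"
        then show "x \<in> (\<lambda>u. th (dv u + w)) ` Ch (Suc p) 0" using 1 Ch_closed(3)[OF _ uv(1)] by blast
      next
        fix x u assume x: "x = th (dv u + w)" and u: "u \<in> Ch (Suc p) 0"
        have "th (dv (u - u0) + c) = th (dv u + w)" unfolding 1[OF Ch_closed(2)[OF u uv(1)]] by simp
        then show "x \<in> (\<lambda>u. th (dv u + c)) ` Ch (Suc p) 0"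
          unfolding x by (intro image_eqI[of _ _ "u - u0"] Ch_closed(2)[OF u uv(1)]) (rule sym)
      qed
    next
      assume fe: "f c = f w"
      have "th c \<in> f c" unfolding f[OF c] by (rule image_eqI[of _ _ 0]) (simp_all add: Ch_closed)
      then obtain u where u: "u \<in> Ch (Suc p) 0" "th c = th (dv u + w)" unfolding fe f[OF w] by blast
      have m: "dv u + w \<in> Ch p 0" using dv_closed[OF u(1)] w by (simp add: Ch_closed)
      have d: "c - (dv u + w) \<in> Ch p 0" by (rule Ch_closed(2)[OF c m])
      have "th (c - (dv u + w)) gs = \<zero>\<^bsub>M\<^esub>" for gs
        using th_diff[OF c m, of gs] th_point_closed[OF m, of gs] th_point_closed[OF d, of gs] u(2)
        by (metis LM.M.add.r_cancel_one')
      then have "th (c - (dv u + w)) = (\<lambda>_. \<zero>\<^bsub>M\<^esub>)" by (simp add: fun_eq_iff)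
      from th_exact[OF d this] obtain v where v: "v \<in> Ch p (Suc 0)" "c - (dv u + w) = dh 0 v" by blast
      then have "c - w = dv u + dh 0 v" by (simp add: algebra_simps)
      then show "zz_eq p 0 c w" unfolding zz_eq_def using u v by blast
    qed
  qed
  show ?thesis unfolding carr using transversal_card_image[OF double_to_NA[OF h] eq] by blast
qed

end

section \<open>The limit formula\<close>

lemma det_on_identity:
  assumes I: "finite I" and A: "\<And>x y. x \<in> I \<Longrightarrow> y \<in> I \<Longrightarrow> A x y = (if x = y then 1 else 0)"
  shows "det_on I A = 1"
proof -
  have "det_on I A = (\<Sum>\<sigma>\<in>{id}. of_int (sign \<sigma>) * (\<Prod>x\<in>I. A x (\<sigma> x)))"
    unfolding det_on_def
  proof (rule sum.mono_neutral_right)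
    show "finite {\<sigma>. \<sigma> permutes I}" by (rule finite_permutations[OF I])
    show "\<forall>\<sigma>\<in>{\<sigma>. \<sigma> permutes I} - {id}. of_int (sign \<sigma>) * (\<Prod>x\<in>I. A x (\<sigma> x)) = 0"
    proof
      fix \<sigma> assume s: "\<sigma> \<in> {\<sigma>. \<sigma> permutes I} - {id}"
      then have p: "\<sigma> permutes I" and "\<sigma> \<noteq> id" by auto
      then obtain x where x: "\<sigma> x \<noteq> x" by (auto simp: fun_eq_iff)
      then have xI: "x \<in> I" "\<sigma> x \<in> I" using p permutes_not_in[OF p, of x] permutes_in_image[OF p, of x] by blast+
      have "A x (\<sigma> x) = 0" using A[OF xI] x by simp
      then have "(\<Prod>x\<in>I. A x (\<sigma> x)) = 0" using I xI(1) by (intro prod_zero) auto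
      then show "of_int (sign \<sigma>) * (\<Prod>x\<in>I. A x (\<sigma> x)) = 0" by simp
    qed
  qed (auto simp: permutes_id)
  also have "\<dots> = 1" using A by simp
  finally show ?thesis .
qed

lemma of_rat_powi_sign: "of_rat (x powi (-1) ^ \<nu>) = (of_rat x powi (-1) ^ \<nu> :: 'a::field_char_0)"
  by (cases "even \<nu>") (simp_all add: power_int_minus of_rat_inverse)

context quotient_resolution
begin

lemma group_ring_det_one:
  "group_ring_det (G Mod N) 1 (\<lambda>i j. c0_quotient_map G N (\<one>\<^bsub>mat_ring 1 S\<^esub> i j)) = 1"
  unfolding group_ring_det_def Q_def[symmetric]
proof (rule det_on_identity)
  show "finite ({..<1::nat} \<times> carrier Q)" using finite_Q by simp
  fix x y assume "x \<in> {..<1::nat} \<times> carrier Q" "y \<in> {..<1::nat} \<times> carrier Q"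
  then obtain a b where ab: "x = (0, a)" "y = (0, b)" "a \<in> carrier Q" "b \<in> carrier Q" by auto
  show "(\<lambda>(i, a) (j, b). (group_elt a \<otimes>\<^bsub>group_ring Q\<^esub> c0_quotient_map G N (\<one>\<^bsub>mat_ring 1 S\<^esub> i j)) b) x y = (if x = y then 1 else 0)"
    using ab by (simp add: group_ring_entry mat_ring_def flS(3))
qed

lemma quotient_euler_char:
  assumes \<delta>: "chain_contraction S C \<delta>"
  shows "finite (carrier (group_homology G N M i))"
    and "finite {i. card (carrier (group_homology G N M i)) \<noteq> 1}"
    and "multiplicative_euler_char G N M \<noteq> 0"
    and "length (basis_index C odd) = length (basis_index C even)"
    and "group_ring_det (G Mod N) (length (basis_index C odd)) (\<lambda>i j. c0_quotient_map G N (torsion_matrix S C \<delta> i j))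
       \<in> {of_rat (multiplicative_euler_char G N M), - of_rat (multiplicative_euler_char G N M)}"
proof -
  let ?d = "top_degree F"
  obtain h where h: "\<And>\<nu>. lat_hom I idg DI \<nu> (h \<nu>) \<and> h \<nu> > 0" and h1: "\<And>\<nu>. \<nu> > ?d \<Longrightarrow> h \<nu> = 1"
    and len: "length (basis_index C odd) = length (basis_index C even)"
    and det: "group_ring_det Q (length (basis_index C odd)) (\<lambda>i j. c0_quotient_map G N (torsion_matrix S C \<delta> i j))
       \<in> {\<Prod>\<nu>\<le>?d. of_nat (h \<nu>) powi (-1) ^ \<nu>, - (\<Prod>\<nu>\<le>?d. of_nat (h \<nu>) powi (-1) ^ \<nu>)}"
    using quotient_det[OF \<delta>] by blast
  have hom: "finite (carrier (group_homology G N M \<nu>))" "card (carrier (group_homology G N M \<nu>)) = h \<nu>" for \<nu>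
    using homology_card h[of \<nu>] by blast+
  show "finite (carrier (group_homology G N M i))" by (rule hom)
  have sub: "{i. h i \<noteq> 1} \<subseteq> {..?d}" using h1 by (auto simp: not_less[symmetric])
  then show "finite {i. card (carrier (group_homology G N M i)) \<noteq> 1}" unfolding hom by (rule finite_subset) simp
  have chi: "multiplicative_euler_char G N M = (\<Prod>\<nu>\<le>?d. of_nat (h \<nu>) powi (-1) ^ \<nu>)"
    unfolding multiplicative_euler_char_def hom by (rule prod.mono_neutral_left) (use sub in auto)
  show "multiplicative_euler_char G N M \<noteq> 0"
    unfolding chi using h by (auto simp: power_int_eq_0_iff less_imp_neq[THEN not_sym])
  show "length (basis_index C odd) = length (basis_index C even)" by (rule len)
  have "(of_rat (multiplicative_euler_char G N M) :: 'p padic) = (\<Prod>\<nu>\<le>?d. of_nat (h \<nu>) powi (-1) ^ \<nu>)"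
    unfolding chi of_rat_prod of_rat_powi_sign by simp
  then show "group_ring_det (G Mod N) (length (basis_index C odd)) (\<lambda>i j. c0_quotient_map G N (torsion_matrix S C \<delta> i j))
       \<in> {of_rat (multiplicative_euler_char G N M), - of_rat (multiplicative_euler_char G N M)}"
    using det by (simp add: Q_def)
qed

end

lemma KT_class_empty: "KT_class G 0 A = KT_class G 1 \<one>\<^bsub>mat_ring 1 (c0 G)\<^esub>"
proof -
  have "stabilize (c0 G) 0 A = stabilize (c0 G) 1 \<one>\<^bsub>mat_ring 1 (c0 G)\<^esub>"
    by (auto simp: stabilize_def mat_ring_def fun_eq_iff)
  then show ?thesis by (simp add: KT_class_def K1_class_def)
qed

context completed_resolution
begin

lemma torsion_limit_formula:
  fixes logdet :: "(nat \<Rightarrow> nat \<Rightarrow> 'g \<Rightarrow> 'p padic) set set \<Rightarrow> 'p padic"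
  assumes re: "reasonable G logdet" and ac: "acyclic_complex C" and N: "converges_to_e G N"
  shows "finite (carrier (group_homology G (N n) M i))"
    and "finite {i. card (carrier (group_homology G (N n) M i)) \<noteq> 1}"
    and "(\<lambda>n. padic_log (of_rat (multiplicative_euler_char G (N n) M)) / of_nat (card (rcosets (N n))))
           \<longlonglongrightarrow> logdet (padic_torsion G F)"
proof -
  define \<delta> where "\<delta> = (SOME \<delta>. chain_contraction S C \<delta>)"
  have \<delta>: "chain_contraction S C \<delta>"
    unfolding \<delta>_def by (rule someI_ex[OF chain_contraction_exists]) (rule C_mod C_hom ac)+
  let ?r = "length (basis_index C odd)" and ?T = "torsion_matrix S C \<delta>"
  have q: "quotient_resolution G M F \<epsilon> S (N n)" for n
    using N completed_resolution_axioms
    by (simp add: quotient_resolution_def finite_quotient_def finite_quotient_axioms_def converges_to_e_def group_axioms)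
  note E = quotient_resolution.quotient_euler_char[OF q \<delta>]
  show "finite (carrier (group_homology G (N n) M i))" by (rule E(1))
  show "finite {i. card (carrier (group_homology G (N n) M i)) \<noteq> 1}" by (rule E(2))
  have tor: "padic_torsion G F = KT_class G ?r ?T"
    unfolding padic_torsion_def Let_def C_eq S_eq[symmetric] \<delta>_def[symmetric] ..
  \<comment> \<open>An empty torsion matrix is replaced by the identity of size one, with the same class and
     determinant, because a reasonable homomorphism is described on matrices of positive size.\<close>
  define r' where "r' = (if ?r = 0 then 1 else ?r)"
  define T' where "T' = (if ?r = 0 then \<one>\<^bsub>mat_ring 1 S\<^esub> else ?T)"
  have tor': "padic_torsion G F = KT_class G r' T'"
    unfolding tor r'_def T'_def using KT_class_empty[of G ?T] by (simp add: S_eq[symmetric])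
  have "ring (mat_ring 1 S)" unfolding mat_ring_eq_sq_mat by (rule ring_sq_mat[OF S_ring]) simp
  then have u: "T' \<in> Units (mat_ring r' S)"
    using torsion_matrix_unit[OF \<delta> E(4)] monoid.Units_one_closed[OF ring.is_monoid, of "mat_ring 1 S"] by (simp add: r'_def T'_def)
  let ?det = "\<lambda>n. group_ring_det (G Mod N n) r' (\<lambda>i j. c0_quotient_map G (N n) (T' i j))"
  have d: "?det n \<in> {of_rat (multiplicative_euler_char G (N n) M), - of_rat (multiplicative_euler_char G (N n) M)}" for n
  proof (cases "?r = 0")
    case True
    have "group_ring_det (G Mod N n) 0 (\<lambda>i j. c0_quotient_map G (N n) (?T i j)) = 1"
      by (simp add: group_ring_det_def det_on_def)
    moreover have "?det n = 1" using True quotient_resolution.group_ring_det_one[OF q] by (simp add: r'_def T'_def)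
    ultimately show ?thesis using E(5)[of n] True by simp
  next
    case False then show ?thesis using E(5)[of n] by (simp add: r'_def T'_def)
  qed
  have "padic_log (?det n) = padic_log (of_rat (multiplicative_euler_char G (N n) M))" for n
    using d[of n] padic_log_minus[OF E(3)[of n], where 'p = 'p] by auto
  moreover have "(\<lambda>n. padic_log (?det n) / of_nat (card (rcosets (N n)))) \<longlonglongrightarrow> logdet (KT_class G r' T')"
  proof -
    have "r' \<ge> 1" by (simp add: r'_def Suc_le_eq)
    moreover have "T' \<in> Units (mat_ring r' (c0 G))" using u by (simp only: S_eq)
    moreover have "\<forall>r\<ge>1. \<forall>f\<in>Units (mat_ring r (c0 G)). \<forall>N. converges_to_e G N \<longrightarrow>
        (\<lambda>n. padic_log (group_ring_det (G Mod N n) r (\<lambda>i j. c0_quotient_map G (N n) (f i j)))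
              / of_nat (card (rcosets (N n)))) \<longlonglongrightarrow> logdet (KT_class G r f)"
      using re unfolding reasonable_def by (elim conjE)
    ultimately show ?thesis using N by blast
  qed
  ultimately show "(\<lambda>n. padic_log (of_rat (multiplicative_euler_char G (N n) M)) / of_nat (card (rcosets (N n))))
           \<longlonglongrightarrow> logdet (padic_torsion G F)" by (simp add: tor')
qed

end

section \<open>Sequences of subgroups converging to the identity\<close>

context group
begin

lemma normal_Int_finite_index:
  assumes H: "H \<lhd> G" "finite (rcosets H)" and K: "K \<lhd> G" "finite (rcosets K)"
  shows "H \<inter> K \<lhd> G" "finite (rcosets (H \<inter> K))"
proof -
  have HK: "H \<subseteq> carrier G" "K \<subseteq> carrier G"
    using H K subgroup.subset normal_imp_subgroup by blast+
  show "H \<inter> K \<lhd> G"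
    using H(1) K(1) by (rule normal_subgroup_intersect)
  have c: "(H \<inter> K) #> x = (H #> x) \<inter> (K #> x)" if "x \<in> carrier G" for x
  proof (intro equalityI subsetI)
    fix y assume "y \<in> (H #> x) \<inter> (K #> x)"
    then obtain h k where hk: "h \<in> H" "k \<in> K" "y = h \<otimes> x" "y = k \<otimes> x" by (auto simp: r_coset_def)
    then have "h = k" using that HK right_cancel[of x h k] by (metis subsetD)
    then show "y \<in> (H \<inter> K) #> x" using hk by (auto simp: r_coset_def)
  qed (auto simp: r_coset_def)
  have "rcosets (H \<inter> K) \<subseteq> (\<lambda>(A, B). A \<inter> B) ` ((rcosets H) \<times> (rcosets K))"
  proof
    fix C assume "C \<in> rcosets (H \<inter> K)"
    then obtain x where x: "x \<in> carrier G" "C = (H \<inter> K) #> x" by (auto simp: RCOSETS_def)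
    have "(H #> x, K #> x) \<in> (rcosets H) \<times> (rcosets K)" using x(1) by (auto simp: RCOSETS_def)
    then show "C \<in> (\<lambda>(A, B). A \<inter> B) ` ((rcosets H) \<times> (rcosets K))"
      unfolding x(2) c[OF x(1)] by (rule rev_image_eqI) simp
  qed
  then show "finite (rcosets (H \<inter> K))" by (rule finite_subset) (use H K in simp)
qed

text \<open>
  \<open>N n\<close> is the intersection of subgroups of finite index that avoid the first \<open>n\<close> elements different
  from \<open>e\<close> of an enumeration of \<open>G\<close>.
\<close>

lemma converges_to_e_exists:
  assumes c: "countable (carrier G)" and rf: "residually_finite G"
  shows "\<exists>N. converges_to_e G N"
proof -
  have top: "carrier G \<lhd> G" "finite (rcosets (carrier G))"
  proof -
    show n: "carrier G \<lhd> G" by (simp add: normal_inv_iff subgroup_self)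
    have "rcosets (carrier G) \<subseteq> {carrier G}"
      using coset_join2[OF _ subgroup_self] by (auto simp: RCOSETS_def)
    then show "finite (rcosets (carrier G))" by (rule finite_subset) simp
  qed
  have "\<exists>K. K \<lhd> G \<and> finite (rcosets K) \<and> (g \<in> carrier G \<longrightarrow> g \<noteq> \<one> \<longrightarrow> g \<notin> K)" for g
    using rf top unfolding residually_finite_def by blast
  then obtain K where K: "\<And>g. K g \<lhd> G \<and> finite (rcosets (K g)) \<and> (g \<in> carrier G \<longrightarrow> g \<noteq> \<one> \<longrightarrow> g \<notin> K g)" by metis
  define e where "e = from_nat_into (carrier G)"
  define N where "N n = (\<Inter>m\<le>n. K (e m))" for n
  have N: "N n \<lhd> G \<and> finite (rcosets (N n))" for n
  proof (induction n)
    case 0 then show ?case using K[of "e 0"] by (simp add: N_def)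
  next
    case (Suc n)
    have "N (Suc n) = K (e (Suc n)) \<inter> N n" by (auto simp: N_def atMost_Suc)
    then show ?case using normal_Int_finite_index[of "K (e (Suc n))" "N n"] K[of "e (Suc n)"] Suc by simp
  qed
  have "(\<Inter>n\<in>A. N n) = {\<one>}" if A: "infinite A" for A
  proof (intro equalityI subsetI)
    fix g assume g: "g \<in> (\<Inter>n\<in>A. N n)"
    obtain n0 where n0: "n0 \<in> A" using A by (metis ex_in_conv finite.emptyI)
    have gG: "g \<in> carrier G" using g n0 N[of n0] subgroup.subset[OF normal_imp_subgroup] by blast
    obtain m where m: "e m = g" unfolding e_def using from_nat_into_surj[OF c gG] by blast
    obtain n where n: "n \<in> A" "m \<le> n" using A unfolding infinite_nat_iff_unbounded_le by blast
    have "g \<in> K g" using g n m by (auto simp: N_def)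
    then show "g \<in> {\<one>}" using K[of g] gG by blast
  next
    fix g assume "g \<in> {\<one>}"
    then show "g \<in> (\<Inter>n\<in>A. N n)" using N subgroup.one_closed[OF normal_imp_subgroup] by blast
  qed
  then show ?thesis using N unfolding converges_to_e_def by blast
qed

end

section \<open>The \<open>p\<close>-adic \<open>R\<close>-torsion as a limit\<close>

theorem theorem5p3:
  fixes G :: "'g monoid"
    and logdet :: "(nat \<Rightarrow> nat \<Rightarrow> 'g \<Rightarrow> 'p::prime_card padic) set set \<Rightarrow> 'p padic"
    and M :: "('g \<Rightarrow> int, 'm) module"
  assumes "group G" and "countable (carrier G)" and "residually_finite G"
    and "reasonable G logdet"
    and "left_module (int_group_ring G) M"
    and "type_FL (int_group_ring G) M"
    and "padically_expansive TYPE('p) G M"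
    and "torsion_limit CARD('p) M = {\<lambda>_. \<zero>\<^bsub>M\<^esub>}"
  shows "(\<forall>(F :: ('g \<Rightarrow> int, 'f) based_complex) \<epsilon>.
            based_resolution (int_group_ring G) M F \<epsilon> \<longrightarrow>
            acyclic_complex (c0_complex G F
              :: ('g \<Rightarrow> 'p padic, (('g \<Rightarrow> 'p padic) \<times> 'f \<Rightarrow>\<^sub>0 int) set) based_complex) \<and>
            logdet (padic_torsion G F) = padic_R_torsion G logdet M) \<and>
         (\<forall>N. converges_to_e G N \<longrightarrow>
            (\<forall>n i. finite (carrier (group_homology G (N n) M i))) \<and>
            (\<forall>n. finite {i. card (carrier (group_homology G (N n) M i)) \<noteq> 1}) \<and>
            (\<lambda>n. padic_log (of_rat (multiplicative_euler_char G (N n) M))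
                  / of_nat (card (rcosets\<^bsub>G\<^esub> (N n))))
            \<longlonglongrightarrow> padic_R_torsion G logdet M)"
proof -
  interpret group G by fact
  let ?S = "c0 G :: ('g \<Rightarrow> 'p padic) ring"
  let ?F0 = "SOME F :: ('g \<Rightarrow> int, nat \<Rightarrow> 'g \<Rightarrow> int) based_complex. \<exists>\<epsilon>. based_resolution (int_group_ring G) M F \<epsilon>"
  have "\<exists>\<epsilon>. based_resolution (int_group_ring G) M ?F0 \<epsilon>"
    by (rule someI_ex) (use assms(6) in \<open>simp add: type_FL_def\<close>)
  then obtain \<epsilon>0 where F0: "based_resolution (int_group_ring G) M ?F0 \<epsilon>0" by blast
  interpret F0: completed_resolution G M ?F0 \<epsilon>0 ?S
    using F0 assms(1,5) by (simp add: completed_resolution_def completed_resolution_axioms_def fl_resolution_def fl_resolution_axioms_def)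
  note lim0 = F0.torsion_limit_formula[OF assms(4) F0.C_acyclic[OF assms(8,7)]]
  have R: "padic_R_torsion G logdet M = logdet (padic_torsion G ?F0)" by (simp add: padic_R_torsion_def)
  show ?thesis
  proof (intro conjI allI impI)
    fix F :: "('g \<Rightarrow> int, 'f) based_complex" and \<epsilon>
    assume F: "based_resolution (int_group_ring G) M F \<epsilon>"
    interpret F: completed_resolution G M F \<epsilon> ?S
      using F assms(1,5) by (simp add: completed_resolution_def completed_resolution_axioms_def fl_resolution_def fl_resolution_axioms_def)
    note ac = F.C_acyclic[OF assms(8,7)]
    show "acyclic_complex (c0_complex G F :: ('g \<Rightarrow> 'p padic, (('g \<Rightarrow> 'p padic) \<times> 'f \<Rightarrow>\<^sub>0 int) set) based_complex)"
      unfolding F.C_eq by (rule ac)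
    \<comment> \<open>Both torsions are limits of the same sequence, which depends only on \<open>M\<close>.\<close>
    obtain N where N: "converges_to_e G N" using converges_to_e_exists[OF assms(2,3)] by blast
    show "logdet (padic_torsion G F) = padic_R_torsion G logdet M"
      unfolding R by (rule LIMSEQ_unique[OF F.torsion_limit_formula(3)[OF assms(4) ac N] lim0(3)[OF N]])
  next
    fix N assume N: "converges_to_e G N"
    fix n i
    show "finite (carrier (group_homology G (N n) M i))" by (rule lim0(1)[OF N])
  next
    fix N n assume N: "converges_to_e G N"
    show "finite {i. card (carrier (group_homology G (N n) M i)) \<noteq> 1}" by (rule lim0(2)[OF N])
  next
    fix N assume N: "converges_to_e G N"
    show "(\<lambda>n. padic_log (of_rat (multiplicative_euler_char G (N n) M)) / of_nat (card (rcosets\<^bsub>G\<^esub> (N n))))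
        \<longlonglongrightarrow> padic_R_torsion G logdet M"
      unfolding R by (rule lim0(3)[OF N])
  qed
qed

end
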